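(* Let $d\ge1$, $B>0$, and let $\mathcal{D}_n=\{(X_i,Y_i)\}_{i=1}^n$, $n\ge 2$, be i.i.d. copies of a random pair $(X,Y)$ whose distribution is supported on $\mathbb{B}^d\times\mathbb{R}$, with $|Y|\le B$ almost surely. Let $\mu$ be the marginal law of $X$ and $h(x)=\mathbb{E}[Y\mid X=x]$, and assume $h\in\mathcal{H}$ for the class $\mathcal{H}$ specified below. Let $\widehat f_n\in\arg\min_{f\in\mathcal{NN}(N_n,M_n)}\frac1n\sum_{i=1}^n(f(X_i)-Y_i)^2$ (assume the minimum is attained). (1) If $\mathcal{H}=\mathcal{H}^\alpha$ with $0<\alpha<(d+3)/2$ and we choose $M_n \asymp n^{\frac{d+3-2\alpha}{2d+4\alpha}}$ and $N_n \gtrsim n^{\frac{d}{d+2\alpha}}$, then there are constants $c_1,c_2>0$ such that \[ \|\mathcal{T}_B\widehat{f}_n-h\|_{L^2(\mu)}^2 \lesssim n^{-\frac{2\alpha}{d+2\alpha}} \log n \] holds with probability at least $1-c_1 \exp(-c_2 n^{\frac{d}{d+2\alpha}} \log n)$. (2) If $\mathcal{H}=\mathcal{F}_\sigma(1)$, and $M\ge1$ is a constant and we choose $M_n=M$ and $N_n\gtrsim n^{\frac{d}{2d+3}}$, then there are constants $c_1,c_2>0$ such that \[ \|\mathcal{T}_B\widehat{f}_n-h\|_{L^2(\mu)}^2 \lesssim n^{-\frac{d+3}{2d+3}} \log n \] holds with probability at least $1-c_1 \exp(-c_2 n^{\frac{d}{2d+3}} \log n)$.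
   Context: $\sigma(t)=\max\{t,0\}$; $\mathbb{B}^d$ is the closed unit Euclidean ball in $\mathbb{R}^d$ and $\mathbb{S}^d$ the unit sphere in $\mathbb{R}^{d+1}$. For $\theta=(a_1,w_1^\intercal,\dots,a_N,w_N^\intercal)^\intercal\in\mathbb{R}^{(d+2)N}$ ($a_i\in\mathbb{R}$, $w_i\in\mathbb{R}^{d+1}$), $f_\theta(x)=\sum_{i=1}^N a_i\sigma((x^\intercal,1)w_i)$ on $\mathbb{B}^d$ and $\kappa(\theta)=\sum_i|a_i|\|w_i\|_2$; $\mathcal{NN}(N,M)=\{f_\theta:\theta\in\mathbb{R}^{(d+2)N},\kappa(\theta)\le M\}$. For a finite signed Borel measure $\mu$ on $\mathbb{S}^d$, $f_\mu(x)=\int_{\mathbb{S}^d}\sigma((x^\intercal,1)v)d\mu(v)$; $\mathcal{F}_\sigma$ is the set of all such $f_\mu$ on $\mathbb{B}^d$, with norm $\gamma(f)=\inf\{|\mu|(\mathbb{S}^d): f=f_\mu\}$, and $\mathcal{F}_\sigma(M)=\{f\in\mathcal{F}_\sigma:\gamma(f)\le M\}$. For $\alpha=r+\beta$ with $r\in\mathbb{N}_0$, $\beta\in(0,1]$, the Hölder norm on $\mathbb{R}^d$ is $\|f\|_{C^{r,\beta}}=\max\{\max_{\|s\|_1\le r}\|\partial^sf\|_{L^\infty},\max_{\|s\|_1=r}\sup_{x\ne y}|\partial^sf(x)-\partial^sf(y)|/\|x-y\|_2^\beta\}$; $C^{r,\beta}(\mathbb{B}^d)$ consists of restrictions to $\mathbb{B}^d$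 with the quotient (infimum over extensions) norm, and $\mathcal{H}^\alpha$ is its closed unit ball. The truncation $\mathcal{T}_Bf(x)=f(x)$ if $|f(x)|\le B$ and $\mathrm{sgn}(f(x))B$ otherwise. $A\lesssim C$ means $A\le cC$ for a constant $c>0$ independent of $n$ (depending on $d,\alpha,B$, and the implied constants in the parameter choices); $A\asymp C$ means $A\lesssim C\lesssim A$. *)

theory Defs
  imports "HOL-Probability.Probability"
begin

definition relu :: "real \<Rightarrow> real" where
  "relu t = max t 0"

text \<open>R^{d+1} is rendered as 'a \<times> real, so (x^T,1) w = inner (x,1) w and
  the Euclidean norm of w is norm w.\<close>

definition nn_class :: "nat \<Rightarrow> real \<Rightarrow> ('a::euclidean_space \<Rightarrow> real) set" where
  "nn_class N M =
     {(\<lambda>x. \<Sum>i<N. a i * relu (inner (x, 1) (w i))) | (a :: nat \<Rightarrow> real) (w :: nat \<Rightarrow> 'a \<times> real).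
        (\<Sum>i<N. \<bar>a i\<bar> * norm (w i)) \<le> M}"

definition truncate :: "real \<Rightarrow> real \<Rightarrow> real" where
  "truncate B t = (if \<bar>t\<bar> \<le> B then t else sgn t * B)"

text \<open>A finite signed Borel measure on the sphere is a difference p - q of two finite
  Borel measures on the sphere; its total variation |mu|(S) is the infimum of
  p(S) + q(S) over such decompositions.\<close>

definition sphere_measure :: "('a::euclidean_space \<times> real) measure \<Rightarrow> bool" where
  "sphere_measure p \<longleftrightarrow> sets p = sets (restrict_space borel (sphere 0 1)) \<and> finite_measure p"

definition f_meas :: "('a::euclidean_space \<times> real) measure \<Rightarrow> 'a \<Rightarrow> real" where
  "f_meas p x = (\<integral>v. relu (inner (x, 1) v) \<partial>p)"

definition barron_norm :: "('a::euclidean_space \<Rightarrow> real) \<Rightarrow> ereal" where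
  "barron_norm g = Inf {ereal (measure p (space p) + measure q (space q)) | p q.
      sphere_measure p \<and> sphere_measure q \<and> (\<forall>x\<in>cball 0 1. g x = f_meas p x - f_meas q x)}"

definition barron_class :: "real \<Rightarrow> ('a::euclidean_space \<Rightarrow> real) set" where
  "barron_class M = {g. barron_norm g \<le> ereal M}"

fun dpart :: "'a list \<Rightarrow> ('a::euclidean_space \<Rightarrow> real) \<Rightarrow> 'a \<Rightarrow> real" where
  "dpart [] f = f"
| "dpart (i # is) f = (\<lambda>x. frechet_derivative (dpart is f) (at x) i)"

definition holder_smooth :: "nat \<Rightarrow> ('a::euclidean_space \<Rightarrow> real) \<Rightarrow> bool" where
  "holder_smooth r f \<longleftrightarrow>
     (\<forall>is. set is \<subseteq> Basis \<and> length is < r \<longrightarrow> (\<forall>x. dpart is f differentiable (at x)))"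

definition holder_norm :: "nat \<Rightarrow> real \<Rightarrow> ('a::euclidean_space \<Rightarrow> real) \<Rightarrow> ereal" where
  "holder_norm r \<beta> f =
     (if holder_smooth r f then
        Sup ({ereal \<bar>dpart is f x\<bar> | is x. set is \<subseteq> Basis \<and> length is \<le> r} \<union>
             {ereal (\<bar>dpart is f x - dpart is f y\<bar> / norm (x - y) powr \<beta>) | is x y.
                 set is \<subseteq> Basis \<and> length is = r \<and> x \<noteq> y})
      else \<infinity>)"

definition holder_ball_norm :: "nat \<Rightarrow> real \<Rightarrow> ('a::euclidean_space \<Rightarrow> real) \<Rightarrow> ereal" where
  "holder_ball_norm r \<beta> g = Inf {holder_norm r \<beta> f | f. \<forall>x\<in>cball 0 1. f x = g x}"

text \<open>alpha = r + beta with r a natural number and beta in (0,1].\<close>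

definition holder_unit_ball :: "real \<Rightarrow> ('a::euclidean_space \<Rightarrow> real) set" where
  "holder_unit_ball \<alpha> =
     {g. holder_ball_norm (nat (\<lceil>\<alpha>\<rceil> - 1)) (\<alpha> - of_int (\<lceil>\<alpha>\<rceil> - 1)) g \<le> 1}"

definition regression_setting :: "('a::euclidean_space \<times> real) measure \<Rightarrow> real \<Rightarrow> ('a \<Rightarrow> real) \<Rightarrow> bool" where
  "regression_setting P B h \<longleftrightarrow>
     prob_space P \<and> sets P = sets borel \<and>
     (AE z in P. fst z \<in> cball 0 1) \<and>
     (AE z in P. \<bar>snd z\<bar> \<le> B) \<and>
     (AE z in P. h (fst z) = real_cond_exp P (vimage_algebra (space P) fst borel) snd z)"

definition emp_risk :: "nat \<Rightarrow> (nat \<Rightarrow> 'a \<times> real) \<Rightarrow> ('a \<Rightarrow> real) \<Rightarrow> real" where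
  "emp_risk n D f = (\<Sum>i<n. (f (fst (D i)) - snd (D i))\<^sup>2) / real n"

text \<open>Squared L2(mu) distance, mu the law of X (concentrated on the unit ball).\<close>

definition l2_err :: "('a::euclidean_space \<times> real) measure \<Rightarrow> ('a \<Rightarrow> real) \<Rightarrow> ('a \<Rightarrow> real) \<Rightarrow> real" where
  "l2_err P f h = (LINT x:cball 0 1|distr P borel fst. (f x - h x)\<^sup>2)"

end

theory Submission
  imports Defs "HOL-Probability.Probability"
begin

text \<open>
  The statistical part compares the minimiser with a much smaller network. Among \<open>m\<close> neurons
  there are always \<open>d + 3\<close> of similar weight whose directions are \<open>m powr (-1/d)\<close>-close and lie in the same
  cell of an arrangement of hyperplanes; they satisfy a linear relation along which one neuron can be
  removed without increasing the weight, and by convexity of the quadratic risk this costs only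
  \<open>M^2 m powr (-2 - 3/d) ln m\<close>. Hence only networks with \<open>n powr (d / (d + 2 \<alpha>))\<close> neurons matter, and these have a
  finite net to which a Bernstein-type deviation bound applies.

  For the approximation, a function of Hoelder smoothness \<open>\<alpha>\<close> is cut off and smoothed at scale \<open>\<delta>\<close> with error
  \<open>\<delta> powr \<alpha>\<close>. Writing the Fourier integral in polar coordinates and expanding \<open>cis (s * b)\<close> to second order turns
  it into a superposition of ReLU functions. Its weight is \<open>O(\<delta> powr (\<alpha> - (d + 3)/2))\<close> by the Cauchy-Schwarz inequality
  and Bessel's inequality, the latter used in the whole space and along each ray.
\<close>

subsection \<open>Sign patterns of hyperplane arrangements\<close>

text \<open>\<open>N_n\<close> is bounded only from below, so the entropy of the class searched by
  the minimiser is uncontrolled; only the weight is. The minimiser must therefore be replaced by a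
  small network close to it both in empirical risk and in \<open>L2(\<mu>)\<close>. One
  sparsification does both if it is run for the average of the empirical measure and the law of
  \<open>(X, fhat X)\<close>, whose quadratic risk is the squared distance to \<open>fhat\<close>;
  minimality on the sample then yields a distance bound. The result lies in a class fixed before the
  sample is seen. The exponents balance: for \<open>N1\<close> of order
  \<open>n powr (d / (d + 2 * \<alpha>))\<close> both the sparsification cost
  \<open>M^2 * N1 powr (-1 - 3/d)\<close> and the entropy per observation \<open>N1 / n\<close> are
  of order \<open>n powr (- 2 * \<alpha> / (d + 2 * \<alpha>))\<close>, up to logarithms.
  Approximating networks may have any width, as they are sparsified too; hence only the weight of an
  integral representation matters there. The class \<open>barron_class 1\<close> corresponds to
  \<open>\<alpha> = (d + 3) / 2\<close>, where the weight exponent vanishes.\<close>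

lemma card_halfspace_patterns_le:
  fixes u :: "'j \<Rightarrow> 'b::euclidean_space" and c :: "'j \<Rightarrow> real"
  assumes "finite J" "affine A" "aff_dim A \<le> int k"
  shows "card ((\<lambda>v. {j\<in>J. u j \<bullet> v > c j}) ` A) \<le> (card J + 1) ^ k"
  using assms
proof (induction J arbitrary: A k rule: finite_induct)
  case empty
  have "(\<lambda>v. {j \<in> {}. u j \<bullet> v > c j}) ` A \<subseteq> {{}}" by auto
  then have "card ((\<lambda>v. {j \<in> {}. u j \<bullet> v > c j}) ` A) \<le> card {{}::'j set}"
    by (intro card_mono) auto
  then show ?case by simp
next
  \<comment> \<open>Deletion and restriction: adding hyperplane \<open>j\<close> doubles only those
    old patterns that occur on both sides of it, and these are patterns of the arrangement
    restricted to the hyperplane, where the dimension is one lower.\<close>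
  case (insert j J)
  define pat where "pat = (\<lambda>v. {i\<in>J. u i \<bullet> v > c i})"
  define P0 where "P0 = pat ` {v\<in>A. u j \<bullet> v \<le> c j}"
  define P1 where "P1 = pat ` {v\<in>A. u j \<bullet> v > c j}"
  define H where "H = {v. u j \<bullet> v = c j}"
  have fin: "finite (pat ` S)" for S
    by (rule finite_subset[of _ "Pow J"]) (use insert.hyps in \<open>auto simp: pat_def\<close>)
  have sub: "(\<lambda>v. {i \<in> insert j J. u i \<bullet> v > c i}) ` A \<subseteq> P0 \<union> (insert j) ` P1"
  proof
    fix S assume "S \<in> (\<lambda>v. {i \<in> insert j J. u i \<bullet> v > c i}) ` A"
    then obtain v where v: "v \<in> A" "S = {i \<in> insert j J. u i \<bullet> v > c i}" by auto
    show "S \<in> P0 \<union> (insert j) ` P1"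
    proof (cases "u j \<bullet> v > c j")
      case True
      then have "S = insert j (pat v)" using v by (auto simp: pat_def)
      with True v show ?thesis by (auto simp: P1_def)
    next
      case False
      then have "S = pat v" using v by (auto simp: pat_def)
      with False v show ?thesis by (auto simp: P0_def)
    qed
  qed
  have "card ((\<lambda>v. {i \<in> insert j J. u i \<bullet> v > c i}) ` A) \<le> card (P0 \<union> (insert j) ` P1)"
    by (rule card_mono[OF _ sub]) (auto simp: P0_def P1_def fin)
  also have "\<dots> \<le> card P0 + card (insert j ` P1)" by (rule card_Un_le)
  also have "\<dots> \<le> card P0 + card P1"
    using card_image_le[of P1 "insert j"] fin by (simp add: P1_def)
  also have "\<dots> = card (P0 \<union> P1) + card (P0 \<inter> P1)"
    by (rule card_Un_Int) (simp_all add: P0_def P1_def fin)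
  also have "P0 \<union> P1 = pat ` A" unfolding P0_def P1_def by (auto simp: not_le[symmetric])
  finally have le: "card ((\<lambda>v. {i \<in> insert j J. u i \<bullet> v > c i}) ` A) \<le> card (pat ` A) + card (P0 \<inter> P1)" .
  have A: "card (pat ` A) \<le> (card J + 1) ^ k"
    using insert.IH[OF insert.prems] by (simp add: pat_def)
  \<comment> \<open>Half-spaces are convex, so the point \<open>z\<close> where the segment from
    \<open>v\<close> to \<open>w\<close> crosses the hyperplane keeps the common pattern of its end
    points.\<close>
  have meet: "P0 \<inter> P1 \<subseteq> pat ` (A \<inter> H)"
  proof
    fix S assume "S \<in> P0 \<inter> P1"
    then obtain v w where v: "v \<in> A" "u j \<bullet> v \<le> c j" "S = pat v"
      and w: "w \<in> A" "u j \<bullet> w > c j" "S = pat w" by (auto simp: P0_def P1_def)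
    define s where "s = (c j - u j \<bullet> v) / (u j \<bullet> w - u j \<bullet> v)"
    have pos: "u j \<bullet> w - u j \<bullet> v > 0" using v w by linarith
    have s: "0 \<le> s" "s \<le> 1" using v w by (auto simp: s_def field_simps)
    define z where "z = (1 - s) *\<^sub>R v + s *\<^sub>R w"
    have zA: "z \<in> A" unfolding z_def using insert.prems(1) v w by (auto simp: affine_alt)
    have ip: "x \<bullet> z = (1 - s) * (x \<bullet> v) + s * (x \<bullet> w)" for x
      by (simp add: z_def inner_add_right)
    have "u j \<bullet> z = u j \<bullet> v + s * (u j \<bullet> w - u j \<bullet> v)" by (simp add: ip algebra_simps)
    also have "\<dots> = c j" using pos by (simp add: s_def)
    finally have "z \<in> H" by (simp add: H_def)
    have "u i \<bullet> z > c i \<longleftrightarrow> u i \<bullet> v > c i" if "i \<in> J" for i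
    proof -
      have iff: "u i \<bullet> v > c i \<longleftrightarrow> u i \<bullet> w > c i" using v(3) w(3) that by (auto simp: pat_def)
      show ?thesis
      proof (cases "u i \<bullet> v > c i")
        case True
        then have "u i \<bullet> w > c i" using iff by simp
        then have "(1 - s) * (u i \<bullet> v) + s * (u i \<bullet> w) > c i" using True s convex_bound_lt[of "- (u i \<bullet> v)" "- c i" "- (u i \<bullet> w)" "1-s" s] by auto
        then show ?thesis using True ip by simp
      next
        case False
        then have "u i \<bullet> w \<le> c i" using iff by simp
        then have "(1 - s) * (u i \<bullet> v) + s * (u i \<bullet> w) \<le> c i" using False s convex_bound_le[of "u i \<bullet> v" "c i" "u i \<bullet> w" "1-s" s] by auto
        then show ?thesis using False ip by simp
      qed
    qed
    then have "pat z = S" using v by (auto simp: pat_def)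
    then show "S \<in> pat ` (A \<inter> H)" using zA \<open>z \<in> H\<close> by auto
  qed
  show ?case
  proof (cases "P0 \<inter> P1 = {}")
    case True
    then have "card ((\<lambda>v. {i \<in> insert j J. u i \<bullet> v > c i}) ` A) \<le> (card J + 1) ^ k" using le A by simp
    also have "\<dots> \<le> (card (insert j J) + 1) ^ k" using insert.hyps by (intro power_mono) auto
    finally show ?thesis .
  next
    case False
    then obtain v w where v: "v \<in> A" "u j \<bullet> v \<le> c j"
      and w: "w \<in> A" "u j \<bullet> w > c j" by (auto simp: P0_def P1_def)
    have ne: "A \<inter> H \<noteq> {}" using meet False by auto
    have "\<not> A \<subseteq> H" using w by (auto simp: H_def)
    then have dim: "aff_dim (A \<inter> H) = aff_dim A - 1"
      using aff_dim_affine_Int_hyperplane[OF insert.prems(1), of "u j" "c j"] ne by (auto simp: H_def Int_commute)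
    then have "aff_dim A \<ge> 1" using ne aff_dim_negative_iff[of "A \<inter> H"] by linarith
    then obtain k' where k: "k = Suc k'" using insert.prems(2) by (cases k) auto
    have "card (pat ` (A \<inter> H)) \<le> (card J + 1) ^ k'"
      unfolding pat_def
      by (rule insert.IH) (use insert.prems dim k in \<open>auto simp: H_def intro!: affine_Int affine_hyperplane\<close>)
    then have "card (P0 \<inter> P1) \<le> (card J + 1) ^ k'"
      using card_mono[OF fin meet] by simp
    then have "card ((\<lambda>v. {i \<in> insert j J. u i \<bullet> v > c i}) ` A) \<le> (card J + 1) ^ k + (card J + 1) ^ k'"
      using le A by simp
    also have "\<dots> = (card J + 2) * (card J + 1) ^ k'" by (simp add: k)
    also have "\<dots> \<le> (card J + 2) * (card J + 2) ^ k'" by (intro mult_left_mono power_mono) auto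
    also have "\<dots> = (card (insert j J) + 1) ^ k" using insert.hyps by (simp add: k)
    finally show ?thesis .
  qed
qed

text \<open>Greedy choice: every remaining set has measure at least \<open>\<epsilon>\<close>, so
  averaging over \<open>\<nu>\<close> gives a point lying in a fraction \<open>\<epsilon>\<close> of
  them, and each further point shrinks what is left by \<open>1 - \<epsilon>\<close>.\<close>

lemma exists_hitting_list:
  fixes E :: "'s \<Rightarrow> 'z set"
  assumes "prob_space \<nu>" "finite S" "\<And>s. s \<in> S \<Longrightarrow> E s \<in> sets \<nu>"
    and "\<And>s. s \<in> S \<Longrightarrow> measure \<nu> (E s) \<ge> \<epsilon>" "\<epsilon> \<le> 1"
  shows "\<exists>xs. length xs = r \<and> set xs \<subseteq> space \<nu> \<and>
     real (card {s\<in>S. \<forall>x\<in>set xs. x \<notin> E s}) \<le> (1 - \<epsilon>) ^ r * real (card S)"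
proof (induction r)
  case 0
  show ?case by (intro exI[of _ "[]"]) auto
next
  case (Suc r)
  interpret prob_space \<nu> by fact
  from Suc obtain xs where xs: "length xs = r" "set xs \<subseteq> space \<nu>"
    "real (card {s\<in>S. \<forall>x\<in>set xs. x \<notin> E s}) \<le> (1 - \<epsilon>) ^ r * real (card S)" by blast
  define U where "U = {s\<in>S. \<forall>x\<in>set xs. x \<notin> E s}"
  have finU: "finite U" using assms(2) by (simp add: U_def)
  have "\<exists>x\<in>space \<nu>. real (card {s\<in>U. x \<in> E s}) \<ge> \<epsilon> * real (card U)"
  proof (rule ccontr)
    assume "\<not> ?thesis"
    then have lt: "real (card {s\<in>U. x \<in> E s}) < \<epsilon> * real (card U)" if "x \<in> space \<nu>" for x
      using that by force
    have eq: "real (card {s\<in>U. x \<in> E s}) = (\<Sum>s\<in>U. indicator (E s) x)" for x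
      using finU by (simp add: indicator_def sum.If_cases Int_def)
    have meas: "E s \<in> sets \<nu>" if "s \<in> U" for s using that assms by (auto simp: U_def)
    have int: "integrable \<nu> (\<lambda>x. \<Sum>s\<in>U. indicator (E s) x :: real)"
      by (intro Bochner_Integration.integrable_sum) (use meas in \<open>auto simp: emeasure_eq_measure\<close>)
    have "(\<integral>x. (\<Sum>s\<in>U. indicator (E s) x :: real) \<partial>\<nu>) < (\<integral>x. \<epsilon> * real (card U) \<partial>\<nu>)"
    proof (rule integral_less_AE_space[OF int])
      show "AE x in \<nu>. (\<Sum>s\<in>U. indicator (E s) x :: real) < \<epsilon> * real (card U)"
        using lt by (auto simp: eq)
      show "emeasure \<nu> (space \<nu>) \<noteq> 0" by (simp add: emeasure_space_1)
    qed auto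
    moreover have "(\<integral>x. (\<Sum>s\<in>U. indicator (E s) x :: real) \<partial>\<nu>) = (\<Sum>s\<in>U. measure \<nu> (E s))"
      by (subst Bochner_Integration.integral_sum) (use meas in \<open>auto simp: emeasure_eq_measure\<close>)
    moreover have "(\<Sum>s\<in>U. measure \<nu> (E s)) \<ge> (\<Sum>s\<in>U. \<epsilon>)"
      by (rule sum_mono) (use assms in \<open>auto simp: U_def\<close>)
    ultimately show False by (simp add: prob_space mult.commute)
  qed
  then obtain x where x: "x \<in> space \<nu>" "real (card {s\<in>U. x \<in> E s}) \<ge> \<epsilon> * real (card U)" by blast
  have "{s\<in>S. \<forall>y\<in>set (x # xs). y \<notin> E s} = U - {s\<in>U. x \<in> E s}" by (auto simp: U_def)
  then have "real (card {s\<in>S. \<forall>y\<in>set (x # xs). y \<notin> E s}) = real (card U) - real (card {s\<in>U. x \<in> E s})"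
    using finU by (simp add: card_Diff_subset of_nat_diff card_mono)
  also have "\<dots> \<le> (1 - \<epsilon>) * real (card U)" using x by (simp add: algebra_simps)
  also have "\<dots> \<le> (1 - \<epsilon>) * ((1 - \<epsilon>) ^ r * real (card S))"
    using xs(3) assms(5) by (intro mult_left_mono) (auto simp: U_def)
  finally show ?case using xs x by (intro exI[of _ "x # xs"]) (auto simp: mult.assoc)
qed

lemma fiber_card_pigeonhole:
  fixes I :: "'i set"
  assumes "finite I" "card (f ` I) * k < card I"
  obtains y where "y \<in> f ` I" "card {i\<in>I. f i = y} > k"
proof -
  have "\<exists>y\<in>f ` I. card {i\<in>I. f i = y} > k"
  proof (rule ccontr)
  assume "\<not> (\<exists>y\<in>f ` I. card {i\<in>I. f i = y} > k)"
  then have le: "card {i\<in>I. f i = y} \<le> k" if "y \<in> f ` I" for y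
    using that by (meson not_le)
  have "I = (\<Union>y\<in>f ` I. {i\<in>I. f i = y})" by auto
  then have "card I \<le> (\<Sum>y\<in>f ` I. card {i\<in>I. f i = y})"
    using card_UN_le[of "f ` I" "\<lambda>y. {i\<in>I. f i = y}"] assms(1) by simp
  also have "\<dots> \<le> (\<Sum>y\<in>f ` I. k)" by (rule sum_mono) (use le in auto)
  finally show False using assms(2) by simp
  qed
  then show thesis using that by blast
qed

lemma norm_normalize_diff_le:
  fixes w z :: "'b::real_normed_vector"
  assumes "norm w \<ge> 1" "norm z \<ge> 1"
  shows "norm ((1 / norm w) *\<^sub>R w - (1 / norm z) *\<^sub>R z) \<le> 2 * norm (w - z)"
proof -
  have eq: "(1 / norm w) *\<^sub>R w - (1 / norm z) *\<^sub>R z = (1 / norm w) *\<^sub>R (w - z) + (1 / norm w - 1 / norm z) *\<^sub>R z"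
    by (simp add: algebra_simps)
  have le: "r / norm w \<le> r" if "r \<ge> 0" for r
    using mult_left_mono[OF assms(1) that] assms that by (simp add: divide_le_eq)
  have a: "norm ((1 / norm w) *\<^sub>R (w - z)) \<le> norm (w - z)"
    using le[of "norm (w - z)"] by simp
  have "(1 / norm w - 1 / norm z) * norm z = (norm z - norm w) / norm w"
    using assms by (auto simp: field_simps)
  then have "norm ((1 / norm w - 1 / norm z) *\<^sub>R z) = \<bar>(norm z - norm w) / norm w\<bar>"
    by (metis abs_mult abs_norm_cancel norm_scaleR)
  also have "\<dots> = \<bar>norm z - norm w\<bar> / norm w" by simp
  also have "\<dots> \<le> norm (w - z) / norm w"
    using assms by (intro divide_right_mono) (auto simp: norm_minus_commute intro: order_trans[OF norm_triangle_ineq3])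
  also have "\<dots> \<le> norm (w - z)"
    by (rule le) simp
  finally have "norm ((1 / norm w - 1 / norm z) *\<^sub>R z) \<le> norm (w - z)" .
  with a show ?thesis unfolding eq
    using norm_triangle_ineq[of "(1 / norm w) *\<^sub>R (w - z)" "(1 / norm w - 1 / norm z) *\<^sub>R z"] by linarith
qed

lemma grid_pattern_close:
  fixes s t :: real and g :: nat
  assumes "g > 0" "\<bar>s\<bar> \<le> 1" "\<bar>t\<bar> \<le> 1"
    and pat: "\<And>k::int. k \<in> {- int g..int g} \<Longrightarrow> s > of_int k / real g \<longleftrightarrow> t > of_int k / real g"
  shows "\<bar>s - t\<bar> \<le> 1 / real g"
proof -
  have main: "s \<le> t + 1 / real g" if st: "\<bar>s\<bar> \<le> 1" "\<bar>t\<bar> \<le> 1"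
    "\<And>k::int. k \<in> {- int g..int g} \<Longrightarrow> s > of_int k / real g \<longleftrightarrow> t > of_int k / real g" for s t
  proof -
    \<comment> \<open>The first grid value not below \<open>t\<close>. By equality of the patterns
      \<open>s\<close> does not exceed it either, and it is less than \<open>1 / g\<close> above
      \<open>t\<close>.\<close>
    define k where "k = \<lceil>real g * t\<rceil>"
    have b: "real g * t \<le> of_int k" "of_int k < real g * t + 1" unfolding k_def by linarith+
    have "real g * t \<le> real g * 1" "real g * t \<ge> real g * (-1)" using st(2) by (intro mult_left_mono; auto)+
    then have "k \<in> {- int g..int g}" unfolding k_def by (auto simp: ceiling_le_iff le_ceiling_iff)
    moreover have "\<not> t > of_int k / real g" using b assms(1) by (simp add: field_simps)
    ultimately have "s \<le> of_int k / real g" using st(3) by force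
    also have "\<dots> \<le> t + 1 / real g" using b assms(1) by (simp add: field_simps)
    finally show ?thesis .
  qed
  have "s \<le> t + 1 / real g" by (rule main) (use assms in auto)
  moreover have "t \<le> s + 1 / real g" by (rule main) (use assms in auto)
  ultimately show ?thesis by linarith
qed

text \<open>The neurons of \<open>S\<close> are neither all active nor all inactive at
  \<open>x\<close>. Only at such points can a linear relation between the directions fail to pass to
  the ReLU functions.\<close>

definition separates :: "'a::euclidean_space \<Rightarrow> ('i \<Rightarrow> 'a \<times> real) \<Rightarrow> 'i set \<Rightarrow> bool" where
  "separates x v S \<longleftrightarrow> (\<exists>i\<in>S. \<exists>j\<in>S. (x, 1) \<bullet> v i > 0 \<and> (x, 1) \<bullet> v j \<le> 0)"

lemma borel_separates:
  assumes "finite S" "sets \<nu> = sets (borel :: ('a::euclidean_space \<times> real) measure)"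
  shows "{z. separates (fst z) v S} \<in> sets \<nu>"
proof -
  have "{z. separates (fst z) v S} = (\<Union>i\<in>S. \<Union>j\<in>S. {z::'a \<times> real. (fst z, 1::real) \<bullet> v i > 0} \<inter> {z. (fst z, 1::real) \<bullet> v j \<le> 0})"
    by (auto simp: separates_def)
  also have "\<dots> \<in> sets borel"
    by (intro sets.finite_UN assms(1) sets.Int borel_open borel_closed open_Collect_less closed_Collect_le continuous_intros)
  finally show ?thesis using assms(2) by simp
qed

text \<open>Pigeonhole in the arrangement of the hyperplanes orthogonal to \<open>(x, 1)\<close>, for few well-chosen \<open>x\<close>,
  and of a grid of hyperplanes on each face of the cube circumscribed to the sphere.\<close>

lemma exists_clustered_group:
  fixes v :: "'i \<Rightarrow> 'a::euclidean_space \<times> real"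
  defines "d \<equiv> DIM('a)"
  defines "q \<equiv> 2 * (d + 1) * (d + 3) * (3 * d + 5) ^ d"
  defines "C \<equiv> 4 * (real d + 4) * real q powr (1 / real d)"
  assumes "prob_space \<nu>" "sets \<nu> = sets (borel :: ('a \<times> real) measure)" "finite I"
    and v: "\<And>i. i \<in> I \<Longrightarrow> norm (v i) = 1" and m: "m = card I" "m \<ge> q"
  shows "\<exists>S\<subseteq>I. card S = d + 3 \<and> (\<forall>i\<in>S. \<forall>j\<in>S. norm (v i - v j) \<le> C * real m powr (- (1 / real d))) \<and>
     measure \<nu> {z. separates (fst z) v S} \<le> C * real m powr (- (1 / real d)) * ln (real m)"
proof -
  interpret prob_space \<nu> by fact
  have d: "d \<ge> 1" by (simp add: d_def Suc_leI)
  have q: "q \<ge> 1" by (simp add: q_def)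
  have "q \<ge> 2 * 1 * (1 + 0) * 1"
    unfolding q_def by (intro mult_mono) auto
  then have q2: "q \<ge> 2" by simp
  have m1: "real m \<ge> 2" using m q2 by linarith
  \<comment> \<open>Solves \<open>q * y ^ d = m\<close>. Here \<open>q * g ^ d\<close> bounds
    \<open>d + 3\<close> times the number of classes \<open>cls\<close> at resolution
    \<open>g\<close>, so that \<open>m\<close> neurons force a class with \<open>d + 3\<close>
    members; rounding \<open>y\<close> down loses at most a factor 2.\<close>
  define y where "y = (real m / real q) powr (1 / real d)"
  have y1: "y \<ge> 1" unfolding y_def using m q by (intro ge_one_powr_ge_zero) (auto simp: field_simps)
  define g where "g = nat \<lfloor>y\<rfloor>"
  have g1: "g \<ge> 1" using y1 by (simp add: g_def le_nat_iff le_floor_iff)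
  have gy: "real g \<le> y" using y1 by (simp add: g_def)
  have gy2: "real g \<ge> y / 2" proof -
    have "real g = of_int \<lfloor>y\<rfloor>" using y1 by (simp add: g_def)
    then show ?thesis using g1 floor_correct[of y] by linarith
  qed
  have gm: "real q * real g ^ d \<le> real m"
  proof -
    have "real g ^ d \<le> y ^ d" using gy by (intro power_mono) auto
    also have "y ^ d = y powr real d" using y1 by (simp add: powr_realpow)
    also have "\<dots> = real m / real q" unfolding y_def using d m q by (simp add: powr_powr)
    finally show ?thesis using q by (simp add: field_simps)
  qed
  have ginv: "1 / real g \<le> 2 * real q powr (1 / real d) * real m powr (- (1 / real d))"
  proof -
    have "1 / real g \<le> 2 / y" using gy2 y1 g1 by (simp add: field_simps)
    also have "\<dots> = 2 * real q powr (1 / real d) * real m powr (- (1 / real d))"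
      using q m1 by (simp add: y_def powr_divide powr_minus field_simps)
    finally show ?thesis .
  qed
  \<comment> \<open>Chosen so that \<open>g * \<epsilon> = (d + 4) * ln m\<close>: after
    \<open>g\<close> greedy points the factor
    \<open>(1 - \<epsilon>) ^ g \<le> 1 / m ^ (d + 4)\<close> beats the at most
    \<open>m ^ (d + 3)\<close> groups, and no bad group stays unhit.\<close>
  define \<epsilon> where "\<epsilon> = (real d + 4) * ln (real m) / real g"
  define X where "X = (\<lambda>S. {z::'a\<times>real. separates (fst z) v S})"
  define Bad where "Bad = {S. S \<subseteq> I \<and> card S = d + 3 \<and> measure \<nu> (X S) \<ge> \<epsilon>}"
  have finI: "finite I" by fact
  have finBad: "finite Bad" by (rule finite_subset[of _ "Pow I"]) (auto simp: Bad_def finI)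
  have XM: "X S \<in> sets \<nu>" if "S \<subseteq> I" for S
    unfolding X_def using borel_separates[of S \<nu>] assms(5) that finite_subset[OF _ finI] by auto
  have cardBad: "real (card Bad) \<le> real m ^ (d + 3)"
  proof -
    have "card Bad \<le> card {S. S \<subseteq> I \<and> card S = d + 3}"
      by (rule card_mono) (auto simp: Bad_def finI)
    also have "\<dots> = m choose (d + 3)" using n_subsets[OF finI] m by simp
    also have "\<dots> \<le> m ^ (d + 3)" by (cases "d + 3 \<le> m") (auto intro: binomial_le_pow simp: binomial_eq_0)
    finally show ?thesis using of_nat_mono by fastforce
  qed
  have "\<exists>xs. length xs = g \<and> {S\<in>Bad. \<forall>x\<in>set xs. x \<notin> X S} = {}"
  proof (cases "\<epsilon> \<le> 1")
    case False
    have "Bad = {}" unfolding Bad_def using False by (auto simp: not_le intro: le_less_trans[OF prob_le_1])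
    then show ?thesis by (intro exI[of _ "replicate g undefined"]) auto
  next
    case True
    obtain xs where xs: "length xs = g"
      "real (card {S\<in>Bad. \<forall>x\<in>set xs. x \<notin> X S}) \<le> (1 - \<epsilon>) ^ g * real (card Bad)"
    proof -
      have "X S \<in> sets \<nu>" "measure \<nu> (X S) \<ge> \<epsilon>" if "S \<in> Bad" for S
        using that XM by (auto simp: Bad_def)
      from exists_hitting_list[where E = X and r = g, OF \<open>prob_space \<nu>\<close> finBad _ _ True]
      have "\<exists>xs. length xs = g \<and> set xs \<subseteq> space \<nu> \<and>
        real (card {S\<in>Bad. \<forall>x\<in>set xs. x \<notin> X S}) \<le> (1 - \<epsilon>) ^ g * real (card Bad)"
        using \<open>\<And>S. S \<in> Bad \<Longrightarrow> X S \<in> sets \<nu>\<close> \<open>\<And>S. S \<in> Bad \<Longrightarrow> \<epsilon> \<le> measure \<nu> (X S)\<close> by auto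
      then show thesis by (elim exE conjE) (rule that)
    qed
    have "(1 - \<epsilon>) ^ g \<le> exp (- \<epsilon>) ^ g" using True exp_ge_add_one_self[of "-\<epsilon>"] by (intro power_mono) auto
    also have "\<dots> = exp (- (real g * \<epsilon>))" by (simp add: exp_of_nat_mult[symmetric])
    also have "real g * \<epsilon> = real (d + 4) * ln (real m)" using g1 by (simp add: \<epsilon>_def)
    also have "exp (- (real (d + 4) * ln (real m))) = 1 / real m ^ (d + 4)"
      using m1 by (simp add: exp_minus exp_of_nat_mult inverse_eq_divide del: of_nat_add)
    finally have "(1 - \<epsilon>) ^ g * real (card Bad) \<le> 1 / real m ^ (d + 4) * real m ^ (d + 3)"
      using cardBad by (intro mult_mono) auto
    also have "\<dots> = 1 / real m" using m1 by (simp add: power_add field_simps eval_nat_numeral)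
    also have "\<dots> < 1" using m1 by simp
    finally have "card {S\<in>Bad. \<forall>x\<in>set xs. x \<notin> X S} = 0" using xs(2) by linarith
    then show ?thesis using xs finBad by (intro exI[of _ xs]) auto
  qed
  then obtain xs where xs: "length xs = g" "{S\<in>Bad. \<forall>x\<in>set xs. x \<notin> X S} = {}" by blast

  \<comment> \<open>\<open>Inl k\<close> is the hyperplane orthogonal to
    \<open>(fst (xs ! k), 1)\<close>, which records the activity at a hitting point;
    \<open>Inr (b, k)\<close> is the grid hyperplane on which coordinate \<open>b\<close> equals
    \<open>k / g\<close>.\<close>
  define J where "J = ({..<g} <+> ((Basis :: ('a\<times>real) set) \<times> {- int g..int g}))"
  define u where "u = case_sum (\<lambda>k. (fst (xs ! k), 1)) (\<lambda>(b, k::int). b :: 'a \<times> real)"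
  define c where "c = case_sum (\<lambda>k::nat. 0) (\<lambda>(b::'a\<times>real, k). of_int k / real g)"
  have finJ: "finite J" by (simp add: J_def)
  have DIM: "DIM('a \<times> real) = d + 1" by (simp add: d_def)
  have cardJ: "card J + 1 \<le> (3 * d + 5) * g"
  proof -
    have "nat (2 * int g + 1) = 1 + 2 * g" by (simp add: nat_add_distrib nat_mult_distrib)
    then have "card J = g + (d + 1) * (2 * g + 1)"
      unfolding J_def using DIM by (simp add: card_Plus card_cartesian_product)
    also have "\<dots> + 1 \<le> g + (d + 1) * (3 * g) + g" using g1 by (intro add_mono mult_left_mono) auto
    also have "\<dots> = (3 * d + 5) * g" by (simp add: algebra_simps)
    finally show ?thesis by simp
  qed
  define pat where "pat = (\<lambda>w. {j\<in>J. u j \<bullet> w > c j})"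
  have finpat: "finite (pat ` A)" for A
    by (rule finite_subset[of _ "Pow J"]) (auto simp: pat_def finJ)
  define bs where "bs = (\<lambda>w::'a\<times>real. SOME b. b \<in> Basis \<and> (\<forall>b'\<in>Basis. \<bar>w \<bullet> b'\<bar> \<le> \<bar>w \<bullet> b\<bar>))"
  have bs: "bs w \<in> Basis \<and> (\<forall>b'\<in>Basis. \<bar>w \<bullet> b'\<bar> \<le> \<bar>w \<bullet> bs w\<bar>)" for w
  proof -
    have "\<exists>b. b \<in> Basis \<and> (\<forall>b'\<in>Basis. \<bar>w \<bullet> b'\<bar> \<le> \<bar>w \<bullet> b\<bar>)"
    proof -
      have "Max ((\<lambda>b. \<bar>w \<bullet> b\<bar>) ` Basis) \<in> (\<lambda>b. \<bar>w \<bullet> b\<bar>) ` Basis" by (rule Max_in) auto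
      then obtain b where "b \<in> Basis" "Max ((\<lambda>b. \<bar>w \<bullet> b\<bar>) ` Basis) = \<bar>w \<bullet> b\<bar>" by (rule imageE) blast
      moreover have "\<forall>b'\<in>Basis. \<bar>w \<bullet> b'\<bar> \<le> Max ((\<lambda>b. \<bar>w \<bullet> b\<bar>) ` Basis)" by auto
      ultimately show ?thesis by (intro exI[of _ b]) simp
    qed
    then show ?thesis unfolding bs_def by (rule someI_ex)
  qed
  have bs0: "w \<bullet> bs w \<noteq> 0" if "norm w = 1" for w
  proof
    assume "w \<bullet> bs w = 0"
    then have "\<And>b. b \<in> Basis \<Longrightarrow> w \<bullet> b = 0" using bs[of w] by auto
    then have "w = 0" by (auto simp: euclidean_eq_iff[of w])
    with that show False by simp
  qed
  \<comment> \<open>Radial projection onto the boundary of the cube, \<open>bs w\<close> being an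
    axis of largest coordinate. Patterns are then counted on \<open>d\<close>-dimensional faces,
    which gives the power \<open>d\<close> instead of \<open>d + 1\<close>; positive scaling does
    not change the sign of the inner product with \<open>(x, 1)\<close>.\<close>
  define pr where "pr = (\<lambda>w::'a\<times>real. (1 / \<bar>w \<bullet> bs w\<bar>) *\<^sub>R w)"
  define cls where "cls = (\<lambda>i. (bs (v i), sgn (v i \<bullet> bs (v i)), pat (pr (v i))))"
  have prb: "pr w \<bullet> bs w = sgn (w \<bullet> bs w)" for w
    by (simp add: pr_def real_sgn_eq)
  have clssub: "cls ` I \<subseteq> (\<Union>(b, s)\<in>Basis \<times> {1, -1}. (\<lambda>p. (b, s, p)) ` (pat ` {w. b \<bullet> w = s}))"
  proof
    fix t assume "t \<in> cls ` I"
    then obtain i where i: "i \<in> I" "t = cls i" by auto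
    have "sgn (v i \<bullet> bs (v i)) \<in> {1, -1}" using bs0[OF v[OF i(1)]] by (auto simp: sgn_if)
    moreover have "bs (v i) \<in> Basis" using bs by blast
    moreover have "pat (pr (v i)) \<in> pat ` {w. bs (v i) \<bullet> w = sgn (v i \<bullet> bs (v i))}"
      using prb[of "v i"] by (auto simp: inner_commute)
    ultimately show "t \<in> (\<Union>(b, s)\<in>Basis \<times> {1, -1}. (\<lambda>p. (b, s, p)) ` (pat ` {w. b \<bullet> w = s}))"
      unfolding i(2) cls_def by (intro UN_I[of "(bs (v i), sgn (v i \<bullet> bs (v i)))"]) auto
  qed
  have cell: "card ((\<lambda>p. (b, s, p)) ` (pat ` {w. b \<bullet> w = s})) \<le> ((3 * d + 5) * g) ^ d"
    if "b \<in> Basis" for b :: "'a \<times> real" and s :: real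
  proof -
    have "b \<noteq> 0" using that nonzero_Basis by auto
    then have "aff_dim {w. b \<bullet> w = s} \<le> int d" using DIM by (simp add: aff_dim_hyperplane)
    then have "card (pat ` {w. b \<bullet> w = s}) \<le> (card J + 1) ^ d"
      unfolding pat_def using card_halfspace_patterns_le[OF finJ affine_hyperplane, where k = d and u = u and c = c] by simp
    also have "\<dots> \<le> ((3 * d + 5) * g) ^ d" using cardJ by (intro power_mono) auto
    finally show ?thesis
      using card_image_le[OF finpat, of "\<lambda>p. (b, s, p)" "{w. b \<bullet> w = s}"] by linarith
  qed
  have finu: "finite (\<Union>(b, s)\<in>(Basis :: ('a\<times>real) set) \<times> {1::real, -1}. (\<lambda>p. (b, s, p)) ` (pat ` {w. b \<bullet> w = s}))"
    by (rule finite_UN_I) (auto simp: case_prod_unfold intro!: finite_imageI finpat)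
  have "card (cls ` I) \<le> card (\<Union>(b, s)\<in>(Basis :: ('a\<times>real) set) \<times> {1::real, -1}. (\<lambda>p. (b, s, p)) ` (pat ` {w. b \<bullet> w = s}))"
    by (rule card_mono[OF finu clssub])
  also have "\<dots> \<le> (\<Sum>(b, s)\<in>(Basis :: ('a\<times>real) set) \<times> {1::real, -1}. card ((\<lambda>p. (b, s, p)) ` (pat ` {w. b \<bullet> w = s})))"
    using card_UN_le[of "(Basis :: ('a\<times>real) set) \<times> {1::real, -1}" "\<lambda>(b, s). (\<lambda>p. (b, s, p)) ` (pat ` {w. b \<bullet> w = s})"]
    by (simp add: case_prod_unfold)
  also have "\<dots> \<le> (\<Sum>(b, s)\<in>(Basis :: ('a\<times>real) set) \<times> {1::real, -1}. ((3 * d + 5) * g) ^ d)"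
    by (rule sum_mono) (use cell in auto)
  also have "\<dots> = 2 * (d + 1) * ((3 * d + 5) * g) ^ d"
    using DIM by (simp add: case_prod_unfold card_cartesian_product del: sum_constant) (simp add: card_cartesian_product)
  finally have "card (cls ` I) * (d + 2) \<le> 2 * (d + 1) * ((3 * d + 5) * g) ^ d * (d + 2)" by (rule mult_right_mono) simp
  also have "\<dots> < 2 * (d + 1) * ((3 * d + 5) * g) ^ d * (d + 3)"
    using g1 by (intro mult_strict_left_mono) auto
  also have "\<dots> = q * g ^ d" by (simp only: q_def power_mult_distrib mult_ac)
  also have "\<dots> \<le> m" using gm by (metis of_nat_le_iff of_nat_mult of_nat_power)
  finally have "card (cls ` I) * (d + 2) < card I" using m by simp
  then obtain t where t: "card {i\<in>I. cls i = t} > d + 2" using fiber_card_pigeonhole[OF finI] by blast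
  then have "d + 3 \<le> card {i\<in>I. cls i = t}" by simp
  then obtain S where S: "S \<subseteq> {i\<in>I. cls i = t}" "card S = d + 3"
    by (rule obtain_subset_with_card_n)
  have SI: "S \<subseteq> I" using S by auto
  have same: "bs (v i) = bs (v j)" "pat (pr (v i)) = pat (pr (v j))" if "i \<in> S" "j \<in> S" for i j
  proof -
    have "cls i = cls j" using that S by auto
    then show "bs (v i) = bs (v j)" "pat (pr (v i)) = pat (pr (v j))" by (auto simp: cls_def)
  qed
  have near: "norm (v i - v j) \<le> C * real m powr (- (1 / real d))" if ij: "i \<in> S" "j \<in> S" for i j
  proof -
    have n1: "norm (v i) = 1" "norm (v j) = 1" using ij SI v by auto
    have coord: "\<bar>pr (v i) \<bullet> b - pr (v j) \<bullet> b\<bar> \<le> 1 / real g" if b: "b \<in> Basis" for b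
    proof (rule grid_pattern_close)
      show "g > 0" using g1 by simp
      show "\<bar>pr (v i) \<bullet> b\<bar> \<le> 1" using bs[of "v i"] b bs0[OF n1(1)] by (simp add: pr_def abs_mult)
      show "\<bar>pr (v j) \<bullet> b\<bar> \<le> 1" using bs[of "v j"] b bs0[OF n1(2)] by (simp add: pr_def abs_mult)
      fix k assume k: "k \<in> {- int g..int g}"
      then have "Inr (b, k) \<in> J" using b by (auto simp: J_def)
      moreover have "Inr (b, k) \<in> pat (pr (v i)) \<longleftrightarrow> Inr (b, k) \<in> pat (pr (v j))" using same[OF ij] by simp
      ultimately show "pr (v i) \<bullet> b > of_int k / real g \<longleftrightarrow> pr (v j) \<bullet> b > of_int k / real g"
        by (simp add: pat_def u_def c_def inner_commute)
    qed
    have ge1: "norm (pr w) \<ge> 1" and renorm: "(1 / norm (pr w)) *\<^sub>R pr w = w" if "norm w = 1" for w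
    proof -
      have "\<bar>w \<bullet> bs w\<bar> \<le> 1" using Basis_le_norm[of "bs w" w] bs[of w] that by simp
      then show "norm (pr w) \<ge> 1" using bs0[OF that] that by (simp add: pr_def field_simps)
      show "(1 / norm (pr w)) *\<^sub>R pr w = w" using bs0[OF that] that by (simp add: pr_def)
    qed
    have "norm (v i - v j) = norm ((1 / norm (pr (v i))) *\<^sub>R pr (v i) - (1 / norm (pr (v j))) *\<^sub>R pr (v j))"
      using renorm n1 by simp
    also have "\<dots> \<le> 2 * norm (pr (v i) - pr (v j))" by (rule norm_normalize_diff_le) (use ge1 n1 in auto)
    also have "norm (pr (v i) - pr (v j)) \<le> (\<Sum>b\<in>Basis. \<bar>(pr (v i) - pr (v j)) \<bullet> b\<bar>)" by (rule norm_le_l1)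
    also have "\<dots> \<le> (\<Sum>b\<in>(Basis::('a\<times>real) set). 1 / real g)" by (rule sum_mono) (use coord in \<open>auto simp: inner_diff_left\<close>)
    also have "\<dots> = (real d + 1) * (1 / real g)" using DIM by simp
    also have "\<dots> \<le> (real d + 1) * (2 * real q powr (1 / real d) * real m powr (- (1 / real d)))"
      by (rule mult_left_mono[OF ginv]) simp
    also have "2 * \<dots> \<le> C * real m powr (- (1 / real d))"
      unfolding C_def by (simp add: algebra_simps)
    finally show ?thesis by simp
  qed
  have unhit: "x \<notin> X S" if x: "x \<in> set xs" for x
  proof
    assume "x \<in> X S"
    then obtain i j where ij: "i \<in> S" "j \<in> S" "(fst x, 1) \<bullet> v i > 0" "(fst x, 1) \<bullet> v j \<le> 0"
      by (auto simp: X_def separates_def)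
    obtain k where k: "k < g" "x = xs ! k" using x xs(1) by (auto simp: in_set_conv_nth)
    have "Inl k \<in> J" using k by (auto simp: J_def)
    moreover have "Inl k \<in> pat (pr (v i)) \<longleftrightarrow> Inl k \<in> pat (pr (v j))" using same[OF ij(1,2)] by simp
    ultimately have iff: "(fst x, 1) \<bullet> pr (v i) > 0 \<longleftrightarrow> (fst x, 1) \<bullet> pr (v j) > 0"
      by (simp add: pat_def u_def c_def k)
    have "norm (v i) = 1" "norm (v j) = 1" using ij SI v by auto
    then have pos: "1 / \<bar>v i \<bullet> bs (v i)\<bar> > 0" "1 / \<bar>v j \<bullet> bs (v j)\<bar> > 0" using bs0 by auto
    have "(fst x, 1) \<bullet> pr (v i) > 0" unfolding pr_def inner_scaleR_right using pos ij by (intro mult_pos_pos)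
    moreover have "(fst x, 1) \<bullet> pr (v j) \<le> 0" unfolding pr_def inner_scaleR_right using pos ij by (intro mult_nonneg_nonpos) auto
    ultimately show False using iff by simp
  qed
  \<comment> \<open>Every bad group is separated by some hitting point, whereas the members of
    \<open>S\<close> lie on the same side at each of them.\<close>
  have "S \<notin> Bad" using xs(2) unhit by auto
  then have "measure \<nu> (X S) < \<epsilon>" using S SI by (auto simp: Bad_def)
  also have "\<epsilon> = (real d + 4) * ln (real m) * (1 / real g)" by (simp add: \<epsilon>_def)
  also have "\<dots> \<le> (real d + 4) * ln (real m) * (2 * real q powr (1 / real d) * real m powr (- (1 / real d)))"
    using m1 by (intro mult_left_mono[OF ginv]) auto
  also have "\<dots> \<le> C * real m powr (- (1 / real d)) * ln (real m)"
  proof -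
    have "(real d + 4) * ln (real m) * (2 * real q powr (1 / real d) * real m powr (- (1 / real d)))
      = (C * real m powr (- (1 / real d)) * ln (real m)) / 2" by (simp add: C_def)
    also have "\<dots> \<le> C * real m powr (- (1 / real d)) * ln (real m)"
      using m1 C_def by simp
    finally show ?thesis .
  qed
  finally show ?thesis using S SI near by (intro exI[of _ S]) (auto simp: X_def)
qed

subsection \<open>Removing neurons\<close>

text \<open>Stated for families, because two neurons may share a direction; such a repetition is
  itself a relation, with coefficients 1 and -1.\<close>

lemma exists_linear_relation:
  fixes w :: "'i \<Rightarrow> 'b::euclidean_space"
  assumes "finite S" "card S > DIM('b)"
  shows "\<exists>c. (\<exists>i\<in>S. c i \<noteq> 0) \<and> (\<Sum>i\<in>S. c i *\<^sub>R w i) = 0"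
proof (cases "inj_on w S")
  case True
  then have "dependent (w ` S)"
    using assms by (intro dependent_biggerset) (auto simp: card_image)
  then obtain u where u: "\<exists>x\<in>w ` S. u x \<noteq> 0" "(\<Sum>x\<in>w ` S. u x *\<^sub>R x) = 0"
    using assms(1) by (auto simp: dependent_finite)
  then have "(\<Sum>i\<in>S. u (w i) *\<^sub>R w i) = 0" using True by (simp add: sum.reindex)
  with u show ?thesis by (intro exI[of _ "\<lambda>i. u (w i)"]) auto
next
  case False
  then obtain i j where ij: "i \<in> S" "j \<in> S" "i \<noteq> j" "w i = w j" by (auto simp: inj_on_def)
  define c where "c = (\<lambda>k. (if k = i then 1 else 0) - (if k = j then 1 else 0 :: real))"
  have "(\<Sum>k\<in>S. c k *\<^sub>R w k) = (\<Sum>k\<in>S. (if k = i then w k else 0)) - (\<Sum>k\<in>S. (if k = j then w k else 0))"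
    unfolding sum_subtractf[symmetric] by (intro sum.cong) (auto simp: c_def scaleR_left_diff_distrib)
  also have "\<dots> = 0" using ij assms(1) by (simp add: sum.delta)
  finally show ?thesis using ij by (intro exI[of _ c]) (auto simp: c_def)
qed

text \<open>An arbitrary index set replaces the initial segment of \<open>nn_class\<close>, so that
  a neuron is deleted without renumbering the others.\<close>

definition network :: "'i set \<Rightarrow> ('i \<Rightarrow> real) \<Rightarrow> ('i \<Rightarrow> 'a::euclidean_space \<times> real) \<Rightarrow> 'a \<Rightarrow> real" where
  "network I a v x = (\<Sum>i\<in>I. a i * relu (inner (x, 1) (v i)))"

definition sq_risk :: "('a::euclidean_space \<times> real) measure \<Rightarrow> ('a \<Rightarrow> real) \<Rightarrow> real" where
  "sq_risk \<rho> f = (\<integral>z. (f (fst z) - snd z)\<^sup>2 \<partial>\<rho>)"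

text \<open>Covers the uniform measure on a sample, the law of \<open>(X, f X)\<close> and averages
  of such measures. The bounds on both components make the quadratic risk of every network
  finite.\<close>

definition risk_measure :: "('a::euclidean_space \<times> real) measure \<Rightarrow> bool" where
  "risk_measure \<rho> \<longleftrightarrow> prob_space \<rho> \<and> sets \<rho> = sets borel \<and> (AE z in \<rho>. fst z \<in> cball 0 1)
     \<and> (\<exists>Y. AE z in \<rho>. \<bar>snd z\<bar> \<le> Y)"

lemma relu_lipschitz: "\<bar>relu s - relu t\<bar> \<le> \<bar>s - t\<bar>"
  by (auto simp: relu_def)

lemma continuous_on_relu [continuous_intros]:
  "continuous_on S f \<Longrightarrow> continuous_on S (\<lambda>x. relu (f x))"
  unfolding relu_def by (intro continuous_intros)

lemma borel_measurable_relu [measurable]: "relu \<in> borel_measurable borel"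
  unfolding relu_def[abs_def] by measurable

lemma continuous_network: "continuous_on A (network I a v)"
  unfolding network_def by (intro continuous_intros)

lemma borel_measurable_network [measurable]: "network I a v \<in> borel_measurable borel"
  by (rule borel_measurable_continuous_onI[OF continuous_network])

lemma norm_Pair_1_le:
  fixes x :: "'a::euclidean_space"
  assumes "x \<in> cball 0 1"
  shows "norm (x, 1::real) \<le> 2" "(norm (x, 1::real))\<^sup>2 \<le> 2"
proof -
  have "(norm x)\<^sup>2 \<le> 1" using assms by (simp add: power_le_one)
  then show *: "(norm (x, 1::real))\<^sup>2 \<le> 2" by (simp add: norm_Pair)
  have "(norm (x, 1::real))\<^sup>2 \<le> 2\<^sup>2" using * by simp
  then show "norm (x, 1::real) \<le> 2" by (rule power2_le_imp_le) simp
qed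

lemma abs_network_le:
  assumes "finite I" "x \<in> cball 0 1"
  shows "\<bar>network I a v x\<bar> \<le> 2 * (\<Sum>i\<in>I. \<bar>a i\<bar> * norm (v i))"
proof -
  have "\<bar>a i * relu (inner (x, 1) (v i))\<bar> \<le> 2 * (\<bar>a i\<bar> * norm (v i))" for i
  proof -
    have "\<bar>relu (inner (x, 1) (v i))\<bar> \<le> \<bar>inner (x, 1) (v i)\<bar>" by (auto simp: relu_def)
    also have "\<dots> \<le> norm (x, 1::real) * norm (v i)" by (rule Cauchy_Schwarz_ineq2)
    also have "\<dots> \<le> 2 * norm (v i)" using norm_Pair_1_le[OF assms(2)] by (intro mult_right_mono) auto
    finally show ?thesis by (simp add: abs_mult mult_left_mono mult.left_commute)
  qed
  then show ?thesis unfolding network_def sum_distrib_left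
    by (intro order_trans[OF sum_abs] sum_mono)
qed

lemma risk_integrable:
  assumes \<rho>: "risk_measure \<rho>" and "f \<in> borel_measurable borel" "g \<in> borel_measurable borel"
    "\<And>x. x \<in> cball 0 1 \<Longrightarrow> \<bar>f x\<bar> \<le> b" "\<And>x. x \<in> cball 0 1 \<Longrightarrow> \<bar>g x\<bar> \<le> b"
  shows "integrable \<rho> (\<lambda>z. (f (fst z) - snd z)\<^sup>2)" "integrable \<rho> (\<lambda>z. (f (fst z) - snd z) * g (fst z))"
    "integrable \<rho> (\<lambda>z. (g (fst z))\<^sup>2)"
proof -
  have [measurable_cong]: "sets \<rho> = sets (borel \<Otimes>\<^sub>M borel)"
    using \<rho> by (simp add: risk_measure_def flip: borel_prod)
  note [measurable] = assms(2,3)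
  interpret prob_space \<rho> using \<rho> by (simp add: risk_measure_def)
  obtain Y where Y: "AE z in \<rho>. fst z \<in> cball 0 1 \<and> \<bar>snd z\<bar> \<le> Y"
    using \<rho> by (auto simp: risk_measure_def)
  have b: "b \<ge> 0" using assms(4)[of 0] by force
  have "\<bar>(f (fst z) - snd z)\<^sup>2\<bar> \<le> (b + Y)\<^sup>2 \<and> \<bar>(f (fst z) - snd z) * g (fst z)\<bar> \<le> (b + Y) * b \<and> \<bar>(g (fst z))\<^sup>2\<bar> \<le> b\<^sup>2"
    if "fst z \<in> cball 0 1 \<and> \<bar>snd z\<bar> \<le> Y" for z
  proof -
    have 1: "\<bar>f (fst z) - snd z\<bar> \<le> b + Y" using that assms(4)[of "fst z"] by linarith
    have 2: "\<bar>g (fst z)\<bar> \<le> b" using that assms(5) by simp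
    have "\<bar>f (fst z) - snd z\<bar>\<^sup>2 \<le> (b + Y)\<^sup>2" by (intro power_mono 1) auto
    moreover have "\<bar>g (fst z)\<bar>\<^sup>2 \<le> b\<^sup>2" by (intro power_mono 2) auto
    moreover have "\<bar>f (fst z) - snd z\<bar> * \<bar>g (fst z)\<bar> \<le> (b + Y) * b"
      using 1 2 b by (intro mult_mono) auto
    ultimately show ?thesis by (simp add: abs_mult)
  qed
  then have ae: "AE z in \<rho>. \<bar>(f (fst z) - snd z)\<^sup>2\<bar> \<le> (b + Y)\<^sup>2 \<and> \<bar>(f (fst z) - snd z) * g (fst z)\<bar> \<le> (b + Y) * b \<and> \<bar>(g (fst z))\<^sup>2\<bar> \<le> b\<^sup>2"
    by (rule eventually_mono[OF Y])
  show "integrable \<rho> (\<lambda>z. (f (fst z) - snd z)\<^sup>2)"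
    by (rule integrable_const_bound[where B = "(b + Y)\<^sup>2"]) (use ae in \<open>auto elim: eventually_mono\<close>)
  show "integrable \<rho> (\<lambda>z. (f (fst z) - snd z) * g (fst z))"
    by (rule integrable_const_bound[where B = "(b + Y) * b"]) (use ae in \<open>auto elim: eventually_mono\<close>)
  show "integrable \<rho> (\<lambda>z. (g (fst z))\<^sup>2)"
    by (rule integrable_const_bound[where B = "b\<^sup>2"]) (use ae in \<open>auto elim: eventually_mono\<close>)
qed

text \<open>Of the two displacements \<open>\<tau>\<^sub>1 e\<close> and \<open>- \<tau>\<^sub>2 e\<close> the linear term of the quadratic risk is
  nonpositive on average, so one of them only pays the quadratic term.\<close>

lemma sq_risk_two_point:
  assumes \<rho>: "risk_measure \<rho>" and "f \<in> borel_measurable borel" "e \<in> borel_measurable borel"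
    "\<And>x. x \<in> cball 0 1 \<Longrightarrow> \<bar>f x\<bar> \<le> b" "\<And>x. x \<in> cball 0 1 \<Longrightarrow> \<bar>e x\<bar> \<le> b" and \<tau>: "\<tau>1 \<ge> 0" "\<tau>2 \<ge> 0"
  shows "\<exists>\<theta>\<in>{\<tau>1, - \<tau>2}. sq_risk \<rho> (\<lambda>x. f x + \<theta> * e x) \<le> sq_risk \<rho> f + \<tau>1 * \<tau>2 * (\<integral>z. (e (fst z))\<^sup>2 \<partial>\<rho>)"
proof -
  note int = risk_integrable[OF assms(1-5)]
  define l where "l = 2 * (\<integral>z. (f (fst z) - snd z) * e (fst z) \<partial>\<rho>)"
  define q where "q = (\<integral>z. (e (fst z))\<^sup>2 \<partial>\<rho>)"
  have eq: "sq_risk \<rho> (\<lambda>x. f x + \<theta> * e x) = sq_risk \<rho> f + \<theta> * l + \<theta>\<^sup>2 * q" for \<theta>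
  proof -
    have "(\<lambda>z. (f (fst z) + \<theta> * e (fst z) - snd z)\<^sup>2) = (\<lambda>z. (f (fst z) - snd z)\<^sup>2 + ((2 * \<theta>) * ((f (fst z) - snd z) * e (fst z)) + \<theta>\<^sup>2 * (e (fst z))\<^sup>2))"
      by (auto simp: fun_eq_iff power2_eq_square algebra_simps)
    then show ?thesis unfolding sq_risk_def l_def q_def using int by simp
  qed
  consider "\<tau>1 = 0" | "\<tau>2 = 0" | "\<tau>1 > 0" "\<tau>2 > 0" using \<tau> by linarith
  then show ?thesis
  proof cases
    case 3
    show ?thesis
    proof (cases "l + \<tau>1 * q \<le> \<tau>2 * q")
      case True
      then have "\<tau>1 * (l + \<tau>1 * q) \<le> \<tau>1 * (\<tau>2 * q)" using 3 by (intro mult_left_mono) auto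
      then show ?thesis by (intro bexI[of _ \<tau>1]) (auto simp: eq simp flip: q_def, simp add: power2_eq_square algebra_simps)
    next
      case False
      then have "- l + \<tau>2 * q \<le> \<tau>1 * q" by linarith
      then have "\<tau>2 * (- l + \<tau>2 * q) \<le> \<tau>2 * (\<tau>1 * q)" using 3 by (intro mult_left_mono) auto
      then have "- \<tau>2 * l + (- \<tau>2)\<^sup>2 * q \<le> \<tau>1 * \<tau>2 * q" by (simp add: power2_eq_square algebra_simps)
      then show ?thesis using eq[of "- \<tau>2"] by (intro bexI[of _ "-\<tau>2"]) (simp_all flip: q_def)
    qed
  qed (auto simp: eq)
qed

text \<open>Where \<open>S\<close> is not separated, its neurons are all inactive or all linear, and
  in both cases the combination vanishes. Elsewhere \<open>(\<Sum>i\<in>S. c i) = 0\<close> permits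
  subtracting one fixed neuron from all of them, which leaves differences of size
  \<open>norm (x, 1) * \<delta>\<close>; the factor 2 bounds the square of that norm.\<close>

lemma exchange_integral_le:
  assumes \<rho>: "risk_measure \<rho>" and "finite S" "(\<Sum>i\<in>S. c i *\<^sub>R v i) = 0" "(\<Sum>i\<in>S. c i) = 0"
    and near: "\<And>i j. i \<in> S \<Longrightarrow> j \<in> S \<Longrightarrow> norm (v i - v j) \<le> \<delta>"
  shows "(\<integral>z. (network S c v (fst z))\<^sup>2 \<partial>\<rho>) \<le> 2 * (\<Sum>i\<in>S. \<bar>c i\<bar>)\<^sup>2 * \<delta>\<^sup>2 * measure \<rho> {z. separates (fst z) v S}"
proof -
  interpret prob_space \<rho> using \<rho> by (simp add: risk_measure_def)
  have sets: "sets \<rho> = sets borel" using \<rho> by (simp add: risk_measure_def)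
  have X: "{z. separates (fst z) v S} \<in> sets \<rho>" by (rule borel_separates) (use assms sets in auto)
  have pt: "(network S c v x)\<^sup>2 \<le> 2 * (\<Sum>i\<in>S. \<bar>c i\<bar>)\<^sup>2 * \<delta>\<^sup>2 * indicator {x. separates x v S} x" if x: "x \<in> cball 0 1" for x
  proof (cases "separates x v S")
    case False
    show ?thesis
    proof (cases "\<exists>i\<in>S. (x, 1) \<bullet> v i > 0")
      case True
      then have "(x, 1) \<bullet> v i > 0" if "i \<in> S" for i using False that by (force simp: separates_def)
      then have "network S c v x = (\<Sum>i\<in>S. c i * ((x, 1) \<bullet> v i))"
        unfolding network_def by (intro sum.cong) (force simp: relu_def)+
      also have "\<dots> = (x, 1) \<bullet> (\<Sum>i\<in>S. c i *\<^sub>R v i)" by (simp add: inner_sum_right)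
      finally show ?thesis using assms by simp
    next
      case False
      then have "network S c v x = 0"
        unfolding network_def by (intro sum.neutral) (auto simp: relu_def max_def not_le dest: order.asym less_imp_le)
      then show ?thesis by simp
    qed
  next
    case True
    then obtain k where k: "k \<in> S" by (auto simp: separates_def)
    let ?r = "\<lambda>i. relu ((x, 1) \<bullet> v i)"
    have "network S c v x = (\<Sum>i\<in>S. c i * ?r i) - (\<Sum>i\<in>S. c i) * ?r k" using assms by (simp add: network_def)
    also have "\<dots> = (\<Sum>i\<in>S. c i * (?r i - ?r k))" by (simp add: sum_distrib_right sum_subtractf algebra_simps)
    finally have "\<bar>network S c v x\<bar> \<le> (\<Sum>i\<in>S. \<bar>c i * (?r i - ?r k)\<bar>)" by (metis sum_abs)
    also have "\<dots> \<le> (\<Sum>i\<in>S. \<bar>c i\<bar> * (norm (x, 1::real) * \<delta>))"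
    proof (rule sum_mono)
      fix i assume i: "i \<in> S"
      have "\<bar>?r i - ?r k\<bar> \<le> \<bar>(x, 1) \<bullet> (v i - v k)\<bar>" using relu_lipschitz by (simp add: inner_diff_right)
      also have "\<dots> \<le> norm (x, 1::real) * norm (v i - v k)" by (rule Cauchy_Schwarz_ineq2)
      also have "\<dots> \<le> norm (x, 1::real) * \<delta>" using near i k by (intro mult_left_mono) auto
      finally show "\<bar>c i * (?r i - ?r k)\<bar> \<le> \<bar>c i\<bar> * (norm (x, 1::real) * \<delta>)" by (simp add: abs_mult mult_left_mono)
    qed
    also have "\<dots> = norm (x, 1::real) * ((\<Sum>i\<in>S. \<bar>c i\<bar>) * \<delta>)" by (simp add: sum_distrib_right mult_ac sum_distrib_left)
    finally have "\<bar>network S c v x\<bar>\<^sup>2 \<le> (norm (x, 1::real) * ((\<Sum>i\<in>S. \<bar>c i\<bar>) * \<delta>))\<^sup>2" by (intro power_mono) auto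
    also have "\<dots> = (norm (x, 1::real))\<^sup>2 * ((\<Sum>i\<in>S. \<bar>c i\<bar>)\<^sup>2 * \<delta>\<^sup>2)" by (simp only: power_mult_distrib)
    also have "\<dots> \<le> 2 * ((\<Sum>i\<in>S. \<bar>c i\<bar>)\<^sup>2 * \<delta>\<^sup>2)" by (intro mult_right_mono norm_Pair_1_le x) auto
    finally show ?thesis using True by simp
  qed
  have "(\<integral>z. (network S c v (fst z))\<^sup>2 \<partial>\<rho>) \<le> (\<integral>z. 2 * (\<Sum>i\<in>S. \<bar>c i\<bar>)\<^sup>2 * \<delta>\<^sup>2 * indicator {z. separates (fst z) v S} z \<partial>\<rho>)"
  proof (rule integral_mono_AE)
    show "integrable \<rho> (\<lambda>z. (network S c v (fst z))\<^sup>2)"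
      by (rule risk_integrable(3)[OF \<rho>, of "\<lambda>_. 0" _ "2 * (\<Sum>i\<in>S. \<bar>c i\<bar> * norm (v i))"])
         (use abs_network_le[OF assms(2)] in \<open>auto intro!: sum_nonneg\<close>)
    show "integrable \<rho> (\<lambda>z. 2 * (\<Sum>i\<in>S. \<bar>c i\<bar>)\<^sup>2 * \<delta>\<^sup>2 * indicator {z. separates (fst z) v S} z)"
      using X by (intro integrable_mult_right) (auto simp: emeasure_eq_measure)
    have "AE z in \<rho>. fst z \<in> cball 0 1" using \<rho> by (simp add: risk_measure_def)
    then show "AE z in \<rho>. (network S c v (fst z))\<^sup>2 \<le> 2 * (\<Sum>i\<in>S. \<bar>c i\<bar>)\<^sup>2 * \<delta>\<^sup>2 * indicator {z. separates (fst z) v S} z"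
      by eventually_elim (use pt in \<open>auto simp: indicator_def\<close>)
  qed
  also have "\<dots> = 2 * (\<Sum>i\<in>S. \<bar>c i\<bar>)\<^sup>2 * \<delta>\<^sup>2 * measure \<rho> {z. separates (fst z) v S}"
    using X by (simp add: emeasure_eq_measure)
  finally show ?thesis .
qed

text \<open>The extreme admissible step sizes along a relation \<open>c\<close> with zero sum.\<close>

lemma exists_exchange_steps:
  fixes t c :: "'i \<Rightarrow> real"
  assumes "finite S" "\<And>i. i \<in> S \<Longrightarrow> t i \<ge> 0" "\<exists>i\<in>S. c i \<noteq> 0" "(\<Sum>i\<in>S. c i) = 0"
  shows "\<exists>\<tau>1 \<tau>2. \<tau>1 \<ge> 0 \<and> \<tau>2 \<ge> 0 \<and> (\<forall>\<theta>\<in>{\<tau>1, - \<tau>2}. (\<forall>i\<in>S. t i + \<theta> * c i \<ge> 0) \<and> (\<exists>i\<in>S. t i + \<theta> * c i = 0)) \<and>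
    \<tau>1 * \<tau>2 * (\<Sum>i\<in>S. \<bar>c i\<bar>)\<^sup>2 \<le> 4 * (\<Sum>i\<in>S. t i)\<^sup>2"
proof -
  define s where "s = (\<Sum>i\<in>S. t i)"
  have s0: "s \<ge> 0" unfolding s_def using assms by (intro sum_nonneg) auto
  have half: "\<exists>\<tau>\<ge>0. (\<forall>i\<in>S. t i + \<tau> * c i \<ge> 0) \<and> (\<exists>i\<in>S. t i + \<tau> * c i = 0) \<and> \<tau> * (\<Sum>i\<in>S. \<bar>c i\<bar>) \<le> 2 * s"
    if c: "\<exists>i\<in>S. c i \<noteq> 0" "(\<Sum>i\<in>S. c i) = 0" for c
  proof -
    define Ng where "Ng = {i\<in>S. c i < 0}"
    have fin: "finite Ng" using assms by (simp add: Ng_def)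
    have ne: "Ng \<noteq> {}"
    proof
      assume "Ng = {}"
      then have "\<And>i. i \<in> S \<Longrightarrow> c i \<ge> 0" by (force simp: Ng_def)
      then have "\<forall>i\<in>S. c i = 0" using c(2) assms(1) by (simp add: sum_nonneg_eq_0_iff)
      with c(1) show False by simp
    qed
    \<comment> \<open>Ratio test: the first step size at which a decreasing weight reaches
      zero.\<close>
    define \<tau> where "\<tau> = Min ((\<lambda>i. t i / (- c i)) ` Ng)"
    have "\<tau> \<in> (\<lambda>i. t i / (- c i)) ` Ng" unfolding \<tau>_def using fin ne by (intro Min_in) auto
    then obtain k where k: "k \<in> Ng" "\<tau> = t k / (- c k)" by auto
    have min: "\<tau> * (- c i) \<le> t i" if "i \<in> Ng" for i
    proof -
      have "\<tau> \<le> t i / (- c i)" unfolding \<tau>_def using fin that by (intro Min_le) auto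
      then show ?thesis using that by (simp add: Ng_def field_simps)
    qed
    have \<tau>0: "\<tau> \<ge> 0" unfolding k(2) using k(1) assms(2) by (intro divide_nonneg_nonneg) (auto simp: Ng_def)
    have all: "t i + \<tau> * c i \<ge> 0" if "i \<in> S" for i
    proof (cases "c i < 0")
      case True
      then show ?thesis using min[of i] that by (simp add: Ng_def)
    next
      case False
      then show ?thesis using assms(2)[OF that] \<tau>0 by simp
    qed
    have "t k + \<tau> * c k = 0" using k by (simp add: Ng_def)
    moreover have "k \<in> S" using k by (simp add: Ng_def)
    \<comment> \<open>As \<open>c\<close> sums to zero, its negative part carries half of the total
      variation; and \<open>\<tau>\<close> times the negative part is at most the weight present
      there.\<close>
    moreover have "(\<Sum>i\<in>S. \<bar>c i\<bar>) = 2 * (\<Sum>i\<in>Ng. - c i)"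
    proof -
      have "(\<Sum>i\<in>S. \<bar>c i\<bar>) = (\<Sum>i\<in>S. c i + 2 * (if c i < 0 then - c i else 0))" by (intro sum.cong) auto
      also have "\<dots> = 2 * (\<Sum>i\<in>S. if c i < 0 then - c i else 0)" using c(2) by (simp add: sum.distrib sum_distrib_left)
      also have "(\<Sum>i\<in>S. if c i < 0 then - c i else 0) = (\<Sum>i\<in>Ng. - c i)"
        unfolding Ng_def using assms(1) by (intro sum.inter_filter[symmetric])
      finally show ?thesis .
    qed
    moreover have "\<tau> * (\<Sum>i\<in>Ng. - c i) \<le> s"
    proof -
      have "\<tau> * (\<Sum>i\<in>Ng. - c i) = (\<Sum>i\<in>Ng. \<tau> * (- c i))" by (rule sum_distrib_left)
      also have "\<dots> \<le> (\<Sum>i\<in>Ng. t i)" by (rule sum_mono) (rule min)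
      also have "\<dots> \<le> s" unfolding s_def using assms by (intro sum_mono2) (auto simp: Ng_def)
      finally show ?thesis .
    qed
    ultimately show ?thesis using \<tau>0 all by (intro exI[of _ \<tau>]) auto
  qed
  obtain \<tau>1 where 1: "\<tau>1 \<ge> 0" "\<forall>i\<in>S. t i + \<tau>1 * c i \<ge> 0" "\<exists>i\<in>S. t i + \<tau>1 * c i = 0" "\<tau>1 * (\<Sum>i\<in>S. \<bar>c i\<bar>) \<le> 2 * s"
    using half[of c] assms by blast
  obtain \<tau>2 where 2: "\<tau>2 \<ge> 0" "\<forall>i\<in>S. t i + \<tau>2 * (- c i) \<ge> 0" "\<exists>i\<in>S. t i + \<tau>2 * (- c i) = 0" "\<tau>2 * (\<Sum>i\<in>S. \<bar>- c i\<bar>) \<le> 2 * s"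
    using half[of "\<lambda>i. - c i"] assms(3,4) by (auto simp: sum_negf)
  have "(\<tau>1 * (\<Sum>i\<in>S. \<bar>c i\<bar>)) * (\<tau>2 * (\<Sum>i\<in>S. \<bar>c i\<bar>)) \<le> (2 * s) * (2 * s)"
    using 1(1,4) 2(1,4) s0 by (intro mult_mono[of "\<tau>1 * (\<Sum>i\<in>S. \<bar>c i\<bar>)"]) (simp_all add: sum_nonneg)
  then have "\<tau>1 * \<tau>2 * (\<Sum>i\<in>S. \<bar>c i\<bar>)\<^sup>2 \<le> 4 * s\<^sup>2" by (simp add: power2_eq_square mult_ac)
  then show ?thesis using 1 2 unfolding s_def by (intro exI[of _ \<tau>1] exI[of _ \<tau>2]) auto
qed

lemma exists_neuron_removal:
  fixes v :: "'i \<Rightarrow> 'a::euclidean_space \<times> real"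
  defines "d \<equiv> DIM('a)"
  defines "q \<equiv> 2 * (d + 1) * (d + 3) * (3 * d + 5) ^ d"
  defines "C \<equiv> 4 * (real d + 4) * real q powr (1 / real d)"
  assumes \<rho>: "risk_measure \<rho>" and finI: "finite I" and v: "\<And>i. i \<in> I \<Longrightarrow> norm (v i) = 1"
    and m: "m = card I" "m \<ge> 4 * q" and M: "(\<Sum>i\<in>I. \<bar>a i\<bar>) \<le> M"
  shows "\<exists>j\<in>I. \<exists>a'. (\<Sum>i\<in>I - {j}. \<bar>a' i\<bar>) \<le> M \<and>
    sq_risk \<rho> (network (I - {j}) a' v) \<le> sq_risk \<rho> (network I a v)
      + 2048 * (real d + 3)\<^sup>2 * C ^ 3 * M\<^sup>2 * (real m powr (- 2 - 3 / real d) * ln (real m))"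
proof -
  interpret prob_space \<rho> using \<rho> by (simp add: risk_measure_def)
  have d: "d \<ge> 1" by (simp add: d_def Suc_leI)
  have q: "q \<ge> 1" by (simp add: q_def)
  have m4: "m \<ge> 4" using m q by linarith
  have C0: "C \<ge> 0" by (simp add: C_def)
  have M0: "M \<ge> 0" by (rule order_trans[OF _ M]) (simp add: sum_nonneg)
  \<comment> \<open>Light neurons, of at most twice the average weight; by Markov's inequality they
    are at least half of all. Restricting to one sign keeps a quarter, and with a common sign the
    absolute weights can be moved linearly as long as they stay nonnegative.\<close>
  define L where "L = {i\<in>I. \<bar>a i\<bar> \<le> 2 * M / m}"
  have L: "2 * card L \<ge> m"
  proof (rule ccontr)
    assume "\<not> 2 * card L \<ge> m"
    moreover have "card (I - L) = m - card L" using m finI by (simp add: L_def card_Diff_subset)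
    ultimately have big: "2 * card (I - L) > m" by simp
    then have ne: "I - L \<noteq> {}" using m4 by (metis card.empty mult_0_right not_less_zero)
    have "M = (m / 2) * (2 * M / m)" using m4 by simp
    also have "\<dots> \<le> card (I - L) * (2 * M / m)" using big M0 by (intro mult_right_mono) auto
    also have "\<dots> = (\<Sum>i\<in>I - L. 2 * M / m)" by simp
    also have "\<dots> < (\<Sum>i\<in>I - L. \<bar>a i\<bar>)" using finI ne by (intro sum_strict_mono) (auto simp: L_def)
    also have "\<dots> \<le> (\<Sum>i\<in>I. \<bar>a i\<bar>)" using finI by (intro sum_mono2) auto
    finally show False using M by simp
  qed
  obtain s I' where s: "s = 1 \<or> s = (-1::real)" and I': "I' \<subseteq> L" "\<And>i. i \<in> I' \<Longrightarrow> a i = s * \<bar>a i\<bar>" "4 * card I' \<ge> m"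
  proof -
    have "card L = card {i\<in>L. a i \<ge> 0} + card {i\<in>L. a i < 0}"
      using finI by (subst card_Un_disjoint[symmetric]) (auto simp: L_def intro!: arg_cong[of _ _ card])
    then consider "4 * card {i\<in>L. a i \<ge> 0} \<ge> m" | "4 * card {i\<in>L. a i < 0} \<ge> m" using L by linarith
    then show thesis
    proof cases
      case 1 then show thesis by (intro that[of 1 "{i\<in>L. a i \<ge> 0}"]) auto
    next
      case 2 then show thesis by (intro that[of "-1" "{i\<in>L. a i < 0}"]) auto
    qed
  qed
  have LI: "L \<subseteq> I" by (auto simp: L_def)
  have finI': "finite I'" using I' LI finI by (meson finite_subset)
  have mI': "card I' \<ge> q" using I'(3) m by linarith
  obtain S where S: "S \<subseteq> I'" "card S = d + 3"
    and near: "\<And>i j. i \<in> S \<Longrightarrow> j \<in> S \<Longrightarrow> norm (v i - v j) \<le> C * real (card I') powr (- (1 / real d))"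
    and sep: "measure \<rho> {z. separates (fst z) v S} \<le> C * real (card I') powr (- (1 / real d)) * ln (real (card I'))"
    using exists_clustered_group[of \<rho> I' v "card I'", folded d_def, folded q_def, folded C_def] \<rho> finI' v I'(1) LI mI'
    unfolding risk_measure_def by blast
  have SI: "S \<subseteq> I" using S I' LI by blast
  have finS: "finite S" using finite_subset[OF SI finI] .
  have pw: "real (card I') powr (- (1 / real d)) \<le> 4 * real m powr (- (1 / real d))"
  proof -
    have "real (card I') powr (- (1 / real d)) \<le> (real m / 4) powr (- (1 / real d))"
      using I'(3) m4 by (intro powr_mono2') auto
    also have "\<dots> = 4 powr (1 / real d) * real m powr (- (1 / real d))"
      by (simp add: powr_divide powr_minus field_simps)
    also have "\<dots> \<le> 4 powr 1 * real m powr (- (1 / real d))" using d by (intro mult_right_mono powr_mono) auto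
    finally show ?thesis by simp
  qed
  define \<delta> where "\<delta> = 4 * C * real m powr (- (1 / real d))"
  have near': "norm (v i - v j) \<le> \<delta>" if "i \<in> S" "j \<in> S" for i j
    using near[OF that] mult_left_mono[OF pw C0] by (simp add: \<delta>_def)
  have sep': "measure \<rho> {z. separates (fst z) v S} \<le> \<delta> * ln (real m)"
  proof -
    have "card I' \<le> m" using I' LI finI m by (metis card_mono order_trans)
    moreover have "card I' > 0" using I'(3) m4 by linarith
    ultimately have "ln (real (card I')) \<le> ln (real m)" "ln (real (card I')) \<ge> 0" by auto
    then have "C * real (card I') powr (- (1 / real d)) * ln (real (card I')) \<le> \<delta> * ln (real m)"
      using mult_left_mono[OF pw C0] C0 by (intro mult_mono) (auto simp: \<delta>_def)
    with sep show ?thesis by linarith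
  qed
  \<comment> \<open>The additional coordinate 1 encodes \<open>(\<Sum>i\<in>S. c i) = 0\<close>,
    which preserves the total weight. The vectors then live in dimension \<open>d + 2\<close>, and
    this is why groups have \<open>d + 3\<close> members.\<close>
  have "card S > DIM(('a \<times> real) \<times> real)" using S by (simp add: d_def)
  from exists_linear_relation[OF finS this, of "\<lambda>i. (v i, 1)"]
  obtain c where c: "\<exists>i\<in>S. c i \<noteq> 0" "(\<Sum>i\<in>S. c i *\<^sub>R (v i, 1::real)) = 0" by blast
  have c1: "(\<Sum>i\<in>S. c i *\<^sub>R v i) = 0" and c2: "(\<Sum>i\<in>S. c i) = 0"
    using arg_cong[OF c(2), of fst] arg_cong[OF c(2), of snd] by (simp_all add: fst_sum snd_sum)
  define t where "t = (\<lambda>i. \<bar>a i\<bar>)"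
  obtain \<tau>1 \<tau>2 where \<tau>: "\<tau>1 \<ge> 0" "\<tau>2 \<ge> 0"
    "\<forall>\<theta>\<in>{\<tau>1, - \<tau>2}. (\<forall>i\<in>S. t i + \<theta> * c i \<ge> 0) \<and> (\<exists>i\<in>S. t i + \<theta> * c i = 0)"
    "\<tau>1 * \<tau>2 * (\<Sum>i\<in>S. \<bar>c i\<bar>)\<^sup>2 \<le> 4 * (\<Sum>i\<in>S. t i)\<^sup>2"
    using exists_exchange_steps[OF finS _ c(1) c2, of t] by (auto simp: t_def)
  define e where "e = (\<lambda>x. s * network S c v x)"
  define b where "b = 2 * (\<Sum>i\<in>I. \<bar>a i\<bar> * norm (v i)) + 2 * (\<Sum>i\<in>S. \<bar>c i\<bar> * norm (v i))"
  have nn: "(\<Sum>i\<in>I. \<bar>a i\<bar> * norm (v i)) \<ge> 0" "(\<Sum>i\<in>S. \<bar>c i\<bar> * norm (v i)) \<ge> 0" by (auto intro: sum_nonneg)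
  have "\<exists>\<theta>\<in>{\<tau>1, - \<tau>2}. sq_risk \<rho> (\<lambda>x. network I a v x + \<theta> * e x) \<le> sq_risk \<rho> (network I a v) + \<tau>1 * \<tau>2 * (\<integral>z. (e (fst z))\<^sup>2 \<partial>\<rho>)"
  proof (rule sq_risk_two_point[OF \<rho> _ _ _ _ \<tau>(1,2)])
    show "\<bar>network I a v x\<bar> \<le> b" if "x \<in> cball 0 1" for x
      using abs_network_le[OF finI that, of a v] nn by (simp add: b_def)
    show "\<bar>e x\<bar> \<le> b" if "x \<in> cball 0 1" for x
      using abs_network_le[OF finS that, of c v] nn s by (auto simp: b_def e_def abs_mult)
  qed (auto simp: e_def)
  then obtain \<theta> where \<theta>: "\<theta> \<in> {\<tau>1, - \<tau>2}"
    "sq_risk \<rho> (\<lambda>x. network I a v x + \<theta> * e x) \<le> sq_risk \<rho> (network I a v) + \<tau>1 * \<tau>2 * (\<integral>z. (e (fst z))\<^sup>2 \<partial>\<rho>)" by blast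
  have \<theta>1: "\<And>i. i \<in> S \<Longrightarrow> t i + \<theta> * c i \<ge> 0" using \<theta>(1) \<tau>(3) by blast
  obtain j where j: "j \<in> S" "t j + \<theta> * c j = 0" using \<theta>(1) \<tau>(3) by blast
  define a' where "a' = (\<lambda>i. if i \<in> S then s * (t i + \<theta> * c i) else a i)"
  have aj: "a' j = 0" using j by (simp add: a'_def)
  have split: "(\<Sum>i\<in>I. f i) = (\<Sum>i\<in>S. f i) + (\<Sum>i\<in>I - S. f i)" for f :: "'i \<Rightarrow> real"
    using sum.subset_diff[OF SI finI, of f] by simp
  have "(\<Sum>i\<in>I - {j}. \<bar>a' i\<bar>) = (\<Sum>i\<in>I. \<bar>a' i\<bar>)"
    using finI aj by (intro sum.mono_neutral_left) auto
  also have "\<dots> = (\<Sum>i\<in>S. t i + \<theta> * c i) + (\<Sum>i\<in>I - S. \<bar>a i\<bar>)"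
    unfolding split using \<theta>1 s by (intro arg_cong2[of _ _ _ _ "(+)"] sum.cong) (auto simp: a'_def abs_mult)
  also have "(\<Sum>i\<in>S. t i + \<theta> * c i) = (\<Sum>i\<in>S. \<bar>a i\<bar>)"
    using c2 by (simp add: sum.distrib t_def flip: sum_distrib_left)
  also have "\<dots> + (\<Sum>i\<in>I - S. \<bar>a i\<bar>) = (\<Sum>i\<in>I. \<bar>a i\<bar>)" by (rule split[symmetric])
  finally have sum': "(\<Sum>i\<in>I - {j}. \<bar>a' i\<bar>) \<le> M" using M by simp
  have "network (I - {j}) a' v = (\<lambda>x. network I a v x + \<theta> * e x)"
  proof
    fix x
    let ?r = "\<lambda>i. relu ((x, 1) \<bullet> v i)"
    have "network (I - {j}) a' v x = network I a' v x"
      unfolding network_def using finI aj j SI by (intro sum.mono_neutral_left) auto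
    also have "\<dots> = (\<Sum>i\<in>S. a i * ?r i + \<theta> * (s * (c i * ?r i))) + (\<Sum>i\<in>I - S. a i * ?r i)"
      unfolding network_def split
    proof (intro arg_cong2[of _ _ _ _ "(+)"] sum.cong refl)
      fix i assume i: "i \<in> S"
      then have "s * t i = a i" using I'(2) S unfolding t_def by (metis subsetD)
      then show "a' i * ?r i = a i * ?r i + \<theta> * (s * (c i * ?r i))" using i by (simp add: a'_def algebra_simps)
    qed (auto simp: a'_def)
    also have "\<dots> = network I a v x + \<theta> * e x"
      unfolding network_def split e_def by (simp add: sum.distrib sum_distrib_left)
    finally show "network (I - {j}) a' v x = network I a v x + \<theta> * e x" .
  qed
  then have "sq_risk \<rho> (network (I - {j}) a' v) \<le> sq_risk \<rho> (network I a v) + \<tau>1 * \<tau>2 * (\<integral>z. (e (fst z))\<^sup>2 \<partial>\<rho>)"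
    using \<theta>(2) by simp
  moreover have "\<tau>1 * \<tau>2 * (\<integral>z. (e (fst z))\<^sup>2 \<partial>\<rho>) \<le> 2048 * (real d + 3)\<^sup>2 * C ^ 3 * M\<^sup>2 * (real m powr (- 2 - 3 / real d) * ln (real m))"
  proof -
    have "(\<lambda>z::'a \<times> real. (e (fst z))\<^sup>2) = (\<lambda>z. (network S c v (fst z))\<^sup>2)" using s by (auto simp: e_def power_mult_distrib)
    then have int_eq: "(\<integral>z. (e (fst z))\<^sup>2 \<partial>\<rho>) = (\<integral>z. (network S c v (fst z))\<^sup>2 \<partial>\<rho>)" by presburger
    have "\<tau>1 * \<tau>2 * (\<integral>z. (e (fst z))\<^sup>2 \<partial>\<rho>) \<le> \<tau>1 * \<tau>2 * (2 * (\<Sum>i\<in>S. \<bar>c i\<bar>)\<^sup>2 * \<delta>\<^sup>2 * measure \<rho> {z. separates (fst z) v S})"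
      unfolding int_eq using \<tau>(1,2) exchange_integral_le[OF \<rho> finS c1 c2 near'] by (intro mult_left_mono) simp_all
    also have "\<dots> = (\<tau>1 * \<tau>2 * (\<Sum>i\<in>S. \<bar>c i\<bar>)\<^sup>2) * (2 * \<delta>\<^sup>2 * measure \<rho> {z. separates (fst z) v S})" by (simp add: mult_ac)
    also have "\<dots> \<le> (4 * (\<Sum>i\<in>S. t i)\<^sup>2) * (2 * \<delta>\<^sup>2 * (\<delta> * ln (real m)))"
      using \<tau>(1,2) by (intro mult_mono[OF \<tau>(4)] mult_left_mono[OF sep']) auto
    also have "\<dots> \<le> (4 * ((real d + 3) * (2 * M / m))\<^sup>2) * (2 * \<delta>\<^sup>2 * (\<delta> * ln (real m)))"
    proof -
      have "(\<Sum>i\<in>S. t i) \<le> (\<Sum>i\<in>S. 2 * M / m)"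
        by (rule sum_mono) (use S I' in \<open>auto simp: t_def L_def\<close>)
      also have "\<dots> = (real d + 3) * (2 * M / m)" using S by simp
      finally have "(\<Sum>i\<in>S. t i)\<^sup>2 \<le> ((real d + 3) * (2 * M / m))\<^sup>2"
        by (intro power_mono) (auto intro: sum_nonneg simp: t_def)
      moreover have "2 * \<delta>\<^sup>2 * (\<delta> * ln (real m)) \<ge> 0" using C0 m4 by (auto simp: \<delta>_def)
      ultimately show ?thesis by (intro mult_right_mono) auto
    qed
    \<comment> \<open>\<open>2048 = 4 * 2^2 * 2 * 4^3\<close>: the product of the two step sizes,
      the light weights, the squared norm of \<open>(x, 1)\<close>, and the cube of the factor 4 in
      \<open>\<delta>\<close>.\<close>
    also have "\<dots> = 2048 * (real d + 3)\<^sup>2 * C ^ 3 * M\<^sup>2 * ((1 / real m)\<^sup>2 * (real m powr (- (1 / real d))) ^ 3 * ln (real m))"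
      by (simp add: \<delta>_def power2_eq_square power3_eq_cube)
    also have "(1 / real m)\<^sup>2 * (real m powr (- (1 / real d))) ^ 3 = real m powr (- 2) * real m powr (- (3 / real d))"
      using m4 by (simp add: powr_power powr_minus power_divide divide_simps powr_numeral)
    also have "\<dots> = real m powr (- 2 - 3 / real d)" by (simp flip: powr_add)
    finally show ?thesis .
  qed
  ultimately show ?thesis using sum' j SI by (intro bexI[of _ j] exI[of _ a']) auto
qed


section \<open>Iterated removal of neurons and uniform sparsification\<close>

lemma ln_powr_telescope:
  fixes p :: real and k :: nat
  assumes "p > 1" "k \<ge> 3"
  shows "real k powr (- p - 1) * ln (real k) \<le>
    2 * (real (k - 1) powr (- p) * (1 + ln (real (k - 1))) - real k powr (- p) * (1 + ln (real k)))"
proof -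
  \<comment> \<open>For \<open>x \<ge> 1\<close> this decreases at least at the rate
    \<open>x powr (- p - 1) * ln x\<close>, so its decrease over a unit interval dominates one term
    up to a factor. The factor 2 pays for replacing \<open>ln k\<close> by
    \<open>ln (k - 1)\<close>, through \<open>k \<le> (k - 1)^2\<close>, valid from 3 on.\<close>
  define \<beta> where "\<beta> = (\<lambda>x::real. x powr (- p) * (1 + ln x))"
  define \<beta>' where "\<beta>' = (\<lambda>x::real. - (x powr (- p - 1) * (p - 1 + p * ln x)))"
  have k1: "real (k - 1) = real k - 1" using assms(2) by simp
  have der: "(\<beta> has_real_derivative \<beta>' x) (at x)" if "x > 0" for x
    unfolding \<beta>_def \<beta>'_def using that
    by (auto intro!: derivative_eq_intros simp: powr_diff field_simps)
  obtain \<xi> where \<xi>: "real k - 1 < \<xi>" "\<xi> < real k" "\<beta> (real k) - \<beta> (real k - 1) = (real k - (real k - 1)) * \<beta>' \<xi>"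
    using MVT2[of "real k - 1" "real k" \<beta> \<beta>'] der assms(2) by auto
  have "ln (real k) \<le> ln ((real k - 1)\<^sup>2)"
  proof -
    have "3 * real k \<le> real k * real k" using assms(2) by (intro mult_right_mono) auto
    then have "real k \<le> (real k - 1)\<^sup>2" by (simp add: power2_eq_square algebra_simps)
    then show ?thesis using assms(2) by (subst ln_le_cancel_iff) auto
  qed
  also have "\<dots> = 2 * ln (real k - 1)" using assms(2) by (simp add: ln_realpow)
  also have "\<dots> \<le> 2 * ln \<xi>" using \<xi> assms(2) by (subst mult_le_cancel_left_pos) auto
  also have "\<dots> \<le> 2 * (p - 1 + p * ln \<xi>)"
  proof -
    have "ln \<xi> \<ge> 0" using \<xi> assms(2) by simp
    then have "1 * ln \<xi> \<le> p * ln \<xi>" using assms(1) by (intro mult_right_mono) auto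
    then show ?thesis using assms(1) by simp
  qed
  finally have le: "ln (real k) \<le> 2 * (p - 1 + p * ln \<xi>)" .
  have "real k powr (- p - 1) * ln (real k) \<le> \<xi> powr (- p - 1) * (2 * (p - 1 + p * ln \<xi>))"
    using \<xi> assms le by (intro mult_mono powr_mono2') auto
  also have "\<dots> = 2 * (\<beta> (real k - 1) - \<beta> (real k))" using \<xi>(3) unfolding \<beta>'_def by (simp add: algebra_simps)
  finally show ?thesis unfolding \<beta>_def k1 .
qed

lemma exists_sparse_network:
  fixes v :: "'i \<Rightarrow> 'a::euclidean_space \<times> real"
  defines "d \<equiv> DIM('a)"
  defines "q \<equiv> 2 * (d + 1) * (d + 3) * (3 * d + 5) ^ d"
  defines "C \<equiv> 2048 * (real d + 3)\<^sup>2 * (4 * (real d + 4) * real q powr (1 / real d)) ^ 3"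
  defines "\<beta> \<equiv> (\<lambda>k::nat. real k powr (- (1 + 3 / real d)) * (1 + ln (real k)))"
  assumes \<rho>: "risk_measure \<rho>" and "finite I" "\<And>i. i \<in> I \<Longrightarrow> norm (v i) = 1"
    and N: "N \<ge> 4 * q" and "(\<Sum>i\<in>I. \<bar>a i\<bar>) \<le> M" "card I \<ge> N"
  shows "\<exists>I' a'. I' \<subseteq> I \<and> card I' = N \<and> (\<Sum>i\<in>I'. \<bar>a' i\<bar>) \<le> M \<and>
    sq_risk \<rho> (network I' a' v) \<le> sq_risk \<rho> (network I a v) + 2 * C * M\<^sup>2 * (\<beta> N - \<beta> (card I))"
  using assms(6,7,9,10)
proof (induction "card I" arbitrary: I a)
  case 0
  then show ?case using N by (intro exI[of _ I] exI[of _ a]) auto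
next
  case (Suc m)
  have d: "d \<ge> 1" by (simp add: d_def Suc_leI)
  have q: "q \<ge> 1" by (simp add: q_def)
  have C0: "C \<ge> 0" by (simp add: C_def)
  show ?case
  proof (cases "card I = N")
    case True
    then show ?thesis using Suc.prems by (intro exI[of _ I] exI[of _ a]) auto
  next
    case False
    then have gt: "card I > N" using Suc.prems by simp
    have "card I \<ge> 4 * q" using gt N by simp
    from exists_neuron_removal[where v = v, OF \<rho> Suc.prems(1) Suc.prems(2) refl this[unfolded q_def d_def] Suc.prems(3), folded d_def, folded q_def, folded C_def]
    obtain j a' where j: "j \<in> I" "(\<Sum>i\<in>I - {j}. \<bar>a' i\<bar>) \<le> M"
      "sq_risk \<rho> (network (I - {j}) a' v) \<le> sq_risk \<rho> (network I a v)
        + C * M\<^sup>2 * (real (card I) powr (- 2 - 3 / real d) * ln (real (card I)))"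
      by blast
    have card: "card (I - {j}) = m" using j(1) Suc.hyps(2) Suc.prems(1) by simp
    obtain I' a'' where I': "I' \<subseteq> I - {j}" "card I' = N" "(\<Sum>i\<in>I'. \<bar>a'' i\<bar>) \<le> M"
      "sq_risk \<rho> (network I' a'' v) \<le> sq_risk \<rho> (network (I - {j}) a' v) + 2 * C * M\<^sup>2 * (\<beta> N - \<beta> m)"
    proof -
      have f: "finite (I - {j})" "m = card (I - {j})" "N \<le> card (I - {j})" using Suc.prems(1) card gt Suc.hyps(2) by auto
      have f4: "\<And>i. i \<in> I - {j} \<Longrightarrow> norm (v i) = 1" using Suc.prems(2) by auto
      have "\<exists>I' a''. I' \<subseteq> I - {j} \<and> card I' = N \<and> (\<Sum>i\<in>I'. \<bar>a'' i\<bar>) \<le> M \<and>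
        sq_risk \<rho> (network I' a'' v) \<le> sq_risk \<rho> (network (I - {j}) a' v) + 2 * C * M\<^sup>2 * (\<beta> N - \<beta> (card (I - {j})))"
        by (rule Suc.hyps(1)[OF f(2) f(1) f4 j(2) f(3)])
      then show thesis unfolding card by (elim exE conjE) (rule that)
    qed
    \<comment> \<open>With \<open>p = 1 + 3 / d\<close> the cost of one removal is bounded by a
      difference of consecutive values of the potential \<open>\<beta>\<close>, so that the costs
      telescope.\<close>
    have tele: "real (card I) powr (- 2 - 3 / real d) * ln (real (card I)) \<le> 2 * (\<beta> m - \<beta> (card I))"
    proof -
      have "card I \<ge> 3" using gt N q by linarith
      moreover have "1 + 3 / real d > 1" "card I - 1 = m" "- (1 + 3 / real d) - 1 = - 2 - 3 / real d"
        using d Suc.hyps(2)[symmetric] by auto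
      ultimately show ?thesis
        using ln_powr_telescope[of "1 + 3 / real d" "card I"] unfolding \<beta>_def by metis
    qed
    have "C * M\<^sup>2 * (real (card I) powr (- 2 - 3 / real d) * ln (real (card I))) \<le> C * M\<^sup>2 * (2 * (\<beta> m - \<beta> (card I)))"
      by (intro mult_left_mono tele) (use C0 in auto)
    then have "sq_risk \<rho> (network I' a'' v) \<le> sq_risk \<rho> (network I a v) + 2 * C * M\<^sup>2 * (\<beta> N - \<beta> (card I))"
      using I'(4) j(3) by (simp add: algebra_simps)
    then show ?thesis using I' by (intro exI[of _ I'] exI[of _ a'']) auto
  qed
qed

lemma network_in_nn_class:
  assumes "finite I" "card I \<le> N" "(\<Sum>i\<in>I. \<bar>a i\<bar> * norm (v i)) \<le> M"
  shows "network I a v \<in> nn_class N M"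
proof -
  obtain e where e: "bij_betw e {..<card I} I" using assms(1) bij_betw_from_nat_into_finite by blast
  define a' where "a' = (\<lambda>i. if i < card I then a (e i) else 0)"
  have red: "(\<Sum>i<N. if i < card I then f (e i) else 0) = (\<Sum>i\<in>I. f i)" for f :: "_ \<Rightarrow> real"
  proof -
    have "(\<Sum>i<N. if i < card I then f (e i) else 0) = (\<Sum>i<card I. f (e i))"
      using assms(2) by (intro sum.mono_neutral_cong_right) auto
    also have "\<dots> = (\<Sum>i\<in>I. f i)" by (rule sum.reindex_bij_betw[OF e])
    finally show ?thesis .
  qed
  have "network I a v = (\<lambda>x. \<Sum>i<N. a' i * relu (inner (x, 1) (v (e i))))"
    unfolding network_def a'_def red[symmetric] by (intro ext sum.cong) auto
  moreover have "(\<Sum>i<N. \<bar>a' i\<bar> * norm (v (e i))) \<le> M"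
  proof -
    have "(\<Sum>i<N. \<bar>a' i\<bar> * norm (v (e i))) = (\<Sum>i<N. if i < card I then \<bar>a (e i)\<bar> * norm (v (e i)) else 0)"
      by (intro sum.cong) (auto simp: a'_def)
    then show ?thesis using assms(3) red[of "\<lambda>i. \<bar>a i\<bar> * norm (v i)"] by simp
  qed
  ultimately show ?thesis unfolding nn_class_def by (auto intro!: exI[of _ a'] exI[of _ "\<lambda>i. v (e i)"])
qed

text \<open>Positive homogeneity of the ReLU moves the norm of an inner weight into its coefficient;
  neurons with zero inner weight contribute nothing and are dropped.\<close>

lemma nn_class_normalized:
  fixes f :: "'a::euclidean_space \<Rightarrow> real"
  assumes "f \<in> nn_class N M"
  obtains I a v where "finite I" "I \<subseteq> {..<N}" "f = network I a v" "\<And>i. i \<in> I \<Longrightarrow> norm (v i) = 1" "(\<Sum>i\<in>I. \<bar>a i\<bar>) \<le> M"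
proof -
  obtain a and w :: "nat \<Rightarrow> 'a \<times> real" where aw: "f = (\<lambda>x. \<Sum>i<N. a i * relu (inner (x, 1) (w i)))" "(\<Sum>i<N. \<bar>a i\<bar> * norm (w i)) \<le> M"
    using assms unfolding nn_class_def by blast
  define I where "I = {i. i < N \<and> w i \<noteq> 0}"
  define v where "v = (\<lambda>i. (1 / norm (w i)) *\<^sub>R w i)"
  have relu_scale: "relu (inner y (w i)) = norm (w i) * relu (inner y (v i))" if "w i \<noteq> 0" for y i
    using that by (auto simp: v_def relu_def max_def field_simps mult_le_0_iff zero_le_mult_iff)
  show thesis
  proof
    show "finite I" "I \<subseteq> {..<N}" by (auto simp: I_def)
    show "f = network I (\<lambda>i. a i * norm (w i)) v"
      unfolding aw(1) network_def
      by (intro ext sum.mono_neutral_cong_right) (auto simp: I_def relu_scale, simp add: relu_def)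
    show "norm (v i) = 1" if "i \<in> I" for i using that by (auto simp: I_def v_def)
    have "(\<Sum>i\<in>I. \<bar>a i * norm (w i)\<bar>) \<le> (\<Sum>i<N. \<bar>a i\<bar> * norm (w i))"
      unfolding abs_mult abs_norm_cancel by (intro sum_mono2) (auto simp: I_def)
    then show "(\<Sum>i\<in>I. \<bar>a i * norm (w i)\<bar>) \<le> M" using aw by simp
  qed
qed

lemma nn_class_mono: "N \<le> N' \<Longrightarrow> M \<le> M' \<Longrightarrow> nn_class N M \<subseteq> nn_class N' M'"
proof
  fix f :: "'a \<Rightarrow> real" assume *: "N \<le> N'" "M \<le> M'" "f \<in> nn_class N M"
  then obtain a w where aw: "f = network {..<N} a w" "(\<Sum>i<N. \<bar>a i\<bar> * norm (w i)) \<le> M"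
    unfolding nn_class_def network_def[abs_def] by blast
  then show "f \<in> nn_class N' M'" using * network_in_nn_class[of "{..<N}" N' a w M'] by simp
qed

text \<open>The constants depend on the dimension alone. Uniformity in \<open>\<rho>\<close> is
  essential, since the theorem is applied to measures that depend on the sample and on the
  minimiser; the width \<open>N'\<close> does not enter the bound.\<close>

theorem nn_class_sparsify:
  "\<exists>C N0. C > 0 \<and> (\<forall>(\<rho> :: ('a::euclidean_space \<times> real) measure) M N N' f.
     risk_measure \<rho> \<and> f \<in> nn_class N' M \<and> N \<ge> N0 \<longrightarrow>
     (\<exists>g\<in>nn_class N M. sq_risk \<rho> g \<le> sq_risk \<rho> f
        + C * M\<^sup>2 * (real N powr (- (1 + 3 / real DIM('a))) * (1 + ln (real N)))))"
proof -
  define d where "d = DIM('a)"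
  define q where "q = 2 * (d + 1) * (d + 3) * (3 * d + 5) ^ d"
  define C where "C = 2048 * (real d + 3)\<^sup>2 * (4 * (real d + 4) * real q powr (1 / real d)) ^ 3"
  define \<beta> where "\<beta> = (\<lambda>k::nat. real k powr (- (1 + 3 / real d)) * (1 + ln (real k)))"
  have q: "q \<ge> 1" by (simp add: q_def)
  have C: "C > 0" using q unfolding C_def by (auto intro!: mult_pos_pos)
  have \<beta>0: "\<beta> k \<ge> 0" for k by (cases k) (auto simp: \<beta>_def intro!: mult_nonneg_nonneg add_nonneg_nonneg)
  have "\<exists>g\<in>nn_class N M. sq_risk \<rho> g \<le> sq_risk \<rho> f + 2 * C * M\<^sup>2 * \<beta> N"
    if \<rho>: "risk_measure \<rho>" and f: "f \<in> nn_class N' M" and N: "N \<ge> 4 * q" for \<rho> M N N' and f :: "'a \<Rightarrow> real"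
  proof -
    obtain I a v where I: "finite I" "I \<subseteq> {..<N'}" "f = network I a v" "\<And>i. i \<in> I \<Longrightarrow> norm (v i) = 1" "(\<Sum>i\<in>I. \<bar>a i\<bar>) \<le> M"
      by (rule nn_class_normalized[OF f]) blast
    show ?thesis
    proof (cases "card I \<ge> N")
      case True
      from exists_sparse_network[where v = v, OF \<rho> I(1,4) N[unfolded q_def d_def] I(5) True, folded d_def, folded q_def, folded C_def, folded \<beta>_def]
      obtain I' a' where I': "I' \<subseteq> I" "card I' = N" "(\<Sum>i\<in>I'. \<bar>a' i\<bar>) \<le> M"
        "sq_risk \<rho> (network I' a' v) \<le> sq_risk \<rho> (network I a v) + 2 * C * M\<^sup>2 * (\<beta> N - \<beta> (card I))"
        unfolding \<beta>_def by blast
      have "(\<Sum>i\<in>I'. \<bar>a' i\<bar> * norm (v i)) = (\<Sum>i\<in>I'. \<bar>a' i\<bar>)" using I' I by (intro sum.cong) auto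
      then have "network I' a' v \<in> nn_class N M"
        using I' I by (intro network_in_nn_class) (auto intro: finite_subset)
      moreover have "2 * C * M\<^sup>2 * (\<beta> N - \<beta> (card I)) \<le> 2 * C * M\<^sup>2 * \<beta> N"
        using C \<beta>0 by (intro mult_left_mono) auto
      ultimately show ?thesis using I' I by (intro bexI[of _ "network I' a' v"]) auto
    next
      case False
      have "(\<Sum>i\<in>I. \<bar>a i\<bar> * norm (v i)) = (\<Sum>i\<in>I. \<bar>a i\<bar>)" using I by (intro sum.cong) auto
      then have "f \<in> nn_class N M" unfolding I(3) using I False by (intro network_in_nn_class) auto
      then show ?thesis using C \<beta>0 by (intro bexI[of _ f]) auto
    qed
  qed
  then show ?thesis using C unfolding \<beta>_def d_def by (intro exI[of _ "2 * C"] exI[of _ "4 * q"]) auto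
qed

subsection \<open>Deviation and covering\<close>

abbreviation sample :: "nat \<Rightarrow> 'b measure \<Rightarrow> (nat \<Rightarrow> 'b) measure" where
  "sample n P \<equiv> PiM {..<n} (\<lambda>_. P)"

lemma exp_le_quadratic:
  fixes x :: real
  assumes "\<bar>x\<bar> \<le> 1"
  shows "exp x \<le> 1 + x + x\<^sup>2"
proof (cases "x \<ge> 0")
  case True
  then show ?thesis using exp_bound[of x] assms by simp
next
  case False
  define y where "y = - x"
  have y: "0 \<le> y" "y \<le> 1" using False assms by (auto simp: y_def)
  have "1 \<le> (1 - y + y\<^sup>2) * (1 + y)"
  proof -
    have "(1 - y + y\<^sup>2) * (1 + y) = 1 + y ^ 3" by (simp add: power2_eq_square power3_eq_cube algebra_simps)
    then show ?thesis using y by simp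
  qed
  also have "\<dots> \<le> (1 - y + y\<^sup>2) * exp y"
    using y exp_ge_add_one_self[of y] by (intro mult_left_mono) (auto intro: add_nonneg_nonneg)
  finally have "exp (- y) \<le> (1 - y + y\<^sup>2) * exp y * exp (- y)"
    by (metis exp_ge_zero mult_1 mult_right_mono)
  also have "\<dots> = 1 - y + y\<^sup>2" by (simp add: exp_minus)
  finally show ?thesis by (simp add: y_def)
qed

text \<open>\<open>exp x \<le> 1 + x + x^2\<close> bounds the moment generating function by two
  moments, and Markov's inequality for the product concludes. The free parameter of Chernoff's
  method is left to the scaling of \<open>W\<close>.\<close>

lemma chernoff_iid:
  fixes W :: "'z \<Rightarrow> real"
  assumes "prob_space P" and [measurable]: "W \<in> borel_measurable P" and W: "AE z in P. \<bar>W z\<bar> \<le> 1"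
  shows "measure (sample n P) {D\<in>space (sample n P).
      (\<Sum>i<n. W (D i)) \<ge> real n * ((\<integral>z. W z \<partial>P) + (\<integral>z. (W z)\<^sup>2 \<partial>P)) + t} \<le> exp (- t)"
proof -
  interpret P: prob_space P by fact
  interpret PP: product_prob_space "\<lambda>_. P" "{..<n}" ..
  define Q where "Q = sample n P"
  interpret Q: prob_space Q unfolding Q_def by (rule prob_space_PiM) (rule assms(1))
  have intW: "integrable P W" by (rule P.integrable_const_bound[where B = 1]) (use W in auto)
  have intW2: "integrable P (\<lambda>z. (W z)\<^sup>2)"
    by (rule P.integrable_const_bound[where B = 1]) (use W in \<open>auto elim!: eventually_mono simp: abs_square_le_1\<close>)
  have intE: "integrable P (\<lambda>z. exp (W z))"
    by (rule P.integrable_const_bound[where B = "exp 1"]) (use W in \<open>auto elim!: eventually_mono\<close>)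
  define \<mu> where "\<mu> = (\<integral>z. W z \<partial>P) + (\<integral>z. (W z)\<^sup>2 \<partial>P)"
  have "(\<integral>z. exp (W z) \<partial>P) \<le> (\<integral>z. 1 + W z + (W z)\<^sup>2 \<partial>P)"
    by (rule integral_mono_AE) (use W intW intW2 intE in \<open>auto elim!: eventually_mono intro: exp_le_quadratic\<close>)
  also have "\<dots> = 1 + \<mu>" using intW intW2 by (simp add: \<mu>_def P.prob_space)
  also have "\<dots> \<le> exp \<mu>" by (rule exp_ge_add_one_self)
  finally have mgf: "(\<integral>z. exp (W z) \<partial>P) \<le> exp \<mu>" .
  have intS: "integrable Q (\<lambda>D. \<Prod>i<n. exp (W (D i)))"
    unfolding Q_def by (rule PP.product_integrable_prod) (use intE in auto)
  have "(\<integral>D. (\<Prod>i<n. exp (W (D i))) \<partial>Q) = (\<Prod>i<n. (\<integral>z. exp (W z) \<partial>P))"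
    unfolding Q_def by (rule PP.product_integral_prod) (use intE in auto)
  also have "\<dots> \<le> (\<Prod>i<n. exp \<mu>)" by (rule prod_mono) (auto simp: mgf)
  also have "\<dots> = exp (real n * \<mu>)" by (simp add: exp_of_nat_mult)
  finally have mgfn: "(\<integral>D. (\<Prod>i<n. exp (W (D i))) \<partial>Q) \<le> exp (real n * \<mu>)" .
  have "measure Q {D\<in>space Q. (\<Sum>i<n. W (D i)) \<ge> real n * \<mu> + t}
     \<le> measure Q {D\<in>space Q. (\<Prod>i<n. exp (W (D i))) \<ge> exp (real n * \<mu> + t)}"
  proof (rule Q.finite_measure_mono)
    show "{D\<in>space Q. (\<Sum>i<n. W (D i)) \<ge> real n * \<mu> + t} \<subseteq> {D\<in>space Q. (\<Prod>i<n. exp (W (D i))) \<ge> exp (real n * \<mu> + t)}"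
      by (auto simp: exp_sum[symmetric])
    show "{D\<in>space Q. (\<Prod>i<n. exp (W (D i))) \<ge> exp (real n * \<mu> + t)} \<in> sets Q"
      unfolding Q_def by measurable
  qed
  also have "\<dots> \<le> (\<integral>D. (\<Prod>i<n. exp (W (D i))) \<partial>Q) / exp (real n * \<mu> + t)"
    by (rule integral_Markov_inequality_measure[OF intS, of "{}"]) (auto intro!: AE_I2 prod_nonneg)
  also have "\<dots> \<le> exp (real n * \<mu>) / exp (real n * \<mu> + t)" using mgfn by (intro divide_right_mono) auto
  also have "\<dots> = exp (- t)" by (simp add: exp_diff[symmetric])
  finally show ?thesis by (simp add: Q_def \<mu>_def)
qed

section \<open>Finite nets of networks in the supremum norm\<close>

lemma exists_ball_net:
  assumes "M \<ge> 0" "\<eta> > 0"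
  shows "\<exists>G::'b::euclidean_space set. finite G \<and> real (card G) \<le> (2 * M / \<eta> + 3) ^ DIM('b) \<and>
     (\<forall>u\<in>cball 0 M. \<exists>g\<in>G. norm (u - g) \<le> real DIM('b) * \<eta>)"
proof -
  define R where "R = {- \<lceil>M / \<eta>\<rceil>..\<lceil>M / \<eta>\<rceil>}"
  define F where "F = PiE (Basis::'b set) (\<lambda>_. R)"
  define p where "p = (\<lambda>k::'b \<Rightarrow> int. \<Sum>b\<in>Basis. (of_int (k b) * \<eta>) *\<^sub>R b)"
  have finF: "finite F" unfolding F_def R_def by (intro finite_PiE) auto
  have cR: "real (card R) \<le> 2 * M / \<eta> + 3"
  proof -
    have "M / \<eta> \<ge> 0" using assms by simp
    then have "real (card R) = 2 * of_int \<lceil>M / \<eta>\<rceil> + 1" by (simp add: R_def)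
    also have "\<dots> \<le> 2 * (M / \<eta> + 1) + 1" by (intro add_mono mult_left_mono of_int_ceiling_le_add_one) auto
    finally show ?thesis by simp
  qed
  have "real (card (p ` F)) \<le> real (card F)" using card_image_le[OF finF] by simp
  also have "card F = card R ^ DIM('b)" by (simp add: F_def card_PiE)
  also have "real (card R ^ DIM('b)) \<le> (2 * M / \<eta> + 3) ^ DIM('b)"
    using cR by (simp add: power_mono)
  finally have "real (card (p ` F)) \<le> (2 * M / \<eta> + 3) ^ DIM('b)" .
  moreover have "\<exists>g\<in>p ` F. norm (u - g) \<le> real DIM('b) * \<eta>" if u: "u \<in> cball 0 M" for u
  proof -
    define k where "k = restrict (\<lambda>b. \<lceil>(u \<bullet> b) / \<eta>\<rceil>) (Basis::'b set)"
    have "k \<in> F"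
      unfolding F_def k_def
    proof (intro restrict_PiE_iff[THEN iffD2] ballI)
      fix b :: 'b assume b: "b \<in> Basis"
      have "\<bar>u \<bullet> b\<bar> \<le> M" using Basis_le_norm[OF b, of u] u by simp
      then have "(u \<bullet> b) / \<eta> \<le> M / \<eta>" "- (M / \<eta>) \<le> (u \<bullet> b) / \<eta>"
        using assms by (auto simp: field_simps)
      then show "\<lceil>(u \<bullet> b) / \<eta>\<rceil> \<in> R" unfolding R_def
        by (smt (verit) atLeastAtMost_iff ceiling_mono le_of_int_ceiling of_int_minus le_ceiling_iff ceiling_correct of_int_ceiling_le_add_one)
    qed
    moreover have "norm (u - p k) \<le> real DIM('b) * \<eta>"
    proof -
      have "norm (u - p k) \<le> (\<Sum>b\<in>Basis. \<bar>(u - p k) \<bullet> b\<bar>)" by (rule norm_le_l1)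
      also have "\<dots> \<le> (\<Sum>b\<in>(Basis::'b set). \<eta>)"
      proof (rule sum_mono)
        fix b :: 'b assume b: "b \<in> Basis"
        have "p k \<bullet> b = of_int \<lceil>(u \<bullet> b) / \<eta>\<rceil> * \<eta>"
          using b by (simp add: p_def k_def inner_sum_left inner_Basis if_distrib sum.delta cong: if_cong)
        moreover have "of_int \<lceil>(u \<bullet> b) / \<eta>\<rceil> * \<eta> \<ge> (u \<bullet> b) / \<eta> * \<eta>" "of_int \<lceil>(u \<bullet> b) / \<eta>\<rceil> * \<eta> \<le> ((u \<bullet> b) / \<eta> + 1) * \<eta>"
          using assms by (intro mult_right_mono; linarith)+
        ultimately show "\<bar>(u - p k) \<bullet> b\<bar> \<le> \<eta>" using assms by (auto simp: inner_diff_left algebra_simps)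
      qed
      finally show ?thesis by simp
    qed
    ultimately show ?thesis by blast
  qed
  ultimately show ?thesis using finF by (intro exI[of _ "p ` F"]) auto
qed

lemma nn_class_net:
  assumes "M \<ge> 0" "\<eta> > 0"
  shows "\<exists>G::('a::euclidean_space \<Rightarrow> real) set. finite G \<and> (\<forall>g\<in>G. continuous_on UNIV g) \<and>
     real (card G) \<le> (2 * (2 * M / \<eta> + 3) ^ (DIM('a) + 1)) ^ N \<and>
     (\<forall>f\<in>nn_class N M. \<exists>g\<in>G. \<forall>x\<in>cball 0 1. \<bar>f x - g x\<bar> \<le> 2 * real N * (real DIM('a) + 1) * \<eta>)"
proof -
  obtain U :: "('a \<times> real) set" where U: "finite U" "real (card U) \<le> (2 * M / \<eta> + 3) ^ (DIM('a) + 1)"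
    "\<And>u. u \<in> cball 0 M \<Longrightarrow> \<exists>g\<in>U. norm (u - g) \<le> (real DIM('a) + 1) * \<eta>"
    using exists_ball_net[OF assms, where 'b = "'a \<times> real"] by (auto simp: algebra_simps)
  define F where "F = PiE {..<N} (\<lambda>_. {1, -1::real} \<times> U)"
  define p where "p = (\<lambda>k (x::'a). \<Sum>i<N. fst (k i) * relu (inner (x, 1) (snd (k i) :: 'a \<times> real)))"
  have finF: "finite F" unfolding F_def using U by (intro finite_PiE) auto
  have "real (card (p ` F)) \<le> real (card F)" using card_image_le[OF finF] by simp
  also have "card F = (2 * card U) ^ N" by (simp add: F_def card_PiE card_cartesian_product mult_2)
  also have "real ((2 * card U) ^ N) \<le> (2 * (2 * M / \<eta> + 3) ^ (DIM('a) + 1)) ^ N"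
    using U(2) by (auto intro!: power_mono)
  finally have card: "real (card (p ` F)) \<le> (2 * (2 * M / \<eta> + 3) ^ (DIM('a) + 1)) ^ N" .
  have net: "\<exists>g\<in>p ` F. \<forall>x\<in>cball 0 1. \<bar>f x - g x\<bar> \<le> 2 * real N * (real DIM('a) + 1) * \<eta>" if f: "f \<in> nn_class N M" for f
  proof -
    obtain a and w :: "nat \<Rightarrow> 'a \<times> real" where aw: "f = (\<lambda>x. \<Sum>i<N. a i * relu (inner (x, 1) (w i)))" "(\<Sum>i<N. \<bar>a i\<bar> * norm (w i)) \<le> M"
      using f unfolding nn_class_def by blast
    have "\<exists>g\<in>U. norm (\<bar>a i\<bar> *\<^sub>R w i - g) \<le> (real DIM('a) + 1) * \<eta>" if i: "i < N" for i
    proof (rule U(3))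
      have "\<bar>a i\<bar> * norm (w i) \<le> (\<Sum>i<N. \<bar>a i\<bar> * norm (w i))" using i by (intro member_le_sum) auto
      then show "\<bar>a i\<bar> *\<^sub>R w i \<in> cball 0 M" using aw by simp
    qed
    then obtain u where u: "\<And>i. i < N \<Longrightarrow> u i \<in> U \<and> norm (\<bar>a i\<bar> *\<^sub>R w i - u i) \<le> (real DIM('a) + 1) * \<eta>" by metis
    define s where "s = (\<lambda>i. if a i \<ge> 0 then 1 else -1 :: real)"
    define k where "k = restrict (\<lambda>i. (s i, u i)) {..<N}"
    have "k \<in> F" using u by (auto simp: F_def k_def s_def)
    moreover have "\<bar>f x - p k x\<bar> \<le> 2 * real N * (real DIM('a) + 1) * \<eta>" if x: "x \<in> cball 0 1" for x
    proof -
      \<comment> \<open>A neuron depends only on the sign of \<open>a i\<close> and on the vector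
        \<open>\<bar>a i\<bar> *\<^sub>R w i\<close> in the ball of radius \<open>M\<close>. One net
        of that ball and two signs thus suffice for each neuron, however large \<open>a i\<close> or
        \<open>w i\<close> is by itself.\<close>
      have hom: "a i * relu (inner (x, 1) (w i)) = s i * relu (inner (x, 1) (\<bar>a i\<bar> *\<^sub>R w i))" for i
        by (auto simp: s_def relu_def max_def mult_le_0_iff zero_le_mult_iff)
      have "\<bar>f x - p k x\<bar> = \<bar>\<Sum>i<N. s i * (relu (inner (x, 1) (\<bar>a i\<bar> *\<^sub>R w i)) - relu (inner (x, 1) (u i)))\<bar>"
        unfolding aw(1) p_def hom sum_subtractf[symmetric] by (intro arg_cong[of _ _ abs] sum.cong) (auto simp: k_def algebra_simps)
      also have "\<dots> \<le> (\<Sum>i<N. \<bar>s i * (relu (inner (x, 1) (\<bar>a i\<bar> *\<^sub>R w i)) - relu (inner (x, 1) (u i)))\<bar>)" by (rule sum_abs)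
      also have "\<dots> \<le> (\<Sum>i<N. 2 * ((real DIM('a) + 1) * \<eta>))"
      proof (rule sum_mono)
        fix i assume i: "i \<in> {..<N}"
        have "\<bar>s i * (relu (inner (x, 1) (\<bar>a i\<bar> *\<^sub>R w i)) - relu (inner (x, 1) (u i)))\<bar> \<le> \<bar>inner (x, 1) (\<bar>a i\<bar> *\<^sub>R w i - u i)\<bar>"
        proof -
          have "\<bar>s i\<bar> = 1" by (simp add: s_def)
          then show ?thesis
            using relu_lipschitz[of "inner (x, 1) (\<bar>a i\<bar> *\<^sub>R w i)" "inner (x, 1) (u i)"]
            by (simp only: abs_mult inner_diff_right mult_1)
        qed
        also have "\<dots> \<le> norm (x, 1::real) * norm (\<bar>a i\<bar> *\<^sub>R w i - u i)" by (rule Cauchy_Schwarz_ineq2)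
        also have "\<dots> \<le> 2 * ((real DIM('a) + 1) * \<eta>)"
          using norm_Pair_1_le[OF x] u i by (intro mult_mono) auto
        finally show "\<bar>s i * (relu (inner (x, 1) (\<bar>a i\<bar> *\<^sub>R w i)) - relu (inner (x, 1) (u i)))\<bar> \<le> 2 * ((real DIM('a) + 1) * \<eta>)" .
      qed
      finally show ?thesis by (simp add: algebra_simps)
    qed
    ultimately show ?thesis by blast
  qed
  have "\<forall>g\<in>p ` F. continuous_on UNIV g" unfolding p_def by (auto intro!: continuous_intros)
  then show ?thesis using finF card net by (intro exI[of _ "p ` F"]) auto
qed

subsection \<open>Excess risk\<close>

lemma truncate_eq: "B \<ge> 0 \<Longrightarrow> truncate B t = max (- B) (min B t)"
  by (auto simp: truncate_def sgn_if)

lemma truncate_bound: "B \<ge> 0 \<Longrightarrow> \<bar>truncate B t\<bar> \<le> B"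
  by (auto simp: truncate_eq)

lemma truncate_lipschitz: "B \<ge> 0 \<Longrightarrow> \<bar>truncate B s - truncate B t\<bar> \<le> \<bar>s - t\<bar>"
  by (auto simp: truncate_eq)

lemma truncate_closer: "\<bar>y\<bar> \<le> B \<Longrightarrow> \<bar>truncate B t - y\<bar> \<le> \<bar>t - y\<bar>"
  by (auto simp: truncate_eq)

lemma truncate_id: "\<bar>t\<bar> \<le> B \<Longrightarrow> truncate B t = t"
  by (simp add: truncate_def)

lemma borel_measurable_truncate [measurable]:
  assumes [measurable]: "f \<in> borel_measurable M" and "B \<ge> 0"
  shows "(\<lambda>x. truncate B (f x)) \<in> borel_measurable M"
  unfolding truncate_eq[OF assms(2)] by measurable

text \<open>\<open>h\<close> may be arbitrary outside the ball and may exceed \<open>B\<close> on a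
  null set; \<open>H\<close> is an everywhere bounded Borel version. The residual is orthogonal to
  bounded functions of \<open>X\<close> because \<open>H(X)\<close> is the conditional expectation
  of \<open>Y\<close>.\<close>

lemma regression_function:
  fixes P :: "('a::euclidean_space \<times> real) measure"
  assumes R: "regression_setting P B h" and B: "B > 0" and h: "continuous_on (cball 0 1) h"
  defines "H \<equiv> (\<lambda>x. truncate B (if x \<in> cball 0 1 then h x else 0))"
  shows "H \<in> borel_measurable borel" "AE z in P. h (fst z) = H (fst z)"
    "\<And>f b. f \<in> borel_measurable borel \<Longrightarrow> (AE z in P. \<bar>f (fst z)\<bar> \<le> b) \<Longrightarrow>
      (\<integral>z. f (fst z) * (snd z - H (fst z)) \<partial>P) = 0"
    "\<And>x. \<bar>H x\<bar> \<le> B"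
proof -
  interpret prob_space P using R by (simp add: regression_setting_def)
  have sP: "sets P = sets borel" using R by (simp add: regression_setting_def)
  have [measurable_cong]: "sets P = sets (borel \<Otimes>\<^sub>M borel)" using sP by (simp flip: borel_prod)
  have spP: "space P = UNIV" using sets_eq_imp_space_eq[OF sP] by simp
  show Hm [measurable]: "H \<in> borel_measurable borel"
    unfolding H_def using B h
    by (intro borel_measurable_truncate borel_measurable_continuous_on_if) auto
  show HB: "\<bar>H x\<bar> \<le> B" for x unfolding H_def using truncate_bound B by simp
  define F where "F = vimage_algebra (space P) (fst :: 'a \<times> real \<Rightarrow> 'a) borel"
  have sub: "subalgebra P F"
  proof -
    have "sets F \<subseteq> sets P" unfolding F_def
      by (rule sets_image_in_sets) simp_all
    then show ?thesis by (simp add: subalgebra_def F_def)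
  qed
  interpret F: finite_measure_subalgebra P F by unfold_locales (rule sub)
  have fstF [measurable]: "fst \<in> borel_measurable F"
    unfolding F_def by (rule measurable_vimage_algebra1) (auto simp: spP)
  have Y: "AE z in P. \<bar>snd z\<bar> \<le> B" and ball: "AE z in P. fst z \<in> cball 0 1"
    and hc: "AE z in P. h (fst z) = real_cond_exp P F snd z"
    using R by (simp_all add: regression_setting_def F_def)
  have intY: "integrable P snd" by (rule integrable_const_bound[where B = B]) (use Y in auto)
  have "AE z in P. real_cond_exp P F snd z \<le> B"
    by (rule F.real_cond_exp_le_c[OF intY]) (use Y in \<open>auto elim!: eventually_mono\<close>)
  moreover have "AE z in P. real_cond_exp P F snd z \<ge> - B"
    by (rule F.real_cond_exp_ge_c[OF intY]) (use Y in \<open>auto elim!: eventually_mono\<close>)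
  ultimately show hH: "AE z in P. h (fst z) = H (fst z)"
    using ball hc
  proof eventually_elim
    case (elim z)
    then have "\<bar>h (fst z)\<bar> \<le> B" by auto
    then show ?case using elim by (simp add: H_def truncate_id)
  qed
  show "(\<integral>z. f (fst z) * (snd z - H (fst z)) \<partial>P) = 0"
    if [measurable]: "f \<in> borel_measurable borel" and b: "AE z in P. \<bar>f (fst z)\<bar> \<le> b" for f b
  proof -
    have i1: "integrable P (\<lambda>z. f (fst z) * snd z)"
    proof (rule integrable_const_bound[where B = "b * B"])
      show "AE z in P. norm (f (fst z) * snd z) \<le> b * B"
        using b Y by eventually_elim (use B in \<open>auto simp: abs_mult intro!: mult_mono\<close>)
    qed measurable
    have i2: "integrable P (\<lambda>z. f (fst z) * H (fst z))"
    proof (rule integrable_const_bound[where B = "b * B"])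
      show "AE z in P. norm (f (fst z) * H (fst z)) \<le> b * B"
        using b by eventually_elim (use B HB in \<open>auto simp: abs_mult intro!: mult_mono\<close>)
    qed measurable
    have "(\<integral>z. f (fst z) * snd z \<partial>P) = (\<integral>z. f (fst z) * real_cond_exp P F snd z \<partial>P)"
      by (rule F.real_cond_exp_intg(2)[symmetric, OF i1]) measurable
    also have "\<dots> = (\<integral>z. f (fst z) * H (fst z) \<partial>P)"
    proof (rule integral_cong_AE)
      show "(\<lambda>z. f (fst z) * real_cond_exp P F snd z) \<in> borel_measurable P"
        using F.real_cond_exp_intg(1)[OF i1] by (intro borel_measurable_integrable) measurable
      show "AE z in P. f (fst z) * real_cond_exp P F snd z = f (fst z) * H (fst z)"
        using hc hH by eventually_elim simp
    qed measurable
    finally show ?thesis using i1 i2 by (simp add: right_diff_distrib)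
  qed
qed

text \<open>When \<open>H\<close> is the regression function, the mean of this excess loss is the
  squared \<open>L2\<close> distance of \<open>g\<close> and \<open>H\<close>.\<close>

definition excess :: "('a \<Rightarrow> real) \<Rightarrow> ('a \<Rightarrow> real) \<Rightarrow> 'a \<times> real \<Rightarrow> real" where
  "excess H g z = (g (fst z) - snd z)\<^sup>2 - (H (fst z) - snd z)\<^sup>2"

lemma sum_excess: "n > 0 \<Longrightarrow> (\<Sum>i<n. excess H g (D i)) = real n * (emp_risk n D g - emp_risk n D H)"
  by (simp add: excess_def emp_risk_def sum_subtractf diff_divide_distrib[symmetric])

text \<open>Chernoff's bound for \<open>\<kappa> * excess\<close>: since the second moment of the excess loss is controlled
  by its mean, the deviation is of the order of the mean itself plus \<open>t / n\<close>.\<close>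

lemma excess_deviation:
  fixes P :: "('a::euclidean_space \<times> real) measure"
  assumes R: "regression_setting P B h" and B: "B > 0" and h: "continuous_on (cball 0 1) h"
  defines "H \<equiv> (\<lambda>x. truncate B (if x \<in> cball 0 1 then h x else 0))"
  assumes [measurable]: "g \<in> borel_measurable borel" and e: "AE z in P. \<bar>g (fst z) - H (fst z)\<bar> \<le> e"
    and l: "\<bar>\<kappa>\<bar> * (e * (e + 4 * B)) \<le> 1"
  defines "\<mu> \<equiv> (\<integral>z. (g (fst z) - H (fst z))\<^sup>2 \<partial>P)"
  shows "measure (sample n P) {D\<in>space (sample n P).
      (\<Sum>i<n. \<kappa> * excess H g (D i)) \<ge> real n * (\<kappa> * \<mu> + (\<kappa> * (e + 4 * B))\<^sup>2 * \<mu>) + t} \<le> exp (- t)"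
proof -
  interpret prob_space P using R by (simp add: regression_setting_def)
  have sP: "sets P = sets borel" using R by (simp add: regression_setting_def)
  have [measurable_cong]: "sets P = sets (borel \<Otimes>\<^sub>M borel)" using sP by (simp flip: borel_prod)
  have Hm [measurable]: "H \<in> borel_measurable borel"
    and HB: "\<And>x. \<bar>H x\<bar> \<le> B"
    and H0: "\<And>f b. f \<in> borel_measurable borel \<Longrightarrow> (AE z in P. \<bar>f (fst z)\<bar> \<le> b) \<Longrightarrow>
      (\<integral>z. f (fst z) * (snd z - H (fst z)) \<partial>P) = 0"
    unfolding H_def by (fact regression_function[OF R B h])+
  have Y: "AE z in P. \<bar>snd z\<bar> \<le> B" using R by (simp add: regression_setting_def)
  have em [measurable]: "excess H g \<in> borel_measurable P" unfolding excess_def[abs_def] by measurable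
  \<comment> \<open>Expansion around \<open>H\<close>: the cross term has mean zero, so the mean is
    \<open>\<mu>\<close>, and the factor \<open>g - H\<close> common to both terms bounds the second
    moment by a multiple of \<open>\<mu>\<close>.\<close>
  have exc: "excess H g z = (g (fst z) - H (fst z))\<^sup>2 - 2 * ((g (fst z) - H (fst z)) * (snd z - H (fst z)))" for z
    by (simp add: excess_def power2_eq_square algebra_simps)
  have e0: "e \<ge> 0"
  proof -
    have "AE z in P. 0 \<le> e" using e by eventually_elim linarith
    then show ?thesis by simp
  qed
  have pt: "AE z in P. \<bar>excess H g z\<bar> \<le> (e + 4 * B) * \<bar>g (fst z) - H (fst z)\<bar> \<and> \<bar>g (fst z) - H (fst z)\<bar> \<le> e"
    using e Y
  proof eventually_elim
    case (elim z)
    have "excess H g z = (g (fst z) - H (fst z)) * ((g (fst z) - H (fst z)) - 2 * (snd z - H (fst z)))"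
      by (simp add: exc power2_eq_square algebra_simps)
    moreover have "\<bar>(g (fst z) - H (fst z)) - 2 * (snd z - H (fst z))\<bar> \<le> e + 4 * B"
      using elim HB[of "fst z"] by (simp add: abs_le_iff)
    ultimately show ?case using elim by (simp add: abs_mult mult.commute mult_left_mono)
  qed
  have i\<mu>: "integrable P (\<lambda>z. (g (fst z) - H (fst z))\<^sup>2)"
  proof (rule integrable_const_bound[where B = "e\<^sup>2"])
    show "AE z in P. norm ((g (fst z) - H (fst z))\<^sup>2) \<le> e\<^sup>2"
      using e by eventually_elim (simp add: abs_le_square_iff[symmetric])
  qed measurable
  have iexc: "integrable P (excess H g)"
  proof (rule integrable_const_bound[where B = "(e + 4 * B) * e"])
    show "AE z in P. norm (excess H g z) \<le> (e + 4 * B) * e"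
      using pt by eventually_elim (use e0 B in \<open>auto intro: order_trans mult_left_mono\<close>)
  qed measurable
  have cross: "(\<integral>z. (g (fst z) - H (fst z)) * (snd z - H (fst z)) \<partial>P) = 0"
    by (rule H0[of "\<lambda>x. g x - H x" e]) (use e in auto)
  have icross: "integrable P (\<lambda>z. (g (fst z) - H (fst z)) * (snd z - H (fst z)))"
  proof -
    have "(\<lambda>z. (g (fst z) - H (fst z)) * (snd z - H (fst z))) = (\<lambda>z. ((g (fst z) - H (fst z))\<^sup>2 - excess H g z) / 2)"
      by (auto simp: exc)
    then show ?thesis using i\<mu> iexc by simp
  qed
  have mean: "(\<integral>z. excess H g z \<partial>P) = \<mu>"
    unfolding exc \<mu>_def using i\<mu> icross cross by simp
  have second: "(\<integral>z. (excess H g z)\<^sup>2 \<partial>P) \<le> (e + 4 * B)\<^sup>2 * \<mu>"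
  proof -
    have "(\<integral>z. (excess H g z)\<^sup>2 \<partial>P) \<le> (\<integral>z. (e + 4 * B)\<^sup>2 * (g (fst z) - H (fst z))\<^sup>2 \<partial>P)"
    proof (rule integral_mono_AE)
      show ae: "AE z in P. (excess H g z)\<^sup>2 \<le> (e + 4 * B)\<^sup>2 * (g (fst z) - H (fst z))\<^sup>2"
        using pt
      proof eventually_elim
        case (elim z)
        then have "\<bar>excess H g z\<bar>\<^sup>2 \<le> ((e + 4 * B) * \<bar>g (fst z) - H (fst z)\<bar>)\<^sup>2" by (intro power_mono) auto
        then show ?case by (simp add: power_mult_distrib)
      qed
      show "integrable P (\<lambda>z. (e + 4 * B)\<^sup>2 * (g (fst z) - H (fst z))\<^sup>2)" using i\<mu> by simp
      then show "integrable P (\<lambda>z. (excess H g z)\<^sup>2)"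
        by (rule Bochner_Integration.integrable_bound) (use ae in auto)
    qed
    then show ?thesis by (simp add: \<mu>_def)
  qed
  have W1: "AE z in P. \<bar>\<kappa> * excess H g z\<bar> \<le> 1"
    using pt
  proof eventually_elim
    case (elim z)
    have "\<bar>\<kappa> * excess H g z\<bar> \<le> \<bar>\<kappa>\<bar> * ((e + 4 * B) * e)"
      unfolding abs_mult using elim e0 B by (intro mult_left_mono order_trans[OF conjunct1[OF elim]]) auto
    also have "\<dots> \<le> 1" using l by (simp add: mult_ac)
    finally show ?case .
  qed
  have "real n * ((\<integral>z. \<kappa> * excess H g z \<partial>P) + (\<integral>z. (\<kappa> * excess H g z)\<^sup>2 \<partial>P)) + t
      \<le> real n * (\<kappa> * \<mu> + (\<kappa> * (e + 4 * B))\<^sup>2 * \<mu>) + t"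
  proof -
    have "(\<integral>z. (\<kappa> * excess H g z)\<^sup>2 \<partial>P) = \<kappa>\<^sup>2 * (\<integral>z. (excess H g z)\<^sup>2 \<partial>P)"
      by (simp add: power_mult_distrib)
    also have "\<dots> \<le> \<kappa>\<^sup>2 * ((e + 4 * B)\<^sup>2 * \<mu>)" using second by (intro mult_left_mono) auto
    finally have "(\<integral>z. (\<kappa> * excess H g z)\<^sup>2 \<partial>P) \<le> (\<kappa> * (e + 4 * B))\<^sup>2 * \<mu>" by (simp add: power_mult_distrib mult.assoc)
    then show ?thesis using mean by (auto intro!: mult_left_mono)
  qed
  then have "measure (sample n P) {D\<in>space (sample n P).
      (\<Sum>i<n. \<kappa> * excess H g (D i)) \<ge> real n * (\<kappa> * \<mu> + (\<kappa> * (e + 4 * B))\<^sup>2 * \<mu>) + t}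
    \<le> measure (sample n P) {D\<in>space (sample n P).
      (\<Sum>i<n. \<kappa> * excess H g (D i)) \<ge> real n * ((\<integral>z. \<kappa> * excess H g z \<partial>P) + (\<integral>z. (\<kappa> * excess H g z)\<^sup>2 \<partial>P)) + t}"
    by (intro finite_measure.finite_measure_mono prob_space.finite_measure prob_space_PiM)
       (auto intro: order_trans prob_space_axioms)
  also have "\<dots> \<le> exp (- t)"
    by (rule chernoff_iid[OF prob_space_axioms _ W1]) measurable
  finally show ?thesis .
qed

text \<open>Lets one sparsification serve two quadratic risks: an increase of the average by at most
  \<open>S\<close> is an increase of the sum by at most \<open>2 * S\<close>. The mixture draws from
  one of the two measures by a fair coin.\<close>

lemma mixture_risk_measure:
  fixes \<rho>1 \<rho>2 :: "('a::euclidean_space \<times> real) measure"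
  assumes 1: "risk_measure \<rho>1" and 2: "risk_measure \<rho>2"
  shows "\<exists>\<rho>. risk_measure \<rho> \<and> (\<forall>f b. f \<in> borel_measurable borel \<and> (\<forall>x\<in>cball 0 1. \<bar>f x\<bar> \<le> b) \<longrightarrow>
    sq_risk \<rho> f = (sq_risk \<rho>1 f + sq_risk \<rho>2 f) / 2)"
proof -
  define N where "N = (\<lambda>b. if b then \<rho>1 else \<rho>2)"
  define \<rho> where "\<rho> = measure_pmf (bernoulli_pmf (1/2)) \<bind> N"
  have s1: "sets \<rho>1 = sets borel" and s2: "sets \<rho>2 = sets borel" using 1 2 by (auto simp: risk_measure_def)
  have p1: "prob_space \<rho>1" and p2: "prob_space \<rho>2" using 1 2 by (auto simp: risk_measure_def)
  have N: "N \<in> measurable (measure_pmf (bernoulli_pmf (1/2))) (subprob_algebra borel)"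
  proof (subst measurable_pmf_measure1, rule Pi_I)
    show "N b \<in> space (subprob_algebra borel)" for b
      using s1 s2 p1 p2 by (cases b) (simp_all add: N_def space_subprob_algebra prob_space_imp_subprob_space)
  qed
  have sets: "sets \<rho> = sets borel" unfolding \<rho>_def by (rule sets_bind[OF sets_kernel[OF N]]) auto
  have nn: "(\<integral>\<^sup>+z. f z \<partial>\<rho>) = ((\<integral>\<^sup>+z. f z \<partial>\<rho>1) + (\<integral>\<^sup>+z. f z \<partial>\<rho>2)) * ennreal (1/2)" if "f \<in> borel_measurable borel" for f
    unfolding \<rho>_def using nn_integral_bind[OF that N] by (simp add: N_def algebra_simps)
  have prob: "prob_space \<rho>" unfolding \<rho>_def
    by (rule measure_pmf.prob_space_bind[OF _ N]) (auto simp: N_def p1 p2)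
  have AE: "AE z in \<rho>. Q z" if "AE z in \<rho>1. Q z" "AE z in \<rho>2. Q z" "{z. Q z} \<in> sets borel" for Q
  proof -
    have m: "{z. \<not> Q z} \<in> sets borel" using sets.compl_sets[OF that(3)] by (simp add: Compl_eq_Diff_UNIV[symmetric] Collect_neg_eq)
    have "emeasure \<rho>1 {z. \<not> Q z} = 0" "emeasure \<rho>2 {z. \<not> Q z} = 0"
      using that(1,2) m s1 s2 sets_eq_imp_space_eq[OF s1] sets_eq_imp_space_eq[OF s2] by (auto simp: AE_iff_measurable[OF _ refl])
    then have "emeasure \<rho> {z. \<not> Q z} = 0"
      using nn[of "indicator {z. \<not> Q z}"] m s1 s2 sets by simp
    then show ?thesis using m sets sets_eq_imp_space_eq[OF sets] by (subst AE_iff_measurable[OF _ refl]) auto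
  qed
  obtain Y1 Y2 where Y: "AE z in \<rho>1. \<bar>snd z\<bar> \<le> Y1" "AE z in \<rho>2. \<bar>snd z\<bar> \<le> Y2" using 1 2 by (auto simp: risk_measure_def)
  have "AE z in \<rho>. fst z \<in> cball 0 1"
    by (rule AE) (use 1 2 in \<open>auto simp: risk_measure_def intro!: borel_closed closed_Collect_le continuous_intros\<close>)
  moreover have "AE z in \<rho>. \<bar>snd z\<bar> \<le> max Y1 Y2"
    by (rule AE) (use Y in \<open>auto elim!: eventually_mono intro!: borel_closed closed_Collect_le continuous_intros\<close>)
  ultimately have rm: "risk_measure \<rho>" using prob sets by (auto simp: risk_measure_def)
  have "sq_risk \<rho> f = (sq_risk \<rho>1 f + sq_risk \<rho>2 f) / 2"
    if f: "f \<in> borel_measurable borel" "\<forall>x\<in>cball 0 1. \<bar>f x\<bar> \<le> b" for f b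
  proof -
    have m: "(\<lambda>z. (f (fst z) - snd z)\<^sup>2) \<in> borel_measurable borel" using f(1) by (simp flip: borel_prod)
    have eq: "ennreal (sq_risk \<sigma> f) = (\<integral>\<^sup>+z. ennreal ((f (fst z) - snd z)\<^sup>2) \<partial>\<sigma>)" if "risk_measure \<sigma>" for \<sigma>
      unfolding sq_risk_def by (rule nn_integral_eq_integral[symmetric]) (use risk_integrable(1)[OF that f(1), of "\<lambda>_. 0" "max b 0"] f(2) in \<open>auto simp: le_max_iff_disj\<close>)
    have pos: "sq_risk \<sigma> f \<ge> 0" for \<sigma> by (simp add: sq_risk_def)
    have "ennreal (sq_risk \<rho> f) = (ennreal (sq_risk \<rho>1 f) + ennreal (sq_risk \<rho>2 f)) * ennreal (1/2)"
      unfolding eq[OF rm] eq[OF 1] eq[OF 2] by (rule nn) (use m in measurable)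
    also have "\<dots> = ennreal ((sq_risk \<rho>1 f + sq_risk \<rho>2 f) * (1/2))"
      using pos by (simp only: ennreal_plus[symmetric] ennreal_mult[symmetric] add_nonneg_nonneg divide_nonneg_nonneg zero_le_numeral zero_le_one)
    finally show ?thesis using pos[of \<rho>] pos[of \<rho>1] pos[of \<rho>2] by (subst (asm) ennreal_inj) auto
  qed
  then show ?thesis using rm by blast
qed

text \<open>The uniform measure on the sample points makes the empirical risk a quadratic risk, to
  which sparsification applies.\<close>

lemma empirical_risk_measure:
  fixes D :: "nat \<Rightarrow> 'a::euclidean_space \<times> real"
  assumes "n > 0" "\<And>i. i < n \<Longrightarrow> fst (D i) \<in> cball 0 1"
  defines "\<rho> \<equiv> distr (measure_pmf (pmf_of_set {..<n})) borel D"
  shows "risk_measure \<rho>" "f \<in> borel_measurable borel \<Longrightarrow> sq_risk \<rho> f = emp_risk n D f"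
proof -
  have ne: "{..<n} \<noteq> {}" using assms(1) by auto
  have set: "set_pmf (pmf_of_set {..<n}) = {..<n}" using ne by (intro set_pmf_of_set) auto
  have Ym: "\<bar>snd (D i)\<bar> \<le> (\<Sum>i<n. \<bar>snd (D i)\<bar>)" if "i < n" for i using that by (intro member_le_sum) auto
  have "prob_space \<rho>" unfolding \<rho>_def by (rule prob_space.prob_space_distr) (auto intro: measure_pmf.prob_space_axioms)
  moreover have "AE z in \<rho>. fst z \<in> cball 0 1"
    unfolding \<rho>_def by (subst AE_distr_iff) (use assms set in \<open>auto simp: AE_measure_pmf_iff intro!: borel_closed closed_Collect_le continuous_intros\<close>)
  moreover have "AE z in \<rho>. \<bar>snd z\<bar> \<le> (\<Sum>i<n. \<bar>snd (D i)\<bar>)"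
    unfolding \<rho>_def by (subst AE_distr_iff) (use Ym set in \<open>auto simp: AE_measure_pmf_iff intro!: borel_closed closed_Collect_le continuous_intros\<close>)
  moreover have "sets \<rho> = sets borel" by (simp add: \<rho>_def)
  ultimately show "risk_measure \<rho>" by (auto simp: risk_measure_def)
  assume "f \<in> borel_measurable borel"
  then have m: "(\<lambda>z. (f (fst z) - snd z)\<^sup>2) \<in> borel_measurable (borel :: ('a \<times> real) measure)" by (simp flip: borel_prod)
  show "sq_risk \<rho> f = emp_risk n D f"
    unfolding sq_risk_def \<rho>_def using ne m
    by (subst integral_distr) (auto simp: integral_pmf_of_set emp_risk_def)
qed

text \<open>Replacing the response by \<open>f X\<close> makes the squared \<open>L2\<close>
  distance to \<open>f\<close> a quadratic risk.\<close>

lemma graph_risk_measure: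
  fixes P :: "('a::euclidean_space \<times> real) measure"
  assumes "regression_setting P B h" and f: "f \<in> borel_measurable borel" "\<And>x. x \<in> cball 0 1 \<Longrightarrow> \<bar>f x\<bar> \<le> b"
  defines "\<rho> \<equiv> distr P borel (\<lambda>z. (fst z, f (fst z)))"
  shows "risk_measure \<rho>" "g \<in> borel_measurable borel \<Longrightarrow> sq_risk \<rho> g = (\<integral>z. (g (fst z) - f (fst z))\<^sup>2 \<partial>P)"
proof -
  have sP: "sets P = sets borel" using assms by (simp add: regression_setting_def)
  have [measurable_cong]: "sets P = sets (borel \<Otimes>\<^sub>M borel)" using sP by (simp flip: borel_prod)
  note [measurable] = f(1)
  have m [measurable]: "(\<lambda>z. (fst z, f (fst z))) \<in> measurable P borel"
    by (subst borel_prod[symmetric]) measurable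
  have ball: "AE z in P. fst z \<in> cball 0 1" using assms by (simp add: regression_setting_def)
  have "prob_space \<rho>" unfolding \<rho>_def using assms m by (intro prob_space.prob_space_distr) (auto simp: regression_setting_def)
  moreover have "AE z in \<rho>. fst z \<in> cball 0 1"
    unfolding \<rho>_def by (subst AE_distr_iff[OF m]) (use ball in \<open>auto intro!: borel_closed closed_Collect_le continuous_intros\<close>)
  moreover have "AE z in \<rho>. \<bar>snd z\<bar> \<le> b"
    unfolding \<rho>_def by (subst AE_distr_iff[OF m]) (use ball f(2) in \<open>auto elim!: eventually_mono intro!: borel_closed closed_Collect_le continuous_intros\<close>)
  moreover have "sets \<rho> = sets borel" by (simp add: \<rho>_def)
  ultimately show "risk_measure \<rho>" by (auto simp: risk_measure_def)
  assume "g \<in> borel_measurable borel"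
  then have m2: "(\<lambda>z. (g (fst z) - snd z)\<^sup>2) \<in> borel_measurable (borel :: ('a \<times> real) measure)" by (simp flip: borel_prod)
  show "sq_risk \<rho> g = (\<integral>z. (g (fst z) - f (fst z))\<^sup>2 \<partial>P)"
    unfolding sq_risk_def \<rho>_def using integral_distr[OF m m2] by simp
qed

lemma emp_risk_truncate_le:
  assumes "\<And>i. i < n \<Longrightarrow> \<bar>snd (D i)\<bar> \<le> B"
  shows "emp_risk n D (\<lambda>x. truncate B (g x)) \<le> emp_risk n D g"
  unfolding emp_risk_def
proof (intro divide_right_mono sum_mono)
  fix i assume "i \<in> {..<n}"
  then have "\<bar>truncate B (g (fst (D i))) - snd (D i)\<bar> \<le> \<bar>g (fst (D i)) - snd (D i)\<bar>"
    using truncate_closer assms by auto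
  then show "(truncate B (g (fst (D i))) - snd (D i))\<^sup>2 \<le> (g (fst (D i)) - snd (D i))\<^sup>2"
    by (simp add: abs_le_square_iff)
qed simp

lemma emp_risk_perturb:
  assumes "n > 0" "\<And>i. i < n \<Longrightarrow> \<bar>snd (D i)\<bar> \<le> B" "\<And>x. \<bar>f x\<bar> \<le> B" "\<And>x. \<bar>g x\<bar> \<le> B"
    and "\<And>i. i < n \<Longrightarrow> \<bar>f (fst (D i)) - g (fst (D i))\<bar> \<le> \<eta>"
  shows "emp_risk n D f \<le> emp_risk n D g + 4 * B * \<eta>"
proof -
  have "(f (fst (D i)) - snd (D i))\<^sup>2 \<le> (g (fst (D i)) - snd (D i))\<^sup>2 + 4 * B * \<eta>" if i: "i < n" for i
  proof -
    let ?f = "f (fst (D i))" and ?g = "g (fst (D i))" and ?y = "snd (D i)"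
    have "(?f - ?y)\<^sup>2 - (?g - ?y)\<^sup>2 = (?f - ?g) * (?f + ?g - 2 * ?y)" by (simp add: power2_eq_square algebra_simps)
    also have "\<dots> \<le> \<bar>?f - ?g\<bar> * \<bar>?f + ?g - 2 * ?y\<bar>" by (metis abs_ge_self abs_mult)
    also have "\<dots> \<le> \<eta> * (4 * B)"
      using assms(2,5)[OF i] assms(3)[of "fst (D i)"] assms(4)[of "fst (D i)"] by (intro mult_mono) linarith+
    finally show ?thesis by (simp add: algebra_simps)
  qed
  then have "(\<Sum>i<n. (f (fst (D i)) - snd (D i))\<^sup>2) \<le> (\<Sum>i<n. (g (fst (D i)) - snd (D i))\<^sup>2 + 4 * B * \<eta>)"
    by (intro sum_mono) auto
  also have "\<dots> = (\<Sum>i<n. (g (fst (D i)) - snd (D i))\<^sup>2) + real n * (4 * B * \<eta>)" by (simp add: sum.distrib)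
  finally have "(\<Sum>i<n. (f (fst (D i)) - snd (D i))\<^sup>2) / n \<le> ((\<Sum>i<n. (g (fst (D i)) - snd (D i))\<^sup>2) + real n * (4 * B * \<eta>)) / n"
    by (rule divide_right_mono) simp
  then show ?thesis using assms(1) by (simp add: emp_risk_def add_divide_distrib)
qed

lemma l2_err_eq:
  fixes P :: "('a::euclidean_space \<times> real) measure"
  assumes R: "regression_setting P B h" and B: "B > 0" and h: "continuous_on (cball 0 1) h"
    and f: "f \<in> borel_measurable borel"
  defines "H \<equiv> (\<lambda>x. truncate B (if x \<in> cball 0 1 then h x else 0))"
  shows "l2_err P f h = (\<integral>z. (f (fst z) - H (fst z))\<^sup>2 \<partial>P)"
proof -
  have sP: "sets P = sets borel" using R by (simp add: regression_setting_def)
  have [measurable_cong]: "sets P = sets (borel \<Otimes>\<^sub>M borel)" using sP by (simp flip: borel_prod)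
  have ball: "AE z in P. fst z \<in> cball 0 1" using R by (simp add: regression_setting_def)
  have Hm [measurable]: "H \<in> borel_measurable borel" and hH: "AE z in P. h (fst z) = H (fst z)"
    unfolding H_def by (fact regression_function[OF R B h])+
  note [measurable] = f
  define h0 where "h0 = (\<lambda>x. if x \<in> cball 0 1 then h x else 0)"
  have h0 [measurable]: "h0 \<in> borel_measurable borel"
    unfolding h0_def using h by (intro borel_measurable_continuous_on_if) auto
  have cb [measurable]: "cball (0::'a) 1 \<in> sets borel" by simp
  have "l2_err P f h = (\<integral>x. indicator (cball 0 1) x *\<^sub>R (f x - h0 x)\<^sup>2 \<partial>distr P borel fst)"
    unfolding l2_err_def set_lebesgue_integral_def by (intro Bochner_Integration.integral_cong) (auto simp: h0_def indicator_def)
  also have "\<dots> = (\<integral>z. indicator (cball 0 1) (fst z) *\<^sub>R (f (fst z) - h0 (fst z))\<^sup>2 \<partial>P)"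
    by (rule integral_distr) measurable
  also have "\<dots> = (\<integral>z. (f (fst z) - H (fst z))\<^sup>2 \<partial>P)"
  proof (rule integral_cong_AE)
    show "AE z in P. indicator (cball 0 1) (fst z) *\<^sub>R (f (fst z) - h0 (fst z))\<^sup>2 = (f (fst z) - H (fst z))\<^sup>2"
      using ball hH by eventually_elim (simp add: h0_def)
  qed measurable
  finally show ?thesis .
qed

lemma nn_class_continuous: "f \<in> nn_class N M \<Longrightarrow> continuous_on A f"
  unfolding nn_class_def by (auto intro!: continuous_intros)

lemma nn_class_measurable: "f \<in> nn_class N M \<Longrightarrow> f \<in> borel_measurable borel"
  by (intro borel_measurable_continuous_onI nn_class_continuous)

lemma nn_class_bound:
  assumes "f \<in> nn_class N M" "x \<in> cball 0 1"
  shows "\<bar>f x\<bar> \<le> 2 * M"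
proof -
  obtain a w where aw: "f = network {..<N} a w" "(\<Sum>i<N. \<bar>a i\<bar> * norm (w i)) \<le> M"
    using assms(1) unfolding nn_class_def network_def[abs_def] by blast
  then show ?thesis using abs_network_le[of "{..<N}" x a w] assms(2) by auto
qed

lemma sets_sum_ge:
  assumes [measurable]: "W \<in> borel_measurable P"
  shows "{D\<in>space (sample n P). (\<Sum>i<n. c * W (D i)) \<ge> (r::real)} \<in> sets (sample n P)"
  by measurable

lemma borel_measurable_excess:
  assumes [measurable]: "H \<in> borel_measurable borel" "g \<in> borel_measurable borel"
    and "sets P = sets (borel :: ('a::euclidean_space \<times> real) measure)"
  shows "excess H g \<in> borel_measurable P"
proof -
  have [measurable_cong]: "sets P = sets (borel \<Otimes>\<^sub>M borel)" using assms(3) by (simp flip: borel_prod)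
  show ?thesis unfolding excess_def[abs_def] by measurable
qed

lemma exists_good_event:
  fixes P :: "('a::euclidean_space \<times> real) measure"
  assumes R: "regression_setting P B h" and B: "B > 0" and h: "continuous_on (cball 0 1) h"
    and G: "finite G" "\<And>g. g \<in> G \<Longrightarrow> continuous_on UNIV g"
    and ht: "continuous_on UNIV ht" "\<And>x. x \<in> cball 0 1 \<Longrightarrow> \<bar>ht x - h x\<bar> \<le> \<epsilon>" "\<epsilon> \<le> A" "A > 0"
    and n: "n > 0"
  defines "H \<equiv> (\<lambda>x. truncate B (if x \<in> cball 0 1 then h x else 0))"
  defines "L \<equiv> 1 + (A + 4 * B)\<^sup>2"
  shows "\<exists>E\<in>sets (sample n P). measure (sample n P) E \<ge> 1 - (real (card G) + 1) * exp (- t) \<and>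
    (\<forall>D\<in>E. D \<in> space (sample n P) \<and> (\<forall>i<n. fst (D i) \<in> cball 0 1 \<and> \<bar>snd (D i)\<bar> \<le> B) \<and>
      (\<forall>g\<in>G. (\<integral>z. (truncate B (g (fst z)) - H (fst z))\<^sup>2 \<partial>P)
         \<le> 2 * (emp_risk n D (\<lambda>x. truncate B (g x)) - emp_risk n D H) + 2 * (72 * B\<^sup>2) * (t / n)) \<and>
      emp_risk n D ht - emp_risk n D H \<le> L * \<epsilon>\<^sup>2 + L * (t / n))"
proof -
  interpret prob_space P using R by (simp add: regression_setting_def)
  have sP: "sets P = sets borel" using R by (simp add: regression_setting_def)
  have [measurable_cong]: "sets P = sets (borel \<Otimes>\<^sub>M borel)" using sP by (simp flip: borel_prod)
  define Q where "Q = sample n P"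
  interpret Q: prob_space Q unfolding Q_def by (rule prob_space_PiM) (rule prob_space_axioms)
  have Hm [measurable]: "H \<in> borel_measurable borel" and hH: "AE z in P. h (fst z) = H (fst z)"
    and HB: "\<And>x. \<bar>H x\<bar> \<le> B"
    unfolding H_def by (fact regression_function[OF R B h])+
  have ball: "AE z in P. fst z \<in> cball 0 1" and Y: "AE z in P. \<bar>snd z\<bar> \<le> B" using R by (simp_all add: regression_setting_def)
  have Gm [measurable]: "g \<in> borel_measurable borel" if "g \<in> G" for g
    using G(2)[OF that] by (rule borel_measurable_continuous_onI)
  have htm [measurable]: "ht \<in> borel_measurable borel" using ht(1) by (rule borel_measurable_continuous_onI)
  define \<mu> where "\<mu> = (\<lambda>g. \<integral>z. (truncate B (g (fst z)) - H (fst z))\<^sup>2 \<partial>P)"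
  \<comment> \<open>For truncated functions \<open>e = 2 * B\<close> and
    \<open>e + 4 * B = 6 * B\<close>, so \<open>(6 * B * \<kappa>)^2 = \<kappa> / 2\<close>: the
    second moment absorbs half of the mean, whence the factor 2 in front of the empirical
    excess.\<close>
  define \<kappa> where "\<kappa> = 1 / (72 * B\<^sup>2)"
  have \<kappa>: "\<kappa> > 0" using B by (simp add: \<kappa>_def)
  define Bad where "Bad = (\<lambda>g. {D\<in>space Q. (\<Sum>i<n. - \<kappa> * excess H (\<lambda>x. truncate B (g x)) (D i))
     \<ge> real n * (- \<kappa> * \<mu> g + (- \<kappa> * (2 * B + 4 * B))\<^sup>2 * \<mu> g) + t})"
  have Bad: "measure Q (Bad g) \<le> exp (- t)" if g: "g \<in> G" for g
    unfolding Bad_def Q_def \<mu>_def H_def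
  proof (rule excess_deviation[OF R B h])
    show "(\<lambda>x. truncate B (g x)) \<in> borel_measurable borel"
      using Gm[OF g] B by (intro borel_measurable_truncate) auto
    show "AE z in P. \<bar>truncate B (g (fst z)) - truncate B (if fst z \<in> cball 0 1 then h (fst z) else 0)\<bar> \<le> 2 * B"
    proof (rule AE_I2)
      fix z
      show "\<bar>truncate B (g (fst z)) - truncate B (if fst z \<in> cball 0 1 then h (fst z) else 0)\<bar> \<le> 2 * B"
        using truncate_bound[of B "g (fst z)"] truncate_bound[of B "if fst z \<in> cball 0 1 then h (fst z) else 0"] B by linarith
    qed
    show "\<bar>- \<kappa>\<bar> * (2 * B * (2 * B + 4 * B)) \<le> 1" using B by (simp add: \<kappa>_def power2_eq_square field_simps)
  qed
  have BadM: "Bad g \<in> sets Q" if "g \<in> G" for g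
    unfolding Bad_def Q_def using Gm[OF that] B
    by (intro sets_sum_ge borel_measurable_excess borel_measurable_truncate Hm sP) auto
  \<comment> \<open>For \<open>ht\<close> only an upper bound of order \<open>\<epsilon>^2\<close>
    is wanted. \<open>L\<close> dominates \<open>\<epsilon> * (\<epsilon> + 4 * B)\<close>, and the
    mean plus second moment together contribute at most \<open>c * L * \<epsilon>^2\<close>.\<close>
  define c where "c = 1 / L"
  have L: "L > 0" by (simp add: L_def add_pos_nonneg)
  have c: "c > 0" using L by (simp add: c_def)
  define \<mu>t where "\<mu>t = (\<integral>z. (ht (fst z) - H (fst z))\<^sup>2 \<partial>P)"
  define Badt where "Badt = {D\<in>space Q. (\<Sum>i<n. c * excess H ht (D i))
     \<ge> real n * (c * \<mu>t + (c * (\<epsilon> + 4 * B))\<^sup>2 * \<mu>t) + t}"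
  have e0: "\<epsilon> \<ge> 0" using ht(2)[of 0] by force
  have hte: "AE z in P. \<bar>ht (fst z) - H (fst z)\<bar> \<le> \<epsilon>"
    using ball hH
  proof eventually_elim
    case (elim z)
    then show ?case using ht(2)[of "fst z"] by simp
  qed
  have Badt: "measure Q Badt \<le> exp (- t)"
    unfolding Badt_def Q_def \<mu>t_def H_def
  proof (rule excess_deviation[OF R B h htm])
    show "AE z in P. \<bar>ht (fst z) - truncate B (if fst z \<in> cball 0 1 then h (fst z) else 0)\<bar> \<le> \<epsilon>"
      using hte by (simp add: H_def)
    have "\<epsilon> * (\<epsilon> + 4 * B) \<le> (A + 4 * B) * (A + 4 * B)" using e0 ht(3) B by (intro mult_mono) auto
    then have "\<epsilon> * (\<epsilon> + 4 * B) \<le> L" by (simp add: L_def power2_eq_square)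
    then show "\<bar>c\<bar> * (\<epsilon> * (\<epsilon> + 4 * B)) \<le> 1" using L by (simp add: c_def field_simps)
  qed
  have BadtM: "Badt \<in> sets Q"
    unfolding Badt_def Q_def by (intro sets_sum_ge borel_measurable_excess Hm htm sP)
  define Spt where "Spt = {D\<in>space Q. \<forall>i<n. fst (D i) \<in> cball 0 1 \<and> \<bar>snd (D i)\<bar> \<le> B}"
  have SptM: "Spt \<in> sets Q"
  proof -
    define Z where "Z = {z::'a \<times> real. fst z \<in> cball 0 1 \<and> \<bar>snd z\<bar> \<le> B}"
    have "closed Z" unfolding Z_def by (auto intro!: closed_Collect_conj closed_Collect_le continuous_intros)
    then have Z: "Z \<in> sets P" using sP by (simp add: borel_closed)
    have "Spt = PiE {..<n} (\<lambda>_. Z)"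
      using sets.sets_into_space[OF Z] by (auto simp: Spt_def Q_def space_PiM Z_def PiE_def Pi_def extensional_def)
    then show ?thesis unfolding Q_def using Z by (simp add: sets_PiM_I_finite)
  qed
  have Spt1: "measure Q Spt = 1"
  proof -
    have "AE D in Q. \<forall>i\<in>{..<n}. fst (D i) \<in> cball 0 1 \<and> \<bar>snd (D i)\<bar> \<le> B"
    proof (rule AE_finite_allI)
      fix i assume i: "i \<in> {..<n}"
      have "AE z in P. fst z \<in> cball 0 1 \<and> \<bar>snd z\<bar> \<le> B" using ball Y by eventually_elim simp
      then show "AE D in Q. fst (D i) \<in> cball 0 1 \<and> \<bar>snd (D i)\<bar> \<le> B"
        unfolding Q_def using i by (intro AE_PiM_component) (auto intro: prob_space_axioms)
    qed simp
    then have "AE D in Q. D \<in> Spt" using AE_space by eventually_elim (auto simp: Spt_def)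
    then show ?thesis using SptM by (simp add: Q.prob_eq_1)
  qed
  \<comment> \<open>The event involves only the finite net and the fixed approximant, so it is
    measurable in whatever way the estimator depends on the sample.\<close>
  define E where "E = Spt - ((\<Union>g\<in>G. Bad g) \<union> Badt)"
  have UM: "(\<Union>g\<in>G. Bad g) \<union> Badt \<in> sets Q"
    using BadM BadtM by (intro sets.Un sets.finite_UN G(1)) auto
  have EM: "E \<in> sets Q" unfolding E_def using SptM UM by auto
  have "measure Q ((\<Union>g\<in>G. Bad g) \<union> Badt) \<le> measure Q (\<Union>g\<in>G. Bad g) + measure Q Badt"
    using G(1) BadM BadtM by (intro measure_subadditive) (auto simp: Q.emeasure_eq_measure)
  also have "measure Q (\<Union>g\<in>G. Bad g) \<le> (\<Sum>g\<in>G. measure Q (Bad g))"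
    using G(1) BadM by (intro Q.finite_measure_subadditive_finite) auto
  also have "\<dots> \<le> (\<Sum>g\<in>G. exp (- t))" by (rule sum_mono) (rule Bad)
  also have "\<dots> = real (card G) * exp (- t)" by simp
  finally have Ub: "measure Q ((\<Union>g\<in>G. Bad g) \<union> Badt) \<le> (real (card G) + 1) * exp (- t)"
    using Badt by (simp add: algebra_simps)
  have "Spt \<subseteq> E \<union> ((\<Union>g\<in>G. Bad g) \<union> Badt)" by (auto simp: E_def)
  then have "1 \<le> measure Q (E \<union> ((\<Union>g\<in>G. Bad g) \<union> Badt))"
    using Q.finite_measure_mono[of Spt "E \<union> ((\<Union>g\<in>G. Bad g) \<union> Badt)"] EM UM Spt1 by auto
  also have "\<dots> \<le> measure Q E + measure Q ((\<Union>g\<in>G. Bad g) \<union> Badt)"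
    using EM UM by (intro measure_subadditive) (auto simp: Q.emeasure_eq_measure)
  finally have Eprob: "measure Q E \<ge> 1 - (real (card G) + 1) * exp (- t)" using Ub by linarith
  have D1: "\<mu> g \<le> 2 * (emp_risk n D (\<lambda>x. truncate B (g x)) - emp_risk n D H) + 2 * (72 * B\<^sup>2) * (t / n)"
    if "D \<in> E" "g \<in> G" for D g
  proof -
    have "D \<notin> Bad g" "D \<in> space Q" using that by (auto simp: E_def Spt_def)
    then have lt: "(\<Sum>i<n. - \<kappa> * excess H (\<lambda>x. truncate B (g x)) (D i)) < real n * (- \<kappa> * \<mu> g + (- \<kappa> * (2 * B + 4 * B))\<^sup>2 * \<mu> g) + t"
      by (auto simp: Bad_def)
    have "(\<Sum>i<n. - \<kappa> * excess H (\<lambda>x. truncate B (g x)) (D i)) = - \<kappa> * (\<Sum>i<n. excess H (\<lambda>x. truncate B (g x)) (D i))"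
      by (rule sum_distrib_left[symmetric])
    also have "\<dots> = - \<kappa> * (real n * (emp_risk n D (\<lambda>x. truncate B (g x)) - emp_risk n D H))"
      unfolding sum_excess[OF n] ..
    finally have l: "(\<Sum>i<n. - \<kappa> * excess H (\<lambda>x. truncate B (g x)) (D i)) = real n * (- \<kappa> * (emp_risk n D (\<lambda>x. truncate B (g x)) - emp_risk n D H))"
      by simp
    have "(- \<kappa> * (2 * B + 4 * B))\<^sup>2 = \<kappa> / 2" using B by (simp add: \<kappa>_def power2_eq_square field_simps)
    then have r: "real n * (- \<kappa> * \<mu> g + (- \<kappa> * (2 * B + 4 * B))\<^sup>2 * \<mu> g) + t = real n * (\<kappa> * (- \<mu> g / 2 + t / (n * \<kappa>)))"
      using n \<kappa> by (simp add: field_simps)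
    have "- \<kappa> * (emp_risk n D (\<lambda>x. truncate B (g x)) - emp_risk n D H) < \<kappa> * (- \<mu> g / 2 + t / (n * \<kappa>))"
    proof -
      have "real n * (- \<kappa> * (emp_risk n D (\<lambda>x. truncate B (g x)) - emp_risk n D H)) < real n * (\<kappa> * (- \<mu> g / 2 + t / (n * \<kappa>)))"
        using lt unfolding l r .
      then show ?thesis using n by (simp only: mult_less_cancel_left_pos of_nat_0_less_iff)
    qed
    then have "\<kappa> * (- (emp_risk n D (\<lambda>x. truncate B (g x)) - emp_risk n D H)) < \<kappa> * (- \<mu> g / 2 + t / (n * \<kappa>))"
      by (simp only: mult_minus_left mult_minus_right)
    then have fin: "- (emp_risk n D (\<lambda>x. truncate B (g x)) - emp_risk n D H) < - \<mu> g / 2 + t / (n * \<kappa>)"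
      using \<kappa> by (rule mult_less_cancel_left_pos[THEN iffD1, rotated])
    have "\<mu> g \<le> 2 * (emp_risk n D (\<lambda>x. truncate B (g x)) - emp_risk n D H) + 2 * (t / (n * \<kappa>))"
    proof -
      have "m \<le> 2 * X + 2 * u" if "- X < - m / 2 + u" for X m u :: real using that by linarith
      from this[OF fin] show ?thesis .
    qed
    also have "t / (n * \<kappa>) = (72 * B\<^sup>2) * (t / n)" using B by (simp add: \<kappa>_def)
    finally show ?thesis by simp
  qed
  have D2: "emp_risk n D ht - emp_risk n D H \<le> L * \<epsilon>\<^sup>2 + L * (t / n)" if "D \<in> E" for D
  proof -
    have "D \<notin> Badt" "D \<in> space Q" using that by (auto simp: E_def Spt_def)
    then have lt: "(\<Sum>i<n. c * excess H ht (D i)) < real n * (c * \<mu>t + (c * (\<epsilon> + 4 * B))\<^sup>2 * \<mu>t) + t" by (auto simp: Badt_def)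
    have l: "(\<Sum>i<n. c * excess H ht (D i)) = real n * (c * (emp_risk n D ht - emp_risk n D H))"
      using sum_excess[OF n, of H ht D] by (simp add: sum_distrib_left[symmetric])
    have \<mu>t: "\<mu>t \<le> \<epsilon>\<^sup>2" "\<mu>t \<ge> 0"
    proof -
      have ae: "AE z in P. (ht (fst z) - H (fst z))\<^sup>2 \<le> \<epsilon>\<^sup>2"
        using hte by eventually_elim (metis power2_abs power_mono abs_ge_zero)
      have "\<mu>t \<le> (\<integral>z. \<epsilon>\<^sup>2 \<partial>P)" unfolding \<mu>t_def
        by (intro integral_mono_AE integrable_const_bound[where B = "\<epsilon>\<^sup>2"]) (use ae in auto)
      then show "\<mu>t \<le> \<epsilon>\<^sup>2" by (simp add: prob_space)
      show "\<mu>t \<ge> 0" unfolding \<mu>t_def by simp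
    qed
    have cc: "c + (c * (\<epsilon> + 4 * B))\<^sup>2 \<le> c * L"
    proof -
      have "(\<epsilon> + 4 * B)\<^sup>2 \<le> (A + 4 * B)\<^sup>2" using e0 ht(3) B by (intro power_mono) auto
      moreover have "c \<le> 1" by (simp add: c_def L_def divide_le_eq add_pos_nonneg)
      ultimately have "c * (\<epsilon> + 4 * B)\<^sup>2 \<le> 1 * (A + 4 * B)\<^sup>2" using c by (intro mult_mono) auto
      then have "c * (c * (\<epsilon> + 4 * B)\<^sup>2) \<le> c * (1 * (A + 4 * B)\<^sup>2)" using c by (intro mult_left_mono) auto
      then show ?thesis by (simp add: L_def power_mult_distrib power2_eq_square algebra_simps)
    qed
    have "(c + (c * (\<epsilon> + 4 * B))\<^sup>2) * \<mu>t \<le> (c * L) * \<epsilon>\<^sup>2"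
      using cc \<mu>t c L by (intro mult_mono) auto
    then have "real n * ((c + (c * (\<epsilon> + 4 * B))\<^sup>2) * \<mu>t) \<le> real n * ((c * L) * \<epsilon>\<^sup>2)" by (rule mult_left_mono) simp
    moreover have "real n * (c * (emp_risk n D ht - emp_risk n D H)) < real n * ((c + (c * (\<epsilon> + 4 * B))\<^sup>2) * \<mu>t) + t"
      using lt unfolding l distrib_right by simp
    ultimately have "real n * (c * (emp_risk n D ht - emp_risk n D H)) \<le> real n * ((c * L) * \<epsilon>\<^sup>2) + t" by linarith
    also have "\<dots> = real n * (c * (L * \<epsilon>\<^sup>2 + L * (t / n)))"
      using n L by (simp add: c_def field_simps)
    finally show ?thesis using n c by simp
  qed
  have D3: "D \<in> space Q \<and> (\<forall>i<n. fst (D i) \<in> cball 0 1 \<and> \<bar>snd (D i)\<bar> \<le> B)" if "D \<in> E" for D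
  proof -
    have "D \<in> Spt" using that unfolding E_def by (rule DiffD1)
    then show ?thesis unfolding Spt_def by (rule CollectD)
  qed
  have "\<forall>D\<in>E. D \<in> space Q \<and> (\<forall>i<n. fst (D i) \<in> cball 0 1 \<and> \<bar>snd (D i)\<bar> \<le> B) \<and>
      (\<forall>g\<in>G. \<mu> g \<le> 2 * (emp_risk n D (\<lambda>x. truncate B (g x)) - emp_risk n D H) + 2 * (72 * B\<^sup>2) * (t / n)) \<and>
      emp_risk n D ht - emp_risk n D H \<le> L * \<epsilon>\<^sup>2 + L * (t / n)"
  proof (rule ballI)
    fix D assume D: "D \<in> E"
    have "\<forall>g\<in>G. \<mu> g \<le> 2 * (emp_risk n D (\<lambda>x. truncate B (g x)) - emp_risk n D H) + 2 * (72 * B\<^sup>2) * (t / n)"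
      using D1[OF D] by (rule ballI)
    then show "D \<in> space Q \<and> (\<forall>i<n. fst (D i) \<in> cball 0 1 \<and> \<bar>snd (D i)\<bar> \<le> B) \<and>
      (\<forall>g\<in>G. \<mu> g \<le> 2 * (emp_risk n D (\<lambda>x. truncate B (g x)) - emp_risk n D H) + 2 * (72 * B\<^sup>2) * (t / n)) \<and>
      emp_risk n D ht - emp_risk n D H \<le> L * \<epsilon>\<^sup>2 + L * (t / n)"
      using D3[OF D, THEN conjunct1] D3[OF D, THEN conjunct2] D2[OF D] by (intro conjI)
  qed
  note D4 = this
  show ?thesis
  proof (rule bexI[where x = E], rule conjI)
    show "E \<in> sets (sample n P)" using EM unfolding Q_def .
    show "1 - (real (card G) + 1) * exp (- t) \<le> measure (sample n P) E" using Eprob unfolding Q_def .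
    show "\<forall>D\<in>E. D \<in> space (sample n P) \<and> (\<forall>i<n. fst (D i) \<in> cball 0 1 \<and> \<bar>snd (D i)\<bar> \<le> B) \<and>
      (\<forall>g\<in>G. (\<integral>z. (truncate B (g (fst z)) - H (fst z))\<^sup>2 \<partial>P)
         \<le> 2 * (emp_risk n D (\<lambda>x. truncate B (g x)) - emp_risk n D H) + 2 * (72 * B\<^sup>2) * (t / n)) \<and>
      emp_risk n D ht - emp_risk n D H \<le> L * \<epsilon>\<^sup>2 + L * (t / n)"
      using D4 unfolding Q_def \<mu>_def .
  qed
qed

subsection \<open>Empirical risk minimisation\<close>

text \<open>The deterministic part of the argument, on one sample. The minimiser is compared with a
  sparse \<open>g1\<close>, and \<open>g1\<close> with a net element \<open>g2\<close>, for which
  the deviation bound is available; three terms in the triangle inequality give the factor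
  3.\<close>

lemma erm_error_bound:
  fixes P :: "('a::euclidean_space \<times> real) measure"
  assumes R: "regression_setting P B h" and B: "B > 0" and h: "continuous_on (cball 0 1) h"
    and sp: "\<And>(\<rho> :: ('a \<times> real) measure) N' f. risk_measure \<rho> \<Longrightarrow> f \<in> nn_class N' M \<Longrightarrow>
       \<exists>g\<in>nn_class N1 M. sq_risk \<rho> g \<le> sq_risk \<rho> f + S"
    and n: "n > 0" and D: "\<And>i. i < n \<Longrightarrow> fst (D i) \<in> cball 0 1 \<and> \<bar>snd (D i)\<bar> \<le> B"
    and fh: "fh \<in> nn_class N M" "\<And>g. g \<in> nn_class N M \<Longrightarrow> emp_risk n D fh \<le> emp_risk n D g"
    and N1: "N1 \<le> N" and ht: "ht \<in> nn_class N' M" and M: "M \<ge> 0"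
    and net: "\<And>f. f \<in> nn_class N1 M \<Longrightarrow> \<exists>g\<in>G. \<forall>x\<in>cball 0 1. \<bar>f x - g x\<bar> \<le> \<eta>"
    and G: "\<And>g. g \<in> G \<Longrightarrow> continuous_on UNIV g"
  defines "H \<equiv> (\<lambda>x. truncate B (if x \<in> cball 0 1 then h x else 0))"
  assumes dev: "\<And>g. g \<in> G \<Longrightarrow> (\<integral>z. (truncate B (g (fst z)) - H (fst z))\<^sup>2 \<partial>P)
         \<le> 2 * (emp_risk n D (\<lambda>x. truncate B (g x)) - emp_risk n D H) + \<tau>1"
    and devt: "emp_risk n D ht - emp_risk n D H \<le> \<tau>2"
  shows "l2_err P (\<lambda>x. truncate B (fh x)) h \<le> 24 * S + 3 * \<eta>\<^sup>2 + 24 * B * \<eta> + 6 * \<tau>2 + 3 * \<tau>1"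
proof -
  interpret prob_space P using R by (simp add: regression_setting_def)
  have sP: "sets P = sets borel" using R by (simp add: regression_setting_def)
  have [measurable_cong]: "sets P = sets (borel \<Otimes>\<^sub>M borel)" using sP by (simp flip: borel_prod)
  have Hm [measurable]: "H \<in> borel_measurable borel" and HB: "\<And>x. \<bar>H x\<bar> \<le> B"
    unfolding H_def by (fact regression_function[OF R B h])+
  have ball: "AE z in P. fst z \<in> cball 0 1" using R by (simp add: regression_setting_def)
  define \<rho>1 where "\<rho>1 = distr (measure_pmf (pmf_of_set {..<n})) borel D"
  have \<rho>1: "risk_measure \<rho>1" "\<And>f. f \<in> borel_measurable borel \<Longrightarrow> sq_risk \<rho>1 f = emp_risk n D f"
    unfolding \<rho>1_def by (rule empirical_risk_measure; use n D in auto)+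
  define \<rho>2 where "\<rho>2 = distr P borel (\<lambda>z. (fst z, fh (fst z)))"
  have fhb: "\<And>x. x \<in> cball 0 1 \<Longrightarrow> \<bar>fh x\<bar> \<le> 2 * M" using nn_class_bound[OF fh(1)] by simp
  have \<rho>2: "risk_measure \<rho>2" "\<And>g. g \<in> borel_measurable borel \<Longrightarrow> sq_risk \<rho>2 g = (\<integral>z. (g (fst z) - fh (fst z))\<^sup>2 \<partial>P)"
    unfolding \<rho>2_def by (rule graph_risk_measure[OF R nn_class_measurable[OF fh(1)] fhb]; simp)+
  obtain \<rho> where \<rho>: "risk_measure \<rho>"
    "\<And>f b. f \<in> borel_measurable borel \<Longrightarrow> \<forall>x\<in>cball 0 1. \<bar>f x\<bar> \<le> b \<Longrightarrow> sq_risk \<rho> f = (sq_risk \<rho>1 f + sq_risk \<rho>2 f) / 2"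
    using mixture_risk_measure[OF \<rho>1(1) \<rho>2(1)] by metis
  have mix: "sq_risk \<rho> f = (emp_risk n D f + (\<integral>z. (f (fst z) - fh (fst z))\<^sup>2 \<partial>P)) / 2" if "f \<in> nn_class K M" for f K
    using \<rho>(2)[of f "2 * M"] nn_class_bound[OF that] \<rho>1(2) \<rho>2(2) nn_class_measurable[OF that] by simp
  \<comment> \<open>Sparsified for the average of both risks. The second risk of \<open>fh\<close>
    is zero and \<open>g1\<close> competes in the minimisation, so \<open>fit\<close> splits into
    closeness in empirical risk and closeness in \<open>L2\<close>.\<close>
  obtain g1 where g1: "g1 \<in> nn_class N1 M" "sq_risk \<rho> g1 \<le> sq_risk \<rho> fh + S" using sp[OF \<rho>(1) fh(1)] by blast
  have g1N: "g1 \<in> nn_class N M" using g1(1) nn_class_mono[OF N1 order_refl, of M] by blast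
  have fit: "emp_risk n D g1 + (\<integral>z. (g1 (fst z) - fh (fst z))\<^sup>2 \<partial>P) \<le> emp_risk n D fh + 2 * S"
    using g1(2) unfolding mix[OF g1(1)] mix[OF fh(1)] by simp
  have pos: "(\<integral>z. (g1 (fst z) - fh (fst z))\<^sup>2 \<partial>P) \<ge> 0" by simp
  have e1: "emp_risk n D g1 \<le> emp_risk n D fh + 2 * S" using fit pos by linarith
  have d1: "(\<integral>z. (g1 (fst z) - fh (fst z))\<^sup>2 \<partial>P) \<le> 2 * S" using fit fh(2)[OF g1N] by linarith
  \<comment> \<open>\<open>ht\<close> may have more than \<open>N\<close> neurons and then does not
    compete with \<open>fh\<close>; its sparsification for the empirical risk does.\<close>
  obtain g0 where g0: "g0 \<in> nn_class N1 M" "sq_risk \<rho>1 g0 \<le> sq_risk \<rho>1 ht + S" using sp[OF \<rho>1(1) ht] by blast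
  have "g0 \<in> nn_class N M" using g0(1) nn_class_mono[OF N1 order_refl, of M] by blast
  then have e0: "emp_risk n D fh \<le> emp_risk n D ht + S"
    using fh(2)[of g0] g0(2) \<rho>1(2) nn_class_measurable[OF g0(1)] nn_class_measurable[OF ht] by simp
  obtain g2 where g2: "g2 \<in> G" "\<And>x. x \<in> cball 0 1 \<Longrightarrow> \<bar>g1 x - g2 x\<bar> \<le> \<eta>" using net[OF g1(1)] by blast
  have g2m [measurable]: "g2 \<in> borel_measurable borel" using G[OF g2(1)] by (rule borel_measurable_continuous_onI)
  have m1 [measurable]: "g1 \<in> borel_measurable borel" "fh \<in> borel_measurable borel"
    using nn_class_measurable g1(1) fh(1) by auto
  define T where "T = truncate B"
  have Tm [measurable]: "(\<lambda>x. T (f x)) \<in> borel_measurable borel" if "f \<in> borel_measurable borel" for f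
    unfolding T_def using that B by (intro borel_measurable_truncate) auto
  have TB: "\<bar>T x\<bar> \<le> B" for x unfolding T_def using truncate_bound B by simp
  have TL: "\<bar>T x - T y\<bar> \<le> \<bar>x - y\<bar>" for x y unfolding T_def using truncate_lipschitz B by simp
  have e2: "emp_risk n D (\<lambda>x. T (g2 x)) \<le> emp_risk n D g1 + 4 * B * \<eta>"
  proof -
    have "emp_risk n D (\<lambda>x. T (g2 x)) \<le> emp_risk n D (\<lambda>x. T (g1 x)) + 4 * B * \<eta>"
    proof (rule emp_risk_perturb[OF n])
      fix i assume "i < n"
      then show "\<bar>T (g2 (fst (D i))) - T (g1 (fst (D i)))\<bar> \<le> \<eta>"
        using TL[of "g2 (fst (D i))" "g1 (fst (D i))"] g2(2)[of "fst (D i)"] D[of i] by (simp add: abs_minus_commute)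
    qed (use D TB in auto)
    also have "emp_risk n D (\<lambda>x. T (g1 x)) \<le> emp_risk n D g1"
      unfolding T_def by (rule emp_risk_truncate_le) (use D in auto)
    finally show ?thesis by simp
  qed
  have d2: "(\<integral>z. (T (g2 (fst z)) - H (fst z))\<^sup>2 \<partial>P) \<le> 2 * (\<tau>2 + 3 * S + 4 * B * \<eta>) + \<tau>1"
    using dev[OF g2(1)] e2 e1 e0 devt unfolding T_def[symmetric] by argo
  have mm [measurable]: "(\<lambda>x. T (fh x)) \<in> borel_measurable borel" "(\<lambda>x. T (g1 x)) \<in> borel_measurable borel"
    "(\<lambda>x. T (g2 x)) \<in> borel_measurable borel" by (intro Tm; simp)+
  have bnd: "integrable P (\<lambda>z. (p (fst z) - q (fst z))\<^sup>2)"
    if [measurable]: "p \<in> borel_measurable borel" "q \<in> borel_measurable borel" and "\<And>x. \<bar>p x\<bar> \<le> B" "\<And>x. \<bar>q x\<bar> \<le> B" for p q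
  proof (rule integrable_const_bound[where B = "(2 * B)\<^sup>2"])
    have "\<bar>p x - q x\<bar>\<^sup>2 \<le> (2 * B)\<^sup>2" for x
    proof (rule power_mono)
      show "\<bar>p x - q x\<bar> \<le> 2 * B" using that(3)[of x] that(4)[of x] by linarith
    qed simp
    then show "AE z in P. norm ((p (fst z) - q (fst z))\<^sup>2) \<le> (2 * B)\<^sup>2" by simp
  qed measurable
  have i1: "integrable P (\<lambda>z. (T (fh (fst z)) - T (g1 (fst z)))\<^sup>2)" by (rule bnd) (auto simp: TB)
  have i2: "integrable P (\<lambda>z. (T (g1 (fst z)) - T (g2 (fst z)))\<^sup>2)" by (rule bnd) (auto simp: TB)
  have i3: "integrable P (\<lambda>z. (T (g2 (fst z)) - H (fst z))\<^sup>2)" by (rule bnd) (auto simp: TB HB)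
  have i4: "integrable P (\<lambda>z. (T (fh (fst z)) - H (fst z))\<^sup>2)" by (rule bnd) (auto simp: TB HB)
  have c1: "(\<integral>z. (T (fh (fst z)) - T (g1 (fst z)))\<^sup>2 \<partial>P) \<le> 2 * S"
  proof -
    have "(\<integral>z. (T (fh (fst z)) - T (g1 (fst z)))\<^sup>2 \<partial>P) \<le> (\<integral>z. (g1 (fst z) - fh (fst z))\<^sup>2 \<partial>P)"
    proof (rule integral_mono[OF i1])
      show "integrable P (\<lambda>z. (g1 (fst z) - fh (fst z))\<^sup>2)"
      proof (rule integrable_const_bound[where B = "(4 * M)\<^sup>2"])
        show "AE z in P. norm ((g1 (fst z) - fh (fst z))\<^sup>2) \<le> (4 * M)\<^sup>2"
          using ball
        proof eventually_elim
          case (elim z)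
          have "\<bar>g1 (fst z) - fh (fst z)\<bar> \<le> 4 * M" using nn_class_bound[OF g1(1) elim] fhb[OF elim] by linarith
          then have "\<bar>g1 (fst z) - fh (fst z)\<bar>\<^sup>2 \<le> (4 * M)\<^sup>2" by (rule power_mono) simp
          then show ?case by simp
        qed
      qed measurable
      fix z
      have "\<bar>T (fh (fst z)) - T (g1 (fst z))\<bar>\<^sup>2 \<le> \<bar>fh (fst z) - g1 (fst z)\<bar>\<^sup>2" by (rule power_mono[OF TL]) simp
      then show "(T (fh (fst z)) - T (g1 (fst z)))\<^sup>2 \<le> (g1 (fst z) - fh (fst z))\<^sup>2" by (simp add: power2_commute)
    qed
    then show ?thesis using d1 by linarith
  qed
  have c2: "(\<integral>z. (T (g1 (fst z)) - T (g2 (fst z)))\<^sup>2 \<partial>P) \<le> \<eta>\<^sup>2"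
  proof -
    have "(\<integral>z. (T (g1 (fst z)) - T (g2 (fst z)))\<^sup>2 \<partial>P) \<le> (\<integral>z. \<eta>\<^sup>2 \<partial>P)"
    proof (rule integral_mono_AE[OF i2])
      show "AE z in P. (T (g1 (fst z)) - T (g2 (fst z)))\<^sup>2 \<le> \<eta>\<^sup>2"
        using ball
      proof eventually_elim
        case (elim z)
        have "\<bar>T (g1 (fst z)) - T (g2 (fst z))\<bar> \<le> \<eta>" using TL g2(2)[OF elim] by (rule order_trans)
        then have "\<bar>T (g1 (fst z)) - T (g2 (fst z))\<bar>\<^sup>2 \<le> \<eta>\<^sup>2" by (rule power_mono) simp
        then show ?case by simp
      qed
    qed simp
    then show ?thesis by (simp add: prob_space)
  qed
  have sq3: "(a + b + c)\<^sup>2 \<le> 3 * a\<^sup>2 + 3 * b\<^sup>2 + 3 * c\<^sup>2" for a b c :: real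
  proof -
    have "3 * a\<^sup>2 + 3 * b\<^sup>2 + 3 * c\<^sup>2 - (a + b + c)\<^sup>2 = (a - b)\<^sup>2 + (b - c)\<^sup>2 + (a - c)\<^sup>2"
      by (simp add: power2_eq_square algebra_simps)
    then show ?thesis by (smt (verit) zero_le_power2)
  qed
  have "l2_err P (\<lambda>x. truncate B (fh x)) h = (\<integral>z. (T (fh (fst z)) - H (fst z))\<^sup>2 \<partial>P)"
    using l2_err_eq[OF R B h, of "\<lambda>x. T (fh x)"] mm unfolding T_def H_def by simp
  also have "\<dots> \<le> (\<integral>z. 3 * (T (fh (fst z)) - T (g1 (fst z)))\<^sup>2 + 3 * (T (g1 (fst z)) - T (g2 (fst z)))\<^sup>2 + 3 * (T (g2 (fst z)) - H (fst z))\<^sup>2 \<partial>P)"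
  proof (rule integral_mono[OF i4])
    show "integrable P (\<lambda>z. 3 * (T (fh (fst z)) - T (g1 (fst z)))\<^sup>2 + 3 * (T (g1 (fst z)) - T (g2 (fst z)))\<^sup>2 + 3 * (T (g2 (fst z)) - H (fst z))\<^sup>2)"
      using i1 i2 i3 by (intro Bochner_Integration.integrable_add integrable_mult_right)
    fix z
    show "(T (fh (fst z)) - H (fst z))\<^sup>2 \<le> 3 * (T (fh (fst z)) - T (g1 (fst z)))\<^sup>2 + 3 * (T (g1 (fst z)) - T (g2 (fst z)))\<^sup>2 + 3 * (T (g2 (fst z)) - H (fst z))\<^sup>2"
      using sq3[of "T (fh (fst z)) - T (g1 (fst z))" "T (g1 (fst z)) - T (g2 (fst z))" "T (g2 (fst z)) - H (fst z)"] by simp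
  qed
  also have "\<dots> = 3 * (\<integral>z. (T (fh (fst z)) - T (g1 (fst z)))\<^sup>2 \<partial>P) + 3 * (\<integral>z. (T (g1 (fst z)) - T (g2 (fst z)))\<^sup>2 \<partial>P) + 3 * (\<integral>z. (T (g2 (fst z)) - H (fst z))\<^sup>2 \<partial>P)"
    using i1 i2 i3 by (simp add: Bochner_Integration.integrable_add)
  also have "\<dots> \<le> 3 * (2 * S) + 3 * \<eta>\<^sup>2 + 3 * (2 * (\<tau>2 + 3 * S + 4 * B * \<eta>) + \<tau>1)"
    using c1 c2 d2 by (intro add_mono mult_left_mono) auto
  also have "\<dots> = 24 * S + 3 * \<eta>\<^sup>2 + 24 * B * \<eta> + 6 * \<tau>2 + 3 * \<tau>1" by (simp add: algebra_simps)
  finally show ?thesis .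
qed

lemma l2_err_trivial:
  fixes P :: "('a::euclidean_space \<times> real) measure"
  assumes R: "regression_setting P B h" and B: "B > 0" and h: "continuous_on (cball 0 1) h"
    and f: "f \<in> borel_measurable borel"
  shows "l2_err P (\<lambda>x. truncate B (f x)) h \<le> 4 * B\<^sup>2"
proof -
  interpret prob_space P using R by (simp add: regression_setting_def)
  have [measurable_cong]: "sets P = sets (borel \<Otimes>\<^sub>M borel)" using R by (simp add: regression_setting_def flip: borel_prod)
  define H where "H = (\<lambda>x. truncate B (if x \<in> cball 0 1 then h x else 0))"
  have Hm [measurable]: "H \<in> borel_measurable borel" and HB: "\<And>x. \<bar>H x\<bar> \<le> B"
    unfolding H_def by (fact regression_function[OF R B h])+
  have fm [measurable]: "(\<lambda>x. truncate B (f x)) \<in> borel_measurable borel" using f B by (intro borel_measurable_truncate) auto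
  have le: "(truncate B (f x) - H x)\<^sup>2 \<le> (2 * B)\<^sup>2" for x
  proof -
    have "\<bar>truncate B (f x) - H x\<bar> \<le> 2 * B" using HB[of x] truncate_bound[of B "f x"] B by linarith
    then have "\<bar>truncate B (f x) - H x\<bar>\<^sup>2 \<le> (2 * B)\<^sup>2" by (rule power_mono) simp
    then show ?thesis by simp
  qed
  have "l2_err P (\<lambda>x. truncate B (f x)) h = (\<integral>z. (truncate B (f (fst z)) - H (fst z))\<^sup>2 \<partial>P)"
    unfolding H_def by (rule l2_err_eq[OF R B h fm])
  also have "\<dots> \<le> (\<integral>z. (2 * B)\<^sup>2 \<partial>P)"
    by (intro integral_mono integrable_const_bound[where B = "(2 * B)\<^sup>2"]) (use le in auto)
  finally show ?thesis by (simp add: prob_space power2_eq_square)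
qed

text \<open>As \<open>ln x \<ge> ln 2\<close>, every additive constant in the logarithm of the size
  is absorbed into a multiple of \<open>ln x\<close>.\<close>

lemma net_size_le:
  fixes Q c x k R l :: real and N1 D :: nat
  assumes l: "l = ln x" "x \<ge> 2" and Q: "Q \<ge> 1" and c: "0 \<le> c" "c \<le> Q * x ^ 4" and N1: "real N1 \<le> r"
  shows "(2 * c ^ (D + 1)) ^ N1 \<le> exp ((1 + (real D + 1) * (ln Q / ln 2 + 4)) * r * l)"
proof -
  have l2: "l \<ge> ln 2" using l by simp
  have l2': "l > 0" using l2 ln_gt_zero[of "2::real"] by linarith
  have "(2 * c ^ (D + 1)) \<le> 2 * (Q * x ^ 4) ^ (D + 1)" using c by (intro mult_left_mono power_mono) auto
  also have "\<dots> = exp (ln (2 * (Q * x ^ 4) ^ (D + 1)))" using Q l by simp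
  also have "ln (2 * (Q * x ^ 4) ^ (D + 1)) = ln 2 + (real D + 1) * (ln Q + 4 * l)"
    using Q l by (simp add: ln_mult ln_realpow algebra_simps)
  also have "\<dots> \<le> l + (real D + 1) * (ln Q / ln 2 * l + 4 * l)"
  proof -
    have "ln Q / ln 2 * ln 2 \<le> ln Q / ln 2 * l" using Q l2 by (intro mult_left_mono) auto
    then show ?thesis using l2 by (intro add_mono mult_left_mono) auto
  qed
  also have "\<dots> = (1 + (real D + 1) * (ln Q / ln 2 + 4)) * l" by (simp add: algebra_simps)
  finally have "2 * c ^ (D + 1) \<le> exp ((1 + (real D + 1) * (ln Q / ln 2 + 4)) * l)" by simp
  then have "(2 * c ^ (D + 1)) ^ N1 \<le> exp ((1 + (real D + 1) * (ln Q / ln 2 + 4)) * l) ^ N1"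
    using c by (intro power_mono) auto
  also have "\<dots> = exp (real N1 * ((1 + (real D + 1) * (ln Q / ln 2 + 4)) * l))" by (simp add: exp_of_nat_mult)
  also have "\<dots> \<le> exp (r * ((1 + (real D + 1) * (ln Q / ln 2 + 4)) * l))"
    using N1 l2' Q by (auto intro!: mult_right_mono mult_nonneg_nonneg add_nonneg_nonneg divide_nonneg_nonneg)
  finally show ?thesis by (simp add: mult_ac)
qed

text \<open>The class of \<open>h\<close> enters only through continuity on the ball and
  approximability at rate \<open>n powr (- \<alpha> / (d + 2 * \<alpha>))\<close> by networks of
  weight \<open>M\<close> and arbitrary width.\<close>

theorem regression_rate:
  fixes \<alpha> k k2 A B :: real
  assumes B: "B > 0" and \<alpha>: "\<alpha> > 0" and k: "k > 0" and k2: "k2 > 0" and A: "A > 0"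
  shows "\<exists>C>0. \<forall>n\<ge>2. \<forall>M N (P :: ('a::euclidean_space \<times> real) measure) h fhat.
     0 \<le> M \<and> M \<le> k2 * real n powr ((real DIM('a) + 3 - 2 * \<alpha>) / (2 * real DIM('a) + 4 * \<alpha>)) \<and>
     k * real n powr (real DIM('a) / (real DIM('a) + 2 * \<alpha>)) \<le> real N \<and>
     regression_setting P B h \<and> continuous_on (cball 0 1) h \<and>
     (\<exists>N'. \<exists>ht\<in>nn_class N' M. \<forall>x\<in>cball 0 1. \<bar>ht x - h x\<bar> \<le> A * real n powr (- (\<alpha> / (real DIM('a) + 2 * \<alpha>)))) \<and>
     (\<forall>D\<in>space (sample n P). fhat D \<in> nn_class N M \<and>
        (\<forall>g\<in>nn_class N M. emp_risk n D (fhat D) \<le> emp_risk n D g)) \<longrightarrow>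
     (\<exists>E\<in>sets (sample n P).
        measure (sample n P) E
          \<ge> 1 - 2 * exp (- 1 * real n powr (real DIM('a) / (real DIM('a) + 2 * \<alpha>)) * ln (real n)) \<and>
        (\<forall>D\<in>E. l2_err P (\<lambda>x. truncate B (fhat D x)) h
            \<le> C * real n powr (- (2 * \<alpha> / (real DIM('a) + 2 * \<alpha>))) * ln (real n)))"
proof -
  define d where "d = real DIM('a)"
  have d: "d \<ge> 1" using DIM_positive[where 'a = 'a] by (simp add: d_def Suc_leI)
  define s where "s = d + 2 * \<alpha>"
  have s: "s > 0" "s > d" using d \<alpha> by (auto simp: s_def)
  obtain Cs N0 where Cs: "Cs > 0" and sparse: "\<And>(\<rho> :: ('a \<times> real) measure) M N N' f.
     risk_measure \<rho> \<Longrightarrow> f \<in> nn_class N' M \<Longrightarrow> N \<ge> N0 \<Longrightarrow>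
     (\<exists>g\<in>nn_class N M. sq_risk \<rho> g \<le> sq_risk \<rho> f + Cs * M\<^sup>2 * (real N powr (- (1 + 3 / d)) * (1 + ln (real N))))"
    using nn_class_sparsify[where 'a = 'a] unfolding d_def by blast
  \<comment> \<open>Below this threshold \<open>N1\<close> would be too small for sparsification.
    There \<open>n\<close> is bounded, and the trivial error bound \<open>4 * B^2\<close> is within
    the rate thanks to the constant \<open>Ct\<close>.\<close>
  define r0 where "r0 = (real N0 + 2) / k"
  have r0: "r0 > 0" using k by (simp add: r0_def)
  define cl where "cl = (1 + \<bar>ln k\<bar>) / ln 2 + 1"
  have cl0: "cl > 0" by (auto simp: cl_def intro!: add_nonneg_pos divide_nonneg_nonneg)
  define CS where "CS = Cs * (k2\<^sup>2 * (k / 2) powr (- (1 + 3 / d)) * cl)"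
  have CS: "CS > 0" unfolding CS_def using Cs k2 k cl0 by (auto intro!: mult_pos_pos)
  define Q where "Q = 4 * k2 * k * (d + 1) + 3"
  have Q: "Q \<ge> 1" unfolding Q_def using k k2 d by (auto intro!: add_nonneg_nonneg mult_nonneg_nonneg)
  define cK where "cK = 1 + (d + 1) * (ln Q / ln 2 + 4)"
  have cK: "cK \<ge> 0" unfolding cK_def using d Q by (intro add_nonneg_nonneg mult_nonneg_nonneg divide_nonneg_nonneg) auto
  \<comment> \<open>\<open>cK * k\<close> times \<open>n powr (d / s) * ln n\<close> bounds the
    logarithm of the size of the net; the added 1 is what survives as the exponent of the failure
    probability.\<close>
  define T0 where "T0 = cK * k + 1"
  have T0: "T0 \<ge> 1" using cK k by (simp add: T0_def)
  define L where "L = 1 + (A + 4 * B)\<^sup>2"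
  have L: "L \<ge> 0" by (simp add: L_def)
  define Ct where "Ct = 4 * B\<^sup>2 / (r0 powr (- (2 * \<alpha> / d)) * ln 2)"
  have Ct: "Ct \<ge> 0" by (simp add: Ct_def)
  define C where "C = 24 * CS + (3 + 24 * B) / ln 2 + 6 * (L * (A\<^sup>2 / ln 2) + L * T0) + 3 * (2 * (72 * B\<^sup>2) * T0) + Ct"
  have Cbig: "24 * CS + (3 + 24 * B) / ln 2 + 6 * (L * (A\<^sup>2 / ln 2) + L * T0) + 3 * (2 * (72 * B\<^sup>2) * T0) \<le> C"
    using Ct by (simp add: C_def)
  have nnC: "(3 + 24 * B) / ln 2 \<ge> 0" "6 * (L * (A\<^sup>2 / ln 2) + L * T0) \<ge> 0" "3 * (2 * (72 * B\<^sup>2) * T0) \<ge> 0"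
    using B L T0 by auto
  have C0: "C > 0" and CCt: "Ct \<le> C" using nnC CS Ct unfolding C_def by linarith+
  have "\<exists>E\<in>sets (sample n P).
        measure (sample n P) E \<ge> 1 - 2 * exp (- 1 * real n powr (d / s) * ln (real n)) \<and>
        (\<forall>D\<in>E. l2_err P (\<lambda>x. truncate B (fhat D x)) h \<le> C * real n powr (- (2 * \<alpha> / s)) * ln (real n))"
    if n: "n \<ge> 2" and M: "0 \<le> M" "M \<le> k2 * real n powr ((d + 3 - 2 * \<alpha>) / (2 * d + 4 * \<alpha>))"
      and N: "k * real n powr (d / s) \<le> real N"
      and R: "regression_setting P B h" and h: "continuous_on (cball 0 1) h"
      and ht: "ht \<in> nn_class N' M" "\<And>x. x \<in> cball 0 1 \<Longrightarrow> \<bar>ht x - h x\<bar> \<le> A * real n powr (- (\<alpha> / s))"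
      and fhat: "\<And>D. D \<in> space (sample n P) \<Longrightarrow> fhat D \<in> nn_class N M \<and>
        (\<forall>g\<in>nn_class N M. emp_risk n D (fhat D) \<le> emp_risk n D g)"
    for n M N N' h ht fhat and P :: "('a \<times> real) measure"
  proof -
    define x where "x = real n"
    have x: "x \<ge> 2" using n by (simp add: x_def)
    define l where "l = ln x"
    have ln2: "ln (2::real) > 0" by simp
    have l2: "l \<ge> ln 2" using x by (simp add: l_def)
    have l0: "l > 0" using l2 ln2 by linarith
    have one: "1 \<le> l / ln 2" using l2 ln2 by simp
    define RR where "RR = x powr (d / s)"
    define e2 where "e2 = x powr (- (2 * \<alpha> / s))"
    have RR1: "RR \<ge> 1" unfolding RR_def using x d s by (intro ge_one_powr_ge_zero) auto
    have e20: "e2 > 0" using x by (simp add: e2_def)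
    have RRe: "RR / x = e2"
    proof -
      have "RR / x = x powr (d / s - 1)" using x by (simp add: RR_def powr_diff)
      also have "d / s - 1 = - (2 * \<alpha> / s)" using s by (simp add: s_def field_simps)
      finally show ?thesis by (simp add: e2_def)
    qed
    interpret P: prob_space P using R by (simp add: regression_setting_def)
    interpret Q: prob_space "sample n P" by (rule prob_space_PiM) (rule P.prob_space_axioms)
    have fm: "fhat D \<in> borel_measurable borel" if "D \<in> space (sample n P)" for D
      using nn_class_measurable fhat[OF that] by blast
    show ?thesis
    proof (cases "RR < r0")
      case True
      have "e2 = RR powr (- (2 * \<alpha> / d))"
        unfolding RR_def e2_def powr_powr using d by simp
      also have "\<dots> \<ge> r0 powr (- (2 * \<alpha> / d))" using True RR1 \<alpha> d by (intro powr_mono2') auto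
      finally have "r0 powr (- (2 * \<alpha> / d)) * ln 2 \<le> e2 * l" using l2 e20 by (intro mult_mono) auto
      then have "Ct * (r0 powr (- (2 * \<alpha> / d)) * ln 2) \<le> C * (e2 * l)" using C0 by (intro mult_mono[OF CCt]) auto
      moreover have "Ct * (r0 powr (- (2 * \<alpha> / d)) * ln 2) = 4 * B\<^sup>2" using r0 by (simp add: Ct_def)
      ultimately have le: "4 * B\<^sup>2 \<le> C * e2 * l" by (simp add: mult.assoc)
      show ?thesis
      proof (intro bexI[of _ "space (sample n P)"] conjI ballI)
        show "l2_err P (\<lambda>x. truncate B (fhat D x)) h \<le> C * real n powr (- (2 * \<alpha> / s)) * ln (real n)"
          if "D \<in> space (sample n P)" for D
          using l2_err_trivial[OF R B h fm[OF that]] le by (simp add: e2_def l_def x_def)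
      qed (auto simp: Q.prob_space)
    next
      case False
      \<comment> \<open>The sparse width: fixed before the sample is drawn, and as large as the
        lower bound on \<open>N\<close> guarantees. The finite nets are taken at this width.\<close>
      define N1 where "N1 = nat \<lfloor>k * RR\<rfloor>"
      have kR: "k * RR \<ge> real N0 + 2" using False k by (simp add: r0_def field_simps)
      have N1r: "real N1 = of_int \<lfloor>k * RR\<rfloor>" using kR by (simp add: N1_def)
      have N1u: "real N1 \<le> k * RR" unfolding N1r by simp
      have N1l: "real N1 > k * RR - 1" unfolding N1r using floor_correct[of "k * RR"] by linarith
      have N1N0: "N1 \<ge> N0" and N11: "N1 \<ge> 1" using N1l kR by linarith+
      have N1h: "real N1 \<ge> k * RR / 2" using N1l kR by linarith
      have N1N: "N1 \<le> N" using N1u N by (simp add: RR_def x_def)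
      define S where "S = Cs * M\<^sup>2 * (real N1 powr (- (1 + 3 / d)) * (1 + ln (real N1)))"
      \<comment> \<open>The powers of \<open>x\<close> from weight and width combine to \<open>(d +
        3 - 2 * \<alpha>) / s - (d + 3) / s = - 2 * \<alpha> / s\<close>, which is where the
        prescribed growth of \<open>M\<close> comes from.\<close>
      have S: "S \<le> CS * (e2 * l)"
      proof -
        have a: "M\<^sup>2 \<le> k2\<^sup>2 * x powr ((d + 3 - 2 * \<alpha>) / s)"
        proof -
          have "M\<^sup>2 \<le> (k2 * x powr ((d + 3 - 2 * \<alpha>) / (2 * d + 4 * \<alpha>)))\<^sup>2" using M by (intro power_mono) (auto simp: x_def)
          also have "\<dots> = k2\<^sup>2 * x powr (2 * ((d + 3 - 2 * \<alpha>) / (2 * d + 4 * \<alpha>)))"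
            using x by (simp add: power_mult_distrib powr_power mult.commute)
          also have "2 * ((d + 3 - 2 * \<alpha>) / (2 * d + 4 * \<alpha>)) = (d + 3 - 2 * \<alpha>) / s"
            using s by (simp add: s_def field_simps)
          finally show ?thesis .
        qed
        have b: "real N1 powr (- (1 + 3 / d)) \<le> (k / 2) powr (- (1 + 3 / d)) * x powr (- ((d + 3) / s))"
        proof -
          have "real N1 powr (- (1 + 3 / d)) \<le> (k / 2 * RR) powr (- (1 + 3 / d))"
            using N1h k RR1 d by (intro powr_mono2') (auto intro: order_trans[of _ 0])
          also have "\<dots> = (k / 2) powr (- (1 + 3 / d)) * RR powr (- (1 + 3 / d))"
            by (rule powr_mult)
          also have "RR powr (- (1 + 3 / d)) = x powr (d / s * (- (1 + 3 / d)))" by (simp add: RR_def powr_powr)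
          also have "d / s * (- (1 + 3 / d)) = - ((d + 3) / s)" using d s by (simp add: field_simps)
          finally show ?thesis .
        qed
        have c: "1 + ln (real N1) \<le> cl * l"
        proof -
          have "ln (real N1) \<le> ln (k * RR)" using N1u N11 by (subst ln_le_cancel_iff) auto
          also have "\<dots> = ln k + d / s * l" using k x by (simp add: RR_def l_def ln_mult ln_powr)
          also have "\<dots> \<le> \<bar>ln k\<bar> + 1 * l" using s d l0 by (intro add_mono mult_right_mono) auto
          finally have "1 + ln (real N1) \<le> (1 + \<bar>ln k\<bar>) * 1 + l" by simp
          also have "\<dots> \<le> (1 + \<bar>ln k\<bar>) * (l / ln 2) + l" using one by (intro add_mono mult_left_mono) auto
          also have "\<dots> = cl * l" by (simp add: cl_def algebra_simps)
          finally show ?thesis .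
        qed
        have ln0: "ln (real N1) \<ge> 0" using N11 by simp
        have "S \<le> Cs * (k2\<^sup>2 * x powr ((d + 3 - 2 * \<alpha>) / s)) * (((k / 2) powr (- (1 + 3 / d)) * x powr (- ((d + 3) / s))) * (cl * l))"
          unfolding S_def using a b c ln0 Cs by (intro mult_mono mult_left_mono) (auto intro!: mult_nonneg_nonneg)
        also have "\<dots> = CS * ((x powr ((d + 3 - 2 * \<alpha>) / s) * x powr (- ((d + 3) / s))) * l)" by (simp add: CS_def mult_ac)
        also have "x powr ((d + 3 - 2 * \<alpha>) / s) * x powr (- ((d + 3) / s)) = e2"
        proof -
          have "(d + 3 - 2 * \<alpha>) / s + - ((d + 3) / s) = - (2 * \<alpha> / s)"
            by (simp add: diff_divide_distrib add_divide_distrib)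
          then show ?thesis unfolding e2_def powr_add[symmetric] by (rule arg_cong)
        qed
        finally show ?thesis .
      qed
      \<comment> \<open>Makes the net accurate to \<open>1 / n\<close> in the supremum norm on the
        ball, which is below the rate, while the number of choices per neuron stays polynomial in
        \<open>n\<close>.\<close>
      define \<eta>' where "\<eta>' = 1 / (2 * x * real N1 * (d + 1))"
      have \<eta>'0: "\<eta>' > 0" using x N11 d by (simp add: \<eta>'_def)
      have \<eta>': "2 * real N1 * (d + 1) * \<eta>' = 1 / x" using x N11 d by (simp add: \<eta>'_def)
      obtain G :: "('a \<Rightarrow> real) set" where G: "finite G" "\<And>g. g \<in> G \<Longrightarrow> continuous_on UNIV g"
        "real (card G) \<le> (2 * (2 * M / \<eta>' + 3) ^ (DIM('a) + 1)) ^ N1"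
        "\<And>f. f \<in> nn_class N1 M \<Longrightarrow> \<exists>g\<in>G. \<forall>x\<in>cball 0 1. \<bar>f x - g x\<bar> \<le> 2 * real N1 * (real DIM('a) + 1) * \<eta>'"
        using nn_class_net[OF M(1) \<eta>'0, where 'a = 'a and N = N1] by blast
      have cardG: "real (card G) \<le> exp (cK * (k * RR) * l)"
      proof -
        have "2 * M / \<eta>' + 3 \<le> Q * x ^ 4"
        proof -
          have "(d + 3 - 2 * \<alpha>) / (2 * d + 4 * \<alpha>) \<le> 2" using d \<alpha> by (simp add: divide_le_eq)
          then have "x powr ((d + 3 - 2 * \<alpha>) / (2 * d + 4 * \<alpha>)) \<le> x powr 2" using x by (intro powr_mono) auto
          then have "k2 * x powr ((d + 3 - 2 * \<alpha>) / (2 * d + 4 * \<alpha>)) \<le> k2 * x\<^sup>2" using x k2 by (simp add: powr_numeral)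
          then have Mx: "M \<le> k2 * x\<^sup>2" using M(2) by (simp add: x_def)
          have "RR \<le> x powr 1" unfolding RR_def using x d s by (intro powr_mono) auto
          then have "k * RR \<le> k * x" using x k by simp
          then have Nx: "real N1 \<le> k * x" using N1u by linarith
          have "2 * M / \<eta>' = 4 * (d + 1) * x * (M * real N1)" by (simp add: \<eta>'_def)
          also have "\<dots> \<le> 4 * (d + 1) * x * ((k2 * x\<^sup>2) * (k * x))"
            using Mx Nx M x d by (intro mult_left_mono mult_mono) auto
          also have "\<dots> = (4 * k2 * k * (d + 1)) * x ^ 4" by (simp add: power2_eq_square power4_eq_xxxx)
          finally have "2 * M / \<eta>' + 3 \<le> (4 * k2 * k * (d + 1)) * x ^ 4 + 3 * 1" by simp
          also have "\<dots> \<le> (4 * k2 * k * (d + 1)) * x ^ 4 + 3 * x ^ 4" using x by (intro add_left_mono mult_left_mono one_le_power) auto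
          also have "\<dots> = Q * x ^ 4" by (simp add: Q_def algebra_simps)
          finally show ?thesis .
        qed
        from net_size_le[OF l_def x Q _ this N1u, of "DIM('a)"] M \<eta>'0 G(3)
        show ?thesis by (simp add: cK_def d_def mult.assoc)
      qed
      define t where "t = T0 * (RR * l)"
      define \<epsilon> where "\<epsilon> = A * x powr (- (\<alpha> / s))"
      have \<epsilon>A: "\<epsilon> \<le> A"
      proof -
        have "x powr (- (\<alpha> / s)) \<le> x powr 0" using x \<alpha> s by (intro powr_mono) auto
        then have "A * x powr (- (\<alpha> / s)) \<le> A * 1" using A x by (intro mult_left_mono) auto
        then show ?thesis by (simp add: \<epsilon>_def)
      qed
      have \<epsilon>2: "\<epsilon>\<^sup>2 = A\<^sup>2 * e2"
        using x by (simp add: \<epsilon>_def e2_def power_mult_distrib powr_power)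
      have n0: "n > 0" using n by simp
      obtain E where E: "E \<in> sets (sample n P)" "measure (sample n P) E \<ge> 1 - (real (card G) + 1) * exp (- t)"
        and ED: "\<forall>D\<in>E. D \<in> space (sample n P) \<and> (\<forall>i<n. fst (D i) \<in> cball 0 1 \<and> \<bar>snd (D i)\<bar> \<le> B) \<and>
          (\<forall>g\<in>G. (\<integral>z. (truncate B (g (fst z)) - truncate B (if fst z \<in> cball 0 1 then h (fst z) else 0))\<^sup>2 \<partial>P)
             \<le> 2 * (emp_risk n D (\<lambda>x. truncate B (g x)) - emp_risk n D (\<lambda>x. truncate B (if x \<in> cball 0 1 then h x else 0))) + 2 * (72 * B\<^sup>2) * (t / n)) \<and>
          emp_risk n D ht - emp_risk n D (\<lambda>x. truncate B (if x \<in> cball 0 1 then h x else 0)) \<le> L * \<epsilon>\<^sup>2 + L * (t / n)"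
        using exists_good_event[OF R B h G(1,2) nn_class_continuous[OF ht(1)] ht(2)[folded x_def, folded \<epsilon>_def] \<epsilon>A A n0, of t, folded L_def]
        by blast
      have prob: "1 - 2 * exp (- 1 * real n powr (d / s) * ln (real n)) \<le> measure (sample n P) E"
      proof -
        have "1 \<le> exp (cK * (k * RR) * l)" using cK k RR1 l0 by simp
        then have "(real (card G) + 1) * exp (- t) \<le> (2 * exp (cK * (k * RR) * l)) * exp (- t)"
          using cardG by (intro mult_right_mono[of "real (card G) + 1"]) (linarith, simp)
        also have "\<dots> = 2 * exp (cK * (k * RR) * l - t)" by (simp add: exp_diff exp_minus field_simps)
        also have "cK * (k * RR) * l - t = - 1 * RR * l" by (simp add: t_def T0_def algebra_simps)
        finally show ?thesis using E(2) unfolding RR_def l_def x_def by linarith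
      qed
      have tn: "t / real n = T0 * (e2 * l)" using RRe by (simp add: t_def x_def flip: RRe)
      have ex: "1 / x \<le> e2"
        unfolding RRe[symmetric] using RR1 x by (intro divide_right_mono) auto
      have e2l: "e2 \<le> e2 * l / ln 2" using one e20 by (metis mult_left_mono mult.right_neutral less_imp_le times_divide_eq_right)
      have err: "l2_err P (\<lambda>x. truncate B (fhat D x)) h \<le> C * real n powr (- (2 * \<alpha> / s)) * ln (real n)" if D: "D \<in> E" for D
      proof -
        have sp: "\<exists>g\<in>nn_class N1 M. sq_risk \<rho> g \<le> sq_risk \<rho> f + S" if "risk_measure \<rho>" "f \<in> nn_class N'' M" for \<rho> :: "('a \<times> real) measure" and N'' f
          using sparse[OF that N1N0] by (simp add: S_def)
        have DD: "D \<in> space (sample n P)" using ED D by blast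
        have net: "\<exists>g\<in>G. \<forall>y\<in>cball 0 1. \<bar>f y - g y\<bar> \<le> 1 / x" if "f \<in> nn_class N1 M" for f
          using G(4)[OF that] \<eta>' by (simp add: d_def)
        have "l2_err P (\<lambda>x. truncate B (fhat D x)) h
          \<le> 24 * S + 3 * (1 / x)\<^sup>2 + 24 * B * (1 / x) + 6 * (L * \<epsilon>\<^sup>2 + L * (t / n)) + 3 * (2 * (72 * B\<^sup>2) * (t / n))"
          by (rule erm_error_bound[OF R B h sp n0 _ _ _ N1N ht(1) M(1) net G(2)]) (use ED D fhat[OF DD] in auto)
        also have "\<dots> \<le> 24 * (CS * (e2 * l)) + 3 * (e2 * l / ln 2) + 24 * B * (e2 * l / ln 2) + 6 * (L * (A\<^sup>2 * (e2 * l / ln 2)) + L * (T0 * (e2 * l))) + 3 * (2 * (72 * B\<^sup>2) * (T0 * (e2 * l)))"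
        proof (intro add_mono mult_left_mono)
          have "(1 / x)\<^sup>2 \<le> (1 / x) * 1" unfolding power2_eq_square using x by (intro mult_left_mono) auto
          then show "(1 / x)\<^sup>2 \<le> e2 * l / ln 2" using ex e2l by linarith
          show "1 / x \<le> e2 * l / ln 2" using ex e2l by linarith
          show "\<epsilon>\<^sup>2 \<le> A\<^sup>2 * (e2 * l / ln 2)" unfolding \<epsilon>2 by (intro mult_left_mono e2l) auto
        qed (use S B L tn in auto)
        also have "\<dots> = (24 * CS + (3 + 24 * B) / ln 2 + 6 * (L * (A\<^sup>2 / ln 2) + L * T0) + 3 * (2 * (72 * B\<^sup>2) * T0)) * (e2 * l)"
          by (simp add: algebra_simps add_divide_distrib)
        also have "\<dots> \<le> C * (e2 * l)" using Cbig e20 l0 by (intro mult_right_mono) auto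
        finally show ?thesis by (simp add: e2_def l_def x_def mult.assoc)
      qed
      show ?thesis using E(1) prob err by (intro bexI[of _ E] conjI ballI)
    qed
  qed
  then show ?thesis using C0 unfolding d_def s_def by (intro exI[of _ C]) blast
qed

subsection \<open>Superpositions of ReLU functions\<close>

lemma nn_class_add:
  assumes "f \<in> nn_class N1 M1" "g \<in> nn_class N2 M2"
  shows "(\<lambda>x. f x + g x) \<in> nn_class (N1 + N2) (M1 + M2)"
proof -
  obtain a w where f: "f = network {..<N1} a w" "(\<Sum>i<N1. \<bar>a i\<bar> * norm (w i)) \<le> M1"
    using assms(1) unfolding nn_class_def network_def[abs_def] by blast
  obtain b u where g: "g = network {..<N2} b u" "(\<Sum>i<N2. \<bar>b i\<bar> * norm (u i)) \<le> M2"
    using assms(2) unfolding nn_class_def network_def[abs_def] by blast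
  define I where "I = {..<N1} <+> {..<N2}"
  have plus: "(\<Sum>i\<in>I. p i) = (\<Sum>i<N1. p (Inl i)) + (\<Sum>i<N2. p (Inr i))" for p :: "_ \<Rightarrow> real"
    unfolding I_def by (subst sum.Plus) auto
  have "(\<lambda>x. f x + g x) = network I (case_sum a b) (case_sum w u)"
    unfolding f(1) g(1) network_def plus by simp
  moreover have "network I (case_sum a b) (case_sum w u) \<in> nn_class (N1 + N2) (M1 + M2)"
  proof (rule network_in_nn_class)
    show "(\<Sum>i\<in>I. \<bar>case_sum a b i\<bar> * norm (case_sum w u i)) \<le> M1 + M2" unfolding plus using f g by simp
  qed (auto simp: I_def card_Plus)
  ultimately show ?thesis by simp
qed

lemma nn_class_scale:
  assumes "f \<in> nn_class N M"
  shows "(\<lambda>x. c * f x) \<in> nn_class N (\<bar>c\<bar> * M)"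
proof -
  obtain a w where f: "f = network {..<N} a w" "(\<Sum>i<N. \<bar>a i\<bar> * norm (w i)) \<le> M"
    using assms unfolding nn_class_def network_def[abs_def] by blast
  have "(\<lambda>x. c * f x) = network {..<N} (\<lambda>i. c * a i) w"
    unfolding f(1) network_def by (simp add: sum_distrib_left mult.assoc)
  moreover have "(\<Sum>i<N. \<bar>c * a i\<bar> * norm (w i)) \<le> \<bar>c\<bar> * M"
    using f(2) by (simp add: abs_mult mult.assoc mult_left_mono flip: sum_distrib_left)
  ultimately show ?thesis using network_in_nn_class[of "{..<N}" N "\<lambda>i. c * a i" w] by simp
qed

text \<open>A Riemann sum: directions are moved to the centres of a fine Borel partition of the
  ball, and \<open>D\<close> is integrated over each cell. The weight does not exceed that of the
  integral; the number of cells is uncontrolled, which later sparsification tolerates.\<close>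

lemma nn_class_integral_approx:
  fixes v :: "'w \<Rightarrow> 'a::euclidean_space \<times> real" and D :: "'w \<Rightarrow> real"
  assumes D: "integrable \<mu> D" and v: "v \<in> borel_measurable \<mu>" and V: "\<And>w. w \<in> space \<mu> \<Longrightarrow> norm (v w) \<le> V" "V \<ge> 0"
    and e: "\<epsilon> > 0"
  shows "\<exists>N. \<exists>f\<in>nn_class N (V * (\<integral>w. \<bar>D w\<bar> \<partial>\<mu>)). \<forall>x\<in>cball 0 1. \<bar>f x - (\<integral>w. D w * relu (inner (x, 1) (v w)) \<partial>\<mu>)\<bar> \<le> \<epsilon>"
proof -
  define m where "m = (\<integral>w. \<bar>D w\<bar> \<partial>\<mu>)"
  have m0: "m \<ge> 0" by (simp add: m_def)
  define \<delta> where "\<delta> = \<epsilon> / (2 * m + 1)"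
  have \<delta>: "\<delta> > 0" using e m0 by (simp add: \<delta>_def add_nonneg_pos)
  have "compact (cball (0::'a \<times> real) V)" by simp
  then obtain K where K: "finite K" "K \<subseteq> cball (0::'a \<times> real) V" "cball 0 V \<subseteq> (\<Union>k\<in>K. ball k \<delta>)"
    using seq_compact_imp_totally_bounded[OF compact_imp_seq_compact] \<delta> by metis
  obtain c where c: "bij_betw c {..<card K} K" using K(1) bij_betw_from_nat_into_finite by blast
  define A where "A = (\<lambda>j. if j < card K then ball (c j) \<delta> else {})"
  define X where "X = disjointed A"
  have XM: "X j \<in> sets borel" for j
    unfolding X_def by (intro sets.range_disjointed_sets[THEN subsetD, of A] ) (auto simp: A_def)
  have Xsub: "X j \<subseteq> A j" for j unfolding X_def by (rule disjointed_subset)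
  have cK: "c j \<in> cball 0 V" if "j < card K" for j
    using bij_betw_apply[OF c, of j] K(2) that by auto
  have one: "(\<Sum>j<card K. indicator (X j) y) = (1::real)" if y: "y \<in> cball 0 V" for y
  proof -
    obtain k where "k \<in> K" "y \<in> ball k \<delta>" using K(3) y by auto
    moreover from this obtain j where "j < card K" "k = c j" using bij_betw_imp_surj_on[OF c] by auto
    ultimately have "y \<in> A j" by (simp add: A_def)
    then have "y \<in> (\<Union>j. X j)" unfolding X_def UN_disjointed_eq by auto
    then obtain i where i: "y \<in> X i" by auto
    then have iK: "i < card K" using Xsub[of i] by (cases "i < card K") (auto simp: A_def)
    have uniq: "y \<in> X j \<longleftrightarrow> j = i" for j
      using i disjoint_family_disjointed[of A] unfolding X_def disjoint_family_on_def by blast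
    have "(\<Sum>j<card K. indicator (X j) y) = (\<Sum>j<card K. if j = i then 1 else (0::real))"
      using uniq by (intro sum.cong) (auto simp: indicator_def)
    also have "\<dots> = 1" using iK by simp
    finally show ?thesis .
  qed
  note [measurable] = v borel_measurable_integrable[OF D] XM
  define a where "a = (\<lambda>j. \<integral>w. D w * indicator (X j) (v w) \<partial>\<mu>)"
  have intD: "integrable \<mu> (\<lambda>w. D w * indicator (X j) (v w))" for j
    by (rule Bochner_Integration.integrable_bound[OF D]) (auto simp: indicator_def)
  have intA: "integrable \<mu> (\<lambda>w. \<bar>D w\<bar> * indicator (X j) (v w))" for j
    by (rule Bochner_Integration.integrable_bound[OF D]) (auto simp: indicator_def)
  have weight: "(\<Sum>j<card K. \<bar>a j\<bar> * norm (c j)) \<le> V * m"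
  proof -
    have "(\<Sum>j<card K. \<bar>a j\<bar> * norm (c j)) \<le> (\<Sum>j<card K. (\<integral>w. \<bar>D w\<bar> * indicator (X j) (v w) \<partial>\<mu>) * V)"
    proof (intro sum_mono mult_mono)
      fix j assume "j \<in> {..<card K}"
      then show "norm (c j) \<le> V" using cK by simp
      have "\<bar>a j\<bar> \<le> (\<integral>w. \<bar>D w * indicator (X j) (v w)\<bar> \<partial>\<mu>)" unfolding a_def by (rule integral_abs_bound)
      then show "\<bar>a j\<bar> \<le> (\<integral>w. \<bar>D w\<bar> * indicator (X j) (v w) \<partial>\<mu>)" by (simp add: abs_mult)
    qed auto
    also have "\<dots> = (\<integral>w. (\<Sum>j<card K. \<bar>D w\<bar> * indicator (X j) (v w)) \<partial>\<mu>) * V"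
      unfolding sum_distrib_right[symmetric] by (subst Bochner_Integration.integral_sum) (use intA in auto)
    also have "(\<integral>w. (\<Sum>j<card K. \<bar>D w\<bar> * indicator (X j) (v w)) \<partial>\<mu>) = m"
      unfolding m_def by (intro Bochner_Integration.integral_cong) (auto simp: one V sum_distrib_left[symmetric])
    finally show ?thesis by (simp add: mult.commute)
  qed
  have "network {..<card K} a c \<in> nn_class (card K) (V * m)"
    by (rule network_in_nn_class) (use weight in auto)
  moreover have "\<bar>network {..<card K} a c x - (\<integral>w. D w * relu (inner (x, 1) (v w)) \<partial>\<mu>)\<bar> \<le> \<epsilon>" if x: "x \<in> cball 0 1" for x
  proof -
    let ?r = "\<lambda>y. relu (inner (x, 1::real) y)"
    have lip: "\<bar>?r y - ?r z\<bar> \<le> 2 * norm (y - z)" for y z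
    proof -
      have "\<bar>?r y - ?r z\<bar> \<le> \<bar>inner (x, 1) (y - z)\<bar>" using relu_lipschitz by (simp add: inner_diff_right)
      also have "\<dots> \<le> norm (x, 1::real) * norm (y - z)" by (rule Cauchy_Schwarz_ineq2)
      also have "\<dots> \<le> 2 * norm (y - z)" using norm_Pair_1_le(1)[OF x] by (intro mult_right_mono) auto
      finally show ?thesis .
    qed
    have rm [measurable]: "(\<lambda>w. ?r (v w)) \<in> borel_measurable \<mu>"
      by (rule measurable_compose[OF v]) (intro borel_measurable_continuous_onI continuous_intros)
    have rb: "\<bar>?r (v w)\<bar> \<le> 2 * V" if "w \<in> space \<mu>" for w using lip[of "v w" 0] V(1)[OF that] by (simp add: relu_def[of 0])
    have intR: "integrable \<mu> (\<lambda>w. D w * ?r (v w))"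
    proof (rule Bochner_Integration.integrable_bound)
      show "integrable \<mu> (\<lambda>w. 2 * V * \<bar>D w\<bar>)" using D by simp
      show "AE w in \<mu>. norm (D w * ?r (v w)) \<le> norm (2 * V * \<bar>D w\<bar>)"
      proof (rule AE_I2)
        fix w assume "w \<in> space \<mu>"
        then have "\<bar>D w\<bar> * \<bar>?r (v w)\<bar> \<le> \<bar>D w\<bar> * (2 * V)" by (intro mult_left_mono rb) auto
        then show "norm (D w * ?r (v w)) \<le> norm (2 * V * \<bar>D w\<bar>)" using V(2) by (simp add: abs_mult mult_ac)
      qed
    qed measurable
    have "network {..<card K} a c x = (\<integral>w. (\<Sum>j<card K. D w * indicator (X j) (v w) * ?r (c j)) \<partial>\<mu>)"
      unfolding network_def a_def using intD by simp
    then have "network {..<card K} a c x - (\<integral>w. D w * ?r (v w) \<partial>\<mu>)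
      = (\<integral>w. (\<Sum>j<card K. D w * indicator (X j) (v w) * ?r (c j)) - D w * ?r (v w) \<partial>\<mu>)"
      using intD intR by simp
    also have "\<bar>\<dots>\<bar> \<le> (\<integral>w. 2 * \<delta> * \<bar>D w\<bar> \<partial>\<mu>)"
    proof (rule order_trans[OF integral_abs_bound])
      show "(\<integral>w. \<bar>(\<Sum>j<card K. D w * indicator (X j) (v w) * ?r (c j)) - D w * ?r (v w)\<bar> \<partial>\<mu>) \<le> (\<integral>w. 2 * \<delta> * \<bar>D w\<bar> \<partial>\<mu>)"
      proof (rule integral_mono)
        show "integrable \<mu> (\<lambda>w. \<bar>(\<Sum>j<card K. D w * indicator (X j) (v w) * ?r (c j)) - D w * ?r (v w)\<bar>)"
          using intD intR by simp
        show "integrable \<mu> (\<lambda>w. 2 * \<delta> * \<bar>D w\<bar>)" using D by simp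
        fix w assume w: "w \<in> space \<mu>"
        have vw: "v w \<in> cball 0 V" using V(1)[OF w] by simp
        have "(\<Sum>j<card K. D w * indicator (X j) (v w) * ?r (c j)) - D w * ?r (v w)
          = (\<Sum>j<card K. D w * indicator (X j) (v w) * ?r (c j)) - D w * ?r (v w) * (\<Sum>j<card K. indicator (X j) (v w))"
          using one[OF vw] by simp
        also have "\<dots> = (\<Sum>j<card K. D w * indicator (X j) (v w) * (?r (c j) - ?r (v w)))"
          by (simp add: sum_distrib_left sum_subtractf algebra_simps)
        finally have eq: "(\<Sum>j<card K. D w * indicator (X j) (v w) * ?r (c j)) - D w * ?r (v w)
          = (\<Sum>j<card K. D w * indicator (X j) (v w) * (?r (c j) - ?r (v w)))" .
        have "\<bar>(\<Sum>j<card K. D w * indicator (X j) (v w) * ?r (c j)) - D w * ?r (v w)\<bar>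
          \<le> (\<Sum>j<card K. \<bar>D w * indicator (X j) (v w) * (?r (c j) - ?r (v w))\<bar>)" unfolding eq by (rule sum_abs)
        also have "\<dots> \<le> (\<Sum>j<card K. \<bar>D w\<bar> * indicator (X j) (v w) * (2 * \<delta>))"
        proof (rule sum_mono)
          fix j assume j: "j \<in> {..<card K}"
          show "\<bar>D w * indicator (X j) (v w) * (?r (c j) - ?r (v w))\<bar> \<le> \<bar>D w\<bar> * indicator (X j) (v w) * (2 * \<delta>)"
          proof (cases "v w \<in> X j")
            case True
            then have "v w \<in> ball (c j) \<delta>" using Xsub[of j] j by (auto simp: A_def)
            then have "norm (c j - v w) \<le> \<delta>" by (simp add: dist_norm)
            then have "\<bar>?r (c j) - ?r (v w)\<bar> \<le> 2 * \<delta>" using lip[of "c j" "v w"] by linarith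
            then show ?thesis using True by (simp add: abs_mult mult_left_mono)
          qed simp
        qed
        also have "\<dots> = \<bar>D w\<bar> * (2 * \<delta>) * (\<Sum>j<card K. indicator (X j) (v w))"
          by (simp add: sum_distrib_left mult_ac)
        also have "\<dots> = 2 * \<delta> * \<bar>D w\<bar>" using one[OF vw] by simp
        finally show "\<bar>(\<Sum>j<card K. D w * indicator (X j) (v w) * ?r (c j)) - D w * ?r (v w)\<bar> \<le> 2 * \<delta> * \<bar>D w\<bar>" .
      qed
    qed
    also have "\<dots> = 2 * m * \<delta>" by (simp add: m_def)
    also have "\<dots> \<le> \<epsilon>" using e m0 by (simp add: \<delta>_def field_simps)
    finally show ?thesis .
  qed
  ultimately show ?thesis unfolding m_def by blast
qed

lemma f_meas_approx:
  assumes p: "sphere_measure p" and e: "\<epsilon> > 0"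
  shows "\<exists>N. \<exists>f\<in>nn_class N (measure p (space p)). \<forall>x\<in>cball 0 1. \<bar>f x - f_meas p x\<bar> \<le> \<epsilon>"
proof -
  interpret finite_measure p using p by (simp add: sphere_measure_def)
  have sp: "sets p = sets (restrict_space borel (sphere 0 1))" using p by (simp add: sphere_measure_def)
  have space: "space p = sphere 0 1" using sets_eq_imp_space_eq[OF sp] by (simp add: space_restrict_space)
  have m: "(\<lambda>v. v) \<in> borel_measurable p"
    unfolding measurable_cong_sets[OF sp refl] by (rule measurable_restrict_space1) simp
  have "\<exists>N. \<exists>f\<in>nn_class N (1 * (\<integral>w. \<bar>1\<bar> \<partial>p)). \<forall>x\<in>cball 0 1. \<bar>f x - (\<integral>w. 1 * relu (inner (x, 1) w) \<partial>p)\<bar> \<le> \<epsilon>"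
    by (rule nn_class_integral_approx[OF _ m]) (use e in \<open>auto simp: space\<close>)
  then show ?thesis by (simp add: f_meas_def)
qed

lemma barron_approx:
  fixes h :: "'a::euclidean_space \<Rightarrow> real"
  assumes h: "h \<in> barron_class 1" and e: "\<epsilon> > 0"
  shows "\<exists>N. \<exists>f\<in>nn_class N 1. \<forall>x\<in>cball 0 1. \<bar>f x - h x\<bar> \<le> \<epsilon>"
proof -
  \<comment> \<open>The infimum in \<open>barron_norm\<close> need not be attained, so only a total
    mass below \<open>1 + \<eta>\<close> is available. Shrinking by \<open>1 / (1 + \<eta>)\<close>
    restores weight 1 and costs at most \<open>4 * \<eta>\<close>.\<close>
  define \<eta> where "\<eta> = min 1 (\<epsilon> / 8)"
  have \<eta>: "\<eta> > 0" "\<eta> \<le> 1" "8 * \<eta> \<le> \<epsilon>" using e by (auto simp: \<eta>_def)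
  have "barron_norm h < ereal (1 + \<eta>)"
    using h \<eta> by (auto simp: barron_class_def intro: le_less_trans)
  then obtain p q where pq: "sphere_measure p" "sphere_measure q" "\<forall>x\<in>cball 0 1. h x = f_meas p x - f_meas q x"
    "measure p (space p) + measure q (space q) < 1 + \<eta>"
    unfolding barron_norm_def by (auto simp: Inf_less_iff)
  obtain N1 f1 where f1: "f1 \<in> nn_class N1 (measure p (space p))" "\<forall>x\<in>cball 0 1. \<bar>f1 x - f_meas p x\<bar> \<le> \<eta>"
    using f_meas_approx[OF pq(1) \<eta>(1)] by blast
  obtain N2 f2 where f2: "f2 \<in> nn_class N2 (measure q (space q))" "\<forall>x\<in>cball 0 1. \<bar>f2 x - f_meas q x\<bar> \<le> \<eta>"
    using f_meas_approx[OF pq(2) \<eta>(1)] by blast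
  define g where "g = (\<lambda>x. f1 x + (- 1) * f2 x)"
  have "g \<in> nn_class (N1 + N2) (measure p (space p) + \<bar>- 1\<bar> * measure q (space q))"
    unfolding g_def by (intro nn_class_add nn_class_scale f1 f2)
  then have g: "g \<in> nn_class (N1 + N2) (1 + \<eta>)"
    using nn_class_mono[of "N1 + N2" "N1 + N2" "measure p (space p) + measure q (space q)" "1 + \<eta>"] pq(4) by auto
  define c where "c = 1 / (1 + \<eta>)"
  have c: "c \<ge> 0" "c \<le> 1" "1 - c \<le> \<eta>" "\<bar>c\<bar> * (1 + \<eta>) = 1" using \<eta> by (auto simp: c_def field_simps)
  have "(\<lambda>x. c * g x) \<in> nn_class (N1 + N2) 1" using nn_class_scale[OF g, of c] c by simp
  moreover have "\<bar>c * g x - h x\<bar> \<le> \<epsilon>" if x: "x \<in> cball 0 1" for x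
  proof -
    have "\<bar>g x - h x\<bar> \<le> 2 * \<eta>" using f1(2) f2(2) pq(3) x unfolding g_def by (smt (verit))
    moreover have "\<bar>c * g x - g x\<bar> \<le> 4 * \<eta>"
    proof -
      have "\<bar>c * g x - g x\<bar> = (1 - c) * \<bar>g x\<bar>"
      proof -
        have "c * g x - g x = (c - 1) * g x" by (simp add: algebra_simps)
        then show ?thesis using c by (simp add: abs_mult)
      qed
      also have "\<dots> \<le> \<eta> * (2 * (1 + \<eta>))" using c \<eta> nn_class_bound[OF g x] by (intro mult_mono) auto
      also have "\<dots> \<le> \<eta> * 4" using \<eta> by (intro mult_left_mono) auto
      finally show ?thesis by simp
    qed
    ultimately show ?thesis using \<eta>(1,3) by linarith
  qed
  ultimately show ?thesis by (intro exI[of _ "N1 + N2"] bexI[of _ "\<lambda>x. c * g x"]) auto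
qed

text \<open>Networks are continuous and uniform limits preserve continuity. This supplies the
  continuity demanded by \<open>regression_rate\<close> for both function classes.\<close>

lemma continuous_if_nn_approx:
  fixes h :: "'a::euclidean_space \<Rightarrow> real"
  assumes "\<And>\<epsilon>. \<epsilon> > 0 \<Longrightarrow> \<exists>N M. \<exists>f\<in>nn_class N M. \<forall>x\<in>cball 0 1. \<bar>f x - h x\<bar> \<le> \<epsilon>"
  shows "continuous_on (cball 0 1) h"
proof -
  have "\<exists>f. continuous_on (cball 0 1) f \<and> (\<forall>x\<in>cball 0 1. \<bar>f x - h x\<bar> \<le> inverse (real (Suc n)))" for n
    using assms[of "inverse (real (Suc n))"] nn_class_continuous by (metis inverse_positive_iff_positive of_nat_0_less_iff zero_less_Suc)
  then obtain F where F: "\<And>n. continuous_on (cball 0 1) (F n)" "\<And>n x. x \<in> cball 0 1 \<Longrightarrow> \<bar>F n x - h x\<bar> \<le> inverse (real (Suc n))"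
    by metis
  show ?thesis
  proof (rule uniform_limit_theorem)
    show "\<forall>\<^sub>F n in sequentially. continuous_on (cball 0 1) (F n)" using F by simp
    show "uniform_limit (cball 0 1) F h sequentially"
    proof (rule uniform_limitI)
      fix e :: real assume "e > 0"
      then obtain n where n: "inverse (real (Suc n)) < e" using reals_Archimedean by blast
      show "\<forall>\<^sub>F n in sequentially. \<forall>x\<in>cball 0 1. dist (F n x) (h x) < e"
      proof (rule eventually_sequentiallyI[of n], intro ballI)
        fix k x assume kx: "n \<le> k" "x \<in> cball (0::'a) 1"
        have "inverse (real (Suc k)) \<le> inverse (real (Suc n))" using kx by (intro le_imp_inverse_le) auto
        then show "dist (F k x) (h x) < e" using F(2)[OF kx(2), of k] n unfolding dist_real_def by linarith
      qed
    qed
  qed simp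
qed

subsection \<open>Gaussian kernels and the Fourier transform\<close>

abbreviation lborel2 :: "('a::euclidean_space \<times> 'b::euclidean_space) measure" where
  "lborel2 \<equiv> lborel \<Otimes>\<^sub>M lborel"

lemma nn_integral_lborel_affine:
  fixes t :: "'a::euclidean_space"
  assumes [measurable]: "f \<in> borel_measurable borel" and c: "c \<noteq> 0"
  shows "(\<integral>\<^sup>+x. f x \<partial>lborel) = ennreal (\<bar>c\<bar> ^ DIM('a)) * (\<integral>\<^sup>+x. f (t + c *\<^sub>R x) \<partial>lborel)"
  by (subst lborel_affine[OF c, of t])
     (simp add: nn_integral_density nn_integral_distr nn_integral_cmult ennreal_power)

lemma integrable_lborel_affine:
  fixes f :: "'a::euclidean_space \<Rightarrow> 'b::{banach, second_countable_topology}"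
  assumes f: "integrable lborel f" and c: "c \<noteq> 0"
  shows "integrable lborel (\<lambda>x. f (t + c *\<^sub>R x))"
  using f f[THEN borel_measurable_integrable] c unfolding integrable_iff_bounded
  by (subst (asm) nn_integral_lborel_affine[where c=c and t=t]) (auto simp: ennreal_mult_less_top)

lemma integrable_lborel_affine_iff:
  fixes f :: "'a::euclidean_space \<Rightarrow> 'b::{banach, second_countable_topology}"
  assumes c: "c \<noteq> 0"
  shows "integrable lborel (\<lambda>x. f (t + c *\<^sub>R x)) \<longleftrightarrow> integrable lborel f"
proof
  assume "integrable lborel (\<lambda>x. f (t + c *\<^sub>R x))"
  from integrable_lborel_affine[OF this, of "1 / c" "- (1 / c) *\<^sub>R t"] c
  show "integrable lborel f" by (simp add: algebra_simps)
qed (rule integrable_lborel_affine[OF _ c])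

lemma integral_lborel_affine:
  fixes f :: "'a::euclidean_space \<Rightarrow> 'b::{banach, second_countable_topology}"
  assumes c: "c \<noteq> 0"
  shows "(\<integral>x. f x \<partial>lborel) = (\<bar>c\<bar> ^ DIM('a)) *\<^sub>R (\<integral>x. f (t + c *\<^sub>R x) \<partial>lborel)"
proof (cases "integrable lborel f")
  case True
  then show ?thesis
    using c True[THEN borel_measurable_integrable] integrable_lborel_affine[OF True c, of t]
    by (subst lborel_affine[OF c, of t]) (simp add: integral_density integral_distr ennreal_power)
next
  case False
  with c show ?thesis by (simp add: integrable_lborel_affine_iff not_integrable_integral_eq)
qed

lemma
  fixes f :: "'a::euclidean_space \<Rightarrow> real \<Rightarrow> complex"
  assumes f: "\<And>b. b \<in> Basis \<Longrightarrow> integrable lborel (f b)"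
  shows integrable_lborel_prod: "integrable lborel (\<lambda>u. \<Prod>b\<in>Basis. f b (u \<bullet> b))"
    and integral_lborel_prod: "(\<integral>u. (\<Prod>b\<in>Basis. f b (u \<bullet> b)) \<partial>lborel) = (\<Prod>b\<in>Basis. \<integral>x. f b x \<partial>lborel)"
proof -
  interpret product_sigma_finite "\<lambda>_::'a. lborel :: real measure" ..
  have fm [measurable]: "f b \<in> borel_measurable borel" if "b \<in> Basis" for b
    using borel_measurable_integrable[OF f[OF that]] by simp
  have m: "(\<lambda>u. \<Prod>b\<in>Basis. f b (u \<bullet> b)) \<in> borel_measurable (borel :: 'a measure)" by measurable
  have mm: "(\<lambda>g. \<Sum>b\<in>Basis. g b *\<^sub>R b) \<in> measurable (Pi\<^sub>M Basis (\<lambda>_. lborel)) (borel :: 'a measure)" by measurable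
  have eq: "(\<lambda>g. \<Prod>b\<in>Basis. f b ((\<Sum>c\<in>Basis. g c *\<^sub>R c) \<bullet> b)) = (\<lambda>g. \<Prod>b\<in>Basis. f b (g b))"
    by (intro ext prod.cong refl) (simp add: inner_sum_left inner_Basis if_distrib sum.delta cong: if_cong)
  have L: "(lborel :: 'a measure) = distr (Pi\<^sub>M Basis (\<lambda>_. lborel)) borel (\<lambda>g. \<Sum>b\<in>Basis. g b *\<^sub>R b)"
    by (rule lborel_eq)
  show "integrable lborel (\<lambda>u. \<Prod>b\<in>Basis. f b (u \<bullet> b))"
    unfolding L integrable_distr_eq[OF mm m] eq
    by (rule product_integrable_prod) (use f in auto)
  show "(\<integral>u. (\<Prod>b\<in>Basis. f b (u \<bullet> b)) \<partial>lborel) = (\<Prod>b\<in>Basis. \<integral>x. f b x \<partial>lborel)"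
    unfolding L integral_distr[OF mm m] eq
    by (rule product_integral_prod) (use f in auto)
qed

text \<open>\<open>\<tau>\<close> is the reciprocal of the width: on the frequency side a small
  \<open>\<tau>\<close> is a mild cutoff, and it corresponds to averaging at scale
  \<open>\<tau>\<close> in space.\<close>

definition gauss :: "real \<Rightarrow> 'a::euclidean_space \<Rightarrow> real" where
  "gauss \<tau> u = exp (- (\<tau>\<^sup>2 * (norm u)\<^sup>2 / 2))"

lemma gauss_pos: "gauss \<tau> u > 0" by (simp add: gauss_def)

lemma gauss_le_1: "gauss \<tau> u \<le> 1" by (simp add: gauss_def)

lemma continuous_gauss [continuous_intros]: "continuous_on A f \<Longrightarrow> continuous_on A (\<lambda>x. gauss \<tau> (f x))"
  unfolding gauss_def by (auto intro!: continuous_intros)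

lemma borel_measurable_gauss [measurable]: "gauss \<tau> \<in> borel_measurable borel"
  by (intro borel_measurable_continuous_onI continuous_intros)

lemma continuous_cis_real [continuous_intros]: "continuous_on A f \<Longrightarrow> continuous_on A (\<lambda>x. cis (f x))"
  unfolding cis_conv_exp by (intro continuous_intros)

lemma borel_measurable_cis [measurable]: "cis \<in> borel_measurable borel"
  by (intro borel_measurable_continuous_onI continuous_intros)

lemma gauss_ft_real:
  fixes y :: real
  shows "integrable lborel (\<lambda>x. exp (complex_of_real (- (x\<^sup>2 / 2)) + \<i> * complex_of_real (x * y)))"
    and "(\<integral>x. exp (complex_of_real (- (x\<^sup>2 / 2)) + \<i> * complex_of_real (x * y)) \<partial>lborel)
      = complex_of_real (sqrt (2 * pi) * exp (- (y\<^sup>2 / 2)))"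
proof -
  have eq: "exp (complex_of_real (- (x\<^sup>2 / 2)) + \<i> * complex_of_real (x * y))
     = sqrt (2 * pi) *\<^sub>R (std_normal_density x *\<^sub>R iexp (y * x))" for x
  proof -
    have "exp (complex_of_real (- (x\<^sup>2 / 2)) + \<i> * complex_of_real (x * y)) = complex_of_real (exp (- (x\<^sup>2 / 2))) * iexp (x * y)"
      by (simp only: exp_add exp_of_real)
    then show ?thesis by (simp add: std_normal_density_def scaleR_conv_of_real mult.commute)
  qed
  have i: "integrable lborel (\<lambda>x. std_normal_density x *\<^sub>R iexp (y * x))"
  proof (rule Bochner_Integration.integrable_bound)
    show "integrable lborel std_normal_density" using integrable_std_normal_moment_abs[of 0] by simp
    show "AE x in lborel. norm (std_normal_density x *\<^sub>R iexp (y * x)) \<le> norm (std_normal_density x)" by simp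
  qed measurable
  then show "integrable lborel (\<lambda>x. exp (complex_of_real (- (x\<^sup>2 / 2)) + \<i> * complex_of_real (x * y)))"
    unfolding eq by (rule integrable_scaleR_right)
  have "(\<integral>x. std_normal_density x *\<^sub>R iexp (y * x) \<partial>lborel) = char std_normal_distribution y"
    unfolding char_def by (subst integral_density) (auto intro!: borel_measurable_continuous_onI continuous_intros)
  also have "\<dots> = complex_of_real (exp (- (y\<^sup>2) / 2))" by (simp add: char_std_normal_distribution)
  finally show "(\<integral>x. exp (complex_of_real (- (x\<^sup>2 / 2)) + \<i> * complex_of_real (x * y)) \<partial>lborel)
      = complex_of_real (sqrt (2 * pi) * exp (- (y\<^sup>2 / 2)))"
    unfolding eq using i by (simp add: scaleR_conv_of_real)
qed

lemma gauss_ft_unit: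
  fixes z :: "'a::euclidean_space"
  shows "integrable lborel (\<lambda>u. complex_of_real (gauss 1 u) * cis (u \<bullet> z))"
    and "(\<integral>u. complex_of_real (gauss 1 u) * cis (u \<bullet> z) \<partial>lborel) = complex_of_real (sqrt (2 * pi) ^ DIM('a) * gauss 1 z)"
proof -
  have n2: "(norm u)\<^sup>2 = (\<Sum>b\<in>Basis. (u \<bullet> b)\<^sup>2)" for u :: 'a
    unfolding power2_norm_eq_inner by (subst euclidean_inner) (simp add: power2_eq_square)
  have eq: "complex_of_real (gauss 1 u) * cis (u \<bullet> z)
    = (\<Prod>b\<in>Basis. exp (complex_of_real (- ((u \<bullet> b)\<^sup>2 / 2)) + \<i> * complex_of_real ((u \<bullet> b) * (z \<bullet> b))))" for u
  proof -
    have "complex_of_real (gauss 1 u) * cis (u \<bullet> z) = exp (complex_of_real (- (norm u)\<^sup>2 / 2) + \<i> * complex_of_real (u \<bullet> z))"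
      by (simp only: gauss_def cis_conv_exp exp_add exp_of_real) simp
    also have "complex_of_real (- (norm u)\<^sup>2 / 2) + \<i> * complex_of_real (u \<bullet> z)
       = (\<Sum>b\<in>Basis. complex_of_real (- ((u \<bullet> b)\<^sup>2 / 2)) + \<i> * complex_of_real ((u \<bullet> b) * (z \<bullet> b)))"
      unfolding n2 euclidean_inner[of u z] by (simp add: sum_subtractf sum_distrib_left sum_negf sum_divide_distrib)
    also have "exp \<dots> = (\<Prod>b\<in>Basis. exp (complex_of_real (- ((u \<bullet> b)\<^sup>2 / 2)) + \<i> * complex_of_real ((u \<bullet> b) * (z \<bullet> b))))"
      by (rule exp_sum) simp
    finally show ?thesis .
  qed
  show "integrable lborel (\<lambda>u. complex_of_real (gauss 1 u) * cis (u \<bullet> z))"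
    unfolding eq by (rule integrable_lborel_prod) (rule gauss_ft_real)
  have "(\<integral>u. complex_of_real (gauss 1 u) * cis (u \<bullet> z) \<partial>lborel) = (\<Prod>b\<in>(Basis::'a set). complex_of_real (sqrt (2 * pi) * exp (- ((z \<bullet> b)\<^sup>2 / 2))))"
    unfolding eq using gauss_ft_real by (subst integral_lborel_prod) (auto simp del: of_real_mult)
  also have "\<dots> = complex_of_real (sqrt (2 * pi) ^ DIM('a) * exp (\<Sum>b\<in>Basis. - ((z \<bullet> b)\<^sup>2 / 2)))"
    unfolding exp_sum[OF finite_Basis] by (simp add: prod.distrib)
  also have "(\<Sum>b\<in>Basis. - ((z \<bullet> b)\<^sup>2 / 2)) = - ((norm z)\<^sup>2 / 2)"
    unfolding n2 by (simp add: sum_negf sum_divide_distrib)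
  finally show "(\<integral>u. complex_of_real (gauss 1 u) * cis (u \<bullet> z) \<partial>lborel) = complex_of_real (sqrt (2 * pi) ^ DIM('a) * gauss 1 z)"
    by (simp add: gauss_def)
qed

lemma gauss_ft:
  fixes z :: "'a::euclidean_space"
  assumes \<tau>: "\<tau> > 0"
  shows "integrable lborel (\<lambda>u. complex_of_real (gauss \<tau> u) * cis (u \<bullet> z))"
    and "(\<integral>u. complex_of_real (gauss \<tau> u) * cis (u \<bullet> z) \<partial>lborel) = complex_of_real ((sqrt (2 * pi) / \<tau>) ^ DIM('a) * gauss (1 / \<tau>) z)"
proof -
  let ?f = "\<lambda>u::'a. complex_of_real (gauss 1 u) * cis (u \<bullet> ((1 / \<tau>) *\<^sub>R z))"
  have eq: "?f (0 + \<tau> *\<^sub>R u) = complex_of_real (gauss \<tau> u) * cis (u \<bullet> z)" for u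
    using \<tau> by (simp add: gauss_def power_mult_distrib)
  show "integrable lborel (\<lambda>u. complex_of_real (gauss \<tau> u) * cis (u \<bullet> z))"
    using integrable_lborel_affine[OF gauss_ft_unit(1)[of "(1 / \<tau>) *\<^sub>R z"], of \<tau> 0] \<tau> unfolding eq by simp
  have "complex_of_real (sqrt (2 * pi) ^ DIM('a) * gauss 1 ((1 / \<tau>) *\<^sub>R z)) = \<tau> ^ DIM('a) *\<^sub>R (\<integral>u. complex_of_real (gauss \<tau> u) * cis (u \<bullet> z) \<partial>lborel)"
    using integral_lborel_affine[of \<tau> ?f 0] gauss_ft_unit(2)[of "(1 / \<tau>) *\<^sub>R z"] \<tau> unfolding eq by simp
  moreover have "gauss 1 ((1 / \<tau>) *\<^sub>R z) = gauss (1 / \<tau>) z" using \<tau> by (simp add: gauss_def power_divide)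
  ultimately show "(\<integral>u. complex_of_real (gauss \<tau> u) * cis (u \<bullet> z) \<partial>lborel) = complex_of_real ((sqrt (2 * pi) / \<tau>) ^ DIM('a) * gauss (1 / \<tau>) z)"
    using \<tau> by (simp add: scaleR_conv_of_real power_divide field_simps)
qed

lemma
  assumes "\<tau> > 0"
  shows integrable_gauss: "integrable lborel (gauss \<tau> :: 'a::euclidean_space \<Rightarrow> real)"
    and integral_gauss: "(\<integral>u. gauss \<tau> (u::'a) \<partial>lborel) = (sqrt (2 * pi) / \<tau>) ^ DIM('a)"
proof -
  have i: "integrable lborel (\<lambda>u::'a. complex_of_real (gauss \<tau> u))"
    using gauss_ft(1)[OF assms, of "0::'a"] by simp
  then show "integrable lborel (gauss \<tau> :: 'a \<Rightarrow> real)" by (simp add: complex_of_real_integrable_eq)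
  have "complex_of_real (\<integral>u. gauss \<tau> (u::'a) \<partial>lborel) = complex_of_real ((sqrt (2 * pi) / \<tau>) ^ DIM('a))"
    using gauss_ft(2)[OF assms, of "0::'a"] by (simp add: gauss_def)
  then show "(\<integral>u. gauss \<tau> (u::'a) \<partial>lborel) = (sqrt (2 * pi) / \<tau>) ^ DIM('a)" by (simp only: of_real_eq_iff)
qed

text \<open>Dominated by the product of \<open>f\<close> and \<open>g\<close>. With
  \<open>cis\<close> as the bounded kernel this is the form in which Fubini's theorem is applied to
  Fourier integrals.\<close>

lemma integrable_pair_bounded:
  fixes f :: "'a::euclidean_space \<Rightarrow> complex" and g :: "'b::euclidean_space \<Rightarrow> complex"
  assumes f: "integrable lborel f" and g: "integrable lborel g"
    and [measurable]: "k \<in> borel_measurable lborel2" and k: "\<And>p. norm (k p) \<le> 1"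
  shows "integrable lborel2 (\<lambda>(x, y). f x * g y * k (x, y))"
proof (rule lborel_pair.Fubini_integrable)
  note [measurable] = borel_measurable_integrable[OF f] borel_measurable_integrable[OF g]
  show "(\<lambda>(x, y). f x * g y * k (x, y)) \<in> borel_measurable lborel2" by measurable
  have inner: "integrable lborel (\<lambda>y. f x * g y * k (x, y))" for x
  proof (rule Bochner_Integration.integrable_bound)
    show "integrable lborel (\<lambda>y. f x * g y)" using g by simp
    show "AE y in lborel. norm (f x * g y * k (x, y)) \<le> norm (f x * g y)"
    proof (rule AE_I2)
      fix y show "norm (f x * g y * k (x, y)) \<le> norm (f x * g y)"
        using mult_left_mono[OF k[of "(x, y)"], of "norm (f x * g y)"] by (simp add: norm_mult)
    qed
  qed measurable
  then show "AE x in lborel. integrable lborel (\<lambda>y. case (x, y) of (x, y) \<Rightarrow> f x * g y * k (x, y))" by simp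
  show "integrable lborel (\<lambda>x. \<integral>y. norm (case (x, y) of (x, y) \<Rightarrow> f x * g y * k (x, y)) \<partial>lborel)"
  proof (rule Bochner_Integration.integrable_bound)
    show "integrable lborel (\<lambda>x. norm (f x) * (\<integral>y. norm (g y) \<partial>lborel))" using f by simp
    show "AE x in lborel. norm (\<integral>y. norm (case (x, y) of (x, y) \<Rightarrow> f x * g y * k (x, y)) \<partial>lborel) \<le> norm (norm (f x) * (\<integral>y. norm (g y) \<partial>lborel))"
    proof (rule AE_I2)
      fix x
      have "(\<integral>y. norm (f x * g y * k (x, y)) \<partial>lborel) \<le> (\<integral>y. norm (f x) * norm (g y) \<partial>lborel)"
      proof (rule integral_mono)
        fix y show "norm (f x * g y * k (x, y)) \<le> norm (f x) * norm (g y)"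
          using mult_left_mono[OF k[of "(x, y)"], of "norm (f x * g y)"] by (simp add: norm_mult)
      qed (use inner g in auto)
      then show "norm (\<integral>y. norm (case (x, y) of (x, y) \<Rightarrow> f x * g y * k (x, y)) \<partial>lborel) \<le> norm (norm (f x) * (\<integral>y. norm (g y) \<partial>lborel))"
        by (simp add: abs_mult)
    qed
  qed measurable
qed

lemma integral_swap_bounded:
  fixes f :: "'a::euclidean_space \<Rightarrow> complex" and g :: "'b::euclidean_space \<Rightarrow> complex"
  assumes "integrable lborel f" "integrable lborel g"
    and "k \<in> borel_measurable lborel2" "\<And>p. norm (k p) \<le> 1"
  shows "(\<integral>x. f x * (\<integral>y. g y * k (x, y) \<partial>lborel) \<partial>lborel) = (\<integral>y. g y * (\<integral>x. f x * k (x, y) \<partial>lborel) \<partial>lborel)"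
proof -
  have "(\<integral>y. (\<integral>x. f x * g y * k (x, y) \<partial>lborel) \<partial>lborel) = (\<integral>x. (\<integral>y. f x * g y * k (x, y) \<partial>lborel) \<partial>lborel)"
    using lborel_pair.Fubini_integral[OF integrable_pair_bounded[OF assms]] by simp
  moreover have "(\<integral>y. f x * g y * k (x, y) \<partial>lborel) = f x * (\<integral>y. g y * k (x, y) \<partial>lborel)" for x
    by (simp add: mult.assoc)
  moreover have "(\<integral>x. f x * g y * k (x, y) \<partial>lborel) = g y * (\<integral>x. f x * k (x, y) \<partial>lborel)" for y
    by (subst integral_mult_right_zero[symmetric]) (simp add: mult_ac)
  ultimately show ?thesis by simp
qed

text \<open>Unnormalised, which is the origin of the powers of \<open>2 * pi\<close> in inversion
  and in Bessel's inequality.\<close>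

definition ft :: "('a::euclidean_space \<Rightarrow> complex) \<Rightarrow> 'a \<Rightarrow> complex" where
  "ft F \<xi> = (\<integral>y. F y * cis (- (\<xi> \<bullet> y)) \<partial>lborel)"

lemma integrable_ft_kernel:
  assumes "integrable lborel F"
  shows "integrable lborel (\<lambda>y. F y * cis (- (\<xi> \<bullet> y)))"
proof (rule Bochner_Integration.integrable_bound[OF assms])
  note [measurable] = borel_measurable_integrable[OF assms]
  show "(\<lambda>y. F y * cis (- (\<xi> \<bullet> y))) \<in> borel_measurable lborel" by measurable
qed (simp add: norm_mult)

lemma borel_measurable_ft:
  assumes "integrable lborel F"
  shows "ft F \<in> borel_measurable borel"
proof -
  note [measurable] = borel_measurable_integrable[OF assms]
  have "(\<lambda>\<xi>. \<integral>y. F y * cis (- (\<xi> \<bullet> y)) \<partial>lborel) \<in> borel_measurable lborel"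
    by (rule lborel.borel_measurable_lebesgue_integral) measurable
  then show ?thesis by (simp add: ft_def[abs_def])
qed

lemma norm_ft_le:
  assumes "integrable lborel F"
  shows "norm (ft F \<xi>) \<le> (\<integral>y. norm (F y) \<partial>lborel)"
proof -
  have "norm (ft F \<xi>) \<le> (\<integral>y. norm (F y * cis (- (\<xi> \<bullet> y))) \<partial>lborel)"
    unfolding ft_def by (rule integral_norm_bound)
  then show ?thesis by (simp add: norm_mult)
qed

text \<open>Regularised Fourier inversion: by Fubini the integral is a convolution of
  \<open>F\<close> with the transform of a Gaussian, again a Gaussian. The weight makes it converge
  absolutely even if \<open>ft F\<close> is not integrable.\<close>

lemma gauss_mean_ft:
  fixes F :: "'a::euclidean_space \<Rightarrow> complex"
  assumes F: "integrable lborel F" and \<tau>: "\<tau> > 0"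
  shows "(\<integral>\<xi>. complex_of_real (gauss \<tau> \<xi>) * ft F \<xi> * cis (\<xi> \<bullet> x) \<partial>lborel)
     = complex_of_real (sqrt (2 * pi) ^ DIM('a)) * (\<integral>u. complex_of_real (gauss 1 u) * F (x + \<tau> *\<^sub>R u) \<partial>lborel)"
proof -
  have ig: "integrable lborel (\<lambda>\<xi>::'a. complex_of_real (gauss \<tau> \<xi>))" using integrable_gauss[OF \<tau>] by (simp add: complex_of_real_integrable_eq)
  have "(\<integral>\<xi>. complex_of_real (gauss \<tau> \<xi>) * ft F \<xi> * cis (\<xi> \<bullet> x) \<partial>lborel)
      = (\<integral>\<xi>. complex_of_real (gauss \<tau> \<xi>) * (\<integral>y. F y * cis (\<xi> \<bullet> (x - y)) \<partial>lborel) \<partial>lborel)"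
  proof (intro Bochner_Integration.integral_cong refl)
    fix \<xi> :: 'a
    have "ft F \<xi> * cis (\<xi> \<bullet> x) = (\<integral>y. F y * cis (- (\<xi> \<bullet> y)) * cis (\<xi> \<bullet> x) \<partial>lborel)"
      unfolding ft_def by (rule integral_mult_left_zero[symmetric])
    also have "\<dots> = (\<integral>y. F y * cis (\<xi> \<bullet> (x - y)) \<partial>lborel)"
      by (simp add: mult.assoc cis_mult inner_diff_right)
    finally show "complex_of_real (gauss \<tau> \<xi>) * ft F \<xi> * cis (\<xi> \<bullet> x) = complex_of_real (gauss \<tau> \<xi>) * (\<integral>y. F y * cis (\<xi> \<bullet> (x - y)) \<partial>lborel)"
      by (simp add: mult.assoc)
  qed
  also have "\<dots> = (\<integral>y. F y * (\<integral>\<xi>. complex_of_real (gauss \<tau> \<xi>) * cis (\<xi> \<bullet> (x - y)) \<partial>lborel) \<partial>lborel)"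
    using integral_swap_bounded[OF ig F, of "\<lambda>(\<xi>, y). cis (\<xi> \<bullet> (x - y))"] by (simp add: case_prod_unfold)
  also have "\<dots> = (\<integral>y. F y * complex_of_real ((sqrt (2 * pi) / \<tau>) ^ DIM('a) * gauss (1 / \<tau>) (x - y)) \<partial>lborel)"
    by (simp only: gauss_ft(2)[OF \<tau>])
  also have "\<dots> = \<bar>\<tau>\<bar> ^ DIM('a) *\<^sub>R (\<integral>u. F (x + \<tau> *\<^sub>R u) * complex_of_real ((sqrt (2 * pi) / \<tau>) ^ DIM('a) * gauss (1 / \<tau>) (x - (x + \<tau> *\<^sub>R u))) \<partial>lborel)"
    using \<tau> by (intro integral_lborel_affine) auto
  also have "(\<lambda>u::'a. F (x + \<tau> *\<^sub>R u) * complex_of_real ((sqrt (2 * pi) / \<tau>) ^ DIM('a) * gauss (1 / \<tau>) (x - (x + \<tau> *\<^sub>R u))))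
     = (\<lambda>u. complex_of_real ((sqrt (2 * pi) / \<tau>) ^ DIM('a)) * (complex_of_real (gauss 1 u) * F (x + \<tau> *\<^sub>R u)))"
    using \<tau> by (auto simp: gauss_def power_divide power_mult_distrib)
  finally show ?thesis using \<tau>
    by (simp only: integral_mult_right_zero) (simp add: scaleR_conv_of_real power_divide)
qed

text \<open>Bessel's inequality with a Gaussian weight; the weight makes Fubini's theorem applicable, and
  its Fourier transform is a positive kernel of mass \<open>(2 * pi) ^ DIM('a)\<close>.\<close>

lemma gauss_bessel:
  fixes F :: "'a::euclidean_space \<Rightarrow> complex"
  assumes F: "integrable lborel F" and F2: "integrable lborel (\<lambda>y. (norm (F y))\<^sup>2)" and \<tau>: "\<tau> > 0"
  shows "integrable lborel (\<lambda>\<xi>. gauss \<tau> \<xi> * (norm (ft F \<xi>))\<^sup>2)"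
    and "(\<integral>\<xi>. gauss \<tau> \<xi> * (norm (ft F \<xi>))\<^sup>2 \<partial>lborel) \<le> (2 * pi) ^ DIM('a) * (\<integral>y. (norm (F y))\<^sup>2 \<partial>lborel)"
proof -
  note [measurable] = borel_measurable_integrable[OF F] borel_measurable_ft[OF F]
  let ?c = "(sqrt (2 * pi) / \<tau>) ^ DIM('a)"
  have ig: "integrable lborel (gauss \<tau> :: 'a \<Rightarrow> real)" by (rule integrable_gauss[OF \<tau>])
  define B where "B = (\<integral>y. norm (F y) \<partial>lborel)"
  show i: "integrable lborel (\<lambda>\<xi>. gauss \<tau> \<xi> * (norm (ft F \<xi>))\<^sup>2)"
  proof (rule Bochner_Integration.integrable_bound)
    show "integrable lborel (\<lambda>\<xi>::'a. gauss \<tau> \<xi> * B\<^sup>2)" using ig by simp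
    show "AE \<xi> in lborel. norm (gauss \<tau> \<xi> * (norm (ft F \<xi>))\<^sup>2) \<le> norm (gauss \<tau> \<xi> * B\<^sup>2)"
      using norm_ft_le[OF F] gauss_pos by (auto simp: B_def abs_mult less_imp_le intro!: mult_left_mono power_mono)
  qed measurable
  define c where "c = (\<integral>\<xi>. gauss \<tau> \<xi> * (norm (ft F \<xi>))\<^sup>2 \<partial>lborel)"
  have c0: "c \<ge> 0" unfolding c_def by (intro Bochner_Integration.integral_nonneg) (simp add: gauss_def)
  let ?I = "\<lambda>y. (\<integral>\<xi>. complex_of_real (gauss \<tau> \<xi>) * ft F \<xi> * cis (\<xi> \<bullet> y) \<partial>lborel) * cnj (F y)"
  have igm: "integrable lborel ?I" and eqc: "complex_of_real c = (\<integral>y. ?I y \<partial>lborel)"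
  proof -
    have gf: "integrable lborel (\<lambda>\<xi>. complex_of_real (gauss \<tau> \<xi>) * ft F \<xi>)"
    proof (rule Bochner_Integration.integrable_bound)
      show "integrable lborel (\<lambda>\<xi>::'a. gauss \<tau> \<xi> * B)" using ig by simp
      show "AE \<xi> in lborel. norm (complex_of_real (gauss \<tau> \<xi>) * ft F \<xi>) \<le> norm (gauss \<tau> \<xi> * B)"
        using norm_ft_le[OF F] gauss_pos by (auto simp: B_def norm_mult abs_mult less_imp_le intro!: mult_mono)
    qed measurable
    have cF: "integrable lborel (\<lambda>y. cnj (F y))" using F by simp
    have k: "(\<lambda>(\<xi>, y). cis (\<xi> \<bullet> y)) \<in> borel_measurable (lborel2 :: ('a \<times> 'a) measure)" by measurable
    have "integrable lborel2 (\<lambda>(\<xi>, y). complex_of_real (gauss \<tau> \<xi>) * ft F \<xi> * cnj (F y) * (case (\<xi>, y) of (\<xi>, y) \<Rightarrow> cis (\<xi> \<bullet> y)))"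
      by (rule integrable_pair_bounded[OF gf cF k]) auto
    from lborel_pair.integrable_snd[OF this]
    have "integrable lborel (\<lambda>y. \<integral>\<xi>. complex_of_real (gauss \<tau> \<xi>) * ft F \<xi> * cnj (F y) * cis (\<xi> \<bullet> y) \<partial>lborel)" by simp
    moreover have "(\<lambda>y. \<integral>\<xi>. complex_of_real (gauss \<tau> \<xi>) * ft F \<xi> * cnj (F y) * cis (\<xi> \<bullet> y) \<partial>lborel) = ?I"
      by (intro ext, subst integral_mult_left_zero[symmetric]) (simp add: mult_ac)
    ultimately show "integrable lborel ?I" by simp
    have cnjft: "cnj (ft F \<xi>) = (\<integral>y. cnj (F y) * cis (\<xi> \<bullet> y) \<partial>lborel)" for \<xi>
    proof -
      have "cnj (ft F \<xi>) = (\<integral>y. cnj (F y * cis (- (\<xi> \<bullet> y))) \<partial>lborel)" unfolding ft_def by (simp del: complex_cnj_mult)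
      then show ?thesis by (simp add: cis_cnj)
    qed
    have "complex_of_real c = (\<integral>\<xi>. complex_of_real (gauss \<tau> \<xi>) * ft F \<xi> * cnj (ft F \<xi>) \<partial>lborel)"
      unfolding c_def mult.assoc complex_norm_square[symmetric] by (subst integral_complex_of_real[symmetric]) simp
    also have "\<dots> = (\<integral>\<xi>. complex_of_real (gauss \<tau> \<xi>) * ft F \<xi> * (\<integral>y. cnj (F y) * cis (\<xi> \<bullet> y) \<partial>lborel) \<partial>lborel)" by (simp only: cnjft)
    also have "\<dots> = (\<integral>y. cnj (F y) * (\<integral>\<xi>. complex_of_real (gauss \<tau> \<xi>) * ft F \<xi> * cis (\<xi> \<bullet> y) \<partial>lborel) \<partial>lborel)"
      using integral_swap_bounded[OF gf cF k] by (simp add: case_prod_unfold)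
    finally show "complex_of_real c = (\<integral>y. ?I y \<partial>lborel)" by (simp add: mult.commute)
  qed
  let ?s = "sqrt (2 * pi) ^ DIM('a)"
  have Ib: "norm (?I y) \<le> ?s * (\<integral>u. gauss 1 u * norm (F (y + \<tau> *\<^sub>R u)) \<partial>lborel) * norm (F y)" for y
  proof -
    have "norm (\<integral>u. complex_of_real (gauss 1 u) * F (y + \<tau> *\<^sub>R u) \<partial>lborel) \<le> (\<integral>u. norm (complex_of_real (gauss 1 u) * F (y + \<tau> *\<^sub>R u)) \<partial>lborel)"
      by (rule integral_norm_bound)
    also have "\<dots> = (\<integral>u. gauss 1 u * norm (F (y + \<tau> *\<^sub>R u)) \<partial>lborel)"
      by (simp add: norm_mult abs_of_pos[OF gauss_pos])
    finally show ?thesis unfolding gauss_mean_ft[OF F \<tau>] norm_mult complex_mod_cnj norm_of_real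
      by (intro mult_right_mono) (auto intro!: mult_left_mono)
  qed
  have "ennreal c = ennreal (norm (\<integral>y. ?I y \<partial>lborel))" using eqc c0 by (metis abs_of_nonneg norm_of_real)
  also have "\<dots> \<le> (\<integral>\<^sup>+y. norm (?I y) \<partial>lborel)" by (rule integral_norm_bound_ennreal[OF igm])
  \<comment> \<open>The product of a shifted and an unshifted value of \<open>F\<close> is split by
    \<open>2 * a * b \<le> a^2 + b^2\<close>; after Fubini, translation invariance turns both
    squares into the same integral.\<close>
  also have "\<dots> \<le> (\<integral>\<^sup>+y. \<integral>\<^sup>+u. ennreal (?s * gauss 1 u * (((norm (F (y + \<tau> *\<^sub>R u)))\<^sup>2 + (norm (F y))\<^sup>2) / 2)) \<partial>lborel \<partial>lborel)"
  proof (rule nn_integral_mono)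
    fix y
    have nn: "0 \<le> gauss 1 u * norm (F (y + \<tau> *\<^sub>R u))" for u using gauss_pos[of 1 u] by (simp add: less_imp_le)
    have "ennreal (norm (?I y)) \<le> ennreal (?s * (\<integral>u. gauss 1 u * norm (F (y + \<tau> *\<^sub>R u)) \<partial>lborel) * norm (F y))"
      by (rule ennreal_leI[OF Ib])
    also have "\<dots> = ennreal (\<integral>u. ?s * (gauss 1 u * norm (F (y + \<tau> *\<^sub>R u))) * norm (F y) \<partial>lborel)" by simp
    also have "\<dots> \<le> (\<integral>\<^sup>+u. ennreal (?s * (gauss 1 u * norm (F (y + \<tau> *\<^sub>R u))) * norm (F y)) \<partial>lborel)"
    proof (cases "integrable lborel (\<lambda>u. ?s * (gauss 1 u * norm (F (y + \<tau> *\<^sub>R u))) * norm (F y))")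
      case True
      then show ?thesis using nn by (subst nn_integral_eq_integral) auto
    qed (simp add: not_integrable_integral_eq)
    also have "\<dots> \<le> (\<integral>\<^sup>+u. ennreal (?s * gauss 1 u * (((norm (F (y + \<tau> *\<^sub>R u)))\<^sup>2 + (norm (F y))\<^sup>2) / 2)) \<partial>lborel)"
    proof (intro nn_integral_mono ennreal_leI)
      fix u
      have "2 * (norm (F (y + \<tau> *\<^sub>R u)) * norm (F y)) \<le> (norm (F (y + \<tau> *\<^sub>R u)))\<^sup>2 + (norm (F y))\<^sup>2"
        using sum_squares_bound[of "norm (F (y + \<tau> *\<^sub>R u))" "norm (F y)"] by simp
      then have "norm (F (y + \<tau> *\<^sub>R u)) * norm (F y) \<le> ((norm (F (y + \<tau> *\<^sub>R u)))\<^sup>2 + (norm (F y))\<^sup>2) / 2" by simp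
      then have "(?s * gauss 1 u) * (norm (F (y + \<tau> *\<^sub>R u)) * norm (F y)) \<le> (?s * gauss 1 u) * (((norm (F (y + \<tau> *\<^sub>R u)))\<^sup>2 + (norm (F y))\<^sup>2) / 2)"
        using gauss_pos[of 1 u] by (intro mult_left_mono) (auto simp: less_imp_le)
      then show "?s * (gauss 1 u * norm (F (y + \<tau> *\<^sub>R u))) * norm (F y) \<le> ?s * gauss 1 u * (((norm (F (y + \<tau> *\<^sub>R u)))\<^sup>2 + (norm (F y))\<^sup>2) / 2)"
        by (simp only: mult.assoc)
    qed
    finally show "ennreal (norm (?I y)) \<le> (\<integral>\<^sup>+u. ennreal (?s * gauss 1 u * (((norm (F (y + \<tau> *\<^sub>R u)))\<^sup>2 + (norm (F y))\<^sup>2) / 2)) \<partial>lborel)" .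
  qed
  also have "\<dots> = (\<integral>\<^sup>+u. \<integral>\<^sup>+y. ennreal (?s * gauss 1 u * (((norm (F (y + \<tau> *\<^sub>R u)))\<^sup>2 + (norm (F y))\<^sup>2) / 2)) \<partial>lborel \<partial>lborel)"
    by (rule lborel_pair.Fubini') measurable
  also have "\<dots> = (\<integral>\<^sup>+u. ennreal (?s * gauss 1 (u::'a) * (\<integral>y. (norm (F y))\<^sup>2 \<partial>lborel)) \<partial>lborel)"
  proof (intro nn_integral_cong)
    fix u :: 'a
    have tr: "integrable lborel (\<lambda>y. (norm (F (y + \<tau> *\<^sub>R u)))\<^sup>2)" "(\<integral>y. (norm (F (y + \<tau> *\<^sub>R u)))\<^sup>2 \<partial>lborel) = (\<integral>y. (norm (F y))\<^sup>2 \<partial>lborel)"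
      using integrable_lborel_affine[OF F2, of 1 "\<tau> *\<^sub>R u"] integral_lborel_affine[of 1 "\<lambda>y. (norm (F y))\<^sup>2" "\<tau> *\<^sub>R u"]
      by (simp_all add: add.commute)
    have "(\<integral>\<^sup>+y. ennreal (?s * gauss 1 u * (((norm (F (y + \<tau> *\<^sub>R u)))\<^sup>2 + (norm (F y))\<^sup>2) / 2)) \<partial>lborel)
       = ennreal (\<integral>y. ?s * gauss 1 u * (((norm (F (y + \<tau> *\<^sub>R u)))\<^sup>2 + (norm (F y))\<^sup>2) / 2) \<partial>lborel)"
      using tr F2 gauss_pos[of 1 u] by (intro nn_integral_eq_integral) (auto simp: less_imp_le)
    also have "(\<integral>y. ?s * gauss 1 u * (((norm (F (y + \<tau> *\<^sub>R u)))\<^sup>2 + (norm (F y))\<^sup>2) / 2) \<partial>lborel) = ?s * gauss 1 u * (\<integral>y. (norm (F y))\<^sup>2 \<partial>lborel)"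
      using tr F2 by simp
    finally show "(\<integral>\<^sup>+y. ennreal (?s * gauss 1 u * (((norm (F (y + \<tau> *\<^sub>R u)))\<^sup>2 + (norm (F y))\<^sup>2) / 2)) \<partial>lborel)
       = ennreal (?s * gauss 1 u * (\<integral>y. (norm (F y))\<^sup>2 \<partial>lborel))" .
  qed
  also have "\<dots> = ennreal (\<integral>u. ?s * gauss 1 (u::'a) * (\<integral>y. (norm (F y))\<^sup>2 \<partial>lborel) \<partial>lborel)"
    using integrable_gauss[of 1, where 'a = 'a] by (intro nn_integral_eq_integral) (auto simp: less_imp_le[OF gauss_pos] intro!: AE_I2 mult_nonneg_nonneg)
  also have "(\<integral>u. ?s * gauss 1 (u::'a) * (\<integral>y. (norm (F y))\<^sup>2 \<partial>lborel) \<partial>lborel) = (2 * pi) ^ DIM('a) * (\<integral>y. (norm (F y))\<^sup>2 \<partial>lborel)"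
  proof -
    have "?s * ?s = (2 * pi) ^ DIM('a)" 
      unfolding power_mult_distrib[symmetric] by simp
    moreover have "(\<integral>u. ?s * gauss 1 (u::'a) * (\<integral>y. (norm (F y))\<^sup>2 \<partial>lborel) \<partial>lborel) = ?s * (\<integral>u. gauss 1 (u::'a) \<partial>lborel) * (\<integral>y. (norm (F y))\<^sup>2 \<partial>lborel)"
      by simp
    ultimately show ?thesis using integral_gauss[of 1, where 'a = 'a] by simp
  qed
  finally show "(\<integral>\<xi>. gauss \<tau> \<xi> * (norm (ft F \<xi>))\<^sup>2 \<partial>lborel) \<le> (2 * pi) ^ DIM('a) * (\<integral>y. (norm (F y))\<^sup>2 \<partial>lborel)"
    unfolding c_def by (subst (asm) ennreal_le_iff) auto
qed

subsection \<open>Finite differences\<close>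

primrec fdiff :: "nat \<Rightarrow> 'a::real_vector \<Rightarrow> ('a \<Rightarrow> 'b::real_vector) \<Rightarrow> 'a \<Rightarrow> 'b" where
  "fdiff 0 h f x = f x"
| "fdiff (Suc m) h f x = fdiff m h f (x + h) - fdiff m h f x"

lemma fdiff_Suc_inner: "fdiff (Suc m) h f x = fdiff m h (\<lambda>y. f (y + h) - f y) x"
  by (induction m arbitrary: x) auto

lemma fdiff_add: "fdiff m h (\<lambda>x. f x + g x) x = fdiff m h f x + fdiff m h g x"
  by (induction m arbitrary: x) auto

lemma fdiff_sum: "finite A \<Longrightarrow> fdiff m h (\<lambda>x. \<Sum>a\<in>A. f a x) x = (\<Sum>a\<in>A. fdiff m h (f a) x)"
  by (induction m arbitrary: x) (auto simp: sum_subtractf)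

lemma fdiff_mult_left: "fdiff m h (\<lambda>x. c * f x) x = (c::real) * fdiff m h f x"
  by (induction m arbitrary: x) (auto simp: algebra_simps)

text \<open>The coefficients are signed binomial coefficients. Being independent of
  \<open>f\<close>, \<open>h\<close> and \<open>x\<close> they can also define
  \<open>symbol\<close>, where \<open>c 0\<close> isolates the value at the point itself.\<close>

lemma fdiff_expand:
  "\<exists>c::nat \<Rightarrow> real. c 0 = (-1) ^ m \<and> (\<forall>(f :: 'a::real_vector \<Rightarrow> 'b::real_vector) h x.
     fdiff m h f x = (\<Sum>i\<le>m. c i *\<^sub>R f (x + real i *\<^sub>R h)))"
proof (induction m)
  case 0
  show ?case by (intro exI[of _ "\<lambda>_. 1"]) auto
next
  case (Suc m)
  then obtain c :: "nat \<Rightarrow> real" where c: "c 0 = (-1) ^ m" "\<And>(f :: 'a \<Rightarrow> 'b) h x. fdiff m h f x = (\<Sum>i\<le>m. c i *\<^sub>R f (x + real i *\<^sub>R h))"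
    by blast
  define c' where "c' = (\<lambda>i. (if i = 0 then 0 else c (i - 1)) - (if i \<le> m then c i else 0))"
  have "fdiff (Suc m) h f x = (\<Sum>i\<le>Suc m. c' i *\<^sub>R f (x + real i *\<^sub>R h))" for f :: "'a \<Rightarrow> 'b" and h x
  proof -
    have a: "(\<Sum>i\<le>Suc m. (if i = 0 then 0 else c (i - 1)) *\<^sub>R f (x + real i *\<^sub>R h)) = (\<Sum>i\<le>m. c i *\<^sub>R f (x + h + real i *\<^sub>R h))"
      by (subst sum.atMost_Suc_shift) (auto simp: algebra_simps intro!: sum.cong)
    have b: "(\<Sum>i\<le>Suc m. (if i \<le> m then c i else 0) *\<^sub>R f (x + real i *\<^sub>R h)) = (\<Sum>i\<le>m. c i *\<^sub>R f (x + real i *\<^sub>R h))"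
      by (simp add: sum.atMost_Suc)
    show ?thesis unfolding c'_def scaleR_left_diff_distrib sum_subtractf a b by (simp add: c(2))
  qed
  moreover have "c' 0 = (-1) ^ Suc m" by (simp add: c'_def c(1))
  ultimately show ?case by blast
qed

text \<open>Discrete Leibniz rule: one difference of a product is a difference of either factor
  times a (shifted) value of the other, so \<open>m\<close> of them give \<open>2 ^ m\<close> terms,
  each with \<open>i\<close> differences on \<open>f\<close> and \<open>m - i\<close> on
  \<open>g\<close>. The bounds are uniform in \<open>x\<close>, so shifts are harmless.\<close>

lemma fdiff_mult_bound:
  fixes f g :: "'a::real_vector \<Rightarrow> real"
  assumes "\<And>i x. i \<le> m \<Longrightarrow> \<bar>fdiff i h f x\<bar> \<le> u i" "\<And>j x. j \<le> m \<Longrightarrow> \<bar>fdiff j h g x\<bar> \<le> w j"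
    and "\<And>i. i \<le> m \<Longrightarrow> u i * w (m - i) \<le> K"
  shows "\<bar>fdiff m h (\<lambda>x. f x * g x) x\<bar> \<le> 2 ^ m * K"
  using assms
proof (induction m arbitrary: f g u w x)
  case 0
  have "\<bar>f x\<bar> * \<bar>g x\<bar> \<le> u 0 * w 0" using 0(1)[of 0 x] 0(2)[of 0 x] by (intro mult_mono) auto
  then show ?case using 0(3)[of 0] by (simp add: abs_mult)
next
  case (Suc m)
  have shift: "fdiff j h (\<lambda>y. g (y + h)) y = fdiff j h g (y + h)" for j y by (induction j arbitrary: y) auto
  have "\<bar>fdiff m h (\<lambda>y. (f (y + h) - f y) * g (y + h)) x\<bar> \<le> 2 ^ m * K"
  proof (rule Suc.IH[where u = "\<lambda>i. u (Suc i)" and w = w])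
    show "\<bar>fdiff i h (\<lambda>y. f (y + h) - f y) y\<bar> \<le> u (Suc i)" if "i \<le> m" for i y
      using Suc.prems(1)[of "Suc i" y] that by (simp only: fdiff_Suc_inner)
    show "\<bar>fdiff j h (\<lambda>y. g (y + h)) y\<bar> \<le> w j" if "j \<le> m" for j y
      using Suc.prems(2)[of j "y + h"] that by (simp add: shift)
    show "u (Suc i) * w (m - i) \<le> K" if "i \<le> m" for i using Suc.prems(3)[of "Suc i"] that by simp
  qed
  moreover have "\<bar>fdiff m h (\<lambda>y. f y * (g (y + h) - g y)) x\<bar> \<le> 2 ^ m * K"
  proof (rule Suc.IH[where u = u and w = "\<lambda>i. w (Suc i)"])
    show "\<bar>fdiff i h f y\<bar> \<le> u i" if "i \<le> m" for i y using Suc.prems(1)[of i y] that by simp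
    show "\<bar>fdiff j h (\<lambda>y. g (y + h) - g y) y\<bar> \<le> w (Suc j)" if "j \<le> m" for j y
      using Suc.prems(2)[of "Suc j" y] that by (simp only: fdiff_Suc_inner)
    show "u i * w (Suc (m - i)) \<le> K" if "i \<le> m" for i using Suc.prems(3)[of i] that by (simp add: Suc_diff_le)
  qed
  moreover have "fdiff (Suc m) h (\<lambda>x. f x * g x) x = fdiff m h (\<lambda>y. (f (y + h) - f y) * g (y + h)) x + fdiff m h (\<lambda>y. f y * (g (y + h) - g y)) x"
    unfolding fdiff_Suc_inner fdiff_add[symmetric] by (simp add: algebra_simps)
  ultimately show ?case by simp
qed

lemma fdiff_bounded:
  fixes f :: "'a::real_vector \<Rightarrow> real"
  assumes "\<And>x. \<bar>f x\<bar> \<le> c"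
  shows "\<bar>fdiff m h f x\<bar> \<le> 2 ^ m * c"
proof (induction m arbitrary: x)
  case (Suc m)
  show ?case using Suc.IH[of x] Suc.IH[of "x + h"] unfolding fdiff.simps power_Suc mult.assoc by linarith
qed (simp add: assms)

lemma fdiff_has_derivative:
  fixes F :: "'a::real_normed_vector \<Rightarrow> real"
  assumes "\<And>y. F differentiable (at y)"
  shows "(fdiff j h F has_derivative (\<lambda>k. fdiff j h (\<lambda>y. frechet_derivative F (at y) k) x)) (at x)"
proof (induction j arbitrary: x)
  case 0
  have "fdiff 0 h F = F" by auto
  then show ?case using assms[of x] by (simp add: frechet_derivative_works)
next
  case (Suc j)
  have "((\<lambda>x. fdiff j h F (x + h)) has_derivative (\<lambda>k. fdiff j h (\<lambda>y. frechet_derivative F (at y) k) (x + h))) (at x)"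
  proof -
    have "((\<lambda>x. x + h) has_derivative (\<lambda>k. k)) (at x)" by (auto intro!: derivative_eq_intros)
    from has_derivative_compose[OF this Suc.IH[of "x + h"]] show ?thesis .
  qed
  from has_derivative_diff[OF this Suc.IH[of x]]
  have "((\<lambda>x. fdiff j h F (x + h) - fdiff j h F x) has_derivative (\<lambda>k. fdiff (Suc j) h (\<lambda>y. frechet_derivative F (at y) k) x)) (at x)"
    by simp
  moreover have "(\<lambda>x. fdiff j h F (x + h) - fdiff j h F x) = fdiff (Suc j) h F" by auto
  ultimately show ?case by simp
qed

text \<open>The mean value theorem along the segment in direction \<open>h\<close>, applied to the
  \<open>j\<close>-th difference: one difference is traded for one partial derivative.\<close>

lemma fdiff_mean_value:
  fixes F :: "'a::euclidean_space \<Rightarrow> real"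
  assumes F: "\<And>y. F differentiable (at y)"
  shows "\<exists>z. fdiff (Suc j) h F x = (\<Sum>b\<in>Basis. (h \<bullet> b) * fdiff j h (\<lambda>y. frechet_derivative F (at y) b) z)"
proof -
  define \<phi> where "\<phi> = (\<lambda>t. fdiff j h F (x + t *\<^sub>R h))"
  define G where "G = (\<lambda>z. fdiff j h (\<lambda>y. frechet_derivative F (at y) h) z)"
  have "(\<phi> has_real_derivative G (x + t *\<^sub>R h)) (at t)" for t
  proof -
    have d1: "((\<lambda>t. x + t *\<^sub>R h) has_derivative (\<lambda>s. s *\<^sub>R h)) (at t)" by (auto intro!: derivative_eq_intros)
    have d2: "(fdiff j h F has_derivative (\<lambda>k. fdiff j h (\<lambda>y. frechet_derivative F (at y) k) (x + t *\<^sub>R h))) (at (x + t *\<^sub>R h))"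
      by (rule fdiff_has_derivative[OF F])
    have "(\<phi> has_derivative (\<lambda>s. fdiff j h (\<lambda>y. frechet_derivative F (at y) (s *\<^sub>R h)) (x + t *\<^sub>R h))) (at t)"
      unfolding \<phi>_def using has_derivative_compose[OF d1 d2] by simp
    moreover have "(\<lambda>s. fdiff j h (\<lambda>y. frechet_derivative F (at y) (s *\<^sub>R h)) (x + t *\<^sub>R h)) = (*) (G (x + t *\<^sub>R h))"
    proof
      fix s
      have "frechet_derivative F (at y) (s *\<^sub>R h) = s * frechet_derivative F (at y) h" for y
        using linear_frechet_derivative[OF F[of y]] by (simp add: linear_cmul)
      then show "fdiff j h (\<lambda>y. frechet_derivative F (at y) (s *\<^sub>R h)) (x + t *\<^sub>R h) = G (x + t *\<^sub>R h) * s"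
        by (simp add: G_def fdiff_mult_left)
    qed
    ultimately show ?thesis by (simp add: has_field_derivative_def)
  qed
  then obtain t where t: "\<phi> 1 - \<phi> 0 = (1 - 0) * G (x + t *\<^sub>R h)" using MVT2[of 0 1 \<phi> "\<lambda>t. G (x + t *\<^sub>R h)"] by auto
  have lin: "frechet_derivative F (at y) h = (\<Sum>b\<in>Basis. (h \<bullet> b) * frechet_derivative F (at y) b)" for y
  proof -
    have l: "linear (frechet_derivative F (at y))" by (rule linear_frechet_derivative[OF F])
    have "frechet_derivative F (at y) h = frechet_derivative F (at y) (\<Sum>b\<in>Basis. (h \<bullet> b) *\<^sub>R b)" by (simp add: euclidean_representation)
    also have "\<dots> = (\<Sum>b\<in>Basis. (h \<bullet> b) *\<^sub>R frechet_derivative F (at y) b)" by (simp only: linear_sum[OF l] linear_cmul[OF l])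
    finally show ?thesis by simp
  qed
  have "fdiff (Suc j) h F x = G (x + t *\<^sub>R h)" using t by (simp add: \<phi>_def)
  also have "\<dots> = (\<Sum>b\<in>Basis. (h \<bullet> b) * fdiff j h (\<lambda>y. frechet_derivative F (at y) b) (x + t *\<^sub>R h))"
    unfolding G_def lin by (subst fdiff_sum) (auto simp: fdiff_mult_left)
  finally show ?thesis by blast
qed

lemma sum_abs_inner_le: "(\<Sum>b\<in>Basis. \<bar>h \<bullet> b\<bar>) \<le> real DIM('a) * norm (h::'a::euclidean_space)"
  using sum_bounded_above[of Basis "\<lambda>b. \<bar>h \<bullet> b\<bar>" "norm h"] Basis_le_norm by auto

text \<open>Each use of the mean value theorem turns a difference into a derivative and a factor
  \<open>DIM('a) * norm h\<close>. When all \<open>r\<close> derivatives are spent, one last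
  difference is estimated by the Hoelder condition.\<close>

lemma holder_fdiff_bound:
  fixes f :: "'a::euclidean_space \<Rightarrow> real"
  assumes smooth: "\<And>is x. set is \<subseteq> Basis \<Longrightarrow> length is < r \<Longrightarrow> dpart is f differentiable (at x)"
    and bd: "\<And>is x. set is \<subseteq> Basis \<Longrightarrow> length is \<le> r \<Longrightarrow> \<bar>dpart is f x\<bar> \<le> c"
    and hd: "\<And>is x y. set is \<subseteq> Basis \<Longrightarrow> length is = r \<Longrightarrow> \<bar>dpart is f x - dpart is f y\<bar> \<le> c * norm (x - y) powr \<beta>"
  shows "set is \<subseteq> Basis \<Longrightarrow> length is + j \<le> r \<Longrightarrow> \<bar>fdiff j h (dpart is f) x\<bar> \<le> c * (real DIM('a) * norm h) ^ j"
    and "set is \<subseteq> Basis \<Longrightarrow> length is + j = r \<Longrightarrow> \<bar>fdiff (Suc j) h (dpart is f) x\<bar> \<le> c * norm h powr \<beta> * (real DIM('a) * norm h) ^ j"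
proof -
  have step: "\<bar>fdiff (Suc j) h (dpart is f) x\<bar> \<le> (real DIM('a) * norm h) * K"
    if i: "set is \<subseteq> Basis" "length is < r" and K: "\<And>b z. b \<in> Basis \<Longrightarrow> \<bar>fdiff j h (dpart (b # is) f) z\<bar> \<le> K" for j "is" x K
  proof -
    obtain z where z: "fdiff (Suc j) h (dpart is f) x = (\<Sum>b\<in>Basis. (h \<bullet> b) * fdiff j h (\<lambda>y. frechet_derivative (dpart is f) (at y) b) z)"
      using fdiff_mean_value[OF smooth[OF i]] by blast
    have "\<bar>fdiff (Suc j) h (dpart is f) x\<bar> \<le> (\<Sum>b\<in>Basis. \<bar>h \<bullet> b\<bar> * \<bar>fdiff j h (dpart (b # is) f) z\<bar>)"
      unfolding z by (rule order_trans[OF sum_abs]) (simp add: abs_mult)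
    also have "\<dots> \<le> (\<Sum>b\<in>Basis. \<bar>h \<bullet> b\<bar> * K)" by (intro sum_mono mult_left_mono K) auto
    also have "\<dots> = (\<Sum>b\<in>Basis. \<bar>h \<bullet> b\<bar>) * K" by (simp add: sum_distrib_right)
    also have "\<dots> \<le> (real DIM('a) * norm h) * K"
    proof (rule mult_right_mono[OF sum_abs_inner_le])
      obtain b :: 'a where "b \<in> Basis" using nonempty_Basis by blast
      then show "0 \<le> K" using K[of b 0] by (meson abs_ge_zero order_trans)
    qed
    finally show ?thesis .
  qed
  show "set is \<subseteq> Basis \<Longrightarrow> length is + j \<le> r \<Longrightarrow> \<bar>fdiff j h (dpart is f) x\<bar> \<le> c * (real DIM('a) * norm h) ^ j"
  proof (induction j arbitrary: "is" x)
    case 0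
    then show ?case using bd by simp
  next
    case (Suc j)
    have "\<bar>fdiff (Suc j) h (dpart is f) x\<bar> \<le> (real DIM('a) * norm h) * (c * (real DIM('a) * norm h) ^ j)"
    proof (rule step)
      fix b z assume "b \<in> (Basis :: 'a set)"
      then show "\<bar>fdiff j h (dpart (b # is) f) z\<bar> \<le> c * (real DIM('a) * norm h) ^ j"
        using Suc.prems by (intro Suc.IH) auto
    qed (use Suc.prems in auto)
    then show ?case by (simp add: mult_ac)
  qed
  show "set is \<subseteq> Basis \<Longrightarrow> length is + j = r \<Longrightarrow> \<bar>fdiff (Suc j) h (dpart is f) x\<bar> \<le> c * norm h powr \<beta> * (real DIM('a) * norm h) ^ j"
  proof (induction j arbitrary: "is" x)
    case 0
    then show ?case using hd[of "is" "x + h" x] by simp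
  next
    case (Suc j)
    have "\<bar>fdiff (Suc (Suc j)) h (dpart is f) x\<bar> \<le> (real DIM('a) * norm h) * (c * norm h powr \<beta> * (real DIM('a) * norm h) ^ j)"
    proof (rule step)
      fix b z assume "b \<in> (Basis :: 'a set)"
      then show "\<bar>fdiff (Suc j) h (dpart (b # is) f) z\<bar> \<le> c * norm h powr \<beta> * (real DIM('a) * norm h) ^ j"
        using Suc.prems by (intro Suc.IH) auto
    qed (use Suc.prems in auto)
    then show ?case by (simp add: mult_ac)
  qed
qed

section \<open>Cutoff functions from moving averages\<close>

definition box_mean :: "(real \<Rightarrow> real) \<Rightarrow> real \<Rightarrow> real" where
  "box_mean g t = (\<integral>s. indicator {0..1} s * g (t + s) \<partial>lborel)"

lemma integrable_indicator_Icc: "integrable lborel (indicator {a..b::real} :: real \<Rightarrow> real)"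
  by (rule integrable_real_indicator) (auto simp: emeasure_lborel_Icc_eq)

lemma box_mean_integrable:
  fixes g :: "real \<Rightarrow> real"
  assumes [measurable]: "g \<in> borel_measurable borel" and "\<And>t. \<bar>g t\<bar> \<le> c"
  shows "integrable lborel (\<lambda>s. indicator {a..b} s * g (t + s))"
proof (rule Bochner_Integration.integrable_bound)
  show "integrable lborel (\<lambda>s. c * indicator {a..b} s)" by (intro integrable_mult_right integrable_indicator_Icc)
  show "AE s in lborel. norm (indicator {a..b} s * g (t + s)) \<le> norm (c * indicator {a..b} s)"
  proof (rule AE_I2)
    fix s show "norm (indicator {a..b} s * g (t + s)) \<le> norm (c * indicator {a..b} s)"
      using assms(2)[of "t + s"] by (auto simp: indicator_def)
  qed
qed measurable

lemma box_mean_props: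
  assumes g: "g \<in> borel_measurable borel" "\<And>t. \<bar>g t\<bar> \<le> c"
  shows "box_mean g \<in> borel_measurable borel" "\<bar>box_mean g t\<bar> \<le> c"
    "\<bar>box_mean g (t + h) - box_mean g t\<bar> \<le> 2 * \<bar>h\<bar> * c"
proof -
  note [measurable] = g(1)
  have c: "c \<ge> 0" using g(2)[of 0] by linarith
  have "(\<lambda>t. \<integral>s. indicator {0..1} s * g (t + s) \<partial>lborel) \<in> borel_measurable borel"
    by (rule lborel.borel_measurable_lebesgue_integral) measurable
  then show "box_mean g \<in> borel_measurable borel" by (simp add: box_mean_def[abs_def])
  have "\<bar>box_mean g t\<bar> \<le> (\<integral>s. \<bar>indicator {0..1} s * g (t + s)\<bar> \<partial>lborel)" unfolding box_mean_def by (rule integral_abs_bound)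
  also have "\<dots> \<le> (\<integral>s. c * indicator {0..1::real} s \<partial>lborel)"
  proof (rule integral_mono)
    show "integrable lborel (\<lambda>s. \<bar>indicator {0..1} s * g (t + s)\<bar>)" using box_mean_integrable[OF g] by simp
    show "integrable lborel (\<lambda>s. c * indicator {0..1::real} s)" by (intro integrable_mult_right integrable_indicator_Icc)
    show "\<bar>indicator {0..1} s * g (t + s)\<bar> \<le> c * indicator {0..1} s" for s using g(2)[of "t + s"] by (auto simp: indicator_def)
  qed
  also have "\<dots> = c" by simp
  finally show "\<bar>box_mean g t\<bar> \<le> c" .
  have sh: "box_mean g (t + h) = (\<integral>s. indicator {h..1 + h} s * g (t + s) \<partial>lborel)"
  proof -
    have "box_mean g (t + h) = \<bar>1\<bar> *\<^sub>R (\<integral>s. indicator {0..1} (- h + 1 * s) * g (t + h + (- h + 1 * s)) \<partial>lborel)"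
      unfolding box_mean_def by (rule lborel_integral_real_affine) simp
    also have "(\<lambda>s. indicator {0..1} (- h + 1 * s) * g (t + h + (- h + 1 * s))) = (\<lambda>s. indicator {h..1 + h} s * g (t + s))"
      by (auto simp: fun_eq_iff indicator_def)
    finally show ?thesis by simp
  qed
  \<comment> \<open>Shifting the window by \<open>h\<close> alters it only within two intervals of
    length \<open>\<bar>h\<bar>\<close>. This is how one average gains one order in the bounds on
    differences.\<close>
  define k where "k = (\<lambda>s. indicator {h..1 + h} s * g (t + s) - indicator {0..1} s * g (t + s))"
  define b where "b = (\<lambda>s. c * indicator {min 0 h..max 0 h} s + c * indicator {1 + min 0 h..1 + max 0 h} s :: real)"
  have ik: "integrable lborel k"
    unfolding k_def by (intro Bochner_Integration.integrable_diff box_mean_integrable[OF g])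
  have ib: "integrable lborel b"
    unfolding b_def by (intro Bochner_Integration.integrable_add integrable_mult_right integrable_indicator_Icc)
  have kb: "\<bar>k s\<bar> \<le> b s" for s
  proof -
    define y where "y = g (t + s)"
    have "\<bar>y\<bar> \<le> c" using g(2) by (simp add: y_def)
    then show ?thesis unfolding k_def b_def y_def[symmetric] indicator_def using c by (auto simp: min_def max_def)
  qed
  have "box_mean g (t + h) - box_mean g t = (\<integral>s. k s \<partial>lborel)"
    unfolding sh k_def using box_mean_integrable[OF g] by (simp add: box_mean_def)
  then have "\<bar>box_mean g (t + h) - box_mean g t\<bar> \<le> (\<integral>s. \<bar>k s\<bar> \<partial>lborel)" by (simp add: integral_abs_bound)
  also have "\<dots> \<le> (\<integral>s. b s \<partial>lborel)"
    by (rule integral_mono) (use ik ib kb in auto)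
  also have "\<dots> = c * (\<integral>s. indicator {min 0 h..max 0 h} s \<partial>lborel) + c * (\<integral>s. indicator {1 + min 0 h..1 + max 0 h} s \<partial>lborel)"
    unfolding b_def by (simp only: Bochner_Integration.integral_add[OF integrable_mult_right[OF integrable_indicator_Icc] integrable_mult_right[OF integrable_indicator_Icc]] integral_mult_right_zero)
  also have "(\<integral>s. indicator {min 0 h..max 0 h} s \<partial>lborel) = \<bar>h\<bar>" by (simp add: min_def max_def)
  also have "(\<integral>s. indicator {1 + min 0 h..1 + max 0 h} s \<partial>lborel) = \<bar>h\<bar>" by (simp add: min_def max_def)
  also have "c * \<bar>h\<bar> + c * \<bar>h\<bar> = 2 * \<bar>h\<bar> * c" by simp
  finally show "\<bar>box_mean g (t + h) - box_mean g t\<bar> \<le> 2 * \<bar>h\<bar> * c" .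
qed

lemma borel_measurable_fdiff:
  assumes "g \<in> borel_measurable (borel :: 'a::euclidean_space measure)"
  shows "fdiff j h g \<in> (borel_measurable borel :: ('a \<Rightarrow> 'b::euclidean_space) set)"
proof (induction j)
  case 0
  have "fdiff 0 h g = g" by auto
  then show ?case using assms by simp
next
  case (Suc j)
  note [measurable] = Suc
  have "fdiff (Suc j) h g = (\<lambda>x. fdiff j h g (x + h) - fdiff j h g x)" by auto
  moreover have "(\<lambda>x. fdiff j h g (x + h) - fdiff j h g x) \<in> borel_measurable borel" by measurable
  ultimately show ?case by simp
qed

lemma fdiff_box_mean:
  assumes g: "g \<in> borel_measurable borel" "\<And>t. \<bar>g t\<bar> \<le> c"
  shows "fdiff j h (box_mean g) t = box_mean (fdiff j h g) t"
proof (induction j arbitrary: t)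
  case 0
  have "fdiff 0 h g = g" by auto
  then show ?case by simp
next
  case (Suc j)
  have b: "\<And>t. \<bar>fdiff j h g t\<bar> \<le> 2 ^ j * c" by (rule fdiff_bounded[OF g(2)])
  have i: "integrable lborel (\<lambda>s. indicator {0..1} s * fdiff j h g (t + s))" for t
    by (rule box_mean_integrable[OF borel_measurable_fdiff[OF g(1)] b])
  have "box_mean (fdiff (Suc j) h g) t = (\<integral>s. indicator {0..1} s * fdiff j h g (t + h + s) - indicator {0..1} s * fdiff j h g (t + s) \<partial>lborel)"
    unfolding box_mean_def by (auto simp: algebra_simps intro!: Bochner_Integration.integral_cong)
  also have "\<dots> = box_mean (fdiff j h g) (t + h) - box_mean (fdiff j h g) t"
    unfolding box_mean_def using i by simp
  finally show ?case unfolding fdiff.simps(2)[of j h "box_mean g" t] Suc.IH by (rule sym)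
qed

text \<open>An indicator averaged \<open>m\<close> times is a spline whose differences up to order
  \<open>m\<close> have the right size; no more smoothness is asked of a cutoff here.\<close>

lemma exists_cutoff_real:
  "\<exists>\<psi>::real \<Rightarrow> real. \<psi> \<in> borel_measurable borel \<and> (\<forall>t\<in>{-1..1}. \<psi> t = 1) \<and> (\<forall>t. \<bar>t\<bar> > real m + 1 \<longrightarrow> \<psi> t = 0) \<and>
     (\<forall>t. \<bar>\<psi> t\<bar> \<le> 1) \<and> (\<forall>j\<le>m. \<forall>h t. \<bar>fdiff j h \<psi> t\<bar> \<le> (2 * \<bar>h\<bar>) ^ j)"
proof -
  \<comment> \<open>\<open>box_mean\<close> looks to the right: each average shortens the plateau by
    1 at its right end and lengthens the support by 1 at its left end. Hence the start with the
    indicator of \<open>[-1, 1 + m]\<close>, which leaves the plateau \<open>[-1, 1]\<close> after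
    \<open>m\<close> averages.\<close>
  have "\<exists>\<psi>::real \<Rightarrow> real. \<psi> \<in> borel_measurable borel \<and> (\<forall>t\<in>{-1..1 + real m - real k}. \<psi> t = 1) \<and> (\<forall>t. t < - 1 - real k \<or> t > 1 + real m \<longrightarrow> \<psi> t = 0) \<and>
     (\<forall>t. \<bar>\<psi> t\<bar> \<le> 1) \<and> (\<forall>j\<le>k. \<forall>h t. \<bar>fdiff j h \<psi> t\<bar> \<le> (2 * \<bar>h\<bar>) ^ j)" if "k \<le> m" for k
    using that
  proof (induction k)
    case 0
    show ?case by (intro exI[of _ "indicator {-1..1 + real m}"]) (auto simp: indicator_def)
  next
    case (Suc k)
    then obtain \<psi> :: "real \<Rightarrow> real" where \<psi>: "\<psi> \<in> borel_measurable borel" "\<forall>t\<in>{-1..1 + real m - real k}. \<psi> t = 1"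
      "\<forall>t. t < - 1 - real k \<or> t > 1 + real m \<longrightarrow> \<psi> t = 0" "\<And>t. \<bar>\<psi> t\<bar> \<le> 1" "\<And>j h t. j \<le> k \<Longrightarrow> \<bar>fdiff j h \<psi> t\<bar> \<le> (2 * \<bar>h\<bar>) ^ j" by auto
    note bm = box_mean_props[OF \<psi>(1,4)]
    have one: "box_mean \<psi> t = 1" if "t \<in> {-1..1 + real m - real (Suc k)}" for t
    proof -
      have "box_mean \<psi> t = (\<integral>s. indicator {0..1::real} s \<partial>lborel)"
        unfolding box_mean_def using that \<psi>(2) by (intro Bochner_Integration.integral_cong) (auto simp: indicator_def)
      then show ?thesis by simp
    qed
    have zero: "box_mean \<psi> t = 0" if "t < - 1 - real (Suc k) \<or> t > 1 + real m" for t
    proof -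
      have "box_mean \<psi> t = (\<integral>s. 0 \<partial>(lborel :: real measure))"
        unfolding box_mean_def using that \<psi>(3) by (intro Bochner_Integration.integral_cong) (auto simp: indicator_def)
      then show ?thesis by simp
    qed
    have fd: "\<bar>fdiff j h (box_mean \<psi>) t\<bar> \<le> (2 * \<bar>h\<bar>) ^ j" if "j \<le> Suc k" for j h t
    proof (cases j)
      case 0
      then show ?thesis using bm(2) by simp
    next
      case (Suc i)
      have "fdiff (Suc i) h (box_mean \<psi>) t = box_mean (fdiff i h \<psi>) (t + h) - box_mean (fdiff i h \<psi>) t"
        by (subst fdiff.simps(2)) (simp only: fdiff_box_mean[OF \<psi>(1,4)])
      also have "\<bar>\<dots>\<bar> \<le> 2 * \<bar>h\<bar> * (2 * \<bar>h\<bar>) ^ i"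
        by (rule box_mean_props(3)[OF borel_measurable_fdiff[OF \<psi>(1)]]) (use \<psi>(5) Suc that in auto)
      finally show ?thesis using Suc by simp
    qed
    show ?case using bm(1,2) one zero fd by (intro exI[of _ "box_mean \<psi>"]) blast
  qed
  from this[OF order_refl] obtain \<psi> :: "real \<Rightarrow> real" where \<psi>: "\<psi> \<in> borel_measurable borel"
    "\<forall>t\<in>{-1..1 + real m - real m}. \<psi> t = 1" "\<forall>t. t < - 1 - real m \<or> t > 1 + real m \<longrightarrow> \<psi> t = 0"
    "\<forall>t. \<bar>\<psi> t\<bar> \<le> 1" "\<forall>j\<le>m. \<forall>h t. \<bar>fdiff j h \<psi> t\<bar> \<le> (2 * \<bar>h\<bar>) ^ j" by blast
  have "\<psi> t = 0" if "\<bar>t\<bar> > real m + 1" for t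
    using \<psi>(3)[rule_format, of t] that by (auto simp: abs_if split: if_splits)
  then show ?thesis using \<psi> by (intro exI[of _ \<psi>]) auto
qed

text \<open>A product of one-dimensional cutoffs in the coordinates; the Leibniz bound is applied
  once for each coordinate.\<close>

lemma exists_cutoff:
  "\<exists>\<psi>::'a::euclidean_space \<Rightarrow> real. \<exists>C. \<psi> \<in> borel_measurable borel \<and> (\<forall>x\<in>cball 0 1. \<psi> x = 1) \<and>
     (\<forall>x. norm x > real DIM('a) * (real m + 1) \<longrightarrow> \<psi> x = 0) \<and> C \<ge> 1 \<and> (\<forall>j\<le>m. \<forall>h x. \<bar>fdiff j h \<psi> x\<bar> \<le> C * norm h ^ j)"
proof -
  obtain \<psi>1 :: "real \<Rightarrow> real" where \<psi>1: "\<psi>1 \<in> borel_measurable borel" "\<forall>t\<in>{-1..1}. \<psi>1 t = 1" "\<forall>t. \<bar>t\<bar> > real m + 1 \<longrightarrow> \<psi>1 t = 0"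
     "\<forall>t. \<bar>\<psi>1 t\<bar> \<le> 1" "\<And>j h t. j \<le> m \<Longrightarrow> \<bar>fdiff j h \<psi>1 t\<bar> \<le> (2 * \<bar>h\<bar>) ^ j"
    using exists_cutoff_real[of m] by blast
  note [measurable] = \<psi>1(1)
  have coord: "fdiff j h (\<lambda>x. \<psi>1 (x \<bullet> b)) x = fdiff j (h \<bullet> b) \<psi>1 (x \<bullet> b)" for j and h x b :: 'a
    by (induction j arbitrary: x) (auto simp: inner_add_left)
  have prod: "\<exists>C\<ge>1. \<forall>j\<le>m. \<forall>h x. \<bar>fdiff j h (\<lambda>x. \<Prod>b\<in>S. \<psi>1 (x \<bullet> b)) x\<bar> \<le> C * norm h ^ j" if "finite S" "S \<subseteq> (Basis :: 'a set)" for S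
    using that
  proof (induction S rule: finite_induct)
    case empty
    have "fdiff j h (\<lambda>x. 1::real) x = (if j = 0 then 1 else 0)" for j and h x :: 'a by (induction j arbitrary: x) auto
    then show ?case by (intro exI[of _ 1]) auto
  next
    case (insert b S)
    then obtain C where C: "C \<ge> 1" "\<And>j h x. j \<le> m \<Longrightarrow> \<bar>fdiff j h (\<lambda>x. \<Prod>b\<in>S. \<psi>1 (x \<bullet> b)) x\<bar> \<le> C * norm h ^ j" by auto
    have "\<bar>fdiff j h (\<lambda>x. \<psi>1 (x \<bullet> b) * (\<Prod>b\<in>S. \<psi>1 (x \<bullet> b))) x\<bar> \<le> 2 ^ j * (2 ^ m * C * norm h ^ j)" if j: "j \<le> m" for j h x
    proof (rule fdiff_mult_bound[where u = "\<lambda>i. 2 ^ m * norm h ^ i" and w = "\<lambda>i. C * norm h ^ i"])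
      fix i y assume i: "i \<le> j"
      have "\<bar>fdiff i h (\<lambda>x. \<psi>1 (x \<bullet> b)) y\<bar> \<le> (2 * \<bar>h \<bullet> b\<bar>) ^ i" unfolding coord using \<psi>1(5) i j by simp
      also have "\<dots> \<le> (2 * norm h) ^ i" using Basis_le_norm[of b h] insert by (intro power_mono) auto
      also have "\<dots> = 2 ^ i * norm h ^ i" by (rule power_mult_distrib)
      also have "\<dots> \<le> 2 ^ m * norm h ^ i" using i j by (intro mult_right_mono power_increasing) auto
      finally show "\<bar>fdiff i h (\<lambda>x. \<psi>1 (x \<bullet> b)) y\<bar> \<le> 2 ^ m * norm h ^ i" .
      show "\<bar>fdiff i h (\<lambda>x. \<Prod>b\<in>S. \<psi>1 (x \<bullet> b)) y\<bar> \<le> C * norm h ^ i" using C(2) i j by simp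
      show "2 ^ m * norm h ^ i * (C * norm h ^ (j - i)) \<le> 2 ^ m * C * norm h ^ j"
      proof -
        have "norm h ^ i * norm h ^ (j - i) = norm h ^ j" using i by (simp flip: power_add)
        then have "2 ^ m * norm h ^ i * (C * norm h ^ (j - i)) = 2 ^ m * C * norm h ^ j" by (simp add: mult_ac)
        then show ?thesis by (rule eq_refl)
      qed
    qed
    moreover have "2 ^ j * (2 ^ m * C * norm h ^ j) \<le> 2 ^ m * (2 ^ m * C * norm h ^ j)" if "j \<le> m" for j and h :: 'a
      using that C(1) by (intro mult_right_mono power_increasing) auto
    note calculation = calculation this
    have "\<bar>fdiff j h (\<lambda>x. \<Prod>b\<in>insert b S. \<psi>1 (x \<bullet> b)) x\<bar> \<le> 2 ^ m * 2 ^ m * C * norm h ^ j" if "j \<le> m" for j h x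
    proof -
      have "\<bar>fdiff j h (\<lambda>x. \<psi>1 (x \<bullet> b) * (\<Prod>b\<in>S. \<psi>1 (x \<bullet> b))) x\<bar> \<le> 2 ^ m * (2 ^ m * C * norm h ^ j)"
        using calculation(1)[OF that, of h x] calculation(2)[OF that, of h] by linarith
      then show ?thesis using insert(1,2) by (simp add: mult_ac)
    qed
    moreover have "2 ^ m * 2 ^ m * C \<ge> 1" using C(1) one_le_power[of 2 m] by (metis mult_ge1_I one_le_numeral)
    ultimately show ?case by blast
  qed
  define \<psi> where "\<psi> = (\<lambda>x::'a. \<Prod>b\<in>Basis. \<psi>1 (x \<bullet> b))"
  obtain C where C: "C \<ge> 1" "\<forall>j\<le>m. \<forall>h x. \<bar>fdiff j h \<psi> x\<bar> \<le> C * norm h ^ j" unfolding \<psi>_def using prod[of Basis] by auto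
  have m: "\<psi> \<in> borel_measurable borel" unfolding \<psi>_def by measurable
  have one: "\<psi> x = 1" if "x \<in> cball 0 1" for x
    unfolding \<psi>_def
  proof (rule prod.neutral, rule ballI)
    fix b :: 'a assume "b \<in> Basis"
    then have "\<bar>x \<bullet> b\<bar> \<le> 1" using Basis_le_norm[of b x] that by simp
    then show "\<psi>1 (x \<bullet> b) = 1" using \<psi>1(2) by (auto simp: abs_le_iff)
  qed
  have zero: "\<psi> x = 0" if x: "norm x > real DIM('a) * (real m + 1)" for x
  proof -
    have "\<exists>b\<in>Basis. \<bar>x \<bullet> b\<bar> > real m + 1"
    proof (rule ccontr)
      assume "\<not> ?thesis"
      then have "(\<Sum>b\<in>Basis. \<bar>x \<bullet> b\<bar>) \<le> (\<Sum>b\<in>(Basis::'a set). real m + 1)" by (intro sum_mono) force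
      then show False using norm_le_l1[of x] x by (simp add: algebra_simps)
    qed
    then obtain b where "b \<in> Basis" "\<psi>1 (x \<bullet> b) = 0" using \<psi>1(3) by blast
    then show ?thesis unfolding \<psi>_def by (intro prod_zero) auto
  qed
  show ?thesis using C m one zero by blast
qed

lemma holder_cutoff_extension:
  fixes \<alpha> :: real
  assumes \<alpha>: "\<alpha> > 0"
  defines "m \<equiv> Suc (nat (\<lceil>\<alpha>\<rceil> - 1))"
  shows "\<exists>C R. C > 0 \<and> R > 0 \<and> (\<forall>h\<in>holder_unit_ball \<alpha>. \<exists>F::'a::euclidean_space \<Rightarrow> real. F \<in> borel_measurable borel \<and>
    (\<forall>x\<in>cball 0 1. F x = h x) \<and> (\<forall>x. \<bar>F x\<bar> \<le> C) \<and> (\<forall>x. norm x > R \<longrightarrow> F x = 0) \<and>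
    (\<forall>u x. \<bar>fdiff m u F x\<bar> \<le> C * norm u powr \<alpha>))"
proof -
  define r where "r = nat (\<lceil>\<alpha>\<rceil> - 1)"
  define \<beta> where "\<beta> = \<alpha> - of_int (\<lceil>\<alpha>\<rceil> - 1)"
  define d where "d = real DIM('a)"
  have ce: "\<lceil>\<alpha>\<rceil> \<ge> 1" using \<alpha> by simp
  have rr: "real r = of_int (\<lceil>\<alpha>\<rceil> - 1)" using ce by (simp add: r_def)
  have \<alpha>r: "\<alpha> = real r + \<beta>" by (simp add: \<beta>_def rr)
  have \<beta>: "\<beta> > 0" "\<beta> \<le> 1" using ceiling_correct[of \<alpha>] by (simp_all add: \<beta>_def)
  have m: "m = Suc r" by (simp add: m_def r_def)
  have \<alpha>m: "\<alpha> \<le> real m" using \<alpha>r \<beta> m by simp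
  have d: "d \<ge> 1" using DIM_positive[where 'a = 'a] by (simp add: d_def Suc_leI)
  obtain \<psi> :: "'a \<Rightarrow> real" and C2 where \<psi>: "\<psi> \<in> borel_measurable borel" "\<And>x. x \<in> cball 0 1 \<Longrightarrow> \<psi> x = 1"
     "\<And>x. norm x > d * (real m + 1) \<Longrightarrow> \<psi> x = 0" "C2 \<ge> 1" "\<And>j h x. j \<le> m \<Longrightarrow> \<bar>fdiff j h \<psi> x\<bar> \<le> C2 * norm h ^ j"
    using exists_cutoff[of m, where 'a = 'a] unfolding d_def by blast
  define C where "C = 2 ^ m * (2 * d ^ r * C2)"
  have pos1: "2 * d ^ r * C2 \<ge> 2 * 1 * C2" using d \<psi>(4) by (intro mult_right_mono mult_left_mono one_le_power) auto
  have C: "C \<ge> 2 ^ m * (2 * C2)" unfolding C_def using pos1 by (intro mult_left_mono) auto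
  have "2 ^ m * (2 * C2) \<ge> 1 * (2 * C2)" using \<psi>(4) by (intro mult_right_mono one_le_power) auto
  then have C2C: "2 * C2 \<le> C" and C0: "C > 0" using C \<psi>(4) by linarith+
  have ext: "\<exists>F::'a \<Rightarrow> real. F \<in> borel_measurable borel \<and> (\<forall>x\<in>cball 0 1. F x = h x) \<and> (\<forall>x. \<bar>F x\<bar> \<le> C) \<and>
     (\<forall>x. norm x > d * (real m + 1) \<longrightarrow> F x = 0) \<and> (\<forall>u x. \<bar>fdiff m u F x\<bar> \<le> C * norm u powr \<alpha>)"
    if h: "h \<in> holder_unit_ball \<alpha>" for h :: "'a \<Rightarrow> real"
  proof -
    \<comment> \<open>\<open>holder_ball_norm\<close> is an infimum over extensions; relaxing the
      bound 1 to 2 yields an actual extension \<open>f\<close>.\<close>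
    have "holder_ball_norm r \<beta> h < 2"
      using h unfolding holder_unit_ball_def r_def[symmetric] \<beta>_def[symmetric] by (auto intro: le_less_trans)
    then obtain f where f: "holder_norm r \<beta> f < 2" "\<And>x. x \<in> cball 0 1 \<Longrightarrow> f x = h x"
      unfolding holder_ball_norm_def Inf_less_iff by blast
    have smooth: "holder_smooth r f"
    proof (rule ccontr)
      assume "\<not> holder_smooth r f"
      then have "holder_norm r \<beta> f = \<infinity>" by (simp add: holder_norm_def)
      with f(1) show False by simp
    qed
    have sup: "e \<le> 2" if "e \<in> {ereal \<bar>dpart is f x\<bar> | is x. set is \<subseteq> Basis \<and> length is \<le> r} \<union>
             {ereal (\<bar>dpart is f x - dpart is f y\<bar> / norm (x - y) powr \<beta>) | is x y.
                 set is \<subseteq> Basis \<and> length is = r \<and> x \<noteq> y}" for e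
      using Sup_upper[OF that] f(1) smooth by (simp add: holder_norm_def)
    have sm: "dpart is f differentiable (at x)" if "set is \<subseteq> Basis" "length is < r" for "is" x
      using smooth that by (simp add: holder_smooth_def)
    have bd: "\<bar>dpart is f x\<bar> \<le> 2" if "set is \<subseteq> Basis" "length is \<le> r" for "is" x
    proof -
      have "ereal \<bar>dpart is f x\<bar> \<le> 2" by (rule sup) (use that in blast)
      then show ?thesis by simp
    qed
    have hd: "\<bar>dpart is f x - dpart is f y\<bar> \<le> 2 * norm (x - y) powr \<beta>" if "set is \<subseteq> Basis" "length is = r" for "is" x y
    proof (cases "x = y")
      case False
      have "ereal (\<bar>dpart is f x - dpart is f y\<bar> / norm (x - y) powr \<beta>) \<le> 2" by (rule sup) (use that False in blast)
      then have "\<bar>dpart is f x - dpart is f y\<bar> / norm (x - y) powr \<beta> \<le> 2" by simp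
      moreover have "norm (x - y) powr \<beta> > 0" using False by simp
      ultimately show ?thesis by (simp add: divide_le_eq)
    qed simp
    have fd1: "\<bar>fdiff j u f x\<bar> \<le> 2 * (d * norm u) ^ j" if "j \<le> r" for j u x
    proof -
      have "\<bar>fdiff j u (dpart [] f) x\<bar> \<le> 2 * (real DIM('a) * norm u) ^ j"
        by (rule holder_fdiff_bound(1)[where r = r, OF sm bd hd]) (use that in auto)
      then show ?thesis by (simp add: d_def)
    qed
    have fd2: "\<bar>fdiff (Suc r) u f x\<bar> \<le> 2 * norm u powr \<beta> * (d * norm u) ^ r" for u x
    proof -
      have "\<bar>fdiff (Suc r) u (dpart [] f) x\<bar> \<le> 2 * norm u powr \<beta> * (real DIM('a) * norm u) ^ r"
        by (rule holder_fdiff_bound(2)[where r = r, OF sm bd hd]) auto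
      then show ?thesis by (simp add: d_def)
    qed
    have fc: "continuous_on UNIV f"
    proof (cases "r = 0")
      case True
      have hh: "\<bar>f x - f y\<bar> \<le> 2 * norm (x - y) powr \<beta>" for x y using hd[of "[]" x y] True by simp
      show ?thesis
        unfolding continuous_on_iff
      proof (intro ballI allI impI)
        fix x :: 'a and e :: real assume e: "e > 0"
        define \<delta> where "\<delta> = (e / 4) powr (1 / \<beta>)"
        have "\<delta> > 0" using e by (simp add: \<delta>_def)
        moreover have "dist (f y) (f x) < e" if "dist y x < \<delta>" for y
        proof -
          have "norm (y - x) powr \<beta> \<le> \<delta> powr \<beta>" using that \<beta> by (intro powr_mono2) (auto simp: dist_norm)
          also have "\<dots> = e / 4" using e \<beta> by (simp add: \<delta>_def powr_powr)
          finally show ?thesis using hh[of y x] e by (simp add: dist_real_def)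
        qed
        ultimately show "\<exists>d>0. \<forall>x'\<in>UNIV. dist x' x < d \<longrightarrow> dist (f x') (f x) < e" by blast
      qed
    next
      case False
      have "isCont f x" for x using sm[of "[]" x] False differentiable_imp_continuous_within[of f x UNIV] by simp
      then show ?thesis by (simp add: continuous_on_eq_continuous_at)
    qed
    define F where "F = (\<lambda>x. f x * \<psi> x)"
    have "f \<in> borel_measurable borel" by (rule borel_measurable_continuous_onI[OF fc])
    then have Fm: "F \<in> borel_measurable borel" unfolding F_def using \<psi>(1) by measurable
    have F2: "\<bar>F x\<bar> \<le> 2 * C2" for x
      using mult_mono[of "\<bar>f x\<bar>" 2 "\<bar>\<psi> x\<bar>" C2] bd[of "[]" x] \<psi>(5)[of 0 0 x] by (simp add: F_def abs_mult)
    have "\<bar>fdiff m u F x\<bar> \<le> C * norm u powr \<alpha>" for u x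
    proof -
      define t where "t = norm u"
      \<comment> \<open>For steps of length at most 1 the Leibniz rule distributes
        \<open>m = r + 1\<close> differences between \<open>f\<close> and the cutoff, and the
        Hoelder bound is used when all fall on \<open>f\<close>. For longer steps boundedness of
        \<open>F\<close> suffices.\<close>
      consider "t = 0" | "t > 0" "t \<le> 1" | "t > 1" using t_def by fastforce
      then show ?thesis
      proof cases
        case 1
        then show ?thesis by (simp add: t_def m)
      next
        case 2
        define K where "K = 2 * d ^ r * C2 * t powr \<alpha>"
        define uu where "uu = (\<lambda>i. if i \<le> r then 2 * (d * t) ^ i else 2 * t powr \<beta> * (d * t) ^ r)"
        have tm: "t ^ m \<le> t powr \<alpha>"
        proof -
          have "t ^ m = t powr (real m)" using 2 by (simp add: powr_realpow)
          also have "\<dots> \<le> t powr \<alpha>" using 2 \<alpha>m by (intro powr_mono') auto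
          finally show ?thesis .
        qed
        have "\<bar>fdiff m u (\<lambda>x. f x * \<psi> x) x\<bar> \<le> 2 ^ m * K"
        proof (rule fdiff_mult_bound[where u = uu and w = "\<lambda>j. C2 * t ^ j"])
          fix i y assume i: "i \<le> m"
          show "\<bar>fdiff i u f y\<bar> \<le> uu i"
          proof (cases "i \<le> r")
            case True
            then show ?thesis using fd1[of i u y] by (simp add: uu_def t_def)
          next
            case False
            then have "i = Suc r" using i m by simp
            then show ?thesis using fd2[of u y] by (simp add: uu_def t_def)
          qed
          show "\<bar>fdiff i u \<psi> y\<bar> \<le> C2 * t ^ i" using \<psi>(5)[OF i, of u y] by (simp add: t_def)
          show "uu i * (C2 * t ^ (m - i)) \<le> K"
          proof (cases "i \<le> r")
            case True
            have "uu i * (C2 * t ^ (m - i)) = 2 * d ^ i * C2 * (t ^ i * t ^ (m - i))" using True by (simp add: uu_def power_mult_distrib)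
            also have "t ^ i * t ^ (m - i) = t ^ m" using i by (simp flip: power_add)
            also have "2 * d ^ i * C2 * t ^ m \<le> 2 * d ^ r * C2 * t powr \<alpha>"
              using True d \<psi>(4) tm 2 by (intro mult_mono power_increasing) auto
            finally show ?thesis by (simp add: K_def)
          next
            case False
            then have i: "i = m" using i m by simp
            have "t powr \<beta> * t ^ r = t powr \<alpha>" using 2 by (simp add: \<alpha>r powr_add powr_realpow)
            moreover have "uu i * (C2 * t ^ (m - i)) = 2 * d ^ r * C2 * (t powr \<beta> * t ^ r)"
              unfolding i using m by (simp add: uu_def power_mult_distrib)
            ultimately show ?thesis unfolding K_def by (simp only: order_refl)
          qed
        qed
        then show ?thesis by (simp add: F_def C_def K_def t_def mult_ac)
      next
        case 3
        have "\<bar>fdiff m u F x\<bar> \<le> 2 ^ m * (2 * C2)" by (rule fdiff_bounded[OF F2])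
        also have "\<dots> \<le> C * 1" using C by simp
        also have "\<dots> \<le> C * t powr \<alpha>" using C0 3 \<alpha> by (intro mult_left_mono ge_one_powr_ge_zero) auto
        finally show ?thesis by (simp add: t_def)
      qed
    qed
    moreover have "\<bar>F x\<bar> \<le> C" for x using F2[of x] C2C by linarith
    moreover have "F x = h x" if "x \<in> cball 0 1" for x using f(2) \<psi>(2) that by (simp add: F_def)
    moreover have "F x = 0" if "norm x > d * (real m + 1)" for x using \<psi>(3)[OF that] by (simp add: F_def)
    ultimately show ?thesis using Fm by (intro exI[of _ F]) auto
  qed
  show ?thesis
    using C0 ext d by (intro exI[of _ C] exI[of _ "d * (real m + 1)"]) auto
qed

subsection \<open>Fourier decay of functions with small differences\<close>

lemma integrable_fdiff:
  fixes F :: "'a::euclidean_space \<Rightarrow> complex"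
  assumes "integrable lborel F"
  shows "integrable lborel (fdiff m h F)"
proof (induction m)
  case 0
  have "fdiff 0 h F = F" by auto
  then show ?case using assms by simp
next
  case (Suc m)
  have "fdiff (Suc m) h F = (\<lambda>x. fdiff m h F (h + 1 *\<^sub>R x) - fdiff m h F x)" by (auto simp: add.commute)
  moreover have "integrable lborel (\<lambda>x. fdiff m h F (h + 1 *\<^sub>R x) - fdiff m h F x)"
    by (intro Bochner_Integration.integrable_diff Suc integrable_lborel_affine) auto
  ultimately show ?case by simp
qed

text \<open>A translation becomes the phase \<open>cis (\<xi> \<bullet> h)\<close>, so each
  difference contributes one multiplier.\<close>

lemma ft_fdiff:
  fixes F :: "'a::euclidean_space \<Rightarrow> complex"
  assumes F: "integrable lborel F"
  shows "ft (fdiff m h F) \<xi> = (cis (\<xi> \<bullet> h) - 1) ^ m * ft F \<xi>"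
proof (induction m)
  case 0
  have "fdiff 0 h F = F" by auto
  then show ?case by simp
next
  case (Suc m)
  let ?G = "fdiff m h F"
  have G: "integrable lborel ?G" by (rule integrable_fdiff[OF F])
  have Gh: "integrable lborel (\<lambda>y. ?G (y + h))" using integrable_lborel_affine[OF G, of 1 h] by (simp add: add.commute)
  have "ft (\<lambda>y. ?G (y + h)) \<xi> = (\<integral>y. cis (\<xi> \<bullet> h) * (?G (h + 1 *\<^sub>R y) * cis (- (\<xi> \<bullet> (h + 1 *\<^sub>R y)))) \<partial>lborel)"
    unfolding ft_def by (intro Bochner_Integration.integral_cong refl) (simp add: add.commute inner_add_right mult.left_commute cis_mult)
  also have "\<dots> = cis (\<xi> \<bullet> h) * (\<integral>y. ?G (h + 1 *\<^sub>R y) * cis (- (\<xi> \<bullet> (h + 1 *\<^sub>R y))) \<partial>lborel)" by simp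
  also have "(\<integral>y. ?G (h + 1 *\<^sub>R y) * cis (- (\<xi> \<bullet> (h + 1 *\<^sub>R y))) \<partial>lborel) = ft ?G \<xi>"
    using integral_lborel_affine[of 1 "\<lambda>y. ?G y * cis (- (\<xi> \<bullet> y))" h] by (simp add: ft_def)
  finally have sh: "ft (\<lambda>y. ?G (y + h)) \<xi> = cis (\<xi> \<bullet> h) * ft ?G \<xi>" .
  have "fdiff (Suc m) h F = (\<lambda>y. ?G (y + h) - ?G y)" by auto
  then have "ft (fdiff (Suc m) h F) \<xi> = ft (\<lambda>y. ?G (y + h)) \<xi> - ft ?G \<xi>"
    unfolding ft_def using integrable_ft_kernel[OF G] integrable_ft_kernel[OF Gh] by (simp add: left_diff_distrib)
  also have "\<dots> = (cis (\<xi> \<bullet> h) - 1) * ft ?G \<xi>" by (simp add: sh left_diff_distrib)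
  finally show ?case unfolding Suc power_Suc mult.assoc .
qed

lemma fdiff_of_real: "fdiff m h (\<lambda>x. complex_of_real (F x)) x = complex_of_real (fdiff m h F x)"
  by (induction m arbitrary: x) auto

text \<open>Convexity of the power, through its tangent at \<open>a\<close>; integrated against a
  Gaussian it serves as Jensen's inequality.\<close>

lemma power_tangent_le:
  fixes x a :: real
  assumes "x \<ge> 0" "a \<ge> 0"
  shows "a ^ m + real m * a ^ (m - 1) * (x - a) \<le> x ^ m"
proof (induction m)
  case 0
  then show ?case by simp
next
  case (Suc m)
  show ?case
  proof (cases m)
    case 0
    then show ?thesis by simp
  next
    case (Suc k)
    have am: "a ^ m = a * a ^ (m - 1)" using Suc by simp
    have "a ^ Suc m + real (Suc m) * a ^ m * (x - a) \<le> a ^ Suc m + real (Suc m) * a ^ m * (x - a) + real m * a ^ (m - 1) * (x - a)\<^sup>2"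
      using assms by simp
    also have "\<dots> = x * (a ^ m + real m * a ^ (m - 1) * (x - a))"
      unfolding power_Suc am by (simp add: power2_eq_square algebra_simps)
    also have "\<dots> \<le> x * x ^ m" using Suc.IH assms by (intro mult_left_mono) auto
    finally show ?thesis by simp
  qed
qed

lemma power_le_exp:
  fixes y :: real
  assumes "y \<ge> 0"
  shows "y ^ k \<le> real k ^ k * exp y"
proof (cases "k = 0")
  case False
  have "y / real k \<le> exp (y / real k)" using exp_ge_add_one_self[of "y / real k"] by linarith
  then have "(y / real k) ^ k \<le> exp (y / real k) ^ k" using assms by (intro power_mono) auto
  also have "\<dots> = exp y" using False by (simp add: exp_of_nat_mult[symmetric])
  finally show ?thesis using False by (simp add: power_divide divide_le_eq mult.commute)
qed (simp add: assms)

lemma powr_le_exp_square: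
  fixes p :: real
  assumes p: "p \<ge> 0"
  shows "\<exists>C>0. \<forall>t\<ge>0. t powr p \<le> C * exp (t\<^sup>2 / 4)"
proof -
  define k where "k = nat \<lceil>p\<rceil>"
  have k: "p \<le> real k" unfolding k_def by linarith
  define C where "C = 1 + real k ^ k * 4 ^ k"
  have "t powr p \<le> C * exp (t\<^sup>2 / 4)" if t: "t \<ge> 0" for t
  proof (cases "t \<le> 1")
    case True
    then have "t powr p \<le> 1" using t p by (simp add: powr_le1)
    also have "\<dots> \<le> C * 1" by (simp add: C_def)
    also have "\<dots> \<le> C * exp (t\<^sup>2 / 4)" by (intro mult_left_mono) (auto simp: C_def add_nonneg_nonneg)
    finally show ?thesis .
  next
    case False
    then have "t powr p \<le> t powr real (2 * k)" using k by (intro powr_mono) auto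
    also have "\<dots> = 4 ^ k * (t\<^sup>2 / 4) ^ k" using False powr_realpow[of t "2 * k"] by (simp add: power_mult power_divide del: of_nat_mult)
    also have "\<dots> \<le> 4 ^ k * (real k ^ k * exp (t\<^sup>2 / 4))" by (intro mult_left_mono power_le_exp) auto
    also have "\<dots> \<le> C * exp (t\<^sup>2 / 4)" by (simp add: C_def algebra_simps)
    finally show ?thesis .
  qed
  moreover have "C > 0" by (simp add: C_def add_pos_nonneg)
  ultimately show ?thesis by blast
qed

lemma integrable_gauss_moment:
  assumes "p \<ge> 0"
  shows "integrable lborel (\<lambda>u::'a::euclidean_space. gauss 1 u * norm u powr p)"
proof -
  obtain C where C: "C > 0" "\<And>t. t \<ge> 0 \<Longrightarrow> t powr p \<le> C * exp (t\<^sup>2 / 4)" using powr_le_exp_square[OF assms] by blast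
  show ?thesis
  proof (rule Bochner_Integration.integrable_bound)
    show "integrable lborel (\<lambda>u::'a. C * gauss (1 / sqrt 2) u)" by (intro integrable_mult_right integrable_gauss) simp
    show "AE u in lborel. norm (gauss 1 u * norm u powr p) \<le> norm (C * gauss (1 / sqrt 2) (u::'a))"
    proof (rule AE_I2)
      fix u :: 'a
      have "gauss 1 u * norm u powr p \<le> gauss 1 u * (C * exp ((norm u)\<^sup>2 / 4))"
        using C(2)[of "norm u"] gauss_pos[of 1 u] by (intro mult_left_mono) auto
      also have "\<dots> = C * gauss (1 / sqrt 2) u"
        by (simp add: gauss_def exp_add[symmetric] power_divide)
      finally show "norm (gauss 1 u * norm u powr p) \<le> norm (C * gauss (1 / sqrt 2) u)"
        using C(1) gauss_pos[of 1 u] gauss_pos[of "1 / sqrt 2" u] by (simp add: abs_mult)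
    qed
  qed measurable
qed

text \<open>What the cut-off extension of a Hoelder function provides. Smoothness enters only
  through differences, so the Fourier estimates treat integer and fractional \<open>\<alpha>\<close>
  alike.\<close>

locale rough =
  fixes F :: "'a::euclidean_space \<Rightarrow> real" and C R \<alpha> :: real and m :: nat
  assumes Fm [measurable]: "F \<in> borel_measurable borel" and FC: "\<And>x. \<bar>F x\<bar> \<le> C"
    and FR: "\<And>x. norm x > R \<Longrightarrow> F x = 0" and Fd: "\<And>u x. \<bar>fdiff m u F x\<bar> \<le> C * norm u powr \<alpha>"
    and \<alpha>: "\<alpha> > 0" and m: "m > 0"
begin

lemma C_nonneg: "C \<ge> 0"
  using FC[of 0] by linarith

lemma emeasure_support: "emeasure lborel (cball (0::'a) R) < \<infinity>"
  by (rule emeasure_bounded_finite) simp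

lemma integrable_support: "integrable lborel (indicator (cball (0::'a) R) :: 'a \<Rightarrow> real)"
  using emeasure_support by (intro integrable_real_indicator) auto

lemma integrable_F: "integrable lborel F"
proof (rule Bochner_Integration.integrable_bound)
  show "integrable lborel (\<lambda>x::'a. C * indicator (cball 0 R) x)" by (intro integrable_mult_right integrable_support)
  show "AE x in lborel. norm (F x) \<le> norm (C * indicator (cball 0 R) x :: real)"
  proof (rule AE_I2)
    fix x
    show "norm (F x) \<le> norm (C * indicator (cball 0 R) x :: real)"
      using FC[of x] FR[of x] by (cases "norm x > R") (auto simp: indicator_def)
  qed
qed measurable

lemma integrable_Fc: "integrable lborel (\<lambda>x. complex_of_real (F x))"
  using integrable_F by (simp add: complex_of_real_integrable_eq)

lemma fdiff_square:
  shows "integrable lborel (\<lambda>x. (fdiff m h F x)\<^sup>2)"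
    and "(\<integral>x. (fdiff m h F x)\<^sup>2 \<partial>lborel) \<le> C\<^sup>2 * norm h powr (2 * \<alpha>) * (real (m + 1) * measure lborel (cball (0::'a) R))"
proof -
  obtain c :: "nat \<Rightarrow> real" where c: "\<And>(f :: 'a \<Rightarrow> real) h x. fdiff m h f x = (\<Sum>i\<le>m. c i *\<^sub>R f (x + real i *\<^sub>R h))"
    using fdiff_expand[of m] by blast
  \<comment> \<open>The \<open>m\<close>-th difference vanishes unless one of the points
    \<open>x + real i *\<^sub>R h\<close> lies in the ball. Counting these points bounds the volume
    of its support independently of \<open>h\<close>.\<close>
  define S where "S = (\<lambda>x::'a. \<Sum>i\<le>m. indicator (cball 0 R) (real i *\<^sub>R h + 1 *\<^sub>R x) :: real)"
  have i1: "integrable lborel (\<lambda>x. indicator (cball 0 R) (real i *\<^sub>R h + 1 *\<^sub>R x) :: real)" for i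
    by (rule integrable_lborel_affine[OF integrable_support]) simp
  have e1: "(\<integral>x. indicator (cball 0 R) (real i *\<^sub>R h + 1 *\<^sub>R x) \<partial>lborel) = measure lborel (cball (0::'a) R)" for i
    using integral_lborel_affine[of 1 "indicator (cball 0 R) :: 'a \<Rightarrow> real" "real i *\<^sub>R h"] by simp
  have iS: "integrable lborel S" unfolding S_def by (intro Bochner_Integration.integrable_sum i1)
  have eS: "(\<integral>x. S x \<partial>lborel) = real (m + 1) * measure lborel (cball (0::'a) R)"
    unfolding S_def using i1 e1 by (subst Bochner_Integration.integral_sum) auto
  have pt: "(fdiff m h F x)\<^sup>2 \<le> (C * norm h powr \<alpha>)\<^sup>2 * S x" for x
  proof (cases "\<exists>i\<le>m. norm (x + real i *\<^sub>R h) \<le> R")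
    case True
    then obtain i where i: "i \<le> m" "norm (x + real i *\<^sub>R h) \<le> R" by blast
    have "indicator (cball 0 R) (real i *\<^sub>R h + 1 *\<^sub>R x) \<le> S x"
      unfolding S_def using i by (intro member_le_sum) auto
    then have S1: "1 \<le> S x" using i by (simp add: indicator_def add.commute)
    have "\<bar>fdiff m h F x\<bar>\<^sup>2 \<le> (C * norm h powr \<alpha>)\<^sup>2" by (rule power_mono[OF Fd]) simp
    also have "\<dots> \<le> (C * norm h powr \<alpha>)\<^sup>2 * S x" using mult_left_mono[OF S1, of "(C * norm h powr \<alpha>)\<^sup>2"] by simp
    finally show ?thesis by simp
  next
    case False
    then have "F (x + real i *\<^sub>R h) = 0" if "i \<le> m" for i using that FR[of "x + real i *\<^sub>R h"] by (metis not_le)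
    then have "fdiff m h F x = 0" unfolding c by (intro sum.neutral) simp
    moreover have "S x \<ge> 0" unfolding S_def by (intro sum_nonneg) auto
    ultimately show ?thesis by simp
  qed
  have m2: "(\<lambda>x. (fdiff m h F x)\<^sup>2) \<in> borel_measurable lborel" using borel_measurable_fdiff[OF Fm, of m h] by simp
  show int: "integrable lborel (\<lambda>x. (fdiff m h F x)\<^sup>2)"
  proof (rule Bochner_Integration.integrable_bound)
    show "integrable lborel (\<lambda>x. (C * norm h powr \<alpha>)\<^sup>2 * S x)" using iS by simp
    show "AE x in lborel. norm ((fdiff m h F x)\<^sup>2) \<le> norm ((C * norm h powr \<alpha>)\<^sup>2 * S x)"
    proof (rule AE_I2)
      fix x show "norm ((fdiff m h F x)\<^sup>2) \<le> norm ((C * norm h powr \<alpha>)\<^sup>2 * S x)" using pt[of x] by simp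
    qed
  qed (rule m2)
  have "(\<integral>x. (fdiff m h F x)\<^sup>2 \<partial>lborel) \<le> (\<integral>x. (C * norm h powr \<alpha>)\<^sup>2 * S x \<partial>lborel)"
    by (rule integral_mono[OF int]) (use iS pt in auto)
  also have "\<dots> = (C * norm h powr \<alpha>)\<^sup>2 * (real (m + 1) * measure lborel (cball (0::'a) R))" using eS by simp
  also have "(C * norm h powr \<alpha>)\<^sup>2 = C\<^sup>2 * norm h powr (2 * \<alpha>)"
    by (cases "h = 0") (simp_all add: power_mult_distrib powr_power)
  finally show "(\<integral>x. (fdiff m h F x)\<^sup>2 \<partial>lborel) \<le> C\<^sup>2 * norm h powr (2 * \<alpha>) * (real (m + 1) * measure lborel (cball (0::'a) R))" .
qed

lemma ft_fdiff_energy: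
  assumes \<delta>: "\<delta> > 0"
  shows "(\<integral>\<^sup>+\<xi>. ennreal (gauss \<delta> \<xi> * (norm (ft (\<lambda>x. complex_of_real (F x)) \<xi>))\<^sup>2 * (norm (cis (\<xi> \<bullet> h) - 1))\<^sup>2 ^ m) \<partial>lborel)
     \<le> ennreal ((2 * pi) ^ DIM('a) * (C\<^sup>2 * norm h powr (2 * \<alpha>) * (real (m + 1) * measure lborel (cball (0::'a) R))))"
proof -
  let ?G = "fdiff m h (\<lambda>x. complex_of_real (F x))"
  have G: "integrable lborel ?G" by (rule integrable_fdiff[OF integrable_Fc])
  have nG: "(\<lambda>y. (norm (?G y))\<^sup>2) = (\<lambda>y. (fdiff m h F y)\<^sup>2)" by (simp add: fdiff_of_real)
  have G2: "integrable lborel (\<lambda>y. (norm (?G y))\<^sup>2)" unfolding nG by (rule fdiff_square)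
  have eq: "gauss \<delta> \<xi> * (norm (ft (\<lambda>x. complex_of_real (F x)) \<xi>))\<^sup>2 * (norm (cis (\<xi> \<bullet> h) - 1))\<^sup>2 ^ m = gauss \<delta> \<xi> * (norm (ft ?G \<xi>))\<^sup>2" for \<xi>
    by (auto simp: ft_fdiff[OF integrable_Fc] norm_mult norm_power power_mult_distrib power_mult[symmetric] mult.commute)
  have "(\<integral>\<^sup>+\<xi>. ennreal (gauss \<delta> \<xi> * (norm (ft (\<lambda>x. complex_of_real (F x)) \<xi>))\<^sup>2 * (norm (cis (\<xi> \<bullet> h) - 1))\<^sup>2 ^ m) \<partial>lborel)
    = (\<integral>\<^sup>+\<xi>. ennreal (gauss \<delta> \<xi> * (norm (ft ?G \<xi>))\<^sup>2) \<partial>lborel)" by (simp only: eq)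
  also have "\<dots> = ennreal (\<integral>\<xi>. gauss \<delta> \<xi> * (norm (ft ?G \<xi>))\<^sup>2 \<partial>lborel)"
    by (intro nn_integral_eq_integral gauss_bessel[OF G G2 \<delta>]) (auto simp: less_imp_le[OF gauss_pos])
  also have "(\<integral>\<xi>. gauss \<delta> \<xi> * (norm (ft ?G \<xi>))\<^sup>2 \<partial>lborel) \<le> (2 * pi) ^ DIM('a) * (\<integral>y. (norm (?G y))\<^sup>2 \<partial>lborel)"
    by (rule gauss_bessel[OF G G2 \<delta>])
  also have "\<dots> \<le> (2 * pi) ^ DIM('a) * (C\<^sup>2 * norm h powr (2 * \<alpha>) * (real (m + 1) * measure lborel (cball (0::'a) R)))"
    unfolding nG by (intro mult_left_mono fdiff_square) auto
  finally show ?thesis by (simp add: ennreal_leI)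
qed

end

text \<open>For a single step the multiplier vanishes at some frequencies; its average over Gaussian
  steps does not. For exponent 1 the average is computed exactly from the transform of the Gaussian,
  and the tangent inequality passes to the power \<open>m\<close>.\<close>

lemma gauss_mean_cis_ge:
  fixes \<xi> :: "'a::euclidean_space"
  assumes \<tau>: "\<tau> * norm \<xi> \<ge> 1" "\<tau> > 0"
  shows "(2 - 2 * exp (- (1 / 2))) ^ m * sqrt (2 * pi) ^ DIM('a)
     \<le> (\<integral>u. gauss 1 u * (norm (cis (\<xi> \<bullet> (\<tau> *\<^sub>R u)) - 1))\<^sup>2 ^ m \<partial>lborel)" (is "?a ^ m * ?Z \<le> _")
    and "integrable lborel (\<lambda>u. gauss 1 u * (norm (cis (\<xi> \<bullet> (\<tau> *\<^sub>R u)) - 1))\<^sup>2 ^ m)"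
proof -
  define X where "X = (\<lambda>u. (norm (cis (\<xi> \<bullet> (\<tau> *\<^sub>R u)) - 1))\<^sup>2)"
  have X: "X u = 2 - 2 * cos (u \<bullet> (\<tau> *\<^sub>R \<xi>))" for u
  proof -
    let ?t = "u \<bullet> (\<tau> *\<^sub>R \<xi>)"
    have "X u = (norm (cis ?t - 1))\<^sup>2" by (simp add: X_def inner_commute)
    also have "\<dots> = (cos ?t - 1)\<^sup>2 + (sin ?t)\<^sup>2" by (simp add: cmod_power2)
    also have "\<dots> = 2 - 2 * cos ?t" using sin_cos_squared_add[of ?t] by (simp add: power2_eq_square algebra_simps)
    finally show ?thesis .
  qed
  have X0: "X u \<ge> 0" for u by (simp add: X_def)
  have X4: "X u \<le> 4" for u unfolding X using cos_ge_minus_one[of "u \<bullet> (\<tau> *\<^sub>R \<xi>)"] by linarith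
  have Xm [measurable]: "X \<in> borel_measurable borel" unfolding X by measurable
  have ig: "integrable lborel (gauss 1 :: 'a \<Rightarrow> real)" by (rule integrable_gauss) simp
  have iX: "integrable lborel (\<lambda>u. gauss 1 u * X u ^ k)" for k
  proof (rule Bochner_Integration.integrable_bound)
    show "integrable lborel (\<lambda>u::'a. gauss 1 u * 4 ^ k)" using ig by simp
    show "AE u in lborel. norm (gauss 1 u * X u ^ k) \<le> norm (gauss 1 u * 4 ^ k)"
    proof (rule AE_I2)
      fix u
      have "X u ^ k \<le> 4 ^ k" using X0 X4 by (intro power_mono) auto
      then show "norm (gauss 1 u * X u ^ k) \<le> norm (gauss 1 u * 4 ^ k)"
        using X0[of u] gauss_pos[of 1 u] by (simp add: abs_mult)
    qed
  qed measurable
  show "integrable lborel (\<lambda>u. gauss 1 u * (norm (cis (\<xi> \<bullet> (\<tau> *\<^sub>R u)) - 1))\<^sup>2 ^ m)"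
    using iX[of m] by (simp add: X_def)
  have Z0: "?Z > 0" by simp
  have a0: "?a \<ge> 0" by simp
  have mean: "(\<integral>u. gauss 1 u * X u \<partial>lborel) \<ge> ?a * ?Z"
  proof -
    have icos: "integrable lborel (\<lambda>u. gauss 1 u * cos (u \<bullet> (\<tau> *\<^sub>R \<xi>)))"
      using integrable_Re[OF gauss_ft_unit(1)[of "\<tau> *\<^sub>R \<xi>"]] by simp
    have "(\<integral>u. gauss 1 u * cos (u \<bullet> (\<tau> *\<^sub>R \<xi>)) \<partial>lborel) = Re (\<integral>u. complex_of_real (gauss 1 u) * cis (u \<bullet> (\<tau> *\<^sub>R \<xi>)) \<partial>lborel)"
      using integral_Re[OF gauss_ft_unit(1)[of "\<tau> *\<^sub>R \<xi>"]] by simp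
    also have "\<dots> = ?Z * gauss 1 (\<tau> *\<^sub>R \<xi>)" unfolding gauss_ft_unit(2) by simp
    finally have c: "(\<integral>u. gauss 1 u * cos (u \<bullet> (\<tau> *\<^sub>R \<xi>)) \<partial>lborel) = ?Z * gauss 1 (\<tau> *\<^sub>R \<xi>)" .
    have "(\<lambda>u. gauss 1 u * X u) = (\<lambda>u. 2 * gauss 1 u - 2 * (gauss 1 u * cos (u \<bullet> (\<tau> *\<^sub>R \<xi>))))"
      by (auto simp: X algebra_simps)
    then have "(\<integral>u. gauss 1 u * X u \<partial>lborel) = 2 * ?Z - 2 * (?Z * gauss 1 (\<tau> *\<^sub>R \<xi>))"
      using ig icos c integral_gauss[of 1, where 'a = 'a] by simp
    moreover have "gauss 1 (\<tau> *\<^sub>R \<xi>) \<le> exp (- (1 / 2))"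
    proof -
      have "1 \<le> (\<tau> * norm \<xi>)\<^sup>2" using \<tau> by (intro one_le_power) auto
      then show ?thesis using \<tau> by (simp add: gauss_def power_mult_distrib)
    qed
    moreover from this have "?Z * gauss 1 (\<tau> *\<^sub>R \<xi>) \<le> ?Z * exp (- (1 / 2))" using Z0 by (intro mult_left_mono) auto
    moreover have "?a * ?Z = 2 * ?Z - 2 * (?Z * exp (- (1 / 2)))" by (simp add: algebra_simps)
    ultimately show ?thesis by linarith
  qed
  have lin: "(\<lambda>u. gauss 1 u * (?a ^ m + real m * ?a ^ (m - 1) * (X u - ?a)))
      = (\<lambda>u. (?a ^ m - real m * ?a ^ (m - 1) * ?a) * gauss 1 u + (real m * ?a ^ (m - 1)) * (gauss 1 u * X u))"
    by (auto simp: algebra_simps)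
  have "?a ^ m * ?Z \<le> ?a ^ m * ?Z + real m * ?a ^ (m - 1) * ((\<integral>u. gauss 1 u * X u \<partial>lborel) - ?a * ?Z)"
    using mean a0 by simp
  also have "\<dots> = (\<integral>u. gauss 1 u * (?a ^ m + real m * ?a ^ (m - 1) * (X u - ?a)) \<partial>lborel)"
  proof -
    have "(\<integral>u. gauss 1 u * (?a ^ m + real m * ?a ^ (m - 1) * (X u - ?a)) \<partial>lborel)
      = (?a ^ m - real m * ?a ^ (m - 1) * ?a) * ?Z + (real m * ?a ^ (m - 1)) * (\<integral>u. gauss 1 u * X u \<partial>lborel)"
      unfolding lin using ig iX[of 1] integral_gauss[of 1, where 'a = 'a] by simp
    then show ?thesis by (simp add: algebra_simps)
  qed
  also have "\<dots> \<le> (\<integral>u. gauss 1 u * X u ^ m \<partial>lborel)"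
  proof (rule integral_mono)
    show "integrable lborel (\<lambda>u. gauss 1 u * (?a ^ m + real m * ?a ^ (m - 1) * (X u - ?a)))"
      unfolding lin using ig iX[of 1] by (intro Bochner_Integration.integrable_add integrable_mult_right) simp_all
    show "integrable lborel (\<lambda>u. gauss 1 u * X u ^ m)" by (rule iX)
    show "gauss 1 u * (?a ^ m + real m * ?a ^ (m - 1) * (X u - ?a)) \<le> gauss 1 u * X u ^ m" for u
      using power_tangent_le[of "X u" ?a m, OF X0 a0] gauss_pos[of 1 u] by (intro mult_left_mono) auto
  qed
  finally show "?a ^ m * ?Z \<le> (\<integral>u. gauss 1 u * (norm (cis (\<xi> \<bullet> (\<tau> *\<^sub>R u)) - 1))\<^sup>2 ^ m \<partial>lborel)" by (simp add: X_def)
qed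

lemma ennreal_le_divide:
  assumes "c > 0" "y \<ge> 0" "ennreal c * x \<le> ennreal y"
  shows "x \<le> ennreal (y / c)"
proof -
  have "x = ennreal (1 / c) * (ennreal c * x)"
    using assms(1) by (simp add: mult.assoc[symmetric] ennreal_mult[symmetric])
  also have "\<dots> \<le> ennreal (1 / c) * ennreal y" by (rule mult_left_mono[OF assms(3)]) simp
  also have "\<dots> = ennreal (y / c)" using assms by (simp add: ennreal_mult[symmetric])
  finally show ?thesis .
qed

text \<open>The Gaussian average of the energy of the \<open>m\<close>-th differences, divided by
  the lower bound for the averaged multiplier. It is kept explicit because it must not depend on the
  function \<open>F\<close>.\<close>

definition tail_const :: "'a::euclidean_space itself \<Rightarrow> real \<Rightarrow> real \<Rightarrow> real \<Rightarrow> nat \<Rightarrow> real" where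
  "tail_const _ C R \<alpha> m = (2 * pi) ^ DIM('a) * (C\<^sup>2 * (real (m + 1) * measure lborel (cball (0::'a) R))) *
     (\<integral>u. gauss 1 (u::'a) * norm u powr (2 * \<alpha>) \<partial>lborel) / ((2 - 2 * exp (- (1 / 2))) ^ m * sqrt (2 * pi) ^ DIM('a))"

context rough
begin

text \<open>The energy bound for differences is averaged over steps
  \<open>\<tau> *\<^sub>R u\<close> with Gaussian \<open>u\<close>. After Fubini the averaged
  multiplier is bounded below at all frequencies of norm at least \<open>1 / \<tau>\<close>, while
  the other side costs \<open>\<tau> powr (2 * \<alpha>)\<close> times a Gaussian moment.\<close>

lemma tail_energy:
  assumes \<delta>: "\<delta> > 0" and \<tau>: "\<tau> > 0"
  shows "(\<integral>\<^sup>+\<xi>. ennreal (gauss \<delta> \<xi> * (norm (ft (\<lambda>x. complex_of_real (F x)) \<xi>))\<^sup>2 * indicator {\<xi>. 1 \<le> \<tau> * norm \<xi>} \<xi>) \<partial>lborel)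
     \<le> ennreal (tail_const TYPE('a) C R \<alpha> m * \<tau> powr (2 * \<alpha>))"
proof -
  let ?A = "\<lambda>\<xi>. gauss \<delta> \<xi> * (norm (ft (\<lambda>x. complex_of_real (F x)) \<xi>))\<^sup>2"
  let ?X = "\<lambda>\<xi> u. (norm (cis (\<xi> \<bullet> (\<tau> *\<^sub>R u)) - 1))\<^sup>2 ^ m"
  let ?a = "(2 - 2 * exp (- (1 / 2))) ^ m * sqrt (2 * pi) ^ DIM('a)"
  let ?K = "(2 * pi) ^ DIM('a) * (C\<^sup>2 * (real (m + 1) * measure lborel (cball (0::'a) R)))"
  let ?M = "\<integral>u. gauss 1 (u::'a) * norm u powr (2 * \<alpha>) \<partial>lborel"
  have a: "?a > 0" by (intro mult_pos_pos zero_less_power) auto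
  have [measurable]: "ft (\<lambda>x. complex_of_real (F x)) \<in> borel_measurable borel" by (rule borel_measurable_ft[OF integrable_Fc])
  have A0: "?A \<xi> \<ge> 0" for \<xi> using gauss_pos[of \<delta> \<xi>] by simp
  have iM: "integrable lborel (\<lambda>u::'a. gauss 1 u * norm u powr (2 * \<alpha>))" by (rule integrable_gauss_moment) (use \<alpha> in simp)
  have M0: "?M \<ge> 0" by (intro Bochner_Integration.integral_nonneg mult_nonneg_nonneg) (auto simp: less_imp_le[OF gauss_pos])
  have K0: "?K \<ge> 0" by simp
  have "ennreal ?a * (\<integral>\<^sup>+\<xi>. ennreal (?A \<xi> * indicator {\<xi>. 1 \<le> \<tau> * norm \<xi>} \<xi>) \<partial>lborel)
     = (\<integral>\<^sup>+\<xi>. ennreal ?a * ennreal (?A \<xi> * indicator {\<xi>. 1 \<le> \<tau> * norm \<xi>} \<xi>) \<partial>lborel)"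
    by (rule nn_integral_cmult[symmetric]) measurable
  also have "\<dots> \<le> (\<integral>\<^sup>+\<xi>. \<integral>\<^sup>+u. ennreal (gauss 1 u * (?A \<xi> * ?X \<xi> u)) \<partial>lborel \<partial>lborel)"
  proof (rule nn_integral_mono)
    fix \<xi> :: 'a
    show "ennreal ?a * ennreal (?A \<xi> * indicator {\<xi>. 1 \<le> \<tau> * norm \<xi>} \<xi>) \<le> (\<integral>\<^sup>+u. ennreal (gauss 1 u * (?A \<xi> * ?X \<xi> u)) \<partial>lborel)"
    proof (cases "1 \<le> \<tau> * norm \<xi>")
      case True
      note g = gauss_mean_cis_ge[OF True \<tau>, of m]
      have "ennreal ?a * ennreal (?A \<xi> * indicator {\<xi>. 1 \<le> \<tau> * norm \<xi>} \<xi>) = ennreal (?a * ?A \<xi>)"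
        using True a A0[of \<xi>] by (simp add: ennreal_mult[symmetric])
      also have "\<dots> \<le> ennreal ((\<integral>u. gauss 1 u * ?X \<xi> u \<partial>lborel) * ?A \<xi>)"
        by (intro ennreal_leI mult_right_mono g A0)
      also have "(\<integral>u. gauss 1 u * ?X \<xi> u \<partial>lborel) * ?A \<xi> = (\<integral>u. gauss 1 u * ?X \<xi> u * ?A \<xi> \<partial>lborel)" by (rule integral_mult_left_zero[symmetric])
      also have "(\<lambda>u. gauss 1 u * ?X \<xi> u * ?A \<xi>) = (\<lambda>u. gauss 1 u * (?A \<xi> * ?X \<xi> u))" by (simp add: mult_ac)
      also have "ennreal (\<integral>u. gauss 1 u * (?A \<xi> * ?X \<xi> u) \<partial>lborel) = (\<integral>\<^sup>+u. ennreal (gauss 1 u * (?A \<xi> * ?X \<xi> u)) \<partial>lborel)"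
      proof (rule nn_integral_eq_integral[symmetric])
        have "integrable lborel (\<lambda>u. gauss 1 u * ?X \<xi> u * ?A \<xi>)" by (rule integrable_mult_left) (rule g(2))
        then show "integrable lborel (\<lambda>u. gauss 1 u * (?A \<xi> * ?X \<xi> u))" by (simp add: mult_ac)
        show "AE u in lborel. 0 \<le> gauss 1 u * (?A \<xi> * ?X \<xi> u)"
          by (intro AE_I2 mult_nonneg_nonneg A0) (auto simp: less_imp_le[OF gauss_pos])
      qed
      finally show ?thesis .
    qed simp
  qed
  also have "\<dots> = (\<integral>\<^sup>+u. \<integral>\<^sup>+\<xi>. ennreal (gauss 1 u * (?A \<xi> * ?X \<xi> u)) \<partial>lborel \<partial>lborel)"
    by (rule lborel_pair.Fubini') measurable
  also have "\<dots> \<le> (\<integral>\<^sup>+u. ennreal (?K * \<tau> powr (2 * \<alpha>) * (gauss 1 (u::'a) * norm u powr (2 * \<alpha>))) \<partial>lborel)"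
  proof (rule nn_integral_mono)
    fix u :: 'a
    have "(\<integral>\<^sup>+\<xi>. ennreal (gauss 1 u * (?A \<xi> * ?X \<xi> u)) \<partial>lborel) = (\<integral>\<^sup>+\<xi>. ennreal (gauss 1 u) * ennreal (?A \<xi> * ?X \<xi> u) \<partial>lborel)"
      by (intro nn_integral_cong ennreal_mult mult_nonneg_nonneg A0) (auto simp: less_imp_le[OF gauss_pos])
    also have "\<dots> = ennreal (gauss 1 u) * (\<integral>\<^sup>+\<xi>. ennreal (?A \<xi> * ?X \<xi> u) \<partial>lborel)"
      by (rule nn_integral_cmult) measurable
    also have "\<dots> \<le> ennreal (gauss 1 u) * ennreal ((2 * pi) ^ DIM('a) * (C\<^sup>2 * norm (\<tau> *\<^sub>R u) powr (2 * \<alpha>) * (real (m + 1) * measure lborel (cball (0::'a) R))))"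
      by (intro mult_left_mono ft_fdiff_energy[OF \<delta>]) simp
    also have "\<dots> = ennreal (gauss 1 u * ((2 * pi) ^ DIM('a) * (C\<^sup>2 * norm (\<tau> *\<^sub>R u) powr (2 * \<alpha>) * (real (m + 1) * measure lborel (cball (0::'a) R)))))"
      by (rule ennreal_mult[symmetric]) (auto simp: less_imp_le[OF gauss_pos])
    also have "norm (\<tau> *\<^sub>R u) powr (2 * \<alpha>) = \<tau> powr (2 * \<alpha>) * norm u powr (2 * \<alpha>)" using \<tau> by (simp add: powr_mult)
    finally show "(\<integral>\<^sup>+\<xi>. ennreal (gauss 1 u * (?A \<xi> * ?X \<xi> u)) \<partial>lborel) \<le> ennreal (?K * \<tau> powr (2 * \<alpha>) * (gauss 1 u * norm u powr (2 * \<alpha>)))"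
      by (simp add: mult_ac)
  qed
  also have "\<dots> = ennreal (\<integral>u. ?K * \<tau> powr (2 * \<alpha>) * (gauss 1 (u::'a) * norm u powr (2 * \<alpha>)) \<partial>lborel)"
  proof (rule nn_integral_eq_integral)
    show "integrable lborel (\<lambda>u::'a. ?K * \<tau> powr (2 * \<alpha>) * (gauss 1 u * norm u powr (2 * \<alpha>)))" by (rule integrable_mult_right) (rule iM)
    show "AE u in lborel. 0 \<le> ?K * \<tau> powr (2 * \<alpha>) * (gauss 1 (u::'a) * norm u powr (2 * \<alpha>))"
      by (intro AE_I2 mult_nonneg_nonneg) (auto simp: less_imp_le[OF gauss_pos])
  qed
  also have "\<dots> = ennreal (?K * \<tau> powr (2 * \<alpha>) * ?M)" by (simp only: integral_mult_right_zero)
  finally have "(\<integral>\<^sup>+\<xi>. ennreal (?A \<xi> * indicator {\<xi>. 1 \<le> \<tau> * norm \<xi>} \<xi>) \<partial>lborel) \<le> ennreal (?K * \<tau> powr (2 * \<alpha>) * ?M / ?a)"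
    by (intro ennreal_le_divide[OF a]) (use K0 M0 in \<open>auto intro!: mult_nonneg_nonneg\<close>)
  also have "?K * \<tau> powr (2 * \<alpha>) * ?M / ?a = tail_const TYPE('a) C R \<alpha> m * \<tau> powr (2 * \<alpha>)"
    by (simp add: tail_const_def)
  finally show ?thesis .
qed

lemma total_energy:
  assumes \<delta>: "\<delta> > 0"
  shows "(\<integral>\<^sup>+\<xi>. ennreal (gauss \<delta> \<xi> * (norm (ft (\<lambda>x. complex_of_real (F x)) \<xi>))\<^sup>2) \<partial>lborel)
     \<le> ennreal ((2 * pi) ^ DIM('a) * (C\<^sup>2 * measure lborel (cball (0::'a) R)))"
proof -
  have pt: "(F x)\<^sup>2 \<le> C\<^sup>2 * indicator (cball 0 R) x" for x
  proof (cases "norm x > R")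
    case False
    have "\<bar>F x\<bar>\<^sup>2 \<le> C\<^sup>2" by (rule power_mono[OF FC]) simp
    then show ?thesis using False by (simp add: indicator_def)
  qed (simp add: FR)
  have i2: "integrable lborel (\<lambda>x. (F x)\<^sup>2)"
  proof (rule Bochner_Integration.integrable_bound)
    show "integrable lborel (\<lambda>x::'a. C\<^sup>2 * indicator (cball 0 R) x :: real)" by (intro integrable_mult_right integrable_support)
    show "AE x in lborel. norm ((F x)\<^sup>2) \<le> norm (C\<^sup>2 * indicator (cball 0 R) x :: real)"
      by (rule AE_I2) (use pt in auto)
  qed measurable
  have F2: "integrable lborel (\<lambda>y. (norm (complex_of_real (F y)))\<^sup>2)" using i2 by simp
  have "(\<integral>\<^sup>+\<xi>. ennreal (gauss \<delta> \<xi> * (norm (ft (\<lambda>x. complex_of_real (F x)) \<xi>))\<^sup>2) \<partial>lborel)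
     = ennreal (\<integral>\<xi>. gauss \<delta> \<xi> * (norm (ft (\<lambda>x. complex_of_real (F x)) \<xi>))\<^sup>2 \<partial>lborel)"
    by (intro nn_integral_eq_integral gauss_bessel[OF integrable_Fc F2 \<delta>]) (auto simp: less_imp_le[OF gauss_pos])
  also have "\<dots> \<le> ennreal ((2 * pi) ^ DIM('a) * (\<integral>y. (norm (complex_of_real (F y)))\<^sup>2 \<partial>lborel))"
    by (intro ennreal_leI gauss_bessel[OF integrable_Fc F2 \<delta>])
  also have "\<dots> \<le> ennreal ((2 * pi) ^ DIM('a) * (C\<^sup>2 * measure lborel (cball (0::'a) R)))"
  proof (intro ennreal_leI mult_left_mono)
    have "(\<integral>y. (F y)\<^sup>2 \<partial>lborel) \<le> (\<integral>y. C\<^sup>2 * indicator (cball (0::'a) R) y \<partial>lborel)"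
      by (rule integral_mono[OF i2]) (use pt integrable_support in \<open>auto intro!: integrable_mult_right\<close>)
    then show "(\<integral>y. (norm (complex_of_real (F y)))\<^sup>2 \<partial>lborel) \<le> C\<^sup>2 * measure lborel (cball (0::'a) R)" by simp
  qed simp
  finally show ?thesis .
qed

end

text \<open>For \<open>2 ^ j \<le> norm \<xi> < 2 ^ (j + 1)\<close> the weight is comparable to
  \<open>(2 ^ j) ^ p\<close>, a term of the sum; beyond \<open>2 ^ J\<close> the Gaussian absorbs
  every power of \<open>norm \<xi> / 2 ^ J\<close>.\<close>

lemma gauss_weight_dyadic:
  fixes p :: nat
  shows "\<exists>K>0. \<forall>J. \<forall>\<xi>::'a::euclidean_space. gauss (1 / 2 ^ J) \<xi> * (1 + norm \<xi>) ^ p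
     \<le> K * (1 + (\<Sum>j\<le>J. (2 ^ j) ^ p * indicator {\<xi>. 1 \<le> 1 / 2 ^ j * norm \<xi>} \<xi>))"
proof -
  define L where "L = real p ^ p * 2 ^ p"
  define K where "K = 4 ^ p + 2 ^ p * L + 1"
  have L0: "L \<ge> 0" by (simp add: L_def)
  have K: "4 ^ p \<le> K" "2 ^ p * L \<le> K" "K > 0" using L0 by (auto simp: K_def add_nonneg_pos)
  have "gauss (1 / 2 ^ J) \<xi> * (1 + norm \<xi>) ^ p \<le> K * (1 + (\<Sum>j\<le>J. (2 ^ j) ^ p * indicator {\<xi>. 1 \<le> 1 / 2 ^ j * norm \<xi>} \<xi>))" for J and \<xi> :: 'a
  proof -
    let ?S = "\<Sum>j\<le>J. (2 ^ j) ^ p * indicator {\<xi>. 1 \<le> 1 / 2 ^ j * norm \<xi>} \<xi> :: real"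
    have S0: "?S \<ge> 0" by (intro sum_nonneg) auto
    have trm: "(2 ^ j) ^ p \<le> ?S" if "j \<le> J" "2 ^ j \<le> norm \<xi>" for j
    proof -
      have "(2 ^ j) ^ p * indicator {\<xi>. 1 \<le> 1 / 2 ^ j * norm \<xi>} \<xi> \<le> ?S" using that by (intro member_le_sum) auto
      moreover have "indicator {\<xi>. 1 \<le> 1 / 2 ^ j * norm \<xi>} \<xi> = (1::real)" using that by (simp add: field_simps)
      ultimately show ?thesis by simp
    qed
    consider "norm \<xi> < 1" | "norm \<xi> \<ge> 2 ^ J" | "1 \<le> norm \<xi>" "norm \<xi> < 2 ^ J" by linarith
    then show ?thesis
    proof cases
      case 1
      have "gauss (1 / 2 ^ J) \<xi> * (1 + norm \<xi>) ^ p \<le> 1 * 4 ^ p"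
        using gauss_le_1[of "1 / 2 ^ J" \<xi>] gauss_pos[of "1 / 2 ^ J" \<xi>] 1 by (intro mult_mono power_mono) auto
      also have "\<dots> \<le> K * 1" using K by simp
      also have "\<dots> \<le> K * (1 + ?S)" using K S0 by (intro mult_left_mono) auto
      finally show ?thesis .
    next
      case 2
      define y where "y = norm \<xi> / 2 ^ J"
      have y: "y \<ge> 1" using 2 by (simp add: y_def)
      have n: "norm \<xi> = 2 ^ J * y" by (simp add: y_def)
      have n1: "1 \<le> norm \<xi>" using 2 one_le_power[of "2::real" J] by linarith
      have "y ^ p \<le> (y\<^sup>2) ^ p" using y by (intro power_mono) (auto simp: power2_eq_square)
      also have "\<dots> = 2 ^ p * (y\<^sup>2 / 2) ^ p" by (simp add: power_divide)
      also have "\<dots> \<le> 2 ^ p * (real p ^ p * exp (y\<^sup>2 / 2))" by (intro mult_left_mono power_le_exp) auto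
      finally have yp: "y ^ p \<le> L * exp (y\<^sup>2 / 2)" by (simp add: L_def mult_ac)
      have "(1 + norm \<xi>) ^ p \<le> (2 * norm \<xi>) ^ p" using n1 by (intro power_mono) auto
      also have "\<dots> = 2 ^ p * (2 ^ J) ^ p * y ^ p" by (simp add: n power_mult_distrib)
      also have "\<dots> \<le> 2 ^ p * (2 ^ J) ^ p * (L * exp (y\<^sup>2 / 2))" using yp by (intro mult_left_mono) auto
      finally have "gauss (1 / 2 ^ J) \<xi> * (1 + norm \<xi>) ^ p \<le> gauss (1 / 2 ^ J) \<xi> * (2 ^ p * (2 ^ J) ^ p * (L * exp (y\<^sup>2 / 2)))"
        using gauss_pos[of "1 / 2 ^ J" \<xi>] by (intro mult_left_mono) auto
      moreover have ge: "gauss (1 / 2 ^ J) \<xi> = exp (- (y\<^sup>2 / 2))" by (simp add: gauss_def n power_mult_distrib power_divide)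
      ultimately have "gauss (1 / 2 ^ J) \<xi> * (1 + norm \<xi>) ^ p \<le> exp (- (y\<^sup>2 / 2)) * (2 ^ p * (2 ^ J) ^ p * (L * exp (y\<^sup>2 / 2)))"
        by simp
      also have "exp (- (y\<^sup>2 / 2)) * (2 ^ p * (2 ^ J) ^ p * (L * exp (y\<^sup>2 / 2))) = (2 ^ p * L) * (2 ^ J) ^ p" by (simp add: exp_minus)
      also have "\<dots> \<le> K * (1 + ?S)" using K trm[of J] 2 L0 S0 by (intro mult_mono) auto
      finally show ?thesis .
    next
      case 3
      define j where "j = (GREATEST j. 2 ^ j \<le> norm \<xi>)"
      have bnd: "\<forall>i. 2 ^ i \<le> norm \<xi> \<longrightarrow> i \<le> J"
      proof (intro allI impI)
        fix i assume "2 ^ i \<le> norm \<xi>"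
        then have "(2::real) ^ i < 2 ^ J" using 3 by linarith
        then show "i \<le> J" by (simp add: less_imp_le)
      qed
      have j: "2 ^ j \<le> norm \<xi>" unfolding j_def by (rule GreatestI_nat[of _ 0 J]) (use 3 bnd in auto)
      have j2: "\<not> 2 ^ Suc j \<le> norm \<xi>"
      proof
        assume "2 ^ Suc j \<le> norm \<xi>"
        then have "Suc j \<le> j" unfolding j_def by (rule Greatest_le_nat[of _ _ J]) (use bnd in auto)
        then show False by simp
      qed
      have "gauss (1 / 2 ^ J) \<xi> * (1 + norm \<xi>) ^ p \<le> 1 * (4 * 2 ^ j) ^ p"
        using gauss_le_1[of "1 / 2 ^ J" \<xi>] gauss_pos[of "1 / 2 ^ J" \<xi>] 3 j2 by (intro mult_mono power_mono) auto
      also have "\<dots> = 4 ^ p * (2 ^ j) ^ p" by (simp add: power_mult_distrib)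
      also have "\<dots> \<le> K * (1 + ?S)" using K trm[of j] j bnd S0 by (intro mult_mono) auto
      finally show ?thesis .
    qed
  qed
  with K show ?thesis by blast
qed

text \<open>The tail estimates at scales \<open>1 / 2 ^ j\<close> add up to a geometric sum of ratio
  \<open>2 powr (p - 2 * \<alpha>) > 1\<close>, dominated by its last term. Of the two Gaussian
  factors one is spent on the tail estimates, the other on truncating the polynomial weight.\<close>

lemma dyadic_energy:
  fixes C R \<alpha> :: real and m p :: nat
  assumes p: "2 * \<alpha> < real p"
  shows "\<exists>K>0. \<forall>(F :: 'a::euclidean_space \<Rightarrow> real) J. rough F C R \<alpha> m \<longrightarrow>
    (\<integral>\<^sup>+\<xi>. ennreal ((gauss (1 / 2 ^ J) \<xi>)\<^sup>2 * (norm (ft (\<lambda>x. complex_of_real (F x)) \<xi>))\<^sup>2 * (1 + norm \<xi>) ^ p) \<partial>lborel)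
      \<le> ennreal (K * 2 powr (real J * (real p - 2 * \<alpha>)))"
proof -
  obtain K3 where K3: "K3 > 0" "\<And>J (\<xi>::'a). gauss (1 / 2 ^ J) \<xi> * (1 + norm \<xi>) ^ p
     \<le> K3 * (1 + (\<Sum>j\<le>J. (2 ^ j) ^ p * indicator {\<xi>. 1 \<le> 1 / 2 ^ j * norm \<xi>} \<xi>))"
    using gauss_weight_dyadic[of p, where 'a = 'a] by blast
  define K0 where "K0 = (2 * pi) ^ DIM('a) * (C\<^sup>2 * measure lborel (cball (0::'a) R))"
  define K2 where "K2 = max 0 (tail_const TYPE('a) C R \<alpha> m)"
  define q where "q = real p - 2 * \<alpha>"
  define x where "x = 2 powr q"
  have q: "q > 0" using p by (simp add: q_def)
  have x: "x > 1" using q by (simp add: x_def)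
  have K00: "K0 \<ge> 0" by (simp add: K0_def)
  define K where "K = K3 * (K0 + K2 * (x / (x - 1))) + 1"
  have K2x: "K2 * (x / (x - 1)) \<ge> 0" using x by (simp add: K2_def)
  have Kpos: "K > 0" unfolding K_def using K3(1) K00 K2x by (intro add_nonneg_pos mult_nonneg_nonneg) auto
  have "(\<integral>\<^sup>+\<xi>. ennreal ((gauss (1 / 2 ^ J) \<xi>)\<^sup>2 * (norm (ft (\<lambda>x. complex_of_real (F x)) \<xi>))\<^sup>2 * (1 + norm \<xi>) ^ p) \<partial>lborel)
      \<le> ennreal (K * 2 powr (real J * q))" if "rough F C R \<alpha> m" for F :: "'a \<Rightarrow> real" and J
  proof -
    interpret rough F C R \<alpha> m by fact
    define \<delta> :: real where "\<delta> = 1 / 2 ^ J"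
    have \<delta>: "\<delta> > (0::real)" by (simp add: \<delta>_def)
    define A where "A = (\<lambda>\<xi>. gauss \<delta> \<xi> * (norm (ft (\<lambda>x. complex_of_real (F x)) \<xi>))\<^sup>2)"
    have [measurable]: "ft (\<lambda>x. complex_of_real (F x)) \<in> borel_measurable borel" by (rule borel_measurable_ft[OF integrable_Fc])
    have [measurable]: "A \<in> borel_measurable borel" unfolding A_def by measurable
    have A0: "A \<xi> \<ge> 0" for \<xi> unfolding A_def using gauss_pos[of \<delta> \<xi>] by simp
    let ?I = "\<lambda>j \<xi>. indicator {\<xi>::'a. 1 \<le> 1 / 2 ^ j * norm \<xi>} \<xi> :: real"
    have "(\<integral>\<^sup>+\<xi>. ennreal ((gauss \<delta> \<xi>)\<^sup>2 * (norm (ft (\<lambda>x. complex_of_real (F x)) \<xi>))\<^sup>2 * (1 + norm \<xi>) ^ p) \<partial>lborel)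
      \<le> (\<integral>\<^sup>+\<xi>. (ennreal K3 * (ennreal (A \<xi>) + (\<Sum>j\<le>J. ennreal ((2 ^ j) ^ p) * ennreal (A \<xi> * ?I j \<xi>)))) \<partial>lborel)"
    proof (rule nn_integral_mono)
      fix \<xi> :: 'a
      have "(gauss \<delta> \<xi>)\<^sup>2 * (norm (ft (\<lambda>x. complex_of_real (F x)) \<xi>))\<^sup>2 * (1 + norm \<xi>) ^ p = A \<xi> * (gauss \<delta> \<xi> * (1 + norm \<xi>) ^ p)"
        by (simp add: A_def power2_eq_square mult_ac)
      also have "\<dots> \<le> A \<xi> * (K3 * (1 + (\<Sum>j\<le>J. (2 ^ j) ^ p * ?I j \<xi>)))"
        unfolding \<delta>_def by (intro mult_left_mono K3(2) A0[unfolded \<delta>_def])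
      also have "\<dots> = K3 * (A \<xi> + (\<Sum>j\<le>J. (2 ^ j) ^ p * (A \<xi> * ?I j \<xi>)))"
        unfolding distrib_left sum_distrib_left by (intro arg_cong2[of _ _ _ _ "(+)"] sum.cong) (simp_all only: mult_ac mult_1_right)
      finally have "ennreal ((gauss \<delta> \<xi>)\<^sup>2 * (norm (ft (\<lambda>x. complex_of_real (F x)) \<xi>))\<^sup>2 * (1 + norm \<xi>) ^ p)
        \<le> ennreal (K3 * (A \<xi> + (\<Sum>j\<le>J. (2 ^ j) ^ p * (A \<xi> * ?I j \<xi>))))" by (rule ennreal_leI)
      also have "\<dots> = ennreal K3 * (ennreal (A \<xi>) + ennreal (\<Sum>j\<le>J. (2 ^ j) ^ p * (A \<xi> * ?I j \<xi>)))"
        using K3(1) A0[of \<xi>] by (simp add: ennreal_mult sum_nonneg)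
      also have "ennreal (\<Sum>j\<le>J. (2 ^ j) ^ p * (A \<xi> * ?I j \<xi>)) = (\<Sum>j\<le>J. ennreal ((2 ^ j) ^ p) * ennreal (A \<xi> * ?I j \<xi>))"
        using A0[of \<xi>] by (subst sum_ennreal[symmetric]) (auto simp: ennreal_mult[symmetric])
      finally show "ennreal ((gauss \<delta> \<xi>)\<^sup>2 * (norm (ft (\<lambda>x. complex_of_real (F x)) \<xi>))\<^sup>2 * (1 + norm \<xi>) ^ p)
        \<le> ennreal K3 * (ennreal (A \<xi>) + (\<Sum>j\<le>J. ennreal ((2 ^ j) ^ p) * ennreal (A \<xi> * ?I j \<xi>)))" .
    qed
    also have "\<dots> = ennreal K3 * ((\<integral>\<^sup>+\<xi>. ennreal (A \<xi>) \<partial>lborel) + (\<Sum>j\<le>J. ennreal ((2 ^ j) ^ p) * (\<integral>\<^sup>+\<xi>. ennreal (A \<xi> * ?I j \<xi>) \<partial>lborel)))"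
      by (simp add: nn_integral_cmult nn_integral_add nn_integral_sum)
    also have "\<dots> \<le> ennreal K3 * (ennreal K0 + (\<Sum>j\<le>J. ennreal ((2 ^ j) ^ p) * ennreal (K2 * (1 / 2 ^ j) powr (2 * \<alpha>))))"
    proof (intro mult_left_mono add_mono sum_mono)
      show "(\<integral>\<^sup>+\<xi>. ennreal (A \<xi>) \<partial>lborel) \<le> ennreal K0" unfolding A_def K0_def by (rule total_energy[OF \<delta>])
      fix j
      have "(\<integral>\<^sup>+\<xi>. ennreal (A \<xi> * ?I j \<xi>) \<partial>lborel) \<le> ennreal (tail_const TYPE('a) C R \<alpha> m * (1 / 2 ^ j) powr (2 * \<alpha>))"
        unfolding A_def by (rule tail_energy[OF \<delta>]) simp
      also have "\<dots> \<le> ennreal (K2 * (1 / 2 ^ j) powr (2 * \<alpha>))" by (intro ennreal_leI mult_right_mono) (auto simp: K2_def)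
      finally show "(\<integral>\<^sup>+\<xi>. ennreal (A \<xi> * ?I j \<xi>) \<partial>lborel) \<le> ennreal (K2 * (1 / 2 ^ j) powr (2 * \<alpha>))" .
    qed auto
    also have "\<dots> = ennreal (K3 * (K0 + (\<Sum>j\<le>J. (2 ^ j) ^ p * (K2 * (1 / 2 ^ j) powr (2 * \<alpha>)))))"
    proof -
      have "(\<Sum>j\<le>J. ennreal ((2 ^ j) ^ p) * ennreal (K2 * (1 / 2 ^ j) powr (2 * \<alpha>))) = ennreal (\<Sum>j\<le>J. (2 ^ j) ^ p * (K2 * (1 / 2 ^ j) powr (2 * \<alpha>)))"
        by (subst sum_ennreal[symmetric]) (auto simp: ennreal_mult[symmetric] K2_def)
      moreover have "(\<Sum>j\<le>J. (2 ^ j) ^ p * (K2 * (1 / 2 ^ j) powr (2 * \<alpha>))) \<ge> 0" by (intro sum_nonneg) (auto simp: K2_def)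
      ultimately show ?thesis using K3(1) K00 by (simp add: ennreal_mult)
    qed
    also have "\<dots> \<le> ennreal (K * 2 powr (real J * q))"
    proof (rule ennreal_leI)
      have xj: "(2 ^ j) ^ p * (1 / 2 ^ j) powr (2 * \<alpha>) = x ^ j" for j :: nat
      proof -
        have "((2::real) ^ j) ^ p = 2 powr (real j * real p)" by (simp add: powr_realpow[symmetric] powr_powr)
        moreover have "(1 / 2 ^ j) powr (2 * \<alpha>) = 2 powr (- (real j * (2 * \<alpha>)))"
          by (simp add: powr_divide powr_minus_divide powr_realpow[symmetric] powr_powr)
        ultimately have "(2 ^ j) ^ p * (1 / 2 ^ j) powr (2 * \<alpha>) = 2 powr (real j * real p + - (real j * (2 * \<alpha>)))"
          by (simp only: powr_add)
        also have "real j * real p + - (real j * (2 * \<alpha>)) = q * real j" by (simp add: q_def algebra_simps)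
        also have "2 powr (q * real j) = x ^ j" by (simp add: x_def powr_powr[symmetric] powr_realpow)
        finally show ?thesis .
      qed
      have geo: "(\<Sum>j\<le>J. x ^ j) \<le> x / (x - 1) * x ^ J"
      proof -
        have "(\<Sum>j\<le>J. x ^ j) = (x ^ Suc J - 1) / (x - 1)" using x sum_gp_basic[of x J] by (simp add: field_simps)
        also have "\<dots> \<le> x ^ Suc J / (x - 1)" using x by (intro divide_right_mono) auto
        finally show ?thesis by simp
      qed
      have xJ: "x ^ J = 2 powr (real J * q)" by (simp add: x_def powr_powr[symmetric] powr_realpow[symmetric] mult.commute)
      have xJ1: "x ^ J \<ge> 1" using x by simp
      have "(\<Sum>j\<le>J. (2 ^ j) ^ p * (K2 * (1 / 2 ^ j) powr (2 * \<alpha>))) = K2 * (\<Sum>j\<le>J. (2 ^ j) ^ p * (1 / 2 ^ j) powr (2 * \<alpha>))"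
        by (simp add: sum_distrib_left mult_ac)
      also have "\<dots> = K2 * (\<Sum>j\<le>J. x ^ j)" by (simp only: xj)
      also have "\<dots> \<le> K2 * (x / (x - 1) * x ^ J)" using geo by (intro mult_left_mono) (auto simp: K2_def)
      finally have "K0 + (\<Sum>j\<le>J. (2 ^ j) ^ p * (K2 * (1 / 2 ^ j) powr (2 * \<alpha>))) \<le> K0 * x ^ J + K2 * (x / (x - 1)) * x ^ J"
        using mult_left_mono[OF xJ1 K00] by (simp add: mult.assoc)
      then have "K3 * (K0 + (\<Sum>j\<le>J. (2 ^ j) ^ p * (K2 * (1 / 2 ^ j) powr (2 * \<alpha>)))) \<le> K3 * (K0 * x ^ J + K2 * (x / (x - 1)) * x ^ J)"
        using K3(1) by (intro mult_left_mono) auto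
      also have "\<dots> = (K - 1) * x ^ J" by (simp add: K_def algebra_simps)
      also have "\<dots> \<le> K * x ^ J" using x by (intro mult_right_mono) auto
      finally show "K3 * (K0 + (\<Sum>j\<le>J. (2 ^ j) ^ p * (K2 * (1 / 2 ^ j) powr (2 * \<alpha>)))) \<le> K * 2 powr (real J * q)" by (simp add: xJ)
    qed
    finally show ?thesis by (simp add: \<delta>_def)
  qed
  then show ?thesis using Kpos unfolding q_def by blast
qed

subsection \<open>Polar coordinates over a thick shell\<close>

text \<open>Polar coordinates without surface measure: \<open>\<xi>\<close> is the radius times a
  vector of the shell. Each nonzero \<open>\<xi>\<close> is represented for all radii between
  \<open>norm \<xi> / 2\<close> and \<open>norm \<xi>\<close>; with density \<open>1 / s\<close>
  this interval has measure \<open>ln 2\<close>, hence the normalisation.\<close>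

definition polar_weight :: "real \<times> 'a::euclidean_space \<Rightarrow> real" where
  "polar_weight p = (if 0 < fst p \<and> 1 \<le> norm (snd p) \<and> norm (snd p) \<le> 2 then fst p ^ (DIM('a) - 1) / ln 2 else 0)"

lemma polar_weight_nonneg: "polar_weight p \<ge> 0"
  by (simp add: polar_weight_def)

lemma borel_measurable_polar_weight [measurable]: "polar_weight \<in> borel_measurable lborel2"
  unfolding polar_weight_def[abs_def] by measurable

lemma nn_integral_inverse_dyadic:
  fixes r :: real
  assumes "r > 0"
  shows "(\<integral>\<^sup>+s. ennreal (1 / s / ln 2) * indicator {r / 2..r} s \<partial>lborel) = 1"
proof -
  have "(\<integral>\<^sup>+s. ennreal (1 / s / ln 2) * indicator {r / 2..r} s \<partial>lborel) = ennreal (ln r / ln 2 - ln (r / 2) / ln 2)"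
    by (rule nn_integral_FTC_Icc) (use assms in \<open>auto intro!: derivative_eq_intros simp: field_simps\<close>)
  also have "ln r / ln 2 - ln (r / 2) / ln 2 = 1" using assms by (simp add: ln_div diff_divide_distrib)
  finally show ?thesis by simp
qed

lemma polar_nn_integral:
  fixes \<Phi> :: "'a::euclidean_space \<Rightarrow> ennreal"
  assumes [measurable]: "\<Phi> \<in> borel_measurable borel"
  shows "(\<integral>\<^sup>+s. \<integral>\<^sup>+u. ennreal (polar_weight (s, u)) * \<Phi> (s *\<^sub>R u) \<partial>lborel \<partial>lborel) = (\<integral>\<^sup>+\<xi>. \<Phi> \<xi> \<partial>lborel)"
proof -
  \<comment> \<open>The same weight seen from \<open>\<xi>\<close>: it selects the radii
    \<open>s\<close> for which \<open>\<xi>\<close> divided by \<open>s\<close> lies in the shell.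
    One power of \<open>s\<close> is lost from the Jacobian, which leaves
    \<open>1 / s\<close>.\<close>
  let ?K = "\<lambda>s \<xi>::'a. ennreal (if 0 < s \<and> norm \<xi> / 2 \<le> s \<and> s \<le> norm \<xi> then 1 / s / ln 2 else 0)"
  have inner: "(\<integral>\<^sup>+u. ennreal (polar_weight (s, u)) * \<Phi> (s *\<^sub>R u) \<partial>lborel) = (\<integral>\<^sup>+\<xi>. \<Phi> \<xi> * ?K s \<xi> \<partial>lborel)" for s
  proof (cases "s > 0")
    case True
    have d: "DIM('a) = Suc (DIM('a) - 1)" by simp
    have "(\<integral>\<^sup>+\<xi>. \<Phi> \<xi> * ?K s \<xi> \<partial>lborel) = ennreal (s ^ DIM('a)) * (\<integral>\<^sup>+u. \<Phi> (s *\<^sub>R u) * ?K s (s *\<^sub>R u) \<partial>lborel)"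
      using True by (subst nn_integral_lborel_affine[where t=0 and c=s]) (auto simp: ac_simps)
    also have "\<dots> = (\<integral>\<^sup>+u. ennreal (s ^ DIM('a)) * (\<Phi> (s *\<^sub>R u) * ?K s (s *\<^sub>R u)) \<partial>lborel)"
      by (rule nn_integral_cmult[symmetric]) measurable
    also have "\<dots> = (\<integral>\<^sup>+u. ennreal (polar_weight (s, u)) * \<Phi> (s *\<^sub>R u) \<partial>lborel)"
    proof (rule nn_integral_cong)
      fix u :: 'a
      have "ennreal (polar_weight (s, u)) = ennreal (s ^ DIM('a)) * ?K s (s *\<^sub>R u)"
      proof (cases "1 \<le> norm u \<and> norm u \<le> 2")
        case sh: True
        have "ennreal (s ^ DIM('a)) * ennreal (1 / s / ln 2) = ennreal (s ^ (DIM('a) - 1) / ln 2)"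
          using True by (subst d) (simp add: field_simps flip: ennreal_mult' del: DIM_positive)
        then show ?thesis using sh True by (simp add: polar_weight_def)
      next
        case False
        then have "\<not> (norm (s *\<^sub>R u) / 2 \<le> s \<and> s \<le> norm (s *\<^sub>R u))" using True by (auto simp: field_simps)
        then have "?K s (s *\<^sub>R u) = 0" by auto
        then show ?thesis using False by (auto simp: polar_weight_def)
      qed
      then show "ennreal (s ^ DIM('a)) * (\<Phi> (s *\<^sub>R u) * ?K s (s *\<^sub>R u)) = ennreal (polar_weight (s, u)) * \<Phi> (s *\<^sub>R u)"
        by (simp add: ac_simps)
    qed
    finally show ?thesis ..
  qed (simp add: polar_weight_def)
  have "{p \<in> space (borel \<Otimes>\<^sub>M borel). 0 < fst p \<and> norm (snd p::'a) / 2 \<le> fst p \<and> fst p \<le> norm (snd p)} \<in> sets (borel \<Otimes>\<^sub>M borel)"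
    by (intro sets.sets_Collect_conj borel_measurable_le borel_measurable_less; measurable)
  then have Km: "(\<lambda>p. ?K (fst p) (snd p)) \<in> borel_measurable (borel \<Otimes>\<^sub>M borel)"
    by (intro measurable_compose[OF _ measurable_ennreal] measurable_If) simp_all
  have "(\<lambda>(s, \<xi>). \<Phi> \<xi> * ?K s \<xi>) \<in> borel_measurable lborel2"
    using Km by (simp add: split_beta' cong: measurable_cong_sets)
  then have "(\<integral>\<^sup>+s. \<integral>\<^sup>+\<xi>. \<Phi> \<xi> * ?K s \<xi> \<partial>lborel \<partial>lborel) = (\<integral>\<^sup>+\<xi>. \<integral>\<^sup>+s. \<Phi> \<xi> * ?K s \<xi> \<partial>lborel \<partial>lborel)"
    by (rule lborel_pair.Fubini'[symmetric])
  also have "\<dots> = (\<integral>\<^sup>+\<xi>. \<Phi> \<xi> \<partial>lborel)"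
  proof (rule nn_integral_cong_AE)
    have "AE \<xi> in lborel. \<xi> \<noteq> (0::'a)" by (rule AE_lborel_singleton)
    then show "AE \<xi> in lborel. (\<integral>\<^sup>+s. \<Phi> \<xi> * ?K s \<xi> \<partial>lborel) = \<Phi> \<xi>"
    proof eventually_elim
      fix \<xi> :: 'a assume "\<xi> \<noteq> 0"
      then have n: "norm \<xi> > 0" by simp
      have "(\<integral>\<^sup>+s. \<Phi> \<xi> * ?K s \<xi> \<partial>lborel) = \<Phi> \<xi> * (\<integral>\<^sup>+s. ?K s \<xi> \<partial>lborel)"
        by (rule nn_integral_cmult) measurable
      also have "(\<integral>\<^sup>+s. ?K s \<xi> \<partial>lborel) = (\<integral>\<^sup>+s. ennreal (1 / s / ln 2) * indicator {norm \<xi> / 2..norm \<xi>} s \<partial>lborel)"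
        using n by (intro nn_integral_cong) (auto split: split_indicator)
      also have "\<dots> = 1" by (rule nn_integral_inverse_dyadic[OF n])
      finally show "(\<integral>\<^sup>+s. \<Phi> \<xi> * ?K s \<xi> \<partial>lborel) = \<Phi> \<xi>" by simp
    qed
  qed
  finally show ?thesis by (simp add: inner)
qed

lemma polar_lborel:
  "distr (density lborel2 (\<lambda>p. ennreal (polar_weight p))) lborel (\<lambda>(s, u). s *\<^sub>R u) = (lborel :: 'a::euclidean_space measure)"
  (is "?D = _")
proof (rule measure_eqI)
  fix A assume "A \<in> sets ?D"
  then have A[measurable]: "A \<in> sets (borel :: 'a measure)" by simp
  have "emeasure ?D A = (\<integral>\<^sup>+x. indicator A x \<partial>?D)" by simp
  also have "\<dots> = (\<integral>\<^sup>+p. ennreal (polar_weight p) * indicator A (case p of (s, u) \<Rightarrow> s *\<^sub>R u) \<partial>lborel2)"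
    by (subst nn_integral_distr) (auto simp: nn_integral_density)
  also have "\<dots> = (\<integral>\<^sup>+s. \<integral>\<^sup>+u. ennreal (polar_weight (s, u)) * indicator A (s *\<^sub>R u) \<partial>lborel \<partial>lborel)"
    by (subst lborel.nn_integral_fst[symmetric]) auto
  also have "\<dots> = emeasure lborel A" by (subst polar_nn_integral) auto
  finally show "emeasure ?D A = emeasure lborel A" .
qed simp

lemma polar_integral:
  fixes \<Phi> :: "'a::euclidean_space \<Rightarrow> complex"
  assumes i: "integrable lborel \<Phi>"
  shows "integrable lborel2 (\<lambda>(s, u). polar_weight (s, u) *\<^sub>R \<Phi> (s *\<^sub>R u))"
    and "(\<integral>(s, u). polar_weight (s, u) *\<^sub>R \<Phi> (s *\<^sub>R u) \<partial>lborel2) = (\<integral>\<xi>. \<Phi> \<xi> \<partial>lborel)"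
proof -
  note m[measurable] = borel_measurable_integrable[OF i, simplified]
  let ?D = "density lborel2 (\<lambda>p. ennreal (polar_weight p)) :: (real \<times> 'a) measure"
  have eq: "(\<lambda>(s, u). polar_weight (s, u) *\<^sub>R \<Phi> (s *\<^sub>R u)) = (\<lambda>p::real \<times> 'a. polar_weight p *\<^sub>R \<Phi> (case p of (s, u) \<Rightarrow> s *\<^sub>R u))"
    by auto
  have "integrable (distr ?D lborel (\<lambda>(s, u). s *\<^sub>R u)) \<Phi>" unfolding polar_lborel by (rule i)
  then have "integrable ?D (\<lambda>p. \<Phi> (case p of (s, u) \<Rightarrow> s *\<^sub>R u))"
    by (subst (asm) integrable_distr_eq) auto
  then show "integrable lborel2 (\<lambda>(s, u). polar_weight (s, u) *\<^sub>R \<Phi> (s *\<^sub>R u))"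
    unfolding eq by (subst (asm) integrable_density) (auto simp: polar_weight_nonneg)
  have "(\<integral>\<xi>. \<Phi> \<xi> \<partial>lborel) = (\<integral>\<xi>. \<Phi> \<xi> \<partial>distr ?D lborel (\<lambda>(s, u). s *\<^sub>R u))" unfolding polar_lborel ..
  also have "\<dots> = (\<integral>p. \<Phi> (case p of (s, u) \<Rightarrow> s *\<^sub>R u) \<partial>?D)" by (rule integral_distr) auto
  also have "\<dots> = (\<integral>p. polar_weight p *\<^sub>R \<Phi> (case p of (s, u) \<Rightarrow> s *\<^sub>R u) \<partial>lborel2)"
    by (rule integral_density) (auto simp: polar_weight_nonneg)
  finally show "(\<integral>(s, u). polar_weight (s, u) *\<^sub>R \<Phi> (s *\<^sub>R u) \<partial>lborel2) = (\<integral>\<xi>. \<Phi> \<xi> \<partial>lborel)"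
    unfolding eq ..
qed

lemma emeasure_shell_finite: "emeasure lborel {u::'a::euclidean_space. 1 \<le> norm u \<and> norm u \<le> 2} < \<infinity>"
proof (rule emeasure_bounded_finite)
  show "bounded {u::'a. 1 \<le> norm u \<and> norm u \<le> 2}" by (auto simp: bounded_iff)
qed

text \<open>One power above the dimension: in polar coordinates the Jacobian leaves
  \<open>1 / (1 + s)^2\<close> over a shell of finite volume.\<close>

lemma integrable_inverse_power_norm:
  "integrable lborel (\<lambda>\<xi>::'a::euclidean_space. 1 / (1 + norm \<xi>) ^ (DIM('a) + 1))"
proof (rule integrableI_bounded)
  let ?S = "{u::'a. 1 \<le> norm u \<and> norm u \<le> 2}"
  have "?S = cball 0 2 - ball 0 1" by auto
  then have [measurable]: "?S \<in> sets borel" by simp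
  have one: "(\<integral>\<^sup>+s. ennreal (1 / (1 + s)\<^sup>2) * indicator {0..} s \<partial>lborel) = ennreal (0 - (- 1 / (1 + 0)))"
  proof (rule nn_integral_FTC_atLeast)
    show "((\<lambda>s. - 1 / (1 + s)) \<longlongrightarrow> (0::real)) at_top"
      by (intro tendsto_divide_0[OF tendsto_const] filterlim_at_top_imp_at_infinity filterlim_tendsto_add_at_top[OF tendsto_const filterlim_ident])
  qed (auto intro!: derivative_eq_intros simp: power2_eq_square field_simps)
  have "(\<integral>\<^sup>+\<xi>. ennreal (norm (1 / (1 + norm (\<xi>::'a)) ^ (DIM('a) + 1))) \<partial>lborel)
    = (\<integral>\<^sup>+s. \<integral>\<^sup>+u. ennreal (polar_weight (s, u)) * ennreal (norm (1 / (1 + norm (s *\<^sub>R u::'a)) ^ (DIM('a) + 1))) \<partial>lborel \<partial>lborel)"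
    by (rule polar_nn_integral[symmetric]) measurable
  also have "\<dots> \<le> (\<integral>\<^sup>+s. \<integral>\<^sup>+u. ennreal (1 / ln 2) * (ennreal (1 / (1 + s)\<^sup>2) * indicator {0..} s) * indicator ?S u \<partial>lborel \<partial>lborel)"
  proof (intro nn_integral_mono)
    fix s :: real and u :: 'a
    show "ennreal (polar_weight (s, u)) * ennreal (norm (1 / (1 + norm (s *\<^sub>R u)) ^ (DIM('a) + 1)))
      \<le> ennreal (1 / ln 2) * (ennreal (1 / (1 + s)\<^sup>2) * indicator {0..} s) * indicator ?S u"
    proof (cases "0 < s \<and> u \<in> ?S")
      case True
      then have s: "s > 0" and u: "1 \<le> norm u" "norm u \<le> 2" by auto
      define d where "d = DIM('a) - 1"
      have d: "DIM('a) + 1 = d + 2" by (simp add: d_def)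
      have su: "s \<le> norm (s *\<^sub>R u)" using s u by simp
      have "s ^ d / (1 + norm (s *\<^sub>R u)) ^ (d + 2) \<le> (1 + s) ^ d / (1 + s) ^ (d + 2)"
        using s su by (intro frac_le power_mono) auto
      also have "\<dots> = 1 / (1 + s)\<^sup>2" using s by (simp only: power_add) simp
      finally have "s ^ d / ln 2 * (1 / (1 + norm (s *\<^sub>R u)) ^ (d + 2)) \<le> 1 / ln 2 * (1 / (1 + s)\<^sup>2)"
        using divide_right_mono[of "s ^ d / (1 + norm (s *\<^sub>R u)) ^ (d + 2)" "1 / (1 + s)\<^sup>2" "ln 2"]
        by (simp add: mult.commute[of "ln 2"] del: norm_scaleR power_add_numeral2 power_Suc)
      then show ?thesis using s u unfolding d
        by (simp add: polar_weight_def d_def flip: ennreal_mult)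
    qed (auto simp: polar_weight_def)
  qed
  also have "\<dots> = (\<integral>\<^sup>+s. ennreal (1 / ln 2) * (ennreal (1 / (1 + s)\<^sup>2) * indicator {0..} s) * emeasure lborel ?S \<partial>lborel)"
    by (intro nn_integral_cong, subst nn_integral_cmult) auto
  also have "\<dots> = ennreal (1 / ln 2) * 1 * emeasure lborel ?S"
    by (simp add: nn_integral_multc nn_integral_cmult one)
  also have "\<dots> < \<infinity>" using emeasure_shell_finite[where 'a='a] by (simp add: ennreal_mult_less_top)
  finally show "(\<integral>\<^sup>+\<xi>. ennreal (norm (1 / (1 + norm (\<xi>::'a)) ^ (DIM('a) + 1))) \<partial>lborel) < \<infinity>" .
qed simp

text \<open>Taylor's formula of second order at \<open>-2\<close>, with the integral remainder written as a
  superposition of ReLU functions.\<close>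

lemma cis_relu_expansion:
  fixes s b :: real
  assumes b: "\<bar>b\<bar> \<le> 2"
  shows "cis (s * b) = cis (- 2 * s) + \<i> * of_real s * cis (- 2 * s) * of_real (b + 2)
    - of_real (s\<^sup>2) * (\<integral>c. indicator {-2..2} c *\<^sub>R (of_real (relu (b + c)) * cis (- (s * c))) \<partial>lborel)"
proof -
  \<comment> \<open>A primitive of the remainder on \<open>[-b, 2]\<close>, exactly the part of
    \<open>[-2, 2]\<close> where \<open>relu (b + c)\<close> is the linear function
    \<open>b + c\<close>; the hypothesis \<open>\<bar>b\<bar> \<le> 2\<close> keeps it
    inside.\<close>
  let ?F = "\<lambda>c. - (of_real (b + c) * (\<i> * of_real s) * cis (- (s * c))) - cis (- (s * c))"
  let ?f = "\<lambda>c. of_real (- (s\<^sup>2)) * (of_real (b + c) * cis (- (s * c)))"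
  have cisD: "((\<lambda>c. cis (- (s * c))) has_vector_derivative - (\<i> * of_real s * cis (- (s * c)))) (at c within X)" for c X
  proof -
    have "((\<lambda>z. exp (- (\<i> * of_real s * z))) has_field_derivative - (\<i> * of_real s * exp (- (\<i> * of_real s * of_real c)))) (at (of_real c))"
      by (auto intro!: derivative_eq_intros)
    from has_vector_derivative_real_field[OF this, of X] show ?thesis unfolding cis_conv_exp by (simp add: mult.assoc)
  qed
  have D: "(?F has_vector_derivative ?f c) (at c within X)" for c X
  proof -
    have "((\<lambda>c. complex_of_real (b + c) * (\<i> * of_real s)) has_vector_derivative \<i> * of_real s) (at c within X)"
      by (auto intro!: derivative_eq_intros simp: has_vector_derivative_def fun_eq_iff scaleR_conv_of_real algebra_simps)
    from has_vector_derivative_diff[OF has_vector_derivative_minus[OF has_vector_derivative_mult[OF this cisD]] cisD]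
    show ?thesis by (simp add: algebra_simps power2_eq_square)
  qed
  have cont: "continuous_on {-b..2} ?f" by (intro continuous_intros)
  have "(\<integral>c. indicator {-b..2} c *\<^sub>R ?f c \<partial>lborel) = ?F 2 - ?F (- b)"
    by (rule integral_FTC_Icc[OF _ D cont]) (use b in auto)
  also have "?F 2 - ?F (- b) = cis (s * b) - cis (- 2 * s) - \<i> * of_real s * cis (- 2 * s) * of_real (b + 2)"
    by (simp add: algebra_simps)
  also have "(\<integral>c. indicator {-b..2} c *\<^sub>R ?f c \<partial>lborel)
    = (\<integral>c. of_real (- (s\<^sup>2)) * (indicator {-2..2} c *\<^sub>R (of_real (relu (b + c)) * cis (- (s * c)))) \<partial>lborel)"
  proof (intro Bochner_Integration.integral_cong refl)
    fix c :: real
    show "indicator {-b..2} c *\<^sub>R ?f c = of_real (- (s\<^sup>2)) * (indicator {-2..2} c *\<^sub>R (of_real (relu (b + c)) * cis (- (s * c))))"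
    proof (cases "- b \<le> c \<and> c \<le> 2")
      case True
      then have "relu (b + c) = b + c" "c \<in> {-2..2}" using b by (auto simp: relu_def)
      then show ?thesis using True by simp
    next
      case False
      then have "relu (b + c) = 0 \<or> c \<notin> {-2..2}" using b by (auto simp: relu_def)
      then show ?thesis using False by auto
    qed
  qed
  also have "\<dots> = of_real (- (s\<^sup>2)) * (\<integral>c. indicator {-2..2} c *\<^sub>R (of_real (relu (b + c)) * cis (- (s * c))) \<partial>lborel)"
    by (rule integral_mult_right_zero)
  finally show ?thesis by (simp add: algebra_simps)
qed

subsection \<open>Fourier integrals as superpositions of ReLU functions\<close>

lemma weighted_am_gm:
  fixes a q t :: real
  assumes "q > 0" "t > 0"
  shows "a \<le> t / 2 * (1 / q) + 1 / (2 * t) * (a\<^sup>2 * q)"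
proof -
  have "0 \<le> (t - a * q)\<^sup>2" by simp
  then have "2 * t * q * a \<le> t\<^sup>2 + a\<^sup>2 * q\<^sup>2" by (simp add: power2_eq_square algebra_simps)
  then have "2 * t * q * a / (2 * t * q) \<le> (t\<^sup>2 + a\<^sup>2 * q\<^sup>2) / (2 * t * q)"
    using assms by (intro divide_right_mono) auto
  also have "\<dots> = t / 2 * (1 / q) + 1 / (2 * t) * (a\<^sup>2 * q)" using assms by (simp add: power2_eq_square add_divide_distrib)
  also have "2 * t * q * a / (2 * t * q) = a" using assms by simp
  finally show ?thesis .
qed

text \<open>The Cauchy-Schwarz inequality with its square root linearised by a free parameter.
  Nothing but a constant is lost when \<open>t\<close> has the order of the root of the energy, and
  no division by a possibly vanishing energy occurs.\<close>

lemma nn_integral_am_gm: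
  fixes f q :: "'b \<Rightarrow> real"
  assumes [measurable]: "f \<in> borel_measurable M" "q \<in> borel_measurable M"
    and q: "\<And>x. q x > 0" and t: "t > 0"
  shows "(\<integral>\<^sup>+x. ennreal (f x) \<partial>M) \<le> ennreal (t / 2) * (\<integral>\<^sup>+x. ennreal (1 / q x) \<partial>M) + ennreal (1 / (2 * t)) * (\<integral>\<^sup>+x. ennreal ((f x)\<^sup>2 * q x) \<partial>M)"
proof -
  have "(\<integral>\<^sup>+x. ennreal (f x) \<partial>M) \<le> (\<integral>\<^sup>+x. ennreal (t / 2) * ennreal (1 / q x) + ennreal (1 / (2 * t)) * ennreal ((f x)\<^sup>2 * q x) \<partial>M)"
  proof (rule nn_integral_mono)
    fix x
    have "ennreal (f x) \<le> ennreal (t / 2 * (1 / q x) + 1 / (2 * t) * ((f x)\<^sup>2 * q x))"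
      by (intro ennreal_leI weighted_am_gm q t)
    also have "\<dots> = ennreal (t / 2) * ennreal (1 / q x) + ennreal (1 / (2 * t)) * ennreal ((f x)\<^sup>2 * q x)"
    proof -
      have "1 / q x \<ge> 0" "(f x)\<^sup>2 * q x \<ge> 0" using q[of x] by auto
      then show ?thesis using t by (simp only: ennreal_plus ennreal_mult' mult_nonneg_nonneg less_imp_le[OF t] divide_nonneg_nonneg zero_le_numeral zero_le_one)
    qed
    finally show "ennreal (f x) \<le> ennreal (t / 2) * ennreal (1 / q x) + ennreal (1 / (2 * t)) * ennreal ((f x)\<^sup>2 * q x)" .
  qed
  also have "\<dots> = ennreal (t / 2) * (\<integral>\<^sup>+x. ennreal (1 / q x) \<partial>M) + ennreal (1 / (2 * t)) * (\<integral>\<^sup>+x. ennreal ((f x)\<^sup>2 * q x) \<partial>M)"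
    by (simp add: nn_integral_add nn_integral_cmult)
  finally show ?thesis .
qed

lemma constant_in_nn_class: "(\<lambda>x::'a::euclidean_space. k) \<in> nn_class 1 \<bar>k\<bar>"
  unfolding nn_class_def
  by (auto intro!: exI[of _ "\<lambda>_. k"] exI[of _ "\<lambda>_. (0, 1)"] simp: relu_def norm_Pair)

text \<open>\<open>E\<close> is the energy that determines the weight of the network. The condition
  with exponent \<open>DIM('a) + 5\<close> is qualitative: it makes the second moment of
  \<open>\<Psi>\<close> converge, so that all terms of the expansion are integrable.
  \<open>t\<close> is the parameter of \<open>nn_integral_am_gm\<close>.\<close>

locale spectral =
  fixes \<Psi> :: "'a::euclidean_space \<Rightarrow> complex" and E t :: real
  assumes \<Psi>m [measurable]: "\<Psi> \<in> borel_measurable borel"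
    and E: "(\<integral>\<^sup>+\<xi>. ennreal ((norm (\<Psi> \<xi>))\<^sup>2 * (1 + norm \<xi>) ^ (DIM('a) + 3)) \<partial>lborel) \<le> ennreal E" "E \<ge> 0"
    and fin: "(\<integral>\<^sup>+\<xi>. ennreal ((norm (\<Psi> \<xi>))\<^sup>2 * (1 + norm \<xi>) ^ (DIM('a) + 5)) \<partial>lborel) < \<infinity>"
    and t: "t > 0"
begin

definition tail :: real where "tail = (\<integral>\<xi>. 1 / (1 + norm (\<xi>::'a)) ^ (DIM('a) + 1) \<partial>lborel)"

lemma tail_nonneg: "tail \<ge> 0"
  unfolding tail_def by (rule integral_nonneg_AE) auto

lemma nn_moment:
  assumes "s > 0" and p: "p = DIM('a) + 1 + 2 * k"
  shows "(\<integral>\<^sup>+\<xi>. ennreal (norm (\<Psi> \<xi>) * (1 + norm \<xi>) ^ k) \<partial>lborel) \<le> ennreal (s / 2) * ennreal tail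
    + ennreal (1 / (2 * s)) * (\<integral>\<^sup>+\<xi>. ennreal ((norm (\<Psi> \<xi>))\<^sup>2 * (1 + norm \<xi>) ^ p) \<partial>lborel)"
proof -
  have 1: "(\<integral>\<^sup>+\<xi>. ennreal (1 / (1 + norm (\<xi>::'a)) ^ (DIM('a) + 1)) \<partial>lborel) = ennreal tail"
    unfolding tail_def by (rule nn_integral_eq_integral[OF integrable_inverse_power_norm]) auto
  have 2: "(norm (\<Psi> \<xi>) * (1 + norm \<xi>) ^ k)\<^sup>2 * (1 + norm \<xi>) ^ (DIM('a) + 1) = (norm (\<Psi> \<xi>))\<^sup>2 * (1 + norm \<xi>) ^ p" for \<xi>
    unfolding p by (simp add: power_mult_distrib power_add mult_2 power2_eq_square)
  have pos: "(1 + norm (\<xi>::'a)) ^ (DIM('a) + 1) > 0" for \<xi>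
    by (intro zero_less_power) (simp add: add_pos_nonneg)
  show ?thesis
    using nn_integral_am_gm[of "\<lambda>\<xi>. norm (\<Psi> \<xi>) * (1 + norm \<xi>) ^ k" lborel "\<lambda>\<xi>. (1 + norm \<xi>) ^ (DIM('a) + 1)" s, OF _ _ pos assms(1)]
    unfolding 1 2 by simp
qed

lemma integrable_moment:
  assumes "k \<le> 2"
  shows "integrable lborel (\<lambda>\<xi>. norm (\<Psi> \<xi>) * (1 + norm \<xi>) ^ k)"
proof (rule Bochner_Integration.integrable_bound)
  show "integrable lborel (\<lambda>\<xi>. norm (\<Psi> \<xi>) * (1 + norm \<xi>) ^ 2)"
  proof (rule integrableI_bounded)
    have "(\<integral>\<^sup>+\<xi>. ennreal (norm (\<Psi> \<xi>) * (1 + norm \<xi>) ^ 2) \<partial>lborel) < \<infinity>"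
      by (rule le_less_trans[OF nn_moment[of 1 "DIM('a) + 5"]])
         (use fin ennreal_less_top[of "1 / 2"] ennreal_less_top[of tail] in \<open>simp_all add: ennreal_mult_less_top del: ennreal_less_top\<close>)
    then show "(\<integral>\<^sup>+\<xi>. ennreal (norm (norm (\<Psi> \<xi>) * (1 + norm \<xi>) ^ 2)) \<partial>lborel) < \<infinity>" by simp
  qed measurable
  show "AE \<xi> in lborel. norm (norm (\<Psi> \<xi>) * (1 + norm \<xi>) ^ k) \<le> norm (norm (\<Psi> \<xi>) * (1 + norm \<xi>) ^ 2)"
    using assms by (auto intro!: mult_left_mono power_increasing simp: abs_mult)
qed measurable

definition mass :: real where "mass = t / 2 * tail + 1 / (2 * t) * E"

lemma integral_moment: "(\<integral>\<xi>. norm (\<Psi> \<xi>) * (1 + norm \<xi>) \<partial>lborel) \<le> mass"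
proof -
  have "(\<integral>\<^sup>+\<xi>. ennreal (norm (\<Psi> \<xi>) * (1 + norm \<xi>) ^ 1) \<partial>lborel) \<le> ennreal (t / 2) * ennreal tail + ennreal (1 / (2 * t)) * ennreal E"
    by (rule order_trans[OF nn_moment[OF t, of "DIM('a) + 3"]]) (auto intro!: add_left_mono mult_left_mono E)
  also have "\<dots> = ennreal mass"
    using t tail_nonneg E(2) unfolding mass_def by (simp add: ennreal_mult' ennreal_plus del: times_divide_eq_left)
  finally have "(\<integral>\<^sup>+\<xi>. ennreal (norm (\<Psi> \<xi>) * (1 + norm \<xi>)) \<partial>lborel) \<le> ennreal mass" by simp
  moreover have "(\<integral>\<^sup>+\<xi>. ennreal (norm (\<Psi> \<xi>) * (1 + norm \<xi>)) \<partial>lborel) = ennreal (\<integral>\<xi>. norm (\<Psi> \<xi>) * (1 + norm \<xi>) \<partial>lborel)"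
    using integrable_moment[of 1] by (intro nn_integral_eq_integral) auto
  moreover have "mass \<ge> 0" using t tail_nonneg E(2) by (simp add: mass_def)
  ultimately show ?thesis by (simp add: ennreal_le_iff)
qed

definition pol :: "real \<Rightarrow> 'a \<Rightarrow> complex" where
  "pol s u = polar_weight (s, u) *\<^sub>R \<Psi> (s *\<^sub>R u)"

lemma borel_measurable_pol [measurable]: "(\<lambda>p. pol (fst p) (snd p)) \<in> borel_measurable lborel2"
  unfolding pol_def by measurable

lemma pol_eq_0: "\<not> (0 < s \<and> 1 \<le> norm u \<and> norm u \<le> 2) \<Longrightarrow> pol s u = 0"
  by (auto simp: pol_def polar_weight_def)

text \<open>On the shell \<open>s \<le> norm (s *\<^sub>R u)\<close>, so polynomial growth in the
  radius is dominated by a moment of \<open>\<Psi>\<close> in Cartesian coordinates.\<close>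

lemma
  assumes k: "k \<le> 2" and [measurable]: "g \<in> borel_measurable lborel2"
    and g: "\<And>s u. s > 0 \<Longrightarrow> norm u \<le> 2 \<Longrightarrow> norm (g (s, u)) \<le> (1 + s) ^ k"
  shows integrable_pol: "integrable lborel2 (\<lambda>(s, u). pol s u * g (s, u))"
    and integral_pol_le: "(\<integral>p. norm (pol (fst p) (snd p) * g p) \<partial>lborel2) \<le> (\<integral>\<xi>. norm (\<Psi> \<xi>) * (1 + norm \<xi>) ^ k \<partial>lborel)"
proof -
  let ?h = "\<lambda>(s, u). polar_weight (s, u) *\<^sub>R complex_of_real (norm (\<Psi> (s *\<^sub>R u)) * (1 + norm (s *\<^sub>R u)) ^ k)"
  have i: "integrable lborel (\<lambda>\<xi>. complex_of_real (norm (\<Psi> \<xi>) * (1 + norm \<xi>) ^ k))"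
    using integrable_moment[OF k] by (rule integrable_of_real)
  note h = polar_integral[OF i]
  have b: "norm (pol s u * g (s, u)) \<le> norm (?h (s, u))" for s u
  proof (cases "0 < s \<and> 1 \<le> norm u \<and> norm u \<le> 2")
    case True
    then have "s \<le> norm (s *\<^sub>R u)" by simp
    then have "norm (g (s, u)) \<le> (1 + norm (s *\<^sub>R u)) ^ k"
      using True by (intro order_trans[OF g] power_mono) auto
    then have "polar_weight (s, u) * norm (\<Psi> (s *\<^sub>R u)) * norm (g (s, u)) \<le> polar_weight (s, u) * norm (\<Psi> (s *\<^sub>R u)) * (1 + norm (s *\<^sub>R u)) ^ k"
      by (intro mult_left_mono mult_nonneg_nonneg polar_weight_nonneg) auto
    moreover have "norm (?h (s, u)) = polar_weight (s, u) * norm (\<Psi> (s *\<^sub>R u)) * (1 + norm (s *\<^sub>R u)) ^ k"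
      unfolding prod.case norm_scaleR[of "polar_weight (s, u)"] norm_of_real by (simp add: abs_mult polar_weight_nonneg)
    moreover have "norm (pol s u * g (s, u)) = polar_weight (s, u) * norm (\<Psi> (s *\<^sub>R u)) * norm (g (s, u))"
      by (simp add: pol_def norm_mult polar_weight_nonneg)
    ultimately show ?thesis by (simp only:)
  qed (simp add: pol_eq_0)
  show I: "integrable lborel2 (\<lambda>(s, u). pol s u * g (s, u))"
  proof (rule Bochner_Integration.integrable_bound[OF h(1)])
    show "(\<lambda>(s, u). pol s u * g (s, u)) \<in> borel_measurable lborel2"
      unfolding split_beta' by measurable
  qed (use b in auto)
  have eq: "(\<lambda>p. pol (fst p) (snd p) * g p) = (\<lambda>(s, u). pol s u * g (s, u))" by auto
  have "(\<integral>p. norm (pol (fst p) (snd p) * g p) \<partial>lborel2) \<le> (\<integral>p. norm (?h p) \<partial>lborel2)"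
  proof (rule integral_mono)
    show "integrable lborel2 (\<lambda>p. norm (pol (fst p) (snd p) * g p))"
      using I unfolding eq[symmetric] by (rule integrable_norm)
    show "integrable lborel2 (\<lambda>p. norm (?h p))" by (rule integrable_norm[OF h(1)])
    show "norm (pol (fst p) (snd p) * g p) \<le> norm (?h p)" for p using b[of "fst p" "snd p"] by simp
  qed
  also have "\<dots> = (\<integral>p. Re (?h p) \<partial>lborel2)"
  proof (intro Bochner_Integration.integral_cong refl)
    fix p :: "real \<times> 'a"
    obtain s u where p: "p = (s, u)" by force
    have "?h p = complex_of_real (polar_weight (s, u) * (norm (\<Psi> (s *\<^sub>R u)) * (1 + norm (s *\<^sub>R u)) ^ k))"
      unfolding p by (simp only: prod.case scaleR_conv_of_real of_real_mult)
    moreover have "0 \<le> polar_weight (s, u) * (norm (\<Psi> (s *\<^sub>R u)) * (1 + norm (s *\<^sub>R u)) ^ k)"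
      by (intro mult_nonneg_nonneg polar_weight_nonneg) auto
    ultimately show "norm (?h p) = Re (?h p)" by (simp only: norm_of_real abs_of_nonneg Re_complex_of_real)
  qed
  also have "\<dots> = Re (\<integral>p. ?h p \<partial>lborel2)" by (rule integral_Re[OF h(1)])
  also have "\<dots> = Re (complex_of_real (\<integral>\<xi>. norm (\<Psi> \<xi>) * (1 + norm \<xi>) ^ k \<partial>lborel))"
    unfolding h(2) by (simp only: integral_of_real integral_complex_of_real)
  finally show "(\<integral>p. norm (pol (fst p) (snd p) * g p) \<partial>lborel2) \<le> (\<integral>\<xi>. norm (\<Psi> \<xi>) * (1 + norm \<xi>) ^ k \<partial>lborel)"
    by simp
qed

text \<open>The density, over directions \<open>u\<close> and offsets \<open>c\<close>, of ReLU
  functions in the remainder of \<open>cis_relu_expansion\<close>: integrating that remainder over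
  the radius produces a one-dimensional Fourier transform along the ray.\<close>

definition ridge :: "'a \<Rightarrow> real \<Rightarrow> complex" where
  "ridge u c = indicator {-2..2} c *\<^sub>R ft (\<lambda>s. of_real (s\<^sup>2) * pol s u) c"

lemma borel_measurable_ridge [measurable]: "(\<lambda>p. ridge (fst p) (snd p)) \<in> borel_measurable lborel2"
proof -
  have "(\<lambda>p::'a \<times> real. \<integral>s. of_real (s\<^sup>2) * pol s (fst p) * cis (- (snd p \<bullet> s)) \<partial>lborel) \<in> borel_measurable lborel2"
  proof (rule lborel.borel_measurable_lebesgue_integral)
    have "(\<lambda>q::('a \<times> real) \<times> real. (snd q, fst (fst q))) \<in> lborel2 \<Otimes>\<^sub>M lborel \<rightarrow>\<^sub>M lborel2" by measurable
    from measurable_compose[OF this borel_measurable_pol]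
    have [measurable]: "(\<lambda>q::('a \<times> real) \<times> real. pol (snd q) (fst (fst q))) \<in> borel_measurable (lborel2 \<Otimes>\<^sub>M lborel)" by simp
    show "(\<lambda>(p, s). of_real (s\<^sup>2) * pol s (fst p) * cis (- (snd p \<bullet> s))) \<in> borel_measurable (lborel2 \<Otimes>\<^sub>M lborel)"
      unfolding split_beta' by measurable
  qed
  then show ?thesis unfolding ridge_def ft_def by measurable
qed

text \<open>Squaring produces the Jacobian \<open>s ^ (DIM('a) - 1)\<close> twice. One copy remains
  as polar measure; the other joins \<open>s ^ 4\<close> to form \<open>s ^ (DIM('a) + 3)\<close>,
  the weight measured by \<open>E\<close>.\<close>

lemma pol_square:
  "ennreal ((norm (of_real (s\<^sup>2) * pol s u))\<^sup>2) \<le> ennreal (1 / ln 2) * (ennreal (polar_weight (s, u)) * ennreal ((norm (\<Psi> (s *\<^sub>R u)))\<^sup>2 * (1 + norm (s *\<^sub>R u)) ^ (DIM('a) + 3)))"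
proof (cases "0 < s \<and> 1 \<le> norm u \<and> norm u \<le> 2")
  case True
  define d where "d = DIM('a) - 1"
  have d: "DIM('a) + 3 = d + 4" by (simp add: d_def)
  have w: "polar_weight (s, u) = s ^ d / ln 2" using True by (simp add: polar_weight_def d_def)
  have "s \<le> norm (s *\<^sub>R u)" using True by simp
  then have "s \<le> 1 + norm (s *\<^sub>R u)" by linarith
  then have sp: "s ^ (d + 4) \<le> (1 + norm (s *\<^sub>R u)) ^ (d + 4)" using True by (intro power_mono) auto
  have "(norm (of_real (s\<^sup>2) * pol s u))\<^sup>2 = (s\<^sup>2 * (s ^ d / ln 2 * norm (\<Psi> (s *\<^sub>R u))))\<^sup>2"
    using True by (simp add: pol_def w norm_mult norm_power)
  also have "\<dots> = 1 / ln 2 * (s ^ d / ln 2 * ((norm (\<Psi> (s *\<^sub>R u)))\<^sup>2 * s ^ (d + 4)))"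
    by (simp add: power_add power2_eq_square power4_eq_xxxx)
  also have "\<dots> \<le> 1 / ln 2 * (s ^ d / ln 2 * ((norm (\<Psi> (s *\<^sub>R u)))\<^sup>2 * (1 + norm (s *\<^sub>R u)) ^ (d + 4)))"
    using True sp by (intro mult_left_mono) auto
  finally have "ennreal ((norm (of_real (s\<^sup>2) * pol s u))\<^sup>2) \<le> ennreal (1 / ln 2 * (s ^ d / ln 2 * ((norm (\<Psi> (s *\<^sub>R u)))\<^sup>2 * (1 + norm (s *\<^sub>R u)) ^ (d + 4))))"
    by (rule ennreal_leI)
  also have "\<dots> = ennreal (1 / ln 2) * (ennreal (polar_weight (s, u)) * ennreal ((norm (\<Psi> (s *\<^sub>R u)))\<^sup>2 * (1 + norm (s *\<^sub>R u)) ^ (DIM('a) + 3)))"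
    unfolding d w using True by (subst ennreal_mult, simp, simp)+ simp
  finally show ?thesis .
qed (simp add: pol_eq_0)

lemma nn_integral_pol_square: "(\<integral>\<^sup>+u. \<integral>\<^sup>+s. ennreal ((norm (of_real (s\<^sup>2) * pol s u))\<^sup>2) \<partial>lborel \<partial>lborel) \<le> ennreal (E / ln 2)"
proof -
  let ?q = "\<lambda>s u. ennreal (polar_weight (s, u)) * ennreal ((norm (\<Psi> (s *\<^sub>R u)))\<^sup>2 * (1 + norm (s *\<^sub>R u)) ^ (DIM('a) + 3))"
  have "(\<integral>\<^sup>+u. \<integral>\<^sup>+s. ennreal ((norm (of_real (s\<^sup>2) * pol s u))\<^sup>2) \<partial>lborel \<partial>lborel) \<le> (\<integral>\<^sup>+u. \<integral>\<^sup>+s. ennreal (1 / ln 2) * ?q s u \<partial>lborel \<partial>lborel)"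
    by (intro nn_integral_mono pol_square)
  also have "\<dots> = (\<integral>\<^sup>+s. \<integral>\<^sup>+u. ennreal (1 / ln 2) * ?q s u \<partial>lborel \<partial>lborel)"
    by (rule lborel_pair.Fubini') measurable
  also have "\<dots> = (\<integral>\<^sup>+s. ennreal (1 / ln 2) * (\<integral>\<^sup>+u. ?q s u \<partial>lborel) \<partial>lborel)"
    by (intro nn_integral_cong nn_integral_cmult) measurable
  also have "\<dots> = ennreal (1 / ln 2) * (\<integral>\<^sup>+s. \<integral>\<^sup>+u. ?q s u \<partial>lborel \<partial>lborel)"
    by (rule nn_integral_cmult) measurable
  also have "(\<integral>\<^sup>+s. \<integral>\<^sup>+u. ?q s u \<partial>lborel \<partial>lborel) = (\<integral>\<^sup>+\<xi>. ennreal ((norm (\<Psi> \<xi>))\<^sup>2 * (1 + norm \<xi>) ^ (DIM('a) + 3)) \<partial>lborel)"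
    by (rule polar_nn_integral) measurable
  also have "ennreal (1 / ln 2) * \<dots> \<le> ennreal (1 / ln 2) * ennreal E" by (intro mult_left_mono E) auto
  also have "\<dots> = ennreal (E / ln 2)" using E(2) by (simp flip: ennreal_mult')
  finally show ?thesis .
qed

lemma borel_measurable_pol_square: "(\<lambda>u. \<integral>\<^sup>+s. ennreal ((norm (of_real (s\<^sup>2) * pol s u))\<^sup>2) \<partial>lborel) \<in> borel_measurable lborel"
proof -
  have "(\<lambda>q::'a \<times> real. (snd q, fst q)) \<in> lborel2 \<rightarrow>\<^sub>M lborel2" by measurable
  from measurable_compose[OF this borel_measurable_pol]
  have [measurable]: "(\<lambda>q::'a \<times> real. pol (snd q) (fst q)) \<in> borel_measurable lborel2" by simp
  have m: "(\<lambda>(u, s). ennreal ((norm (of_real (s\<^sup>2) * pol s u))\<^sup>2)) \<in> borel_measurable lborel2"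
    unfolding split_beta' by measurable
  show ?thesis by (rule lborel.borel_measurable_nn_integral[OF m, unfolded prod.case])
qed

lemma AE_pol:
  "AE u in lborel. integrable lborel (\<lambda>s. of_real (s\<^sup>2) * pol s u) \<and> integrable lborel (\<lambda>s. (norm (of_real (s\<^sup>2) * pol s u))\<^sup>2)"
proof -
  have "integrable lborel2 (\<lambda>(s, u). pol s u * of_real ((fst (s, u))\<^sup>2))"
    by (rule integrable_pol[of 2]) (auto simp: norm_power intro!: power_mono)
  then have "AE u in lborel. integrable lborel (\<lambda>s. pol s u * of_real (s\<^sup>2))"
    by (intro lborel_pair.AE_integrable_snd) simp
  then have 1: "AE u in lborel. integrable lborel (\<lambda>s. of_real (s\<^sup>2) * pol s u)" by (simp add: mult.commute)
  have "(\<integral>\<^sup>+u. \<integral>\<^sup>+s. ennreal ((norm (of_real (s\<^sup>2) * pol s u))\<^sup>2) \<partial>lborel \<partial>lborel) \<noteq> \<infinity>"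
    using nn_integral_pol_square by (auto simp: top_unique)
  then have "AE u in lborel. (\<integral>\<^sup>+s. ennreal ((norm (of_real (s\<^sup>2) * pol s u))\<^sup>2) \<partial>lborel) \<noteq> \<infinity>"
    by (intro nn_integral_PInf_AE borel_measurable_pol_square)
  with 1 show ?thesis
  proof eventually_elim
    fix u
    assume i: "integrable lborel (\<lambda>s. of_real (s\<^sup>2) * pol s u)" and f: "(\<integral>\<^sup>+s. ennreal ((norm (of_real (s\<^sup>2) * pol s u))\<^sup>2) \<partial>lborel) \<noteq> \<infinity>"
    note [measurable] = borel_measurable_integrable[OF i]
    have "integrable lborel (\<lambda>s. (norm (of_real (s\<^sup>2) * pol s u))\<^sup>2)"
    proof (rule integrableI_nonneg)
      show "(\<lambda>s. (norm (of_real (s\<^sup>2) * pol s u))\<^sup>2) \<in> borel_measurable lborel" by measurable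
    qed (use f in \<open>auto simp: less_top\<close>)
    with i show "integrable lborel (\<lambda>s. of_real (s\<^sup>2) * pol s u) \<and> integrable lborel (\<lambda>s. (norm (of_real (s\<^sup>2) * pol s u))\<^sup>2)" by simp
  qed
qed

lemma ridge_eq_0: "\<not> (1 \<le> norm u \<and> norm u \<le> 2 \<and> \<bar>c\<bar> \<le> 2) \<Longrightarrow> ridge u c = 0"
proof -
  assume n: "\<not> (1 \<le> norm u \<and> norm u \<le> 2 \<and> \<bar>c\<bar> \<le> 2)"
  show ?thesis
  proof (cases "\<bar>c\<bar> \<le> 2")
    case True
    then have "pol s u = 0" for s using n by (intro pol_eq_0) auto
    then show ?thesis by (simp add: ridge_def ft_def)
  qed (auto simp: ridge_def split: split_indicator)
qed

text \<open>Bessel's inequality on the ray bounds the \<open>L2\<close> norm in the offset with no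
  loss of powers of \<open>s\<close>; bounding \<open>ridge\<close> pointwise by an absolute
  integral would call for the larger exponent \<open>DIM('a) + 5\<close>. On \<open>[-2, 2]\<close>
  the Gaussian weight is at least \<open>exp (- 2)\<close>.\<close>

lemma AE_ridge_square:
  "AE u in lborel. (\<integral>\<^sup>+c. ennreal ((norm (ridge u c))\<^sup>2) \<partial>lborel) \<le> ennreal (exp 2 * (2 * pi)) * (\<integral>\<^sup>+s. ennreal ((norm (of_real (s\<^sup>2) * pol s u))\<^sup>2) \<partial>lborel)"
  using AE_pol
proof eventually_elim
  fix u
  let ?F = "\<lambda>s. of_real (s\<^sup>2) * pol s u"
  assume "integrable lborel ?F \<and> integrable lborel (\<lambda>s. (norm (?F s))\<^sup>2)"
  then have i: "integrable lborel ?F" "integrable lborel (\<lambda>s. (norm (?F s))\<^sup>2)" by auto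
  note b = gauss_bessel[OF i zero_less_one]
  have "(\<integral>\<^sup>+c. ennreal ((norm (ridge u c))\<^sup>2) \<partial>lborel) \<le> (\<integral>\<^sup>+c. ennreal (exp 2 * (gauss 1 c * (norm (ft ?F c))\<^sup>2)) \<partial>lborel)"
  proof (intro nn_integral_mono ennreal_leI)
    fix c :: real
    show "(norm (ridge u c))\<^sup>2 \<le> exp 2 * (gauss 1 c * (norm (ft ?F c))\<^sup>2)"
    proof (cases "\<bar>c\<bar> \<le> 2")
      case True
      then have "c\<^sup>2 \<le> 2\<^sup>2" by (subst abs_le_square_iff[symmetric]) simp
      then have "1 \<le> exp 2 * gauss 1 c" by (simp add: gauss_def flip: exp_add)
      then have "1 * (norm (ft ?F c))\<^sup>2 \<le> (exp 2 * gauss 1 c) * (norm (ft ?F c))\<^sup>2" by (rule mult_right_mono) simp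
      moreover have "(norm (ridge u c))\<^sup>2 \<le> (norm (ft ?F c))\<^sup>2" by (simp add: ridge_def split: split_indicator)
      ultimately show ?thesis unfolding mult.assoc mult_1_left by (rule order_trans[rotated])
    next
      case False
      then have "ridge u c = 0" by (intro ridge_eq_0) auto
      then show ?thesis using gauss_pos[of 1 c] by simp
    qed
  qed
  also have "\<dots> = ennreal (\<integral>c. exp 2 * (gauss 1 c * (norm (ft ?F c))\<^sup>2) \<partial>lborel)"
    using b(1) by (intro nn_integral_eq_integral) (auto simp: less_imp_le[OF gauss_pos])
  also have "\<dots> \<le> ennreal (exp 2 * (2 * pi) * (\<integral>s. (norm (?F s))\<^sup>2 \<partial>lborel))"
    using b(2) by (intro ennreal_leI) simp
  also have "\<dots> = ennreal (exp 2 * (2 * pi)) * ennreal (\<integral>s. (norm (?F s))\<^sup>2 \<partial>lborel)"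
    by (rule ennreal_mult) auto
  also have "ennreal (\<integral>s. (norm (?F s))\<^sup>2 \<partial>lborel) = (\<integral>\<^sup>+s. ennreal ((norm (?F s))\<^sup>2) \<partial>lborel)"
    using i(2) by (intro nn_integral_eq_integral[symmetric]) auto
  finally show "(\<integral>\<^sup>+c. ennreal ((norm (ridge u c))\<^sup>2) \<partial>lborel) \<le> ennreal (exp 2 * (2 * pi)) * (\<integral>\<^sup>+s. ennreal ((norm (?F s))\<^sup>2) \<partial>lborel)" .
qed

definition vol :: real where "vol = measure lborel {u::'a. 1 \<le> norm u \<and> norm u \<le> 2}"

definition ridge_mass :: real where "ridge_mass = t / 2 * (4 * vol) + 1 / (2 * t) * (exp 2 * (2 * pi) * (E / ln 2))"

lemma ridge_mass_nonneg: "ridge_mass \<ge> 0"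
  using t E(2) by (simp add: ridge_mass_def vol_def)

text \<open>\<open>ridge\<close> lives on the shell times \<open>[-2, 2]\<close>, a set of volume
  \<open>4 * vol\<close>, so its \<open>L1\<close> norm follows from its \<open>L2\<close> norm by
  \<open>weighted_am_gm\<close>.\<close>

lemma nn_integral_ridge: "(\<integral>\<^sup>+u. \<integral>\<^sup>+c. ennreal (norm (ridge u c)) \<partial>lborel \<partial>lborel) \<le> ennreal ridge_mass"
proof -
  let ?S = "{u::'a. 1 \<le> norm u \<and> norm u \<le> 2}"
  let ?P = "\<lambda>u. \<integral>\<^sup>+s. ennreal ((norm (of_real (s\<^sup>2) * pol s u))\<^sup>2) \<partial>lborel"
  have "?S = cball 0 2 - ball 0 1" by auto
  then have S [measurable]: "?S \<in> sets borel" by simp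
  have Sv: "emeasure lborel ?S = ennreal vol"
    unfolding vol_def using emeasure_shell_finite[where 'a='a] by (intro emeasure_eq_ennreal_measure) auto
  have rm: "(\<lambda>c. norm (ridge u c)) \<in> borel_measurable lborel" for u
    using measurable_compose[OF measurable_Pair1'[of u lborel lborel] borel_measurable_ridge] by simp
  have "AE u in lborel. (\<integral>\<^sup>+c. ennreal (norm (ridge u c)) \<partial>lborel)
    \<le> ennreal (t / 2) * ennreal 4 * indicator ?S u + ennreal (1 / (2 * t)) * (ennreal (exp 2 * (2 * pi)) * ?P u)"
    using AE_ridge_square
  proof eventually_elim
    fix u :: 'a
    assume sq: "(\<integral>\<^sup>+c. ennreal ((norm (ridge u c))\<^sup>2) \<partial>lborel) \<le> ennreal (exp 2 * (2 * pi)) * ?P u"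
    note [measurable] = rm[of u]
    have "(\<integral>\<^sup>+c. ennreal (norm (ridge u c)) \<partial>lborel)
      \<le> (\<integral>\<^sup>+c. ennreal (t / 2) * indicator ?S u * indicator {-2..2} c + ennreal (1 / (2 * t)) * ennreal ((norm (ridge u c))\<^sup>2) \<partial>lborel)"
    proof (rule nn_integral_mono)
      fix c :: real
      show "ennreal (norm (ridge u c)) \<le> ennreal (t / 2) * indicator ?S u * indicator {-2..2} c + ennreal (1 / (2 * t)) * ennreal ((norm (ridge u c))\<^sup>2)"
      proof (cases "1 \<le> norm u \<and> norm u \<le> 2 \<and> \<bar>c\<bar> \<le> 2")
        case True
        have "ennreal (norm (ridge u c)) \<le> ennreal (t / 2 + 1 / (2 * t) * (norm (ridge u c))\<^sup>2)"
          using weighted_am_gm[of 1 t "norm (ridge u c)"] t by (intro ennreal_leI) simp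
        also have "\<dots> = ennreal (t / 2) + ennreal (1 / (2 * t)) * ennreal ((norm (ridge u c))\<^sup>2)"
          using t by (subst ennreal_plus) (auto simp: ennreal_mult' simp del: times_divide_eq_left)
        finally show ?thesis using True by (auto simp: indicator_def)
      qed (simp add: ridge_eq_0)
    qed
    also have "\<dots> = ennreal (t / 2) * indicator ?S u * ennreal 4 + ennreal (1 / (2 * t)) * (\<integral>\<^sup>+c. ennreal ((norm (ridge u c))\<^sup>2) \<partial>lborel)"
      by (simp add: nn_integral_add nn_integral_cmult)
    also have "\<dots> \<le> ennreal (t / 2) * indicator ?S u * ennreal 4 + ennreal (1 / (2 * t)) * (ennreal (exp 2 * (2 * pi)) * ?P u)"
      by (intro add_left_mono mult_left_mono sq) simp
    finally show "(\<integral>\<^sup>+c. ennreal (norm (ridge u c)) \<partial>lborel)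
    \<le> ennreal (t / 2) * ennreal 4 * indicator ?S u + ennreal (1 / (2 * t)) * (ennreal (exp 2 * (2 * pi)) * ?P u)"
      by (simp only: ac_simps)
  qed
  then have "(\<integral>\<^sup>+u. \<integral>\<^sup>+c. ennreal (norm (ridge u c)) \<partial>lborel \<partial>lborel)
    \<le> (\<integral>\<^sup>+u. ennreal (t / 2) * ennreal 4 * indicator ?S u + ennreal (1 / (2 * t)) * (ennreal (exp 2 * (2 * pi)) * ?P u) \<partial>lborel)"
    by (rule nn_integral_mono_AE)
  also have "\<dots> = ennreal (t / 2) * ennreal 4 * emeasure lborel ?S + ennreal (1 / (2 * t)) * (ennreal (exp 2 * (2 * pi)) * (\<integral>\<^sup>+u. ?P u \<partial>lborel))"
    using borel_measurable_pol_square S by (subst nn_integral_add) (auto simp: nn_integral_cmult)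
  also have "\<dots> \<le> ennreal (t / 2) * ennreal 4 * ennreal vol + ennreal (1 / (2 * t)) * (ennreal (exp 2 * (2 * pi)) * ennreal (E / ln 2))"
    unfolding Sv by (intro add_left_mono mult_left_mono nn_integral_pol_square) auto
  also have "\<dots> = ennreal ridge_mass"
  proof -
    have nn: "t / 2 \<ge> 0" "1 / (2 * t) \<ge> 0" "vol \<ge> 0" "E / ln 2 \<ge> 0" "exp (2::real) * (2 * pi) \<ge> 0" using t E(2) by (auto simp: vol_def)
    define q where "q = exp (2::real) * (2 * pi)"
    show ?thesis using nn unfolding ridge_mass_def q_def[symmetric]
      by (simp only: ennreal_plus ennreal_mult mult_nonneg_nonneg zero_le_numeral mult.assoc)
  qed
  finally show ?thesis .
qed

lemma
  shows integrable_ridge: "integrable lborel2 (\<lambda>p. ridge (fst p) (snd p))"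
    and integral_ridge_le: "(\<integral>p. norm (ridge (fst p) (snd p)) \<partial>lborel2) \<le> ridge_mass"
proof -
  have n: "(\<integral>\<^sup>+p. ennreal (norm (ridge (fst p) (snd p))) \<partial>lborel2) \<le> ennreal ridge_mass"
    using nn_integral_ridge by (subst lborel.nn_integral_fst[symmetric]) auto
  show i: "integrable lborel2 (\<lambda>p. ridge (fst p) (snd p))"
    by (rule integrableI_bounded) (use n in \<open>auto intro: le_less_trans\<close>)
  have "ennreal (\<integral>p. norm (ridge (fst p) (snd p)) \<partial>lborel2) = (\<integral>\<^sup>+p. ennreal (norm (ridge (fst p) (snd p))) \<partial>lborel2)"
    using i by (intro nn_integral_eq_integral[symmetric]) auto
  with n show "(\<integral>p. norm (ridge (fst p) (snd p)) \<partial>lborel2) \<le> ridge_mass"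
    using ridge_mass_nonneg by (metis ennreal_le_iff)
qed

lemma integrable_\<Psi>: "integrable lborel \<Psi>"
  using integrable_moment[of 0] by (simp add: integrable_norm_iff)

text \<open>The expansion of \<open>cis (s * b)\<close> with \<open>b = u \<bullet> x\<close>, which
  is at most 2 in absolute value on shell and ball. Its first-order term is a ReLU function as well,
  because \<open>u \<bullet> x + 2\<close> is nonnegative.\<close>

lemma fourier_decomposition:
  assumes x: "x \<in> cball 0 1"
  shows "(\<integral>\<xi>. \<Psi> \<xi> * cis (\<xi> \<bullet> x) \<partial>lborel)
    = (\<integral>p. pol (fst p) (snd p) * cis (- 2 * fst p) \<partial>lborel2)
    + (\<integral>p. pol (fst p) (snd p) * (\<i> * of_real (fst p) * cis (- 2 * fst p)) * of_real (snd p \<bullet> x + 2) \<partial>lborel2)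
    - (\<integral>p. ridge (fst p) (snd p) * of_real (relu (fst p \<bullet> x + snd p)) \<partial>lborel2)
   \<and> integrable lborel2 (\<lambda>p. pol (fst p) (snd p) * (\<i> * of_real (fst p) * cis (- 2 * fst p)) * of_real (snd p \<bullet> x + 2))
   \<and> integrable lborel2 (\<lambda>p. ridge (fst p) (snd p) * of_real (relu (fst p \<bullet> x + snd p)))" (is "?A \<and> ?B \<and> ?C")
proof -
  have bx: "\<bar>u \<bullet> x\<bar> \<le> 2" if "norm u \<le> 2" for u :: 'a
    using Cauchy_Schwarz_ineq2[of u x] that x mult_mono[of "norm u" 2 "norm x" 1] by auto
  have m2 [measurable]: "(\<lambda>p::real \<times> 'a. snd p \<bullet> x) \<in> borel_measurable lborel2" by measurable
  let ?P0 = "\<lambda>s u. pol s u * cis (s * (u \<bullet> x))"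
  let ?P1 = "\<lambda>s u. pol s u * cis (- 2 * s)"
  let ?P2 = "\<lambda>s u. pol s u * (\<i> * of_real s * cis (- 2 * s) * of_real (u \<bullet> x + 2))"
  let ?J = "\<lambda>s b. \<integral>c. indicator {-2..2} c *\<^sub>R (of_real (relu (b + c)) * cis (- (s * c))) \<partial>lborel"
  let ?P3 = "\<lambda>s u. of_real (s\<^sup>2) * pol s u * ?J s (u \<bullet> x)"
  have i\<Psi>: "integrable lborel (\<lambda>\<xi>. \<Psi> \<xi> * cis (\<xi> \<bullet> x))"
    by (rule Bochner_Integration.integrable_bound[OF integrable_\<Psi>]) (auto simp: norm_mult)
  have i0: "integrable lborel2 (\<lambda>(s, u). ?P0 s u)"
    using polar_integral(1)[OF i\<Psi>] by (simp add: pol_def)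
  have e0: "(\<integral>\<xi>. \<Psi> \<xi> * cis (\<xi> \<bullet> x) \<partial>lborel) = (\<integral>(s, u). ?P0 s u \<partial>lborel2)"
    using polar_integral(2)[OF i\<Psi>] by (simp add: pol_def)
  have i1: "integrable lborel2 (\<lambda>(s, u). ?P1 s u)"
    using integrable_pol[of 0 "\<lambda>p. cis (- 2 * fst p)"] by simp
  have "integrable lborel2 (\<lambda>(s, u). pol s u * (\<lambda>p. \<i> * of_real (fst p) * cis (- 2 * fst p) * of_real (snd p \<bullet> x + 2)) (s, u))"
  proof (rule integrable_pol[of 2])
    fix s :: real and u :: 'a assume s: "s > 0" and u: "norm u \<le> 2"
    have "\<bar>u \<bullet> x + 2\<bar> \<le> 4" using bx[OF u] by auto
    then have "s * \<bar>u \<bullet> x + 2\<bar> \<le> s * 4" using s by (intro mult_left_mono) auto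
    also have "s * 4 \<le> (1 + s)\<^sup>2" using zero_le_power2[of "s - 1"] by (simp add: power2_eq_square algebra_simps)
    finally have "s * \<bar>u \<bullet> x + 2\<bar> \<le> (1 + s)\<^sup>2" .
    then show "norm (\<i> * of_real (fst (s, u)) * cis (- 2 * fst (s, u)) * of_real (snd (s, u) \<bullet> x + 2)) \<le> (1 + s) ^ 2"
      unfolding norm_mult norm_of_real using s by simp
  qed auto
  then have i2: "integrable lborel2 (\<lambda>(s, u). ?P2 s u)" by simp
  have p3: "?P3 s u = ?P1 s u + ?P2 s u - ?P0 s u" for s u
  proof (cases "norm u \<le> 2")
    case True
    show ?thesis unfolding cis_relu_expansion[OF bx[OF True], of s] by (simp add: algebra_simps)
  qed (simp add: pol_eq_0)
  have i3: "integrable lborel2 (\<lambda>(s, u). ?P3 s u)"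
    using Bochner_Integration.integrable_diff[OF Bochner_Integration.integrable_add[OF i1 i2] i0]
    unfolding p3 by (simp add: split_beta')
  have sum: "(\<integral>(s, u). ?P0 s u \<partial>lborel2) = (\<integral>(s, u). ?P1 s u \<partial>lborel2) + (\<integral>(s, u). ?P2 s u \<partial>lborel2) - (\<integral>(s, u). ?P3 s u \<partial>lborel2)"
    using Bochner_Integration.integral_diff[OF Bochner_Integration.integrable_add[OF i1 i2] i3]
      Bochner_Integration.integral_add[OF i1 i2] unfolding p3 by (simp add: split_beta')
  have i4: "integrable lborel2 (\<lambda>(u, c). ridge u c * of_real (relu (u \<bullet> x + c)))"
  proof (rule Bochner_Integration.integrable_bound[OF integrable_mult_right[OF integrable_ridge, of 4]])
    show "(\<lambda>(u, c). ridge u c * of_real (relu (u \<bullet> x + c))) \<in> borel_measurable lborel2"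
      unfolding split_beta' by measurable
    have "norm (ridge u c * of_real (relu (u \<bullet> x + c))) \<le> norm (4 * ridge u c)" for u c
    proof (cases "norm u \<le> 2 \<and> \<bar>c\<bar> \<le> 2")
      case True
      then have "\<bar>relu (u \<bullet> x + c)\<bar> \<le> 4" using bx[of u] by (auto simp: relu_def)
      then have "norm (ridge u c) * \<bar>relu (u \<bullet> x + c)\<bar> \<le> norm (ridge u c) * 4" by (rule mult_left_mono) simp
        then show ?thesis by (simp add: norm_mult)
    qed (simp add: ridge_eq_0)
    then show "AE p in lborel2. norm (case p of (u, c) \<Rightarrow> ridge u c * of_real (relu (u \<bullet> x + c))) \<le> norm (4 * ridge (fst p) (snd p))"
      by (intro AE_I2) (auto simp: split_beta')
  qed
  have "(\<integral>(s, u). ?P3 s u \<partial>lborel2) = (\<integral>u. \<integral>s. ?P3 s u \<partial>lborel \<partial>lborel)"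
    by (rule lborel_pair.integral_snd[OF i3, symmetric])
  \<comment> \<open>For almost every direction the integrand is integrable along the ray, so the
    integrals over \<open>s\<close> and \<open>c\<close> may be exchanged; this collects the
    remainder in \<open>ridge\<close>.\<close>
  also have "\<dots> = (\<integral>u. \<integral>c. ridge u c * of_real (relu (u \<bullet> x + c)) \<partial>lborel \<partial>lborel)"
  proof (rule integral_cong_AE)
    show "AE u in lborel. (\<integral>s. ?P3 s u \<partial>lborel) = (\<integral>c. ridge u c * of_real (relu (u \<bullet> x + c)) \<partial>lborel)"
      using AE_pol
    proof eventually_elim
      fix u :: 'a
      assume "integrable lborel (\<lambda>s. of_real (s\<^sup>2) * pol s u) \<and> integrable lborel (\<lambda>s. (norm (of_real (s\<^sup>2) * pol s u))\<^sup>2)"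
      then have i: "integrable lborel (\<lambda>s. of_real (s\<^sup>2) * pol s u)" ..
      let ?g = "\<lambda>c. complex_of_real (indicator {-2..2} c * relu (u \<bullet> x + c))"
      have ig: "integrable lborel ?g"
      proof (intro integrable_of_real Bochner_Integration.integrable_bound[OF integrable_mult_right[OF integrable_indicator_Icc[of "-2" 2], of "\<bar>u \<bullet> x\<bar> + 2"]])
        show "AE c in lborel. norm (indicator {-2..2} c * relu (u \<bullet> x + c)) \<le> norm ((\<bar>u \<bullet> x\<bar> + 2) * indicator {-2..2} c)"
          by (rule AE_I2) (auto simp: relu_def split: split_indicator)
      qed measurable
      have "(\<integral>s. of_real (s\<^sup>2) * pol s u * (\<integral>c. ?g c * (\<lambda>(s, c). cis (- (s * c))) (s, c) \<partial>lborel) \<partial>lborel)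
        = (\<integral>c. ?g c * (\<integral>s. of_real (s\<^sup>2) * pol s u * (\<lambda>(s, c). cis (- (s * c))) (s, c) \<partial>lborel) \<partial>lborel)"
        by (rule integral_swap_bounded[OF i ig]) (auto simp: split_beta')
      then have "(\<integral>s. of_real (s\<^sup>2) * pol s u * (\<integral>c. ?g c * cis (- (s * c)) \<partial>lborel) \<partial>lborel)
        = (\<integral>c. ?g c * ft (\<lambda>s. of_real (s\<^sup>2) * pol s u) c \<partial>lborel)" unfolding ft_def prod.case by (simp only: inner_real_def mult.commute[of _ "_::real"])
      moreover have "(\<integral>c. ?g c * cis (- (s * c)) \<partial>lborel) = ?J s (u \<bullet> x)" for s
        by (intro Bochner_Integration.integral_cong refl) (simp add: scaleR_conv_of_real mult.assoc)
      moreover have "?g c * ft (\<lambda>s. of_real (s\<^sup>2) * pol s u) c = ridge u c * of_real (relu (u \<bullet> x + c))" for c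
        unfolding ridge_def by (simp only: scaleR_conv_of_real of_real_mult mult.assoc mult.commute mult.left_commute)
      ultimately show "(\<integral>s. ?P3 s u \<partial>lborel) = (\<integral>c. ridge u c * of_real (relu (u \<bullet> x + c)) \<partial>lborel)"
        by (simp only:)
    qed
    show "(\<lambda>u. \<integral>s. ?P3 s u \<partial>lborel) \<in> borel_measurable lborel"
      using borel_measurable_integrable[OF lborel_pair.integrable_snd[OF i3]] by simp
    show "(\<lambda>u. \<integral>c. ridge u c * of_real (relu (u \<bullet> x + c)) \<partial>lborel) \<in> borel_measurable lborel"
    proof (rule lborel.borel_measurable_lebesgue_integral)
      show "(\<lambda>(u, c). ridge u c * of_real (relu (u \<bullet> x + c))) \<in> borel_measurable lborel2"
        unfolding split_beta' by measurable
    qed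
  qed
  also have "\<dots> = (\<integral>(u, c). ridge u c * of_real (relu (u \<bullet> x + c)) \<partial>lborel2)"
    by (rule lborel_pair.integral_fst[OF i4])
  finally have ?A unfolding e0 sum by (simp add: split_beta' mult.assoc)
  moreover have ?B using i2 by (simp add: split_beta' mult.assoc)
  moreover have ?C using i4 by (simp add: split_beta')
  ultimately show ?thesis by blast
qed

lemma spectral_network:
  assumes e: "\<epsilon> > 0"
  shows "\<exists>N. \<exists>f\<in>nn_class N (5 * mass + 4 * ridge_mass). \<forall>x\<in>cball 0 1. \<bar>f x - Re (\<integral>\<xi>. \<Psi> \<xi> * cis (\<xi> \<bullet> x) \<partial>lborel)\<bar> \<le> \<epsilon>"
proof -
  define k where "k = Re (\<integral>p. pol (fst p) (snd p) * cis (- 2 * fst p) \<partial>lborel2)"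
  let ?q = "\<lambda>p. pol (fst p) (snd p) * (\<i> * of_real (fst p) * cis (- 2 * fst p))"
  define D where "D p = Re (?q p)" for p
  define H where "H p = - Re (ridge (fst p) (snd p))" for p
  define v where "v p = (if norm (snd p) \<le> 2 then snd p else 0, 2::real)" for p :: "real \<times> 'a"
  define w where "w p = (if norm (fst p) \<le> 2 \<and> \<bar>snd p\<bar> \<le> 2 then fst p else 0, if norm (fst p) \<le> 2 \<and> \<bar>snd p\<bar> \<le> 2 then snd p else 0)" for p :: "'a \<times> real"
  have mom: "(\<integral>\<xi>. norm (\<Psi> \<xi>) * (1 + norm \<xi>) ^ j \<partial>lborel) \<le> mass" if "j \<le> 1" for j
  proof -
    have "(\<integral>\<xi>. norm (\<Psi> \<xi>) * (1 + norm \<xi>) ^ j \<partial>lborel) \<le> (\<integral>\<xi>. norm (\<Psi> \<xi>) * (1 + norm \<xi>) ^ 1 \<partial>lborel)"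
      using that by (intro integral_mono integrable_moment mult_left_mono power_increasing) auto
    then show ?thesis using integral_moment by simp
  qed
  have k: "\<bar>k\<bar> \<le> mass"
  proof -
    have "\<bar>k\<bar> \<le> norm (\<integral>p. pol (fst p) (snd p) * cis (- 2 * fst p) \<partial>lborel2)"
      unfolding k_def by (rule abs_Re_le_cmod)
    also have "\<dots> \<le> (\<integral>p. norm (pol (fst p) (snd p) * cis (- 2 * fst p)) \<partial>lborel2)"
      by (rule integral_norm_bound)
    also have "\<dots> \<le> (\<integral>\<xi>. norm (\<Psi> \<xi>) * (1 + norm \<xi>) ^ 0 \<partial>lborel)" by (rule integral_pol_le) auto
    also have "\<dots> \<le> mass" by (rule mom) simp
    finally show ?thesis .
  qed
  have iq: "integrable lborel2 ?q"
    using integrable_pol[of 1 "\<lambda>p. \<i> * of_real (fst p) * cis (- 2 * fst p)"] by (simp add: split_beta' norm_mult)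
  have iD: "integrable lborel2 D" unfolding D_def using iq by (rule integrable_Re)
  have "(\<integral>p. \<bar>D p\<bar> \<partial>lborel2) \<le> (\<integral>p. norm (?q p) \<partial>lborel2)"
    by (intro integral_mono integrable_abs iD integrable_norm iq) (simp add: D_def abs_Re_le_cmod del: times_complex.sel)
  also have "\<dots> \<le> (\<integral>\<xi>. norm (\<Psi> \<xi>) * (1 + norm \<xi>) ^ 1 \<partial>lborel)"
    by (rule integral_pol_le) (auto simp: norm_mult)
  also have "\<dots> \<le> mass" by (rule mom) simp
  finally have D: "(\<integral>p. \<bar>D p\<bar> \<partial>lborel2) \<le> mass" .
  have iH: "integrable lborel2 H" unfolding H_def by (intro Bochner_Integration.integrable_minus integrable_Re integrable_ridge)
  have "(\<integral>p. \<bar>H p\<bar> \<partial>lborel2) \<le> (\<integral>p. norm (ridge (fst p) (snd p)) \<partial>lborel2)"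
    by (intro integral_mono integrable_abs iH integrable_norm integrable_ridge) (simp add: H_def abs_Re_le_cmod)
  then have H: "(\<integral>p. \<bar>H p\<bar> \<partial>lborel2) \<le> ridge_mass" using integral_ridge_le by simp
  have vn: "norm (v p) \<le> 4" for p unfolding v_def by (rule order_trans[OF norm_Pair_le]) auto
  have wn: "norm (w p) \<le> 4" for p unfolding w_def by (rule order_trans[OF norm_Pair_le]) auto
  have re: "Re (z * of_real r) = Re z * r" for z r by simp
  have "v \<in> borel_measurable lborel2" unfolding v_def[abs_def] borel_prod[symmetric] by measurable
  from nn_class_integral_approx[where v=v and V=4 and \<epsilon>="\<epsilon> / 2", OF iD this vn] e
  have "\<exists>N. \<exists>f\<in>nn_class N (4 * (\<integral>p. \<bar>D p\<bar> \<partial>lborel2)). \<forall>x\<in>cball 0 1. \<bar>f x - (\<integral>p. D p * relu (inner (x, 1) (v p)) \<partial>lborel2)\<bar> \<le> \<epsilon> / 2"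
    by simp
  then obtain N1 f1 where f1: "f1 \<in> nn_class N1 (4 * (\<integral>p. \<bar>D p\<bar> \<partial>lborel2))"
      "\<And>x. x \<in> cball 0 1 \<Longrightarrow> \<bar>f1 x - (\<integral>p. D p * relu (inner (x, 1) (v p)) \<partial>lborel2)\<bar> \<le> \<epsilon> / 2"
    by blast
  have "w \<in> borel_measurable lborel2" unfolding w_def[abs_def] borel_prod[symmetric] by measurable
  from nn_class_integral_approx[where v=w and V=4 and \<epsilon>="\<epsilon> / 2", OF iH this wn] e
  have "\<exists>N. \<exists>f\<in>nn_class N (4 * (\<integral>p. \<bar>H p\<bar> \<partial>lborel2)). \<forall>x\<in>cball 0 1. \<bar>f x - (\<integral>p. H p * relu (inner (x, 1) (w p)) \<partial>lborel2)\<bar> \<le> \<epsilon> / 2"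
    by simp
  then obtain N2 f2 where f2: "f2 \<in> nn_class N2 (4 * (\<integral>p. \<bar>H p\<bar> \<partial>lborel2))"
      "\<And>x. x \<in> cball 0 1 \<Longrightarrow> \<bar>f2 x - (\<integral>p. H p * relu (inner (x, 1) (w p)) \<partial>lborel2)\<bar> \<le> \<epsilon> / 2"
    by blast
  have dec: "Re (\<integral>\<xi>. \<Psi> \<xi> * cis (\<xi> \<bullet> x) \<partial>lborel) = k + (\<integral>p. D p * relu (inner (x, 1) (v p)) \<partial>lborel2) + (\<integral>p. H p * relu (inner (x, 1) (w p)) \<partial>lborel2)"
    if x: "x \<in> cball 0 1" for x
  proof -
    have bx: "\<bar>u \<bullet> x\<bar> \<le> 2" if "norm u \<le> 2" for u :: 'a
      using Cauchy_Schwarz_ineq2[of u x] that x mult_mono[of "norm u" 2 "norm x" 1] by auto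
    have Deq: "Re (?q p * of_real (snd p \<bullet> x + 2)) = D p * relu (inner (x, 1) (v p))" for p
    proof (cases "norm (snd p) \<le> 2")
      case True
      then have "relu (inner (x, 1) (v p)) = snd p \<bullet> x + 2" using bx[OF True] by (simp add: v_def relu_def inner_commute)
      then show ?thesis unfolding D_def re by (simp only:)
    next
      case False
      then have "pol (fst p) (snd p) = 0" by (simp add: pol_eq_0)
      then show ?thesis by (simp add: D_def)
    qed
    have Heq: "Re (ridge (fst p) (snd p) * of_real (relu (fst p \<bullet> x + snd p))) = - (H p * relu (inner (x, 1) (w p)))" for p
    proof (cases "norm (fst p) \<le> 2 \<and> \<bar>snd p\<bar> \<le> 2")
      case True
      then have "relu (inner (x, 1) (w p)) = relu (fst p \<bullet> x + snd p)"
        by (simp add: w_def) (simp add: inner_prod_def inner_commute)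
      then show ?thesis unfolding H_def re by (simp only: mult_minus_left minus_minus)
    next
      case False
      then have "ridge (fst p) (snd p) = 0" by (intro ridge_eq_0) auto
      then show ?thesis by (simp add: H_def)
    qed
    note fd = fourier_decomposition[OF x]
    have r2: "Re (\<integral>p. ?q p * of_real (snd p \<bullet> x + 2) \<partial>lborel2) = (\<integral>p. D p * relu (inner (x, 1) (v p)) \<partial>lborel2)"
      unfolding Deq[symmetric] by (rule integral_Re[symmetric, OF conjunct1[OF conjunct2[OF fd]]])
    have "Re (\<integral>p. ridge (fst p) (snd p) * of_real (relu (fst p \<bullet> x + snd p)) \<partial>lborel2) = (\<integral>p. - (H p * relu (inner (x, 1) (w p))) \<partial>lborel2)"
      unfolding Heq[symmetric] by (rule integral_Re[symmetric, OF conjunct2[OF conjunct2[OF fd]]])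
    then have r3: "Re (\<integral>p. ridge (fst p) (snd p) * of_real (relu (fst p \<bullet> x + snd p)) \<partial>lborel2) = - (\<integral>p. H p * relu (inner (x, 1) (w p)) \<partial>lborel2)"
      by simp
    show ?thesis unfolding conjunct1[OF fd] plus_complex.sel minus_complex.sel r2 r3 k_def by simp
  qed
  let ?f = "\<lambda>x. (k + f1 x) + f2 x"
  have "?f \<in> nn_class ((1 + N1) + N2) ((\<bar>k\<bar> + 4 * (\<integral>p. \<bar>D p\<bar> \<partial>lborel2)) + 4 * (\<integral>p. \<bar>H p\<bar> \<partial>lborel2))"
    by (intro nn_class_add constant_in_nn_class f1 f2)
  then have "?f \<in> nn_class ((1 + N1) + N2) (5 * mass + 4 * ridge_mass)"
    by (rule nn_class_mono[THEN subsetD, rotated -1]) (use k D H in auto)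
  moreover have "\<bar>?f x - Re (\<integral>\<xi>. \<Psi> \<xi> * cis (\<xi> \<bullet> x) \<partial>lborel)\<bar> \<le> \<epsilon>" if x: "x \<in> cball 0 1" for x
    using f1(2)[OF x] f2(2)[OF x] unfolding dec[OF x] by linarith
  ultimately show ?thesis by (intro exI bexI[where x="?f"] ballI)
qed

end

subsection \<open>Approximation of Hoelder functions\<close>

text \<open>Multiplying the Fourier transform by this symbol averages all terms of the \<open>m\<close>-th difference
  except the zeroth one against a Gaussian, which reproduces the function up to an averaged \<open>m\<close>-th difference.\<close>

definition symbol :: "(nat \<Rightarrow> real) \<Rightarrow> nat \<Rightarrow> real \<Rightarrow> 'a::euclidean_space \<Rightarrow> real" where
  "symbol c m \<delta> \<xi> = - ((-1) ^ m) / (2 * pi) ^ DIM('a) * (\<Sum>i=1..m. c i * gauss (real i * \<delta>) \<xi>)"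

lemma borel_measurable_symbol [measurable]: "symbol c m \<delta> \<in> borel_measurable borel"
  unfolding symbol_def[abs_def] by measurable

lemma gauss_antimono: "0 \<le> \<sigma> \<Longrightarrow> \<sigma> \<le> \<tau> \<Longrightarrow> gauss \<tau> u \<le> gauss \<sigma> u"
  unfolding gauss_def by (auto intro!: mult_right_mono divide_right_mono power_mono)

lemma symbol_bound:
  assumes "\<delta> \<ge> 0"
  shows "\<bar>symbol c m \<delta> (\<xi>::'a::euclidean_space)\<bar> \<le> (\<Sum>i=1..m. \<bar>c i\<bar>) * gauss \<delta> \<xi>"
proof -
  have "\<bar>\<Sum>i=1..m. c i * gauss (real i * \<delta>) \<xi>\<bar> \<le> (\<Sum>i=1..m. \<bar>c i * gauss (real i * \<delta>) \<xi>\<bar>)" by (rule sum_abs)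
  also have "\<dots> \<le> (\<Sum>i=1..m. \<bar>c i\<bar> * gauss \<delta> \<xi>)"
  proof (rule sum_mono)
    fix i assume "i \<in> {1..m}"
    then have "1 * \<delta> \<le> real i * \<delta>" using assms by (intro mult_right_mono) auto
    then have "gauss (real i * \<delta>) \<xi> \<le> gauss \<delta> \<xi>" using assms by (intro gauss_antimono) auto
    then show "\<bar>c i * gauss (real i * \<delta>) \<xi>\<bar> \<le> \<bar>c i\<bar> * gauss \<delta> \<xi>"
      using gauss_pos[of "real i * \<delta>" \<xi>] by (simp add: abs_mult mult_left_mono)
  qed
  finally have s: "\<bar>\<Sum>i=1..m. c i * gauss (real i * \<delta>) \<xi>\<bar> \<le> (\<Sum>i=1..m. \<bar>c i\<bar>) * gauss \<delta> \<xi>"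
    by (simp add: sum_distrib_right)
  have "1 \<le> (2 * pi) ^ DIM('a)" using pi_gt3 by (intro one_le_power) linarith
  then have "\<bar>symbol c m \<delta> \<xi>\<bar> \<le> 1 * \<bar>\<Sum>i=1..m. c i * gauss (real i * \<delta>) \<xi>\<bar>"
    unfolding symbol_def abs_mult by (intro mult_right_mono) (auto simp: abs_divide power_abs)
  then show ?thesis using s by linarith
qed

context rough
begin

text \<open>By regularised inversion the terms of \<open>symbol\<close> are Gaussian means of
  \<open>F\<close> at scales \<open>i * \<delta>\<close>. Together they are the averaged
  \<open>m\<close>-th difference without its zeroth term \<open>(-1) ^ m * F x\<close>; the
  prefactor cancels this sign and the constants of the unnormalised transform.\<close>

lemma symbol_reproduces:
  fixes x :: 'a
  assumes c: "c 0 = (-1) ^ m" "\<And>(f::'a \<Rightarrow> real) h x. fdiff m h f x = (\<Sum>i\<le>m. c i *\<^sub>R f (x + real i *\<^sub>R h))"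
    and \<delta>: "\<delta> > 0"
  shows "(\<integral>\<xi>. of_real (symbol c m \<delta> \<xi>) * ft (\<lambda>x. complex_of_real (F x)) \<xi> * cis (\<xi> \<bullet> x) \<partial>lborel)
    = of_real (F x - (-1) ^ m / sqrt (2 * pi) ^ DIM('a) * (\<integral>u. gauss 1 u * fdiff m (\<delta> *\<^sub>R u) F x \<partial>lborel))"
proof -
  let ?Fc = "\<lambda>x. complex_of_real (F x)"
  let ?g = "sqrt (2 * pi) ^ DIM('a)"
  let ?I = "\<lambda>i. \<integral>u. gauss 1 u * F (x + (real i * \<delta>) *\<^sub>R u) \<partial>lborel"
  note [measurable] = borel_measurable_ft[OF integrable_Fc]
  have g0: "?g > 0" by simp
  have gg: "(2 * pi) ^ DIM('a) = ?g * ?g" by (subst power_mult_distrib[symmetric]) simp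
  have iI: "integrable lborel (\<lambda>u. gauss 1 u * F (x + (real i * \<delta>) *\<^sub>R u))" for i
  proof (rule Bochner_Integration.integrable_bound)
    show "integrable lborel (\<lambda>u::'a. C * gauss 1 u)" by (intro integrable_mult_right integrable_gauss) simp
    show "AE u in lborel. norm (gauss 1 u * F (x + (real i * \<delta>) *\<^sub>R u)) \<le> norm (C * gauss 1 u)"
    proof (rule AE_I2)
      fix u :: 'a
      have "\<bar>F (x + (real i * \<delta>) *\<^sub>R u)\<bar> * \<bar>gauss 1 u\<bar> \<le> C * \<bar>gauss 1 u\<bar>" by (intro mult_right_mono FC) simp
      then show "norm (gauss 1 u * F (x + (real i * \<delta>) *\<^sub>R u)) \<le> norm (C * gauss 1 u)"
        using C_nonneg by (simp only: real_norm_def abs_mult abs_of_nonneg mult.commute)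
    qed
  qed measurable
  have ii: "integrable lborel (\<lambda>\<xi>. of_real (gauss (real i * \<delta>) \<xi>) * ft ?Fc \<xi> * cis (\<xi> \<bullet> x))" if "i \<in> {1..m}" for i
  proof (rule Bochner_Integration.integrable_bound)
    show "integrable lborel (\<lambda>\<xi>::'a. (\<integral>y. norm (?Fc y) \<partial>lborel) * gauss (real i * \<delta>) \<xi>)"
      using that \<delta> by (intro integrable_mult_right integrable_gauss) simp
    show "AE \<xi> in lborel. norm (of_real (gauss (real i * \<delta>) \<xi>) * ft ?Fc \<xi> * cis (\<xi> \<bullet> x)) \<le> norm ((\<integral>y. norm (?Fc y) \<partial>lborel) * gauss (real i * \<delta>) \<xi>)"
    proof (rule AE_I2)
      fix \<xi> :: 'a
      have "norm (ft ?Fc \<xi>) * gauss (real i * \<delta>) \<xi> \<le> (\<integral>y. norm (?Fc y) \<partial>lborel) * gauss (real i * \<delta>) \<xi>"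
        by (intro mult_right_mono norm_ft_le integrable_Fc less_imp_le[OF gauss_pos])
      also have "\<dots> \<le> \<bar>\<dots>\<bar>" by (rule abs_ge_self)
      finally show "norm (of_real (gauss (real i * \<delta>) \<xi>) * ft ?Fc \<xi> * cis (\<xi> \<bullet> x)) \<le> norm ((\<integral>y. norm (?Fc y) \<partial>lborel) * gauss (real i * \<delta>) \<xi>)"
        by (simp add: norm_mult less_imp_le[OF gauss_pos] mult.commute)
    qed
  qed measurable
  have ei: "(\<integral>\<xi>. of_real (gauss (real i * \<delta>) \<xi>) * ft ?Fc \<xi> * cis (\<xi> \<bullet> x) \<partial>lborel) = of_real (?g * ?I i)" if "i \<in> {1..m}" for i
  proof -
    have "(\<integral>u. complex_of_real (gauss 1 u) * ?Fc (x + (real i * \<delta>) *\<^sub>R u) \<partial>lborel) = of_real (?I i)"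
      by (simp only: of_real_mult[symmetric] integral_complex_of_real)
    then show ?thesis using gauss_mean_ft[OF integrable_Fc, of "real i * \<delta>" x] that \<delta> by simp
  qed
  have "(\<integral>\<xi>. of_real (symbol c m \<delta> \<xi>) * ft ?Fc \<xi> * cis (\<xi> \<bullet> x) \<partial>lborel)
    = (\<integral>\<xi>. (\<Sum>i=1..m. of_real (- ((-1) ^ m) / (2 * pi) ^ DIM('a) * c i) * (of_real (gauss (real i * \<delta>) \<xi>) * ft ?Fc \<xi> * cis (\<xi> \<bullet> x))) \<partial>lborel)"
    by (intro Bochner_Integration.integral_cong refl) (simp add: symbol_def sum_distrib_left sum_distrib_right sum_negf mult.assoc)
  also have "\<dots> = (\<Sum>i=1..m. of_real (- ((-1) ^ m) / (2 * pi) ^ DIM('a) * c i) * (\<integral>\<xi>. of_real (gauss (real i * \<delta>) \<xi>) * ft ?Fc \<xi> * cis (\<xi> \<bullet> x) \<partial>lborel))"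
    by (subst Bochner_Integration.integral_sum) (use ii in \<open>auto intro!: integrable_mult_right\<close>)
  also have "\<dots> = (\<Sum>i=1..m. of_real (- ((-1) ^ m) / (2 * pi) ^ DIM('a) * c i) * of_real (?g * ?I i))"
    using ei by (intro sum.cong) auto
  also have "\<dots> = of_real (\<Sum>i=1..m. - ((-1) ^ m) / ?g * (c i * ?I i))"
    unfolding of_real_sum of_real_mult[symmetric] gg using g0 by (intro sum.cong arg_cong[where f=of_real]) auto
  also have "(\<Sum>i=1..m. - ((-1) ^ m) / ?g * (c i * ?I i)) = - ((-1) ^ m) / ?g * (\<Sum>i=1..m. c i * ?I i)"
    by (simp only: sum_distrib_left)
  also have "(\<Sum>i=1..m. c i * ?I i) = (\<integral>u. (\<Sum>i=1..m. c i * (gauss 1 u * F (x + (real i * \<delta>) *\<^sub>R u))) \<partial>lborel)"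
    by (subst Bochner_Integration.integral_sum) (use iI in auto)
  also have "\<dots> = (\<integral>u. gauss 1 u * fdiff m (\<delta> *\<^sub>R u) F x - ((-1) ^ m * F x) * gauss 1 u \<partial>lborel)"
  proof (intro Bochner_Integration.integral_cong refl)
    fix u :: 'a
    have "{..m} = insert 0 {1..m}" by auto
    then have "fdiff m (\<delta> *\<^sub>R u) F x = (-1) ^ m * F x + (\<Sum>i=1..m. c i * F (x + (real i * \<delta>) *\<^sub>R u))"
      unfolding c(2) by (simp add: c(1))
    then show "(\<Sum>i=1..m. c i * (gauss 1 u * F (x + (real i * \<delta>) *\<^sub>R u))) = gauss 1 u * fdiff m (\<delta> *\<^sub>R u) F x - ((-1) ^ m * F x) * gauss 1 u"
      by (simp add: sum_distrib_left algebra_simps)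
  qed
  also have "\<dots> = (\<integral>u. gauss 1 u * fdiff m (\<delta> *\<^sub>R u) F x \<partial>lborel) - (\<integral>u. ((-1) ^ m * F x) * gauss 1 (u::'a) \<partial>lborel)"
  proof (rule Bochner_Integration.integral_diff)
    have "(\<lambda>u. gauss 1 u * fdiff m (\<delta> *\<^sub>R u) F x) = (\<lambda>u. \<Sum>i\<le>m. c i * (gauss 1 u * F (x + (real i * \<delta>) *\<^sub>R u)))"
      unfolding c(2) by (simp add: sum_distrib_left ac_simps)
    moreover have "integrable lborel (\<lambda>u. \<Sum>i\<le>m. c i * (gauss 1 u * F (x + (real i * \<delta>) *\<^sub>R u)))"
      by (intro Bochner_Integration.integrable_sum integrable_mult_right iI)
    ultimately show "integrable lborel (\<lambda>u. gauss 1 u * fdiff m (\<delta> *\<^sub>R u) F x)" by simp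
  qed (intro integrable_mult_right integrable_gauss zero_less_one)
  also have "(\<integral>u. ((-1) ^ m * F x) * gauss 1 (u::'a) \<partial>lborel) = (-1) ^ m * F x * ?g"
    using integral_gauss[of 1, where 'a='a] by simp
  also have "- ((-1) ^ m) / ?g * ((\<integral>u. gauss 1 u * fdiff m (\<delta> *\<^sub>R u) F x \<partial>lborel) - (-1) ^ m * F x * ?g)
    = F x - (-1) ^ m / ?g * (\<integral>u. gauss 1 u * fdiff m (\<delta> *\<^sub>R u) F x \<partial>lborel)"
  proof -
    have "((-1) ^ m)\<^sup>2 = (1::real)" by (simp flip: power_mult)
    then have s: "(-1) ^ m * ((-1) ^ m * z) = (z::real)" for z by (simp add: power2_eq_square flip: mult.assoc)
    show ?thesis using g0 by (simp add: right_diff_distrib s)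
  qed
  finally show ?thesis .
qed

lemma averaged_difference_bound:
  assumes \<delta>: "\<delta> > 0"
  shows "\<bar>(-1) ^ m / sqrt (2 * pi) ^ DIM('a) * (\<integral>u. gauss 1 u * fdiff m (\<delta> *\<^sub>R u) F x \<partial>lborel)\<bar>
    \<le> C * \<delta> powr \<alpha> * (\<integral>u. gauss 1 (u::'a) * norm u powr \<alpha> \<partial>lborel)"
proof -
  let ?g = "sqrt (2 * pi) ^ DIM('a)"
  have "1 \<le> ?g" using pi_gt3 by (intro one_le_power) auto
  have "\<bar>\<integral>u. gauss 1 u * fdiff m (\<delta> *\<^sub>R u) F x \<partial>lborel\<bar> \<le> (\<integral>u. C * \<delta> powr \<alpha> * (gauss 1 (u::'a) * norm u powr \<alpha>) \<partial>lborel)"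
    unfolding real_norm_def[symmetric]
  proof (rule order_trans[OF integral_norm_bound integral_mono])
    show i: "integrable lborel (\<lambda>u::'a. C * \<delta> powr \<alpha> * (gauss 1 u * norm u powr \<alpha>))"
      using \<alpha> by (intro integrable_mult_right integrable_gauss_moment) simp
    have b: "norm (gauss 1 u * fdiff m (\<delta> *\<^sub>R u) F x) \<le> C * \<delta> powr \<alpha> * (gauss 1 u * norm u powr \<alpha>)" for u
    proof -
      have "gauss 1 u * \<bar>fdiff m (\<delta> *\<^sub>R u) F x\<bar> \<le> gauss 1 u * (C * norm (\<delta> *\<^sub>R u) powr \<alpha>)"
        by (intro mult_left_mono Fd less_imp_le[OF gauss_pos])
      then show ?thesis using \<delta> by (simp add: abs_mult less_imp_le[OF gauss_pos] powr_mult ac_simps)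
    qed
    show "norm (gauss 1 u * fdiff m (\<delta> *\<^sub>R u) F x) \<le> C * \<delta> powr \<alpha> * (gauss 1 u * norm u powr \<alpha>)" for u by (rule b)
    obtain c where c: "\<And>(f::'a \<Rightarrow> real) h x. fdiff m h f x = (\<Sum>i\<le>m. c i *\<^sub>R f (x + real i *\<^sub>R h))"
      using fdiff_expand[of m] by metis
    have "(\<lambda>u. gauss 1 u * fdiff m (\<delta> *\<^sub>R u) F x) \<in> borel_measurable lborel" unfolding c by measurable
    then show "integrable lborel (\<lambda>u. norm (gauss 1 u * fdiff m (\<delta> *\<^sub>R u) F x))"
      using b by (intro integrable_norm Bochner_Integration.integrable_bound[OF i]) (auto intro: order_trans[OF _ abs_ge_self])
  qed
  also have "\<dots> = C * \<delta> powr \<alpha> * (\<integral>u. gauss 1 (u::'a) * norm u powr \<alpha> \<partial>lborel)" by simp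
  finally have *: "\<bar>\<integral>u. gauss 1 u * fdiff m (\<delta> *\<^sub>R u) F x \<partial>lborel\<bar> \<le> C * \<delta> powr \<alpha> * (\<integral>u. gauss 1 (u::'a) * norm u powr \<alpha> \<partial>lborel)" .
  have "\<bar>(-1) ^ m / ?g * (\<integral>u. gauss 1 u * fdiff m (\<delta> *\<^sub>R u) F x \<partial>lborel)\<bar> \<le> 1 * \<bar>\<integral>u. gauss 1 u * fdiff m (\<delta> *\<^sub>R u) F x \<partial>lborel\<bar>"
    unfolding abs_mult using \<open>1 \<le> ?g\<close> by (intro mult_right_mono) (auto simp: abs_divide power_abs)
  with * show ?thesis by linarith
qed

end

lemma rough_network:
  fixes C R \<alpha> :: real and m :: nat
  assumes \<alpha>: "2 * \<alpha> < real DIM('a::euclidean_space) + 3"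
  shows "\<exists>K>0. \<forall>(F :: 'a \<Rightarrow> real) J. rough F C R \<alpha> m \<longrightarrow>
    (\<exists>N. \<exists>f\<in>nn_class N (K * 2 powr (real J * ((real DIM('a) + 3) / 2 - \<alpha>))). \<forall>x\<in>cball 0 1. \<bar>f x - F x\<bar> \<le> K * 2 powr (- (real J * \<alpha>)))"
proof -
  let ?p = "DIM('a) + 3"
  let ?Fh = "\<lambda>F::'a \<Rightarrow> real. ft (\<lambda>x. complex_of_real (F x))"
  have p: "2 * \<alpha> < real ?p" "2 * \<alpha> < real (DIM('a) + 5)" using \<alpha> by auto
  obtain c where c: "c 0 = (-1) ^ m" "\<And>(f::'a \<Rightarrow> real) h x. fdiff m h f x = (\<Sum>i\<le>m. c i *\<^sub>R f (x + real i *\<^sub>R h))"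
    using fdiff_expand[of m] by metis
  obtain K1 where K1: "K1 > 0" "\<And>(F::'a \<Rightarrow> real) J. rough F C R \<alpha> m \<Longrightarrow>
      (\<integral>\<^sup>+\<xi>. ennreal ((gauss (1 / 2 ^ J) \<xi>)\<^sup>2 * (norm (?Fh F \<xi>))\<^sup>2 * (1 + norm \<xi>) ^ ?p) \<partial>lborel) \<le> ennreal (K1 * 2 powr (real J * (real ?p - 2 * \<alpha>)))"
    using dyadic_energy[OF p(1), of C R m, where 'a='a] by blast
  obtain K2 where K2: "K2 > 0" "\<And>(F::'a \<Rightarrow> real) J. rough F C R \<alpha> m \<Longrightarrow>
      (\<integral>\<^sup>+\<xi>. ennreal ((gauss (1 / 2 ^ J) \<xi>)\<^sup>2 * (norm (?Fh F \<xi>))\<^sup>2 * (1 + norm \<xi>) ^ (DIM('a) + 5)) \<partial>lborel) \<le> ennreal (K2 * 2 powr (real J * (real (DIM('a) + 5) - 2 * \<alpha>)))"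
    using dyadic_energy[OF p(2), of C R m, where 'a='a] by blast
  define s where "s = (\<Sum>i=1..m. \<bar>c i\<bar>)"
  define G where "G = (\<integral>u. gauss 1 (u::'a) * norm u powr \<alpha> \<partial>lborel)"
  have G0: "G \<ge> 0" unfolding G_def by (rule integral_nonneg_AE) (auto simp: less_imp_le[OF gauss_pos])
  define tl where "tl = (\<integral>\<xi>. 1 / (1 + norm (\<xi>::'a)) ^ (DIM('a) + 1) \<partial>lborel)"
  have tl0: "tl \<ge> 0" unfolding tl_def by (rule integral_nonneg_AE) auto
  define vl where "vl = measure lborel {u::'a. 1 \<le> norm u \<and> norm u \<le> 2}"
  have vl0: "vl \<ge> 0" by (simp add: vl_def)
  define e0 where "e0 = s\<^sup>2 * K1"
  have e00: "e0 \<ge> 0" using K1(1) by (simp add: e0_def)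
  define W where "W = 5 * (1 / 2 * tl + 1 / 2 * e0) + 4 * (1 / 2 * (4 * vl) + 1 / 2 * (exp 2 * (2 * pi) * (e0 / ln 2)))"
  have W0: "W \<ge> 0" using tl0 vl0 e00 by (auto simp: W_def intro!: add_nonneg_nonneg mult_nonneg_nonneg)
  define K where "K = W + \<bar>C\<bar> * G + 1"
  have K: "K > 0" "W \<le> K" "1 + \<bar>C\<bar> * G \<le> K" using W0 G0 by (auto simp: K_def intro!: add_nonneg_pos)
  have "\<exists>N. \<exists>f\<in>nn_class N (K * 2 powr (real J * ((real DIM('a) + 3) / 2 - \<alpha>))). \<forall>x\<in>cball 0 1. \<bar>f x - F x\<bar> \<le> K * 2 powr (- (real J * \<alpha>))"
    if "rough F C R \<alpha> m" for F :: "'a \<Rightarrow> real" and J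
  proof -
    interpret rough F C R \<alpha> m by fact
    define \<delta> :: real where "\<delta> = 1 / 2 ^ J"
    have \<delta>: "\<delta> > 0" by (simp add: \<delta>_def)
    \<comment> \<open>The root of the energy bound
      \<open>2 powr (J * (DIM('a) + 3 - 2 * \<alpha>))\<close>. With this parameter both terms of
      \<open>mass\<close> and of \<open>ridge_mass\<close> are constant multiples of
      \<open>t\<close>.\<close>
    define t :: real where "t = 2 powr (real J * ((real DIM('a) + 3) / 2 - \<alpha>))"
    have t0: "t > 0" by (simp add: t_def)
    have tt: "2 powr (real J * (real ?p - 2 * \<alpha>)) = t * t"
      unfolding t_def powr_add[symmetric] by (simp add: algebra_simps)
    define \<Psi> where "\<Psi> \<xi> = of_real (symbol c m \<delta> \<xi>) * ?Fh F \<xi>" for \<xi>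
    note [measurable] = borel_measurable_ft[OF integrable_Fc]
    have \<Psi>m [measurable]: "\<Psi> \<in> borel_measurable borel" unfolding \<Psi>_def by measurable
    have sq: "(norm (\<Psi> \<xi>))\<^sup>2 * q \<le> s\<^sup>2 * ((gauss (1 / 2 ^ J) \<xi>)\<^sup>2 * (norm (?Fh F \<xi>))\<^sup>2 * q)" if "q \<ge> 0" for \<xi> q
    proof -
      have "\<bar>symbol c m \<delta> \<xi>\<bar> \<le> s * gauss \<delta> \<xi>" unfolding s_def using \<delta> by (intro symbol_bound) simp
      then have "\<bar>symbol c m \<delta> \<xi>\<bar>\<^sup>2 \<le> (s * gauss \<delta> \<xi>)\<^sup>2" by (rule power_mono) simp
      then have "\<bar>symbol c m \<delta> \<xi>\<bar>\<^sup>2 * ((norm (?Fh F \<xi>))\<^sup>2 * q) \<le> (s * gauss \<delta> \<xi>)\<^sup>2 * ((norm (?Fh F \<xi>))\<^sup>2 * q)"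
        using that by (intro mult_right_mono) auto
      then show ?thesis unfolding \<Psi>_def norm_mult norm_of_real power_mult_distrib \<delta>_def by (simp only: mult.assoc)
    qed
    have en: "(\<integral>\<^sup>+\<xi>. ennreal ((norm (\<Psi> \<xi>))\<^sup>2 * (1 + norm \<xi>) ^ k) \<partial>lborel)
      \<le> ennreal (s\<^sup>2) * (\<integral>\<^sup>+\<xi>. ennreal ((gauss (1 / 2 ^ J) \<xi>)\<^sup>2 * (norm (?Fh F \<xi>))\<^sup>2 * (1 + norm \<xi>) ^ k) \<partial>lborel)" for k
    proof -
      have "(\<integral>\<^sup>+\<xi>. ennreal ((norm (\<Psi> \<xi>))\<^sup>2 * (1 + norm \<xi>) ^ k) \<partial>lborel)
        \<le> (\<integral>\<^sup>+\<xi>. ennreal (s\<^sup>2) * ennreal ((gauss (1 / 2 ^ J) \<xi>)\<^sup>2 * (norm (?Fh F \<xi>))\<^sup>2 * (1 + norm \<xi>) ^ k) \<partial>lborel)"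
      proof (rule nn_integral_mono)
        fix \<xi> :: 'a
        have "ennreal ((norm (\<Psi> \<xi>))\<^sup>2 * (1 + norm \<xi>) ^ k) \<le> ennreal (s\<^sup>2 * ((gauss (1 / 2 ^ J) \<xi>)\<^sup>2 * (norm (?Fh F \<xi>))\<^sup>2 * (1 + norm \<xi>) ^ k))"
          by (intro ennreal_leI sq) simp
        also have "\<dots> = ennreal (s\<^sup>2) * ennreal ((gauss (1 / 2 ^ J) \<xi>)\<^sup>2 * (norm (?Fh F \<xi>))\<^sup>2 * (1 + norm \<xi>) ^ k)"
          by (rule ennreal_mult) auto
        finally show "ennreal ((norm (\<Psi> \<xi>))\<^sup>2 * (1 + norm \<xi>) ^ k) \<le> \<dots>" .
      qed
      also have "\<dots> = ennreal (s\<^sup>2) * (\<integral>\<^sup>+\<xi>. ennreal ((gauss (1 / 2 ^ J) \<xi>)\<^sup>2 * (norm (?Fh F \<xi>))\<^sup>2 * (1 + norm \<xi>) ^ k) \<partial>lborel)"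
        by (rule nn_integral_cmult) measurable
      finally show ?thesis .
    qed
    interpret sp: spectral \<Psi> "e0 * (t * t)" t
    proof
      have "(\<integral>\<^sup>+\<xi>. ennreal ((norm (\<Psi> \<xi>))\<^sup>2 * (1 + norm \<xi>) ^ ?p) \<partial>lborel) \<le> ennreal (s\<^sup>2) * ennreal (K1 * (t * t))"
        unfolding tt[symmetric] by (rule order_trans[OF en mult_left_mono[OF K1(2)[OF \<open>rough F C R \<alpha> m\<close>]]]) simp
      also have "\<dots> = ennreal (e0 * (t * t))" using K1(1) unfolding e0_def by (simp add: mult.assoc flip: ennreal_mult)
      finally show "(\<integral>\<^sup>+\<xi>. ennreal ((norm (\<Psi> \<xi>))\<^sup>2 * (1 + norm \<xi>) ^ ?p) \<partial>lborel) \<le> ennreal (e0 * (t * t))" .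
      have "(\<integral>\<^sup>+\<xi>. ennreal ((norm (\<Psi> \<xi>))\<^sup>2 * (1 + norm \<xi>) ^ (DIM('a) + 5)) \<partial>lborel) \<le> ennreal (s\<^sup>2) * ennreal (K2 * 2 powr (real J * (real (DIM('a) + 5) - 2 * \<alpha>)))"
        by (rule order_trans[OF en mult_left_mono[OF K2(2)[OF \<open>rough F C R \<alpha> m\<close>]]]) simp
      also have "\<dots> < \<infinity>" by (simp add: ennreal_mult_less_top)
      finally show "(\<integral>\<^sup>+\<xi>. ennreal ((norm (\<Psi> \<xi>))\<^sup>2 * (1 + norm \<xi>) ^ (DIM('a) + 5)) \<partial>lborel) < \<infinity>" .
    qed (use t0 e00 \<Psi>m in auto)
    have e: "2 powr (- (real J * \<alpha>)) > (0::real)" by simp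
    obtain N f where f: "f \<in> nn_class N (5 * sp.mass + 4 * sp.ridge_mass)"
        "\<And>x. x \<in> cball 0 1 \<Longrightarrow> \<bar>f x - Re (\<integral>\<xi>. \<Psi> \<xi> * cis (\<xi> \<bullet> x) \<partial>lborel)\<bar> \<le> 2 powr (- (real J * \<alpha>))"
      using sp.spectral_network[OF e] by blast
    have "5 * sp.mass + 4 * sp.ridge_mass = W * t"
      unfolding sp.mass_def sp.ridge_mass_def sp.tail_def sp.vol_def tl_def[symmetric] vl_def[symmetric] W_def
      using t0 by (simp add: field_simps)
    also have "\<dots> \<le> K * t" using K(2) t0 by (intro mult_right_mono) auto
    finally have "f \<in> nn_class N (K * t)" using f(1) nn_class_mono[of N N] by blast
    moreover have "\<bar>f x - F x\<bar> \<le> K * 2 powr (- (real J * \<alpha>))" if x: "x \<in> cball 0 1" for x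
    proof -
      define D where "D = (-1) ^ m / sqrt (2 * pi) ^ DIM('a) * (\<integral>u. gauss 1 u * fdiff m (\<delta> *\<^sub>R u) F x \<partial>lborel)"
      have "Re (\<integral>\<xi>. \<Psi> \<xi> * cis (\<xi> \<bullet> x) \<partial>lborel) = F x - D"
        unfolding \<Psi>_def D_def symbol_reproduces[OF c \<delta>] by (rule Re_complex_of_real)
      moreover have "\<bar>D\<bar> \<le> C * \<delta> powr \<alpha> * G" unfolding D_def G_def by (rule averaged_difference_bound[OF \<delta>])
      moreover have "\<delta> powr \<alpha> = 2 powr (- (real J * \<alpha>))"
        unfolding \<delta>_def by (simp add: powr_divide powr_minus_divide powr_powr flip: powr_realpow)
      ultimately have "Re (\<integral>\<xi>. \<Psi> \<xi> * cis (\<xi> \<bullet> x) \<partial>lborel) = F x - D" "\<bar>D\<bar> \<le> C * 2 powr (- (real J * \<alpha>)) * G"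
        by (simp_all only:)
      then have "\<bar>f x - F x\<bar> \<le> 2 powr (- (real J * \<alpha>)) + C * 2 powr (- (real J * \<alpha>)) * G"
        using f(2)[OF x] by linarith
      also have "\<dots> = (1 + \<bar>C\<bar> * G) * 2 powr (- (real J * \<alpha>))" using C_nonneg by (simp add: algebra_simps)
      also have "\<dots> \<le> K * 2 powr (- (real J * \<alpha>))" using K(3) by (intro mult_right_mono) auto
      finally show ?thesis .
    qed
    ultimately show ?thesis unfolding t_def by blast
  qed
  then show ?thesis using K(1) by blast
qed

lemma holder_network:
  assumes \<alpha>: "0 < \<alpha>" "\<alpha> < (real DIM('a::euclidean_space) + 3) / 2"
  shows "\<exists>K>0. \<forall>h\<in>holder_unit_ball \<alpha>. \<forall>J. (\<forall>x\<in>cball 0 1. \<bar>h x\<bar> \<le> K) \<and>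
    (\<exists>N. \<exists>f\<in>nn_class N (K * 2 powr (real J * ((real DIM('a) + 3) / 2 - \<alpha>))). \<forall>x\<in>cball (0::'a) 1. \<bar>f x - h x\<bar> \<le> K * 2 powr (- (real J * \<alpha>)))"
proof -
  define m where "m = Suc (nat (\<lceil>\<alpha>\<rceil> - 1))"
  obtain C R where C: "C > 0" and ext: "\<And>h. h \<in> holder_unit_ball \<alpha> \<Longrightarrow> \<exists>F::'a \<Rightarrow> real. F \<in> borel_measurable borel \<and>
    (\<forall>x\<in>cball 0 1. F x = h x) \<and> (\<forall>x. \<bar>F x\<bar> \<le> C) \<and> (\<forall>x. norm x > R \<longrightarrow> F x = 0) \<and>
    (\<forall>u x. \<bar>fdiff m u F x\<bar> \<le> C * norm u powr \<alpha>)"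
    using holder_cutoff_extension[OF \<alpha>(1), where 'a='a] unfolding m_def by blast
  have "2 * \<alpha> < real DIM('a) + 3" using \<alpha>(2) by simp
  from rough_network[OF this, of C R m] obtain K where K: "K > 0" "\<And>(F :: 'a \<Rightarrow> real) J. rough F C R \<alpha> m \<Longrightarrow>
    (\<exists>N. \<exists>f\<in>nn_class N (K * 2 powr (real J * ((real DIM('a) + 3) / 2 - \<alpha>))). \<forall>x\<in>cball 0 1. \<bar>f x - F x\<bar> \<le> K * 2 powr (- (real J * \<alpha>)))"
    by blast
  have "(\<forall>x\<in>cball 0 1. \<bar>h x\<bar> \<le> max K C) \<and> (\<exists>N. \<exists>f\<in>nn_class N (max K C * 2 powr (real J * ((real DIM('a) + 3) / 2 - \<alpha>))). \<forall>x\<in>cball (0::'a) 1. \<bar>f x - h x\<bar> \<le> max K C * 2 powr (- (real J * \<alpha>)))"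
    if h: "h \<in> holder_unit_ball \<alpha>" for h J
  proof -
    obtain F :: "'a \<Rightarrow> real" where F: "F \<in> borel_measurable borel" "\<forall>x\<in>cball 0 1. F x = h x" "\<forall>x. \<bar>F x\<bar> \<le> C" "\<forall>x. norm x > R \<longrightarrow> F x = 0"
      "\<forall>u x. \<bar>fdiff m u F x\<bar> \<le> C * norm u powr \<alpha>" using ext[OF h] by blast
    have "rough F C R \<alpha> m" by unfold_locales (use F \<alpha> in \<open>auto simp: m_def\<close>)
    from K(2)[OF this, of J] obtain N f where f: "f \<in> nn_class N (K * 2 powr (real J * ((real DIM('a) + 3) / 2 - \<alpha>)))"
      "\<forall>x\<in>cball 0 1. \<bar>f x - F x\<bar> \<le> K * 2 powr (- (real J * \<alpha>))" by blast
    have "f \<in> nn_class N (max K C * 2 powr (real J * ((real DIM('a) + 3) / 2 - \<alpha>)))"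
      by (rule nn_class_mono[THEN subsetD, OF order_refl _ f(1)]) (intro mult_right_mono, auto)
    moreover have "\<bar>f x - h x\<bar> \<le> max K C * 2 powr (- (real J * \<alpha>))" if "x \<in> cball 0 1" for x
    proof -
      have "\<bar>f x - h x\<bar> \<le> K * 2 powr (- (real J * \<alpha>))" using f(2) F(2) that by auto
      also have "\<dots> \<le> max K C * 2 powr (- (real J * \<alpha>))" by (intro mult_right_mono) auto
      finally show ?thesis .
    qed
    moreover have "\<bar>h x\<bar> \<le> max K C" if "x \<in> cball 0 1" for x
      using F(2,3) that by (metis max.coboundedI2)
    ultimately show ?thesis by blast
  qed
  then show ?thesis using K(1) by (intro exI[of _ "max K C"]) auto
qed

section \<open>Choice of the smoothing scale and conclusion\<close>

lemma dyadic_floor: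
  fixes y :: real
  assumes "y \<ge> 1"
  shows "\<exists>J::nat. 2 powr real J \<le> y \<and> y \<le> 2 * 2 powr real J"
proof -
  define J where "J = nat \<lfloor>log 2 y\<rfloor>"
  have l: "log 2 y \<ge> 0" using assms by simp
  then have J: "real J \<le> log 2 y" "log 2 y \<le> 1 + real J" unfolding J_def by linarith+
  have "2 powr real J \<le> 2 powr (log 2 y)" "2 powr (log 2 y) \<le> 2 powr (1 + real J)" using J by (auto intro!: powr_mono)
  then have "2 powr real J \<le> y" "y \<le> 2 * 2 powr real J" using assms by (auto simp: powr_add)
  then show ?thesis by blast
qed

lemma holder_rate_network:
  fixes \<alpha> k1 :: real
  assumes \<alpha>: "0 < \<alpha>" "\<alpha> < (real DIM('a::euclidean_space) + 3) / 2" and k1: "k1 > 0"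
  shows "\<exists>A>0. \<forall>h\<in>holder_unit_ball \<alpha>. continuous_on (cball (0::'a) 1) h \<and> (\<forall>n\<ge>2. \<exists>N.
    \<exists>f\<in>nn_class N (k1 * real n powr ((real DIM('a) + 3 - 2 * \<alpha>) / (2 * real DIM('a) + 4 * \<alpha>))).
      \<forall>x\<in>cball 0 1. \<bar>f x - h x\<bar> \<le> A * real n powr (- (\<alpha> / (real DIM('a) + 2 * \<alpha>))))"
proof -
  obtain K where K: "K > 0" "\<And>h x. h \<in> holder_unit_ball \<alpha> \<Longrightarrow> x \<in> cball (0::'a) 1 \<Longrightarrow> \<bar>h x\<bar> \<le> K"
    "\<And>h J. h \<in> holder_unit_ball \<alpha> \<Longrightarrow> \<exists>N. \<exists>f\<in>nn_class N (K * 2 powr (real J * ((real DIM('a) + 3) / 2 - \<alpha>))). \<forall>x\<in>cball (0::'a) 1. \<bar>f x - h x\<bar> \<le> K * 2 powr (- (real J * \<alpha>))"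
    using holder_network[OF \<alpha>] by blast
  define e where "e = (real DIM('a) + 3) / 2 - \<alpha>"
  define q where "q = real DIM('a) + 2 * \<alpha>"
  have e: "e > 0" using \<alpha>(2) by (simp add: e_def)
  have q: "q > 0" using \<alpha>(1) by (simp add: q_def add_nonneg_pos)
  have ex: "(real DIM('a) + 3 - 2 * \<alpha>) / (2 * real DIM('a) + 4 * \<alpha>) = e / q"
  proof -
    have "2 * real DIM('a) + 4 * \<alpha> = 2 * q" "real DIM('a) + 3 - 2 * \<alpha> = 2 * e" by (auto simp: q_def e_def)
    then show ?thesis by simp
  qed
  \<comment> \<open>Solves \<open>K * c powr e = k1\<close>: at scale
    \<open>y = c * n powr (1 / q)\<close> the weight \<open>K * y powr e\<close> is exactly the one
    allowed. Rounding \<open>y\<close> down to a power of two costs the factor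
    \<open>2 powr \<alpha>\<close> contained in \<open>A\<close>.\<close>
  define c where "c = (k1 / K) powr (1 / e)"
  have c: "c > 0" using k1 K(1) by (simp add: c_def)
  have ce: "K * c powr e = k1" unfolding c_def powr_powr using e k1 K(1) by simp
  define A where "A = K * (2 / c) powr \<alpha>"
  have A: "A > 0" using K(1) c by (simp add: A_def)
  have cont: "continuous_on (cball 0 1) h" if h: "h \<in> holder_unit_ball \<alpha>" for h :: "'a \<Rightarrow> real"
  proof (rule continuous_if_nn_approx)
    fix \<epsilon> :: real assume \<epsilon>: "\<epsilon> > 0"
    have "2 powr (- \<alpha>) < 2 powr 0" using \<alpha>(1) by (intro powr_less_mono) auto
    then obtain J where J: "(2 powr (- \<alpha>)) ^ J < \<epsilon> / K" using real_arch_pow_inv[of "\<epsilon> / K" "2 powr (- \<alpha>)"] \<epsilon> K(1) by auto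
    have "2 powr (- (real J * \<alpha>)) = (2 powr (- \<alpha>)) ^ J" by (simp add: powr_powr mult.commute flip: powr_realpow)
    then have "K * 2 powr (- (real J * \<alpha>)) \<le> \<epsilon>" using J K(1) by (simp add: field_simps)
    then show "\<exists>N M. \<exists>f\<in>nn_class N M. \<forall>x\<in>cball 0 1. \<bar>f x - h x\<bar> \<le> \<epsilon>"
      using K(3)[OF h, of J] by (meson order_trans)
  qed
  have app: "\<exists>N. \<exists>f\<in>nn_class N (k1 * real n powr (e / q)). \<forall>x\<in>cball 0 1. \<bar>f x - h x\<bar> \<le> A * real n powr (- (\<alpha> / q))"
    if h: "h \<in> holder_unit_ball \<alpha>" and n: "n \<ge> 2" for h :: "'a \<Rightarrow> real" and n :: nat
  proof -
    define y where "y = c * real n powr (1 / q)"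
    have y0: "y > 0" using c n by (simp add: y_def)
    have ye: "K * y powr e = k1 * real n powr (e / q)"
      using c ce[symmetric] by (simp add: y_def powr_mult powr_powr)
    have ya: "K * (y / 2) powr (- \<alpha>) = A * real n powr (- (\<alpha> / q))"
    proof -
      have "y / 2 = (c / 2) * real n powr (1 / q)" by (simp add: y_def)
      then have "(y / 2) powr (- \<alpha>) = (c / 2) powr (- \<alpha>) * real n powr (- (\<alpha> / q))"
        using c by (simp only: powr_mult powr_powr) simp
      also have "(c / 2) powr (- \<alpha>) = (2 / c) powr \<alpha>" using c by (simp add: powr_minus_divide powr_divide)
      finally show ?thesis by (simp add: A_def)
    qed
    show ?thesis
    proof (cases "y \<ge> 1")
      case True
      then obtain J :: nat where J: "2 powr real J \<le> y" "y \<le> 2 * 2 powr real J" using dyadic_floor by blast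
      obtain N f where f: "f \<in> nn_class N (K * 2 powr (real J * e))" "\<And>x. x \<in> cball (0::'a) 1 \<Longrightarrow> \<bar>f x - h x\<bar> \<le> K * 2 powr (- (real J * \<alpha>))"
        using K(3)[OF h, of J] unfolding e_def by blast
      have "(2 powr real J) powr e \<le> y powr e" using J(1) e by (intro powr_mono2) auto
      then have "K * 2 powr (real J * e) \<le> K * y powr e" using K(1) by (simp add: powr_powr)
      then have "f \<in> nn_class N (k1 * real n powr (e / q))" using f(1) ye nn_class_mono[of N N] by (metis order_refl subsetD)
      moreover have "(2 powr real J) powr (- \<alpha>) \<le> (y / 2) powr (- \<alpha>)"
        using J(2) y0 \<alpha>(1) by (intro powr_mono2') auto
      then have "K * 2 powr (- (real J * \<alpha>)) \<le> K * (y / 2) powr (- \<alpha>)" using K(1) by (simp add: powr_powr)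
      then have "\<bar>f x - h x\<bar> \<le> A * real n powr (- (\<alpha> / q))" if "x \<in> cball 0 1" for x
        using f(2)[OF that] unfolding ya by linarith
      ultimately show ?thesis by blast
    next
      \<comment> \<open>Here no admissible dyadic scale exists, but \<open>n\<close> is small enough
        for the zero network to be within the rate, since \<open>h\<close> is bounded by
        \<open>K\<close>.\<close>
      case False
      have "(\<lambda>x. 0) \<in> nn_class 0 (k1 * real n powr (e / q))" using k1 by (auto simp: nn_class_def)
      moreover have "1 \<le> (y / 2) powr (- \<alpha>)"
      proof -
        have "1 powr (- \<alpha>) \<le> (y / 2) powr (- \<alpha>)" using False y0 \<alpha>(1) by (intro powr_mono2') auto
        then show ?thesis by simp
      qed
      then have "K * 1 \<le> K * (y / 2) powr (- \<alpha>)" using K(1) by (intro mult_left_mono) auto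
      then have "\<bar>0 - h x\<bar> \<le> A * real n powr (- (\<alpha> / q))" if "x \<in> cball 0 1" for x
        using K(2)[OF h that] unfolding ya by simp
      ultimately show ?thesis by (intro exI bexI[where x="\<lambda>_. 0"] ballI)
    qed
  qed
  show ?thesis unfolding ex using A cont app unfolding q_def by blast
qed

theorem theorem3:
  fixes B :: real
  assumes "B > 0"
  shows
  "(\<forall>\<alpha> k1 k2 k. 0 < \<alpha> \<and> \<alpha> < (real DIM('a) + 3) / 2 \<and> k1 > 0 \<and> k2 > 0 \<and> k > 0 \<longrightarrow>
     (\<exists>C c1 c2. C > 0 \<and> c1 > 0 \<and> c2 > 0 \<and>
       (\<forall>(Mn :: nat \<Rightarrow> real) (Nn :: nat \<Rightarrow> nat).
          (\<forall>n\<ge>2. k1 * real n powr ((real DIM('a) + 3 - 2 * \<alpha>) / (2 * real DIM('a) + 4 * \<alpha>)) \<le> Mn n \<and>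
                  Mn n \<le> k2 * real n powr ((real DIM('a) + 3 - 2 * \<alpha>) / (2 * real DIM('a) + 4 * \<alpha>))) \<and>
          (\<forall>n\<ge>2. k * real n powr (real DIM('a) / (real DIM('a) + 2 * \<alpha>)) \<le> real (Nn n)) \<longrightarrow>
          (\<forall>n\<ge>2. \<forall>(P :: ('a::euclidean_space \<times> real) measure) h (fhat :: (nat \<Rightarrow> 'a \<times> real) \<Rightarrow> 'a \<Rightarrow> real).
             regression_setting P B h \<and> h \<in> holder_unit_ball \<alpha> \<and>
             (\<forall>D\<in>space (PiM {..<n} (\<lambda>_. P)).
                 fhat D \<in> nn_class (Nn n) (Mn n) \<and>
                 (\<forall>g\<in>nn_class (Nn n) (Mn n). emp_risk n D (fhat D) \<le> emp_risk n D g)) \<longrightarrow>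
             (\<exists>E\<in>sets (PiM {..<n} (\<lambda>_. P)).
                 measure (PiM {..<n} (\<lambda>_. P)) E
                   \<ge> 1 - c1 * exp (- c2 * real n powr (real DIM('a) / (real DIM('a) + 2 * \<alpha>)) * ln (real n)) \<and>
                 (\<forall>D\<in>E. l2_err P (\<lambda>x. truncate B (fhat D x)) h
                     \<le> C * real n powr (- (2 * \<alpha> / (real DIM('a) + 2 * \<alpha>))) * ln (real n)))))))
   \<and>
   (\<forall>M k. M \<ge> 1 \<and> k > 0 \<longrightarrow>
     (\<exists>C c1 c2. C > 0 \<and> c1 > 0 \<and> c2 > 0 \<and>
       (\<forall>Nn :: nat \<Rightarrow> nat.
          (\<forall>n\<ge>2. k * real n powr (real DIM('a) / (2 * real DIM('a) + 3)) \<le> real (Nn n)) \<longrightarrow>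
          (\<forall>n\<ge>2. \<forall>(P :: ('a::euclidean_space \<times> real) measure) h (fhat :: (nat \<Rightarrow> 'a \<times> real) \<Rightarrow> 'a \<Rightarrow> real).
             regression_setting P B h \<and> h \<in> barron_class 1 \<and>
             (\<forall>D\<in>space (PiM {..<n} (\<lambda>_. P)).
                 fhat D \<in> nn_class (Nn n) M \<and>
                 (\<forall>g\<in>nn_class (Nn n) M. emp_risk n D (fhat D) \<le> emp_risk n D g)) \<longrightarrow>
             (\<exists>E\<in>sets (PiM {..<n} (\<lambda>_. P)).
                 measure (PiM {..<n} (\<lambda>_. P)) E
                   \<ge> 1 - c1 * exp (- c2 * real n powr (real DIM('a) / (2 * real DIM('a) + 3)) * ln (real n)) \<and>
                 (\<forall>D\<in>E. l2_err P (\<lambda>x. truncate B (fhat D x)) h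
                     \<le> C * real n powr (- ((real DIM('a) + 3) / (2 * real DIM('a) + 3))) * ln (real n)))))))"
proof (intro conjI allI impI, goal_cases)
  case (1 \<alpha> k1 k2 k)
  then have \<alpha>: "0 < \<alpha>" "\<alpha> < (real DIM('a) + 3) / 2" and k: "k1 > 0" "k2 > 0" "k > 0" by auto
  \<comment> \<open>The lower bound \<open>k1\<close> on the weight is spent on approximation; the
    upper bound \<open>k2\<close> enters below, in sparsification and in the size of the
    nets.\<close>
  obtain A where A: "A > 0"
    "\<And>h. h \<in> holder_unit_ball \<alpha> \<Longrightarrow> continuous_on (cball (0::'a) 1) h"
    "\<And>h n. h \<in> holder_unit_ball \<alpha> \<Longrightarrow> n \<ge> 2 \<Longrightarrow> \<exists>N. \<exists>f\<in>nn_class N (k1 * real n powr ((real DIM('a) + 3 - 2 * \<alpha>) / (2 * real DIM('a) + 4 * \<alpha>))).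
      \<forall>x\<in>cball (0::'a) 1. \<bar>f x - h x\<bar> \<le> A * real n powr (- (\<alpha> / (real DIM('a) + 2 * \<alpha>)))"
    using holder_rate_network[OF \<alpha> k(1)] by blast
  from regression_rate[OF assms \<alpha>(1) k(3) k(2) A(1), where 'a='a] show ?case
  proof (elim exE conjE, goal_cases)
    case (1 C)
    note C = 1(1) and rate = 1(2)
    show ?case
    proof (rule exI[of _ C], rule exI[of _ 2], rule exI[of _ 1], intro conjI allI impI, goal_cases)
      case (4 Mn Nn n P h fhat)
      note n = 4(2) and H = 4(3)
      have M: "k1 * real n powr ((real DIM('a) + 3 - 2 * \<alpha>) / (2 * real DIM('a) + 4 * \<alpha>)) \<le> Mn n" using 4(1) n by auto
      moreover have "0 \<le> k1 * real n powr ((real DIM('a) + 3 - 2 * \<alpha>) / (2 * real DIM('a) + 4 * \<alpha>))" using k(1) by simp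
      ultimately have M0: "0 \<le> Mn n" by linarith
      have h: "h \<in> holder_unit_ball \<alpha>" using H by blast
      have "\<exists>N'. \<exists>f\<in>nn_class N' (Mn n). \<forall>x\<in>cball 0 1. \<bar>f x - h x\<bar> \<le> A * real n powr (- (\<alpha> / (real DIM('a) + 2 * \<alpha>)))"
        using A(3)[OF h n] nn_class_mono[OF order_refl M] by blast
      then show ?case
        by (intro rate[THEN spec, THEN mp, OF n, THEN spec[where x="Mn n"], THEN spec[where x="Nn n"], THEN spec[where x=P], THEN spec[where x=h], THEN spec[where x=fhat], THEN mp])
           (use H 4(1) n M0 A(2)[OF h] in simp)
    qed (use C in auto)
  qed
next
  case (2 M k)
  then have M: "M \<ge> 1" "M > 0" and k: "k > 0" by auto
  \<comment> \<open>At this value \<open>d + 3 - 2 * \<alpha>\<close> vanishes, so a constant weight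
    is admissible with \<open>k2 = M\<close>, and \<open>d + 2 * \<alpha>\<close> becomes
    \<open>2 * d + 3\<close>.\<close>
  define \<alpha> where "\<alpha> = (real DIM('a) + 3) / 2"
  have \<alpha>: "\<alpha> > 0" by (simp add: \<alpha>_def add_nonneg_pos)
  have ex: "real DIM('a) + 2 * \<alpha> = 2 * real DIM('a) + 3" "2 * \<alpha> = real DIM('a) + 3" by (auto simp: \<alpha>_def)
  from regression_rate[OF assms \<alpha> k M(2) zero_less_one, where 'a='a, unfolded ex(1), unfolded ex(2)] show ?case
  proof (elim exE conjE, goal_cases)
    case (1 C)
    note C = 1(1) and rate = 1(2)
    show ?case
    proof (rule exI[of _ C], rule exI[of _ 2], rule exI[of _ 1], intro conjI allI impI, goal_cases)
      case (4 Nn n P h fhat)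
      note n = 4(2) and H = 4(3)
      have h: "h \<in> barron_class 1" using H by blast
      have cont: "continuous_on (cball 0 1) h"
        by (rule continuous_if_nn_approx) (use barron_approx[OF h] in blast)
      \<comment> \<open>A function of \<open>barron_class 1\<close> is approximated to any accuracy
        with weight 1, in particular to the one demanded by the rate.\<close>
      have "1 * real n powr (- (\<alpha> / (2 * real DIM('a) + 3))) > 0" using n by simp
      from barron_approx[OF h this]
      have "\<exists>N'. \<exists>f\<in>nn_class N' M. \<forall>x\<in>cball 0 1. \<bar>f x - h x\<bar> \<le> 1 * real n powr (- (\<alpha> / (2 * real DIM('a) + 3)))"
        using nn_class_mono[OF order_refl M(1)] by blast
      then show ?case
        by (intro rate[THEN spec, THEN mp, OF n, THEN spec[where x=M], THEN spec[where x="Nn n"], THEN spec[where x=P], THEN spec[where x=h], THEN spec[where x=fhat], THEN mp])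
           (use H 4(1) n M(2) cont in simp)
    qed (use C in auto)
  qed
qed

end
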